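(* Let $f_1,f_2:\mathbb{N}\to\mathbb{C}$ be multiplicative functions such that, for $i=1,2$, $f_i$ satisfies the following three conditions with $M=M_i$ (a positive integer, which is a period of $f_i$): (i) for some prime $q\mid M$, $\sum_{k=0}^\infty \frac{f_i(q^k)}{q^k}=0$; (ii) for each prime power $p^a\,\|\,M$, $f_i(p^k)=f_i(p^a)$ for all $k\geq a$; (iii) for each prime $p$ with $\gcd(p,M)=1$, $f_i(p^k)=1$ for all $k\geq 1$. Let $g=f_1\ast f_2\ast\mu\ast\mu$. Then the limit $$\lim_{X\to\infty}\frac{1}{X^{3/2}}\int_1^X\left|\sum_{n\leq x}(f_1\ast f_2)(n)\right|^2dx$$ exists, is positive, and equals $$\frac{1}{6\pi^2}\frac{\zeta(3/2)^4}{\zeta(3)}\sum_{n,m\mid M_1M_2}g(n)\overline{g(m)}\frac{\gcd(n,m)^{3/2}}{nm}\,\tau\!\left(\frac{nm}{\gcd(n,m)^2}\right)\prod_{p^{k}\| nm/\gcd(n,m)^2}\frac{1-\frac{k-1}{k+1}p^{-3/2}}{1+p^{-3/2}}.$$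
   Context: $\ast$ denotes Dirichlet convolution $(f\ast h)(n)=\sum_{d\mid n}f(d)h(n/d)$, $\mu$ is the Möbius function, $\tau(n)$ is the number of divisors of $n$, $\zeta$ is the Riemann zeta function. $p^k\| N$ means $p^k\mid N$ and $p^{k+1}\nmid N$; the product is over primes dividing $nm/\gcd(n,m)^2$. *)

theory Defs
  imports "HOL-Analysis.Analysis" "HOL-Computational_Algebra.Computational_Algebra"
begin

(* Arithmetic functions live on the positive integers; the value at 0 is never used. *)

definition multiplicative :: "(nat \<Rightarrow> complex) \<Rightarrow> bool" where
  "multiplicative f \<longleftrightarrow>
     f 1 = 1 \<and> (\<forall>m n. 0 < m \<longrightarrow> 0 < n \<longrightarrow> coprime m n \<longrightarrow> f (m * n) = f m * f n)"

definition has_period :: "(nat \<Rightarrow> complex) \<Rightarrow> nat \<Rightarrow> bool" where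
  "has_period f M \<longleftrightarrow> 0 < M \<and> (\<forall>n>0. f (n + M) = f n)"

definition exactly_divides :: "nat \<Rightarrow> nat \<Rightarrow> nat \<Rightarrow> bool" where
  "exactly_divides p k N \<longleftrightarrow> p ^ k dvd N \<and> \<not> p ^ (k + 1) dvd N"

definition period_conditions :: "(nat \<Rightarrow> complex) \<Rightarrow> nat \<Rightarrow> bool" where
  "period_conditions f M \<longleftrightarrow>
     (\<exists>q. prime q \<and> q dvd M \<and> (\<lambda>k. f (q ^ k) / of_nat (q ^ k)) sums 0) \<and>
     (\<forall>p a. prime p \<longrightarrow> 1 \<le> a \<longrightarrow> exactly_divides p a M \<longrightarrow> (\<forall>k\<ge>a. f (p ^ k) = f (p ^ a))) \<and>
     (\<forall>p. prime p \<longrightarrow> coprime p M \<longrightarrow> (\<forall>k\<ge>1. f (p ^ k) = 1))"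

definition dirichlet_conv ::
    "(nat \<Rightarrow> complex) \<Rightarrow> (nat \<Rightarrow> complex) \<Rightarrow> nat \<Rightarrow> complex" (infixl "\<star>" 70) where
  "(f \<star> h) n = (\<Sum>d | d dvd n. f d * h (n div d))"

definition moebius_mu :: "nat \<Rightarrow> complex" where
  "moebius_mu n = (if squarefree n then (- 1) ^ card (prime_factors n) else 0)"

definition num_divisors :: "nat \<Rightarrow> nat" where
  "num_divisors n = card {d. d dvd n}"

(* The Riemann zeta function by its Dirichlet series, which defines it for s > 1;
   for s \<le> 1 the value here is meaningless. *)
definition zeta :: "real \<Rightarrow> real" where
  "zeta s = (\<Sum>n. 1 / real (Suc n) powr s)"

(* n m / gcd(n,m)^2; the natural-number division is exact. *)
definition reduced_prod :: "nat \<Rightarrow> nat \<Rightarrow> nat" where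
  "reduced_prod n m = (n * m) div (gcd n m)\<^sup>2"

definition local_factor :: "nat \<Rightarrow> nat \<Rightarrow> real" where
  "local_factor p k =
     (1 - (real k - 1) / (real k + 1) * real p powr (- 3 / 2)) / (1 + real p powr (- 3 / 2))"

(* For a prime p dividing N, the k with p^k exactly dividing N is multiplicity p N. *)
definition local_product :: "nat \<Rightarrow> real" where
  "local_product N = (\<Prod>p\<in>prime_factors N. local_factor p (multiplicity p N))"

end

theory Submission
  imports Defs "HOL-Real_Asymp.Real_Asymp"
begin

text \<open>Put $g_i = f_i \ast \mu$, so that $g = g_1 \ast g_2$ is supported on the divisors of
  $M_1 M_2$. Condition (i) makes both $\sum g_i(d)/d$ vanish, hence $\sum g(d)/d = \sum g(d) \ln(d)/d = 0$
  and the partial sums of $f_1 \ast f_2$ equal $\sum_d g(d) \Delta(x/d)$, where $\Delta$ is the error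
  term of Dirichlet's divisor problem.

  In mean square, $\Delta(x)$ is approximated by
  $x^{1/4}\, \mathrm{Im} (\kappa \sum_{r \le R} \tau(r) r^{-3/4} e(2 \sqrt{r x}))$ with
  $|\kappa|^2 = 1/(2\pi^2)$. No functional equation is used: a smoothed hyperbola method writes
  $\Delta$ as a sum of $\psi(x/n)$, the Fourier series of $\psi$ is inserted, the frequencies
  $k \le K$ are transformed by Poisson summation and stationary phase into the terms $r = kl$, and
  everything else is bounded by expanding the square and counting solutions of $km - ln = j$.

  Inserting this, only the pairs of terms with equal frequencies $r/d = r'/d'$ survive, and the sum over
  them is evaluated by an Euler product. The limit is positive because the frequency $1/d_0$, with
  $d_0$ the largest divisor such that $g(d_0) \neq 0$, arises from a single term.\<close>

section \<open>Exponentials and integration\<close>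

text \<open>Two vanishing sums are needed because zeta(s)^2 has a double pole at s = 1: each g_i
  supplies one simple zero, and together they remove both x ln x and x from the summatory function.
  Only mean square closeness of size e X^(3/2) is ever asked of a truncation, never a pointwise
  error bound. This dictates the order of limits: the length R of the Voronoi sum is fixed first,
  then X tends to infinity, and R grows last. All auxiliary cut-offs are chosen after R, so the
  bounds on discarded terms have to be uniform in them. The factor 1/(6 pi^2) is 2/3 times 1/(4
  pi^2). Here 2/3 comes from integrating sqrt x, and 1/(4 pi^2) from two conjugate frequencies of
  weight |kappa|^2/4 = 1/(8 pi^2) each. Only |kappa| enters, so the phase of the Fresnel integral
  never has to be determined.\<close>

definition ee :: "real \<Rightarrow> complex" where "ee x = cis (2 * pi * x)"

lemma ee_add: "ee (x + y) = ee x * ee y"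
  by (simp add: ee_def cis_mult distrib_left)

lemma ee_0 [simp]: "ee 0 = 1"
  by (simp add: ee_def)

lemma norm_ee [simp]: "cmod (ee x) = 1"
  by (simp add: ee_def)

lemma cnj_ee: "cnj (ee x) = ee (- x)"
  by (simp add: ee_def cis_cnj)

lemma Im_ee: "Im (ee x) = sin (2 * pi * x)"
  by (simp add: ee_def)

lemma ee_has_vector_derivative [derivative_intros]:
  assumes "(f has_real_derivative f') (at x within S)"
  shows "((\<lambda>x. ee (f x)) has_vector_derivative (complex_of_real (2 * pi * f') * \<i> * ee (f x))) (at x within S)"
  unfolding ee_def has_vector_derivative_def
  by (rule derivative_eq_intros assms[unfolded has_field_derivative_def] | simp)+
     (auto simp: fun_eq_iff scaleR_conv_of_real)

lemma of_real_has_vector_derivative: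
  "(f has_real_derivative f') (at x within S) \<Longrightarrow>
    ((\<lambda>x. complex_of_real (f x)) has_vector_derivative complex_of_real f') (at x within S)"
  by (simp add: has_real_derivative_iff_has_vector_derivative has_vector_derivative_of_real)

lemma continuous_on_ee [continuous_intros]:
  "continuous_on S f \<Longrightarrow> continuous_on S (\<lambda>x. ee (f x))"
  unfolding ee_def by (intro continuous_intros)

lemma measurable_ee [measurable]: "ee \<in> borel_measurable borel"
  by (intro borel_measurable_continuous_onI continuous_intros)

lemma integral_parts:
  fixes q P :: "real \<Rightarrow> complex"
  assumes "a \<le> b"
    and q: "\<And>x. x \<in> {a..b} \<Longrightarrow> (q has_vector_derivative q' x) (at x within {a..b})"
    and P: "\<And>x. x \<in> {a..b} \<Longrightarrow> (P has_vector_derivative P' x) (at x within {a..b})"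
    and "continuous_on {a..b} q'" "continuous_on {a..b} P'"
  shows "integral {a..b} (\<lambda>x. q x * P' x) = q b * P b - q a * P a - integral {a..b} (\<lambda>x. q' x * P x)"
proof -
  have cq: "continuous_on {a..b} q" "continuous_on {a..b} P"
    using q P by (meson continuous_on_vector_derivative)+
  have "((\<lambda>x. q x * P' x + q' x * P x) has_integral (q b * P b - q a * P a)) {a..b}"
  proof (rule fundamental_theorem_of_calculus[OF \<open>a \<le> b\<close>])
    fix x assume "x \<in> {a..b}"
    then show "((\<lambda>x. q x * P x) has_vector_derivative q x * P' x + q' x * P x) (at x within {a..b})"
      using has_vector_derivative_mult[OF q P] by blast
  qed
  then have 1: "integral {a..b} (\<lambda>x. q x * P' x + q' x * P x) = q b * P b - q a * P a"
    by (rule integral_unique)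
  have 2: "(\<lambda>x. q x * P' x) integrable_on {a..b}" "(\<lambda>x. q' x * P x) integrable_on {a..b}"
    by (intro integrable_continuous_real continuous_intros assms cq)+
  show ?thesis using 1 unfolding integral_add[OF 2] by (simp only: eq_diff_eq)
qed

text \<open>\<open>psi\<close>, \<open>Dsum\<close> and the partial sums have jumps, so continuity
  cannot justify their integrals; boundedness and measurability can.\<close>

lemma integrable_bounded_measurable:
  fixes f :: "real \<Rightarrow> 'a::euclidean_space"
  assumes "f \<in> borel_measurable borel" and B: "\<And>x. x \<in> {a..b} \<Longrightarrow> norm (f x) \<le> B"
  shows "f integrable_on {a..b}"
proof (rule measurable_bounded_by_integrable_imp_integrable[where g = "\<lambda>_. B"])
  show "f \<in> borel_measurable (lebesgue_on {a..b})"
    using assms(1) by (simp add: measurable_completion measurable_restrict_space1)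
qed (use B in auto)

lemma integral_norm_le:
  fixes f :: "real \<Rightarrow> complex"
  assumes "continuous_on {a..b} f" "a \<le> b" "\<And>x. x \<in> {a..b} \<Longrightarrow> norm (f x) \<le> B"
  shows "norm (integral {a..b} f) \<le> B * (b - a)"
  using integral_bound[OF assms(2,1,3)] by simp

section \<open>Dirichlet convolution and the support of $g$\<close>

text \<open>Every number divides 0, so the defining sum runs over an infinite set and takes the
  default value 0. Hence commutativity and associativity hold as equations between functions, which
  is what AC rewriting needs.\<close>

lemma conv_0 [simp]: "(f \<star> h) 0 = 0"
  by (simp add: dirichlet_conv_def)

lemma conv_cong:
  assumes "\<And>k. 0 < k \<Longrightarrow> f k = f' k" "\<And>k. 0 < k \<Longrightarrow> h k = h' k"
  shows "(f \<star> h) n = (f' \<star> h') n"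
proof (cases "n = 0")
  case False
  then show ?thesis unfolding dirichlet_conv_def
    by (intro sum.cong refl) (auto simp: assms dvd_pos_nat elim!: dvdE)
qed simp

lemma conv_commute: "f \<star> h = h \<star> f"
proof
  fix n show "(f \<star> h) n = (h \<star> f) n"
  proof (cases "n = 0")
    case False
    then show ?thesis unfolding dirichlet_conv_def
      by (intro sum.reindex_bij_witness[of _ "\<lambda>d. n div d" "\<lambda>d. n div d"])
         (auto elim!: dvdE)
  qed simp
qed

lemma conv_assoc: "(f \<star> g) \<star> h = f \<star> (g \<star> h)"
proof
  fix n show "((f \<star> g) \<star> h) n = (f \<star> (g \<star> h)) n"
  proof (cases "n = 0")
    case False
    have "((f \<star> g) \<star> h) n = (\<Sum>(d,e)\<in>(SIGMA d:{d. d dvd n}. {e. e dvd d}). f e * g (d div e) * h (n div d))"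
      using False unfolding dirichlet_conv_def
      by (subst sum.Sigma [symmetric]) (auto simp: sum_distrib_right dvd_pos_nat)
    also have "\<dots> = (\<Sum>(e,c)\<in>(SIGMA e:{e. e dvd n}. {c. c dvd n div e}). f e * (g c * h (n div e div c)))"
      using False
      by (intro sum.reindex_bij_witness[of _ "\<lambda>(e,c). (e*c, e)" "\<lambda>(d,e). (e, d div e)"])
         (auto elim!: dvdE simp: div_mult2_eq mult.assoc)
    also have "\<dots> = (f \<star> (g \<star> h)) n"
      using False unfolding dirichlet_conv_def
      by (subst sum.Sigma [symmetric]) (auto simp: sum_distrib_left dvd_pos_nat elim!: dvdE)
    finally show ?thesis .
  qed simp
qed

lemma conv_left_commute: "f \<star> (g \<star> h) = g \<star> (f \<star> h)"
  by (metis conv_assoc conv_commute)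

lemmas conv_ac = conv_assoc conv_commute conv_left_commute

section \<open>Multiplicative functions and Moebius inversion\<close>

lemma sum_divisors_coprime:
  fixes F :: "nat \<Rightarrow> 'a::comm_monoid_add"
  assumes "coprime m n" "m > 0" "n > 0"
  shows "(\<Sum>d | d dvd m * n. F d) = (\<Sum>a | a dvd m. \<Sum>b | b dvd n. F (a * b))"
proof -
  have gcdm: "gcd (a * b) m = a" if "a dvd m" "b dvd n" for a b
  proof -
    have "coprime b m" using assms(1) that(2) by (meson coprime_commute coprime_divisors dvd_refl)
    then show ?thesis using that(1)
      by (metis gcd_mult_right_right_cancel coprime_commute gcd.commute gcd_nat.absorb_iff1 mult.commute)
  qed
  have gcdn: "gcd (a * b) n = b" if "a dvd m" "b dvd n" for a b
  proof -
    have "coprime a n" using assms(1) that(1) by (meson coprime_divisors dvd_refl)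
    then show ?thesis using that(2)
      by (metis gcd_mult_right_right_cancel coprime_commute gcd.commute gcd_nat.absorb_iff1 mult.commute)
  qed
  have prod: "gcd d m * gcd d n = d" if "d dvd m * n" for d
  proof -
    obtain a b where "d = a * b" "a dvd m" "b dvd n" using \<open>d dvd m * n\<close> by (rule dvd_productE)
    then show ?thesis using gcdm gcdn by simp
  qed
  have "(\<Sum>d | d dvd m * n. F d) = (\<Sum>(a,b)\<in>{a. a dvd m} \<times> {b. b dvd n}. F (a * b))"
    by (rule sum.reindex_bij_witness[of _ "\<lambda>(a,b). a * b" "\<lambda>d. (gcd d m, gcd d n)"])
       (auto simp: gcdm gcdn prod intro: mult_dvd_mono)
  also have "\<dots> = (\<Sum>a | a dvd m. \<Sum>b | b dvd n. F (a * b))"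
    by (simp add: sum.cartesian_product)
  finally show ?thesis .
qed

lemma multiplicative_conv:
  assumes f: "multiplicative f" and h: "multiplicative h"
  shows "multiplicative (f \<star> h)"
  unfolding multiplicative_def
proof (intro conjI allI impI)
  show "(f \<star> h) 1 = 1" using f h by (simp add: dirichlet_conv_def multiplicative_def)
next
  fix m n :: nat assume mn: "0 < m" "0 < n" "coprime m n"
  have "(f \<star> h) (m * n) = (\<Sum>a | a dvd m. \<Sum>b | b dvd n. f (a * b) * h (m * n div (a * b)))"
    unfolding dirichlet_conv_def by (rule sum_divisors_coprime) (use mn in auto)
  also have "\<dots> = (\<Sum>a | a dvd m. \<Sum>b | b dvd n. (f a * h (m div a)) * (f b * h (n div b)))"
  proof (intro sum.cong refl)
    fix a b assume ab: "a \<in> {a. a dvd m}" "b \<in> {b. b dvd n}"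
    then obtain a' b' where [simp]: "m = a * a'" "n = b * b'" by (auto elim!: dvdE)
    have pos: "a > 0" "a' > 0" "b > 0" "b' > 0" using mn by auto
    have cop: "coprime a b" "coprime a' b'" using mn(3) by auto
    have "m * n div (a * b) = a' * b'" using pos by (simp add: mult_ac)
    moreover have "f (a * b) = f a * f b" "h (a' * b') = h a' * h b'"
      using f h cop pos by (auto simp: multiplicative_def)
    ultimately show "f (a * b) * h (m * n div (a * b)) = (f a * h (m div a)) * (f b * h (n div b))"
      using pos by simp
  qed
  also have "\<dots> = (f \<star> h) m * (f \<star> h) n"
    unfolding dirichlet_conv_def by (simp add: sum_product)
  finally show "(f \<star> h) (m * n) = (f \<star> h) m * (f \<star> h) n" .
qed

text \<open>Induction strips off the full power of one prime at a time. Moebius inversion, the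
  dependence on gcd(n, M) and Ramanujan's identity are all reduced to prime powers in this
  way.\<close>

lemma multiplicative_eqI:
  assumes f: "multiplicative f" and h: "multiplicative h"
    and pp: "\<And>p k. prime p \<Longrightarrow> 1 \<le> k \<Longrightarrow> f (p ^ k) = h (p ^ k)"
    and "n > 0"
  shows "f n = h n"
  using \<open>n > 0\<close>
proof (induction n rule: less_induct)
  case (less n)
  show ?case
  proof (cases "n = 1")
    case True
    then show ?thesis using f h by (simp add: multiplicative_def)
  next
    case False
    then obtain p where p: "prime p" "p dvd n" using prime_factor_nat by blast
    define k where "k = multiplicity p n"
    obtain m where m: "n = p ^ k * m" "\<not> p dvd m"
      using multiplicity_decompose'[of n p] less.prems p(1) unfolding k_def
      by (metis not_prime_unit not_gr_zero)
    have k: "k \<ge> 1" using p less.prems unfolding k_def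
      by (metis One_nat_def Suc_leI multiplicity_gt_zero_iff not_gr_zero not_prime_unit)
    have cop: "coprime (p ^ k) m" using p(1) m(2) by (simp add: prime_imp_coprime)
    have mpos: "m > 0" using m less.prems by (cases m) auto
    have "p ^ k > 1" using p(1) k by (metis One_nat_def one_less_power prime_gt_1_nat zero_less_one Suc_le_eq)
    then have "m < n" using m(1) mpos by simp
    then have "f m = h m" using less.IH mpos by blast
    then show ?thesis using f h pp[OF p(1) k] cop mpos \<open>p ^ k > 1\<close> unfolding m(1) multiplicative_def
      by (metis gr0I not_one_less_zero)
  qed
qed

lemma conv_prime_power:
  assumes "prime p"
  shows "(f \<star> h) (p ^ k) = (\<Sum>i\<le>k. f (p ^ i) * h (p ^ (k - i)))"
proof -
  have p: "p > 0" "p > 1" using assms prime_gt_0_nat prime_gt_1_nat by auto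
  have "{d. d dvd p ^ k} = (\<lambda>i. p ^ i) ` {..k}"
    using divides_primepow_nat[OF assms] by auto
  moreover have "inj_on (\<lambda>i. p ^ i) {..k}" using p by (auto simp: inj_on_def power_inject_exp)
  ultimately show ?thesis unfolding dirichlet_conv_def
    using p by (simp add: sum.reindex power_diff)
qed

lemma multiplicative_moebius: "multiplicative moebius_mu"
  unfolding multiplicative_def
proof (intro conjI allI impI)
  show "moebius_mu 1 = 1" by (simp add: moebius_mu_def)
next
  fix m n :: nat assume mn: "0 < m" "0 < n" "coprime m n"
  have disj: "prime_factors m \<inter> prime_factors n = {}"
    using mn(3) by (auto simp: in_prime_factors_iff) (metis coprime_common_divisor not_prime_unit)
  have "prime_factors (m * n) = prime_factors m \<union> prime_factors n"
    using mn by (simp add: prime_factors_product)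
  then have "card (prime_factors (m * n)) = card (prime_factors m) + card (prime_factors n)"
    using disj by (simp add: card_Un_disjoint)
  moreover have "squarefree (m * n) \<longleftrightarrow> squarefree m \<and> squarefree n"
    using mn by (metis squarefree_mult_coprime squarefree_multD)
  ultimately show "moebius_mu (m * n) = moebius_mu m * moebius_mu n"
    by (simp add: moebius_mu_def power_add)
qed

lemma moebius_prime_power:
  assumes "prime p"
  shows "moebius_mu (p ^ k) = (if k = 0 then 1 else if k = 1 then -1 else 0)"
proof -
  have "\<not> squarefree (p ^ k)" if "k \<ge> 2"
    using that assms by (auto simp: squarefree_power_iff)
  moreover have "squarefree p" using assms by (simp add: squarefree_prime)
  ultimately show ?thesis using assms
    by (auto simp: moebius_mu_def prime_prime_factors)
qed

lemma multiplicative_one: "multiplicative (\<lambda>_. 1)"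
  by (simp add: multiplicative_def)

lemma multiplicative_unit: "multiplicative (\<lambda>n. if n = 1 then 1 else 0)"
  by (auto simp: multiplicative_def)

lemma moebius_conv_one:
  assumes "n > 0"
  shows "(moebius_mu \<star> (\<lambda>_. 1)) n = (if n = 1 then 1 else 0)"
proof (rule multiplicative_eqI[OF multiplicative_conv[OF multiplicative_moebius multiplicative_one]
        multiplicative_unit _ assms])
  fix p k :: nat assume p: "prime p" and k: "1 \<le> k"
  have "(moebius_mu \<star> (\<lambda>_. 1)) (p ^ k) = (\<Sum>i\<le>k. if i = 0 then 1 else if i = 1 then -1 else 0)"
    by (simp add: conv_prime_power[OF p] moebius_prime_power[OF p])
  also have "\<dots> = (\<Sum>i\<in>{0,1::nat}. if i = 0 then 1 else if i = 1 then -1 else 0)"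
    by (rule sum.mono_neutral_right) (use k in auto)
  also have "\<dots> = 0" by simp
  finally show "(moebius_mu \<star> (\<lambda>_. 1)) (p ^ k) = (if p ^ k = 1 then 1 else 0)"
    using p k by auto
qed

lemma conv_unit:
  assumes "n > 0"
  shows "(f \<star> (\<lambda>n. if n = 1 then 1 else 0)) n = f n"
proof -
  have "(f \<star> (\<lambda>n. if n = 1 then 1 else 0)) n = (\<Sum>d | d dvd n. if d = n then f d else 0)"
    unfolding dirichlet_conv_def by (intro sum.cong refl) (use assms in \<open>auto elim!: dvdE\<close>)
  then show ?thesis using assms by simp
qed

lemma moebius_inversion:
  assumes "n > 0"
  shows "(f \<star> moebius_mu \<star> (\<lambda>_. 1)) n = f n"
proof -
  have "(f \<star> moebius_mu \<star> (\<lambda>_. 1)) n = (f \<star> (\<lambda>n. if n = 1 then 1 else 0)) n"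
    unfolding conv_assoc by (rule conv_cong) (simp_all add: moebius_conv_one del: One_nat_def)
  then show ?thesis using conv_unit[OF assms] by simp
qed

section \<open>Consequences of the period conditions: support and vanishing sum of f * mu\<close>

lemma gcd_mult_coprime:
  fixes m n M :: nat
  assumes "coprime m n"
  shows "gcd (m * n) M = gcd m M * gcd n M"
proof (rule dvd_antisym)
  obtain a b where ab: "gcd (m * n) M = a * b" "a dvd m" "b dvd n"
    using gcd_dvd1[of "m * n" M] by (rule dvd_productE)
  have "a dvd M" "b dvd M" using ab(1) by (metis dvd_mult_left dvd_mult_right gcd_dvd2)+
  then show "gcd (m * n) M dvd gcd m M * gcd n M" using ab by (simp add: mult_dvd_mono)
  have "coprime (gcd m M) (gcd n M)" using assms by (meson coprime_divisors gcd_dvd1)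
  then show "gcd m M * gcd n M dvd gcd (m * n) M"
    by (simp add: divides_mult mult_dvd_mono)
qed

text \<open>Both sides are multiplicative in n. At p^k the gcd is p^min(k, v), where v is the
  exponent of p in M: condition (ii) freezes f beyond p^v, and condition (iii) settles the case v =
  0.\<close>

lemma period_conditions_gcd:
  assumes f: "multiplicative f" and M: "M > 0" and pc: "period_conditions f M" and n: "n > 0"
  shows "f n = f (gcd n M)"
proof (rule multiplicative_eqI[OF f _ _ n])
  show "multiplicative (\<lambda>n. f (gcd n M))"
    unfolding multiplicative_def
  proof (intro conjI allI impI)
    show "f (gcd 1 M) = 1" using f by (simp add: multiplicative_def)
    fix m n :: nat assume mn: "0 < m" "0 < n" "coprime m n"
    have "gcd (m * n) M = gcd m M * gcd n M"
      using gcd_mult_coprime[OF mn(3)] .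
    moreover have "coprime (gcd m M) (gcd n M)" using mn(3)
      by (meson coprime_divisors gcd_dvd1)
    ultimately show "f (gcd (m * n) M) = f (gcd m M) * f (gcd n M)"
      using f M by (simp add: multiplicative_def)
  qed
next
  fix p k :: nat assume p: "prime p" and k: "1 \<le> k"
  define v where "v = multiplicity p M"
  have ex: "exactly_divides p v M" unfolding exactly_divides_def v_def
    using M p by (metis multiplicity_dvd power_dvd_iff_le_multiplicity not_prime_unit Suc_eq_plus1 Suc_n_not_le_n neq0_conv)
  show "f (p ^ k) = f (gcd (p ^ k) M)"
  proof (cases "v = 0")
    case True
    then have "\<not> p dvd M" using ex by (simp add: exactly_divides_def)
    then have "coprime p M" using p by (simp add: prime_imp_coprime)
    then show ?thesis using pc p k f unfolding period_conditions_def multiplicative_def by auto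
  next
    case False
    have "gcd (p ^ k) M = p ^ (min k v)"
    proof (rule gcd_unique_nat[THEN iffD1, symmetric], intro conjI allI impI)
      show "p ^ min k v dvd p ^ k" by (simp add: le_imp_power_dvd)
      show "p ^ min k v dvd M" using ex unfolding exactly_divides_def
        by (meson dvd_trans le_imp_power_dvd min.cobounded2)
      fix e assume e: "e dvd p ^ k \<and> e dvd M"
      then obtain i where i: "e = p ^ i" "i \<le> k" using divides_primepow_nat[OF p] by auto
      have "i \<le> v" unfolding v_def using e i M p
        by (metis not_prime_unit power_dvd_iff_le_multiplicity neq0_conv)
      then show "e dvd p ^ min k v" using i by (simp add: le_imp_power_dvd)
    qed
    then show ?thesis using pc p False ex unfolding period_conditions_def
      by (auto simp: min_def)
  qed
qed

text \<open>Since f(n) = f(gcd(n, M)), summing h = f * mu over the common divisors of n and M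
  already gives f(n). Thus h and its truncation to the divisors of M have the same divisor sums, and
  Moebius inversion makes them equal.\<close>

lemma conv_moebius_support:
  assumes f: "multiplicative f" and M: "M > 0" and pc: "period_conditions f M" and n: "n > 0"
    and ndvd: "\<not> n dvd M"
  shows "(f \<star> moebius_mu) n = 0"
proof -
  define h where "h = f \<star> moebius_mu"
  define h' where "h' = (\<lambda>d. if d dvd M then h d else 0)"
  have eq: "(h' \<star> (\<lambda>_. 1)) k = (h \<star> (\<lambda>_. 1)) k" if k: "k > 0" for k
  proof -
    have "(h' \<star> (\<lambda>_. 1)) k = (\<Sum>d | d dvd k. if d dvd M then h d else 0)"
      by (simp add: dirichlet_conv_def h'_def)
    also have "\<dots> = (\<Sum>d | d dvd gcd k M. h d)"
      using k by (subst sum.inter_filter[symmetric]) (auto intro!: sum.cong)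
    also have "\<dots> = (h \<star> (\<lambda>_. 1)) (gcd k M)" by (simp add: dirichlet_conv_def)
    also have "\<dots> = f (gcd k M)" unfolding h_def using k by (intro moebius_inversion) simp
    also have "\<dots> = f k" using period_conditions_gcd[OF f M pc k] by simp
    also have "\<dots> = (h \<star> (\<lambda>_. 1)) k" unfolding h_def using moebius_inversion[OF k] by simp
    finally show ?thesis .
  qed
  have "h' n = (h' \<star> moebius_mu \<star> (\<lambda>_. 1)) n" using moebius_inversion[OF n] by simp
  also have "\<dots> = (h' \<star> (\<lambda>_. 1) \<star> moebius_mu) n" by (simp add: conv_ac)
  also have "\<dots> = (h \<star> (\<lambda>_. 1) \<star> moebius_mu) n" by (rule conv_cong) (simp_all add: eq)
  also have "\<dots> = (h \<star> moebius_mu \<star> (\<lambda>_. 1)) n" by (simp add: conv_ac)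
  also have "\<dots> = h n" using moebius_inversion[OF n] by simp
  finally show ?thesis using ndvd by (simp add: h'_def h_def)
qed

text \<open>The sum factors over the primes dividing M, and the factor at q is (1 - 1/q) times the
  series of condition (i), hence 0. It is a finite sum because h(q^i) vanishes beyond the exponent
  of q in M.\<close>

lemma conv_moebius_sum_eq_0:
  assumes f: "multiplicative f" and M: "M > 0" and pc: "period_conditions f M"
  shows "(\<Sum>d | d dvd M. (f \<star> moebius_mu) d / of_nat d) = 0"
proof -
  define h where "h = f \<star> moebius_mu"
  have hm: "multiplicative h" unfolding h_def by (rule multiplicative_conv[OF f multiplicative_moebius])
  obtain q where q: "prime q" "q dvd M" and s: "(\<lambda>k. f (q ^ k) / of_nat (q ^ k)) sums 0"
    using pc unfolding period_conditions_def by blast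
  define a where "a = multiplicity q M"
  obtain m where m: "M = q ^ a * m" "\<not> q dvd m"
    using multiplicity_decompose'[of M q] M q(1) unfolding a_def
    by (metis not_prime_unit not_gr_zero)
  have cop: "coprime (q ^ a) m" using q(1) m(2) by (simp add: prime_imp_coprime)
  have q0: "q > 0" using q(1) prime_gt_0_nat by blast
  have hq: "h (q ^ Suc i) = f (q ^ Suc i) - f (q ^ i)" for i
  proof -
    have "h (q ^ Suc i) = (moebius_mu \<star> f) (q ^ Suc i)" unfolding h_def by (simp add: conv_commute)
    also have "\<dots> = (\<Sum>j\<le>Suc i. (if j = 0 then 1 else if j = 1 then -1 else 0) * f (q ^ (Suc i - j)))"
      by (subst conv_prime_power[OF q(1)]) (simp add: moebius_prime_power[OF q(1)])
    also have "\<dots> = (\<Sum>j\<in>{0,1::nat}. (if j = 0 then 1 else if j = 1 then -1 else 0) * f (q ^ (Suc i - j)))"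
      by (rule sum.mono_neutral_right) auto
    finally show ?thesis by simp
  qed
  have h1: "h 1 = 1" "f 1 = 1" using hm f by (auto simp: multiplicative_def)
  have h0: "h (q ^ i) = 0" if "i > a" for i
  proof -
    have "\<not> q ^ i dvd M" using that M q(1) unfolding a_def
      by (metis not_prime_unit power_dvd_iff_le_multiplicity neq0_conv not_le)
    then show ?thesis unfolding h_def using q0 by (intro conv_moebius_support[OF f M pc]) auto
  qed
  \<comment> \<open>The term k = 0 equals 1, so the series from k = 1 has sum -1. Subtracting the
    full series divided by q, whose sum is 0, leaves the terms h(q^(i+1))/q^(i+1); restoring h(1) =
    1 then gives 0.\<close>
  have "(\<lambda>i. f (q ^ Suc i) / of_nat (q ^ Suc i)) sums (0 - 1)"
    using sums_Suc_iff[of "\<lambda>k. f (q ^ k) / of_nat (q ^ k)"] s h1 by (simp add: sums_Suc_iff)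
  moreover have "(\<lambda>i. f (q ^ i) / of_nat (q ^ i) / of_nat q) sums (0 / of_nat q)"
    by (rule sums_divide[OF s])
  ultimately have "(\<lambda>i. f (q ^ Suc i) / of_nat (q ^ Suc i) - f (q ^ i) / of_nat (q ^ i) / of_nat q) sums (0 - 1 - 0 / of_nat q)"
    by (rule sums_diff)
  moreover have "f (q ^ Suc i) / of_nat (q ^ Suc i) - f (q ^ i) / of_nat (q ^ i) / of_nat q = h (q ^ Suc i) / of_nat (q ^ Suc i)" for i
    unfolding hq diff_divide_distrib by (simp add: divide_divide_eq_left mult.commute)
  ultimately have "(\<lambda>i. h (q ^ Suc i) / of_nat (q ^ Suc i)) sums (-1)"
    by (simp only: diff_zero div_0 diff_0)
  then have "(\<lambda>i. h (q ^ i) / of_nat (q ^ i)) sums 0"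
    by (subst (asm) sums_Suc_iff) (use h1 in simp)
  moreover have "(\<lambda>i. h (q ^ i) / of_nat (q ^ i)) sums (\<Sum>i\<le>a. h (q ^ i) / of_nat (q ^ i))"
    by (rule sums_finite) (use h0 in auto)
  ultimately have z: "(\<Sum>i\<le>a. h (q ^ i) / of_nat (q ^ i)) = 0" using sums_unique2 by blast
  have "{d. d dvd q ^ a} = (\<lambda>i. q ^ i) ` {..a}"
    using divides_primepow_nat[OF q(1)] by auto
  moreover have "inj_on (\<lambda>i. q ^ i) {..a}" using prime_gt_1_nat[OF q(1)] by (auto simp: inj_on_def power_inject_exp)
  ultimately have z': "(\<Sum>d | d dvd q ^ a. h d / of_nat d) = 0"
    using z by (simp add: sum.reindex)
  have "(\<Sum>d | d dvd M. h d / of_nat d) = (\<Sum>b | b dvd q ^ a. \<Sum>c | c dvd m. h (b * c) / of_nat (b * c))"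
    unfolding m(1) using cop M m(1) by (intro sum_divisors_coprime) auto
  also have "\<dots> = (\<Sum>b | b dvd q ^ a. \<Sum>c | c dvd m. (h b / of_nat b) * (h c / of_nat c))"
  proof (intro sum.cong refl)
    fix b c assume bc: "b \<in> {b. b dvd q ^ a}" "c \<in> {c. c dvd m}"
    then have "coprime b c" using coprime_divisors[of b "q ^ a" c m] cop by blast
    moreover have "b > 0" "c > 0" using bc dvd_pos_nat[of "q ^ a" b] dvd_pos_nat[of m c] M m(1) q0 by auto
    ultimately show "h (b * c) / of_nat (b * c) = (h b / of_nat b) * (h c / of_nat c)"
      using hm by (simp add: multiplicative_def)
  qed
  also have "\<dots> = (\<Sum>b | b dvd q ^ a. h b / of_nat b) * (\<Sum>c | c dvd m. h c / of_nat c)"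
    by (simp add: sum_product)
  finally show ?thesis using z' by (simp add: h_def)
qed

text \<open>\<open>F\<close> is left arbitrary because the lemma is applied twice, with F(n) = 1/n
  and with F(n) = ln n / n.\<close>

lemma sum_conv_support:
  assumes M: "M1 > 0" "M2 > 0"
    and s1: "\<And>n. n > 0 \<Longrightarrow> \<not> n dvd M1 \<Longrightarrow> h1 n = 0"
    and s2: "\<And>n. n > 0 \<Longrightarrow> \<not> n dvd M2 \<Longrightarrow> h2 n = 0"
  shows "(\<Sum>n | n dvd M1 * M2. (h1 \<star> h2) n * F n) = (\<Sum>d | d dvd M1. \<Sum>e | e dvd M2. h1 d * h2 e * F (d * e))"
proof -
  have N: "M1 * M2 > 0" using M by simp
  have fin: "finite {d. d dvd n}" if "n dvd M1 * M2" for n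
    using dvd_pos_nat[OF N that] by (rule finite_divisors_nat)
  have "(\<Sum>n | n dvd M1 * M2. (h1 \<star> h2) n * F n)
      = (\<Sum>(n,d)\<in>(SIGMA n:{n. n dvd M1 * M2}. {d. d dvd n}). h1 d * h2 (n div d) * F n)"
    using N fin unfolding dirichlet_conv_def
    by (subst sum.Sigma [symmetric]) (auto simp: sum_distrib_right)
  also have "\<dots> = (\<Sum>(n,d)\<in>{(n,d). d dvd n \<and> d dvd M1 \<and> n div d dvd M2 \<and> n > 0}. h1 d * h2 (n div d) * F n)"
  proof (rule sum.mono_neutral_right)
    show "finite (SIGMA n:{n. n dvd M1 * M2}. {d. d dvd n})" using N fin by (intro finite_SigmaI) auto
    show "{(n,d). d dvd n \<and> d dvd M1 \<and> n div d dvd M2 \<and> n > 0} \<subseteq> (SIGMA n:{n. n dvd M1 * M2}. {d. d dvd n})"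
      by (auto elim!: dvdE)
    show "\<forall>i\<in>(SIGMA n:{n. n dvd M1 * M2}. {d. d dvd n}) - {(n,d). d dvd n \<and> d dvd M1 \<and> n div d dvd M2 \<and> n > 0}.
       (case i of (n, d) \<Rightarrow> h1 d * h2 (n div d) * F n) = 0"
    proof
      fix i assume i: "i \<in> (SIGMA n:{n. n dvd M1 * M2}. {d. d dvd n}) - {(n,d). d dvd n \<and> d dvd M1 \<and> n div d dvd M2 \<and> n > 0}"
      obtain n d where [simp]: "i = (n, d)" by (cases i)
      have nd: "n dvd M1 * M2" "d dvd n" "\<not> (d dvd n \<and> d dvd M1 \<and> n div d dvd M2 \<and> 0 < n)" using i by auto
      have n: "n > 0" using nd(1) N dvd_pos_nat by blast
      then have "d > 0" "n div d > 0" using nd(2) by (auto elim!: dvdE)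
      then show "(case i of (n, d) \<Rightarrow> h1 d * h2 (n div d) * F n) = 0" using nd n s1[of d] s2[of "n div d"] by auto
    qed
  qed
  also have "\<dots> = (\<Sum>(d,e)\<in>{d. d dvd M1} \<times> {e. e dvd M2}. h1 d * h2 e * F (d * e))"
    by (rule sum.reindex_bij_witness[of _ "\<lambda>(d,e). (d*e, d)" "\<lambda>(n,d). (d, n div d)"])
       (use M in \<open>auto simp: dvd_pos_nat\<close>)
  also have "\<dots> = (\<Sum>d | d dvd M1. \<Sum>e | e dvd M2. h1 d * h2 e * F (d * e))"
    by (simp add: sum.cartesian_product)
  finally show ?thesis .
qed

lemma num_divisors_conv:
  assumes "n > 0" shows "((\<lambda>_. 1) \<star> (\<lambda>_. 1)) n = of_nat (num_divisors n)"
  by (simp add: dirichlet_conv_def num_divisors_def)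

section \<open>The function g and its two vanishing sums\<close>

locale paper_setup =
  fixes f1 f2 g :: "nat \<Rightarrow> complex" and M1 M2 :: nat
  assumes f1: "multiplicative f1" and f2: "multiplicative f2"
    and M1: "M1 > 0" and M2: "M2 > 0"
    and pc1: "period_conditions f1 M1" and pc2: "period_conditions f2 M2"
    and g: "g = f1 \<star> f2 \<star> moebius_mu \<star> moebius_mu"
begin

definition "h1 = f1 \<star> moebius_mu"
definition "h2 = f2 \<star> moebius_mu"

lemma g_eq: "g = h1 \<star> h2"
  unfolding g h1_def h2_def by (simp add: conv_ac)

lemma h_support: "n > 0 \<Longrightarrow> \<not> n dvd M1 \<Longrightarrow> h1 n = 0" "n > 0 \<Longrightarrow> \<not> n dvd M2 \<Longrightarrow> h2 n = 0"
  unfolding h1_def h2_def using conv_moebius_support f1 f2 M1 M2 pc1 pc2 by blast+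

lemma g_support:
  assumes "n > 0" "\<not> n dvd M1 * M2" shows "g n = 0"
  unfolding g_eq dirichlet_conv_def
proof (rule sum.neutral, safe)
  fix d assume d: "d dvd n"
  then obtain e where e: "n = d * e" by (auto elim: dvdE)
  have "d > 0" "e > 0" using assms e by auto
  moreover have "\<not> (d dvd M1 \<and> e dvd M2)" using assms e by (auto intro: mult_dvd_mono)
  ultimately show "h1 d * h2 (n div d) = 0" using h_support[of d] h_support[of e] e by auto
qed

lemma g_1: "g 1 = 1"
  using multiplicative_conv[OF multiplicative_conv[OF multiplicative_conv[OF f1 f2] multiplicative_moebius] multiplicative_moebius]
  unfolding g multiplicative_def by blast

lemma sum_g: "(\<Sum>d | d dvd M1 * M2. g d / of_nat d) = 0"
proof -
  have "(\<Sum>d | d dvd M1 * M2. g d / of_nat d) = (\<Sum>n | n dvd M1 * M2. (h1 \<star> h2) n * (1 / of_nat n))"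
    by (simp add: g_eq)
  also have "\<dots> = (\<Sum>d | d dvd M1. \<Sum>e | e dvd M2. h1 d * h2 e * (1 / of_nat (d * e)))"
    using M1 M2 h_support by (rule sum_conv_support)
  also have "\<dots> = (\<Sum>d | d dvd M1. h1 d / of_nat d) * (\<Sum>e | e dvd M2. h2 e / of_nat e)"
    by (simp add: sum_product)
  finally show ?thesis using conv_moebius_sum_eq_0[OF f1 M1 pc1] by (simp add: h1_def)
qed

text \<open>As ln(de) = ln d + ln e, the sum splits into two products, each containing one of the
  vanishing sums for h1 and h2. This is where condition (i) is used for both functions.\<close>

lemma sum_g_ln: "(\<Sum>d | d dvd M1 * M2. g d * complex_of_real (ln (real d)) / of_nat d) = 0"
proof -
  have "(\<Sum>d | d dvd M1 * M2. g d * complex_of_real (ln (real d)) / of_nat d)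
      = (\<Sum>n | n dvd M1 * M2. (h1 \<star> h2) n * (complex_of_real (ln (real n)) / of_nat n))"
    by (simp add: g_eq)
  also have "\<dots> = (\<Sum>d | d dvd M1. \<Sum>e | e dvd M2. h1 d * h2 e * (complex_of_real (ln (real (d*e))) / of_nat (d * e)))"
    using M1 M2 h_support by (rule sum_conv_support)
  also have "\<dots> = (\<Sum>d | d dvd M1. \<Sum>e | e dvd M2. (h1 d * complex_of_real (ln (real d)) / of_nat d) * (h2 e / of_nat e)
      + (h1 d / of_nat d) * (h2 e * complex_of_real (ln (real e)) / of_nat e))"
  proof (intro sum.cong refl)
    fix d e assume "d \<in> {d. d dvd M1}" "e \<in> {e. e dvd M2}"
    then have "d > 0" "e > 0" using dvd_pos_nat[OF M1] dvd_pos_nat[OF M2] by auto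
    then show "h1 d * h2 e * (complex_of_real (ln (real (d*e))) / of_nat (d * e)) =
      (h1 d * complex_of_real (ln (real d)) / of_nat d) * (h2 e / of_nat e)
      + (h1 d / of_nat d) * (h2 e * complex_of_real (ln (real e)) / of_nat e)"
      by (simp add: ln_mult field_simps)
  qed
  also have "\<dots> = (\<Sum>d | d dvd M1. h1 d * complex_of_real (ln (real d)) / of_nat d) * (\<Sum>e | e dvd M2. h2 e / of_nat e)
     + (\<Sum>d | d dvd M1. h1 d / of_nat d) * (\<Sum>e | e dvd M2. h2 e * complex_of_real (ln (real e)) / of_nat e)"
    by (simp add: sum.distrib sum_product)
  finally show ?thesis using conv_moebius_sum_eq_0[OF f1 M1 pc1] conv_moebius_sum_eq_0[OF f2 M2 pc2]
    by (simp add: h1_def h2_def)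
qed

lemma f_conv:
  assumes "n > 0"
  shows "(f1 \<star> f2) n = (\<Sum>d | d dvd n. g d * of_nat (num_divisors (n div d)))"
proof -
  have "(f1 \<star> f2) n = ((h1 \<star> (\<lambda>_. 1)) \<star> (h2 \<star> (\<lambda>_. 1))) n"
    by (rule conv_cong) (simp_all add: h1_def h2_def moebius_inversion)
  also have "\<dots> = (g \<star> ((\<lambda>_. 1) \<star> (\<lambda>_. 1))) n" unfolding g_eq by (simp add: conv_ac)
  also have "\<dots> = (\<Sum>d | d dvd n. g d * of_nat (num_divisors (n div d)))"
    unfolding dirichlet_conv_def[of g] using assms
    by (intro sum.cong refl) (auto simp: num_divisors_conv elim!: dvdE)
  finally show ?thesis .
qed

end

section \<open>Correlations of the divisor function\<close>

abbreviation (input) tau :: "nat \<Rightarrow> real" where "tau n \<equiv> real (num_divisors n)"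

lemma multiplicative_num_divisors: "multiplicative (\<lambda>n. of_nat (num_divisors n))"
  using multiplicative_conv[OF multiplicative_one multiplicative_one] unfolding multiplicative_def
  by (auto simp: num_divisors_conv[symmetric] simp del: One_nat_def)

lemma tau_mult_coprime:
  assumes "coprime m n" "m > 0" "n > 0"
  shows "tau (m * n) = tau m * tau n"
proof -
  have "complex_of_nat (num_divisors (m * n)) = of_nat (num_divisors m) * of_nat (num_divisors n)"
    using multiplicative_num_divisors assms unfolding multiplicative_def by blast
  then have "num_divisors (m * n) = num_divisors m * num_divisors n"
    by (metis of_nat_eq_iff of_nat_mult)
  then show ?thesis by simp
qed

lemma num_divisors_prime_power:
  assumes "prime p"
  shows "num_divisors (p ^ k) = k + 1"
proof -
  have "{d. d dvd p ^ k} = (\<lambda>i. p ^ i) ` {..k}"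
    using divides_primepow_nat[OF assms] by auto
  moreover have "inj_on (\<lambda>i. p ^ i) {..k}" using prime_gt_1_nat[OF assms] by (auto simp: inj_on_def power_inject_exp)
  ultimately show ?thesis by (simp add: num_divisors_def card_image)
qed

lemma num_divisors_1 [simp]: "num_divisors (Suc 0) = 1"
  by (simp add: num_divisors_def)

text \<open>The coefficients of zeta(2s): division by zeta(2s) in Ramanujan's formula becomes a
  convolution identity in which all terms are nonnegative.\<close>

definition square_ind :: "nat \<Rightarrow> nat" where
  "square_ind n = (if is_nth_power 2 n then 1 else 0)"

lemma multiplicative_square_ind: "multiplicative (\<lambda>n. of_nat (square_ind n))"
  unfolding multiplicative_def
proof (intro conjI allI impI)
  show "complex_of_nat (square_ind 1) = 1" by (simp add: square_ind_def)
next
  fix m n :: nat assume "0 < m" "0 < n" "coprime m n"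
  then have "is_nth_power 2 (m * n) \<longleftrightarrow> is_nth_power 2 m \<and> is_nth_power 2 n"
    by (intro is_nth_power_mult_coprime_nat_iff) auto
  then show "complex_of_nat (square_ind (m * n)) = of_nat (square_ind m) * of_nat (square_ind n)"
    by (auto simp: square_ind_def)
qed

text \<open>The coefficient of x^k in the square of (1-x)^(-2).\<close>

lemma sum_convolution_linear:
  "(\<Sum>i\<le>k. (of_nat (i + 1) :: complex) * of_nat (k - i + 1)) = of_nat (k + 1) * of_nat (k + 2) * of_nat (k + 3) / 6"
proof (induction k)
  case (Suc k)
  have lin: "(\<Sum>i\<le>m. (of_nat (i + 1) :: complex)) = of_nat (m + 1) * of_nat (m + 2) / 2" for m
    by (induction m) (auto simp: field_simps)
  have "(\<Sum>i\<le>Suc k. (of_nat (i + 1) :: complex) * of_nat (Suc k - i + 1))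
      = (\<Sum>i\<le>k. (of_nat (i + 1) :: complex) * of_nat (k - i + 1) + of_nat (i + 1)) + of_nat (Suc k + 1)"
    by (simp add: Suc_diff_le algebra_simps)
  also have "\<dots> = (\<Sum>i\<le>k. (of_nat (i + 1) :: complex) * of_nat (k - i + 1)) + (\<Sum>i\<le>Suc k. of_nat (i + 1))"
    by (simp add: sum.distrib)
  also have "\<dots> = of_nat (k + 1) * of_nat (k + 2) * of_nat (k + 3) / 6 + of_nat (Suc k + 1) * of_nat (Suc k + 2) / 2"
    unfolding Suc.IH lin ..
  also have "\<dots> = of_nat (Suc k + 1) * of_nat (Suc k + 2) * of_nat (Suc k + 3) / 6"
    by (simp add: field_simps)
  finally show ?case .
qed simp

text \<open>The coefficient of x^k in (1+x)(1-x)^(-3) times (1-x^2)^(-1), which is again (1-x)^(-4).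
  Agreement with the preceding sum is Ramanujan's identity at one prime. The induction advances by
  two in order to preserve the parity of k - i.\<close>

lemma sum_alternate_squares:
  "(\<Sum>i\<le>k. (of_nat (i + 1) :: complex)\<^sup>2 * (if even (k - i) then 1 else 0))
     = of_nat (k + 1) * of_nat (k + 2) * of_nat (k + 3) / 6"
proof (induction k rule: nat_induct2)
  case (step k)
  have "(\<Sum>i\<le>k+2. (of_nat (i + 1) :: complex)\<^sup>2 * (if even (k + 2 - i) then 1 else 0))
      = (\<Sum>i\<le>k. (of_nat (i + 1) :: complex)\<^sup>2 * (if even (k + 2 - i) then 1 else 0)) + of_nat (k + 3) ^ 2"
    by (simp add: eval_nat_numeral)
  also have "(\<Sum>i\<le>k. (of_nat (i + 1) :: complex)\<^sup>2 * (if even (k + 2 - i) then 1 else 0))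
     = (\<Sum>i\<le>k. (of_nat (i + 1) :: complex)\<^sup>2 * (if even (k - i) then 1 else 0))"
    by (intro sum.cong refl) (auto simp: Suc_diff_le)
  finally show ?case unfolding step by (simp add: field_simps power2_eq_square)
qed (simp_all add: atMost_Suc)

text \<open>The coefficientwise form of Ramanujan's $\zeta(2s)\sum \tau(n)^2 n^{-s} = \zeta(s)^4$.\<close>

lemma tau_squared_conv:
  assumes "n > 0"
  shows "((\<lambda>n. of_nat (num_divisors n) ^ 2) \<star> (\<lambda>n. of_nat (square_ind n))) n
       = ((\<lambda>n. of_nat (num_divisors n)) \<star> (\<lambda>n. of_nat (num_divisors n))) n"
proof (rule multiplicative_eqI[OF multiplicative_conv multiplicative_conv _ assms])
  show "multiplicative (\<lambda>n. (complex_of_nat (num_divisors n))\<^sup>2)"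
    using multiplicative_num_divisors by (auto simp: multiplicative_def power_mult_distrib)
next
  fix p k :: nat assume p: "prime p" and "1 \<le> k"
  have "square_ind (p ^ i) = (if even i then 1 else 0)" for i
    using p by (simp add: square_ind_def is_nth_power_prime_power_nat_iff)
  then show "((\<lambda>n. (complex_of_nat (num_divisors n))\<^sup>2) \<star> (\<lambda>n. of_nat (square_ind n))) (p ^ k)
      = ((\<lambda>n. of_nat (num_divisors n)) \<star> (\<lambda>n. of_nat (num_divisors n))) (p ^ k)"
    unfolding conv_prime_power[OF p] num_divisors_prime_power[OF p]
    using sum_alternate_squares[of k] sum_convolution_linear[of k] by (simp only: of_nat_1 of_nat_0 if_distrib[of of_nat])
qed (rule multiplicative_square_ind multiplicative_num_divisors)+

section \<open>Dirichlet series as unordered sums over the positive integers\<close>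

lemma has_sum_times:
  fixes u :: "'a \<Rightarrow> real" and v :: "'b \<Rightarrow> real"
  assumes u: "(u has_sum U) A" and v: "(v has_sum V) B"
    and "\<And>a. a \<in> A \<Longrightarrow> u a \<ge> 0" "\<And>b. b \<in> B \<Longrightarrow> v b \<ge> 0"
  shows "((\<lambda>(a,b). u a * v b) has_sum (U * V)) (A \<times> B)"
proof (rule has_sum_SigmaI)
  show "((\<lambda>b. case (a, b) of (a, b) \<Rightarrow> u a * v b) has_sum (u a * V)) B" for a
    using has_sum_cmult_right[OF v] by simp
  show *: "((\<lambda>a. u a * V) has_sum U * V) A" using has_sum_cmult_left[OF u] .
  show "(\<lambda>(a, b). u a * v b) summable_on A \<times> B"
    by (rule summable_on_SigmaI[where g = "\<lambda>a. u a * V"])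
       (use has_sum_cmult_right[OF v] * assms in \<open>auto simp: summable_on_def\<close>)
qed

lemma has_sum_dirichlet:
  fixes u v :: "nat \<Rightarrow> real"
  assumes u: "(u has_sum U) {0<..}" and v: "(v has_sum V) {0<..}"
    and "\<And>n. u n \<ge> 0" "\<And>n. v n \<ge> 0"
  shows "((\<lambda>n. \<Sum>d | d dvd n. u d * v (n div d)) has_sum (U * V)) {0<..}"
proof -
  have "((\<lambda>(a,b). u a * v b) has_sum (U * V)) ({0<..} \<times> {0<..})"
    by (rule has_sum_times) (use assms in auto)
  also have "?this \<longleftrightarrow> ((\<lambda>(n,d). u d * v (n div d)) has_sum (U * V)) (SIGMA n:{0<..}. {d. d dvd n})"
    by (rule has_sum_reindex_bij_witness[of _ "\<lambda>(n,d). (d, n div d)" "\<lambda>(a,b). (a*b, a)"])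
       (auto elim!: dvdE)
  finally show ?thesis
    by (rule has_sum_SigmaD) (auto intro!: has_sum_finiteI simp: finite_divisors_nat)
qed

lemma has_sum_zeta:
  assumes "s > 1"
  shows "((\<lambda>n. real n powr (-s)) has_sum zeta s) {0<..}"
proof -
  have "summable (\<lambda>n. real n powr (-s))" using assms by (simp add: summable_real_powr_iff)
  then have "summable (\<lambda>n. real (Suc n) powr (-s))" by (subst summable_Suc_iff)
  then have "((\<lambda>n. real (Suc n) powr (-s)) has_sum (\<Sum>n. real (Suc n) powr (-s))) UNIV"
    by (intro norm_summable_imp_has_sum) (auto intro: summable_sums)
  moreover have "(\<Sum>n. real (Suc n) powr (-s)) = zeta s"
    unfolding zeta_def by (simp add: powr_minus_divide)
  moreover have "bij_betw Suc UNIV {0<..}"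
    by (rule bij_betw_byWitness[of _ "\<lambda>n. n - 1"]) auto
  ultimately show ?thesis
    using has_sum_reindex_bij_betw[of Suc UNIV "{0<..}" "\<lambda>n. real n powr (-s)"] by simp
qed

lemma zeta_pos:
  assumes "s > 1" shows "zeta s > 0"
proof -
  have "real 1 powr (-s) \<le> zeta s"
    using has_sum_mono_neutral[OF has_sum_finite[of "{1}"] has_sum_zeta[OF assms]]
    by force
  then show ?thesis by simp
qed

lemma has_sum_tau:
  "((\<lambda>n. tau n * real n powr (-3/2)) has_sum zeta (3/2) ^ 2) {0<..}"
proof -
  have "((\<lambda>n. \<Sum>d | d dvd n. real d powr (-3/2) * real (n div d) powr (-3/2)) has_sum zeta (3/2) ^ 2) {0<..}"
    unfolding power2_eq_square using has_sum_zeta[of "3/2"]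
    by (intro has_sum_dirichlet) auto
  also have "?this \<longleftrightarrow> ?thesis"
  proof (rule has_sum_cong)
    fix n :: nat assume "n \<in> {0<..}"
    then have "(\<Sum>d | d dvd n. real d powr (-3/2) * real (n div d) powr (-3/2)) = (\<Sum>d | d dvd n. real n powr (-3/2))"
      by (intro sum.cong refl) (auto simp: powr_mult[symmetric] elim!: dvdE)
    then show "(\<Sum>d | d dvd n. real d powr (-3/2) * real (n div d) powr (-3/2)) = tau n * real n powr (-3/2)"
      by (simp add: num_divisors_def)
  qed
  finally show ?thesis .
qed

lemma has_sum_dirichlet_weighted:
  fixes u v :: "nat \<Rightarrow> real"
  assumes u: "((\<lambda>n. u n * real n powr s) has_sum U) {0<..}" and v: "((\<lambda>n. v n * real n powr s) has_sum V) {0<..}"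
    and "\<And>n. u n \<ge> 0" "\<And>n. v n \<ge> 0"
  shows "((\<lambda>n. (\<Sum>d | d dvd n. u d * v (n div d)) * real n powr s) has_sum (U * V)) {0<..}"
proof -
  have "((\<lambda>n. \<Sum>d | d dvd n. (u d * real d powr s) * (v (n div d) * real (n div d) powr s)) has_sum (U * V)) {0<..}"
    by (rule has_sum_dirichlet[OF u v]) (use assms in auto)
  also have "?this \<longleftrightarrow> ?thesis"
  proof (rule has_sum_cong)
    fix n :: nat assume "n \<in> {0<..}"
    then show "(\<Sum>d | d dvd n. (u d * real d powr s) * (v (n div d) * real (n div d) powr s))
       = (\<Sum>d | d dvd n. u d * v (n div d)) * real n powr s"
      unfolding sum_distrib_right
      by (intro sum.cong refl) (auto simp: powr_mult elim!: dvdE)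
  qed
  finally show ?thesis .
qed

text \<open>Let T be the sum of the series. Convolving with the squares multiplies it by zeta(3) and
  produces tau * tau, with sum zeta(3/2)^4, so T can be solved for. Convergence must come first; it
  follows by comparison with tau * tau.\<close>

lemma has_sum_tau_squared:
  "((\<lambda>n. tau n ^ 2 * real n powr (-3/2)) has_sum (zeta (3/2) ^ 4 / zeta 3)) {0<..}"
proof -
  have four: "((\<lambda>n. (\<Sum>d | d dvd n. tau d * tau (n div d)) * real n powr (-3/2)) has_sum (zeta (3/2) ^ 4)) {0<..}"
    using has_sum_dirichlet_weighted[OF has_sum_tau has_sum_tau] by (simp add: power_add[symmetric])
  have id: "(\<Sum>d | d dvd n. tau d ^ 2 * real (square_ind (n div d))) = (\<Sum>d | d dvd n. tau d * tau (n div d))" if "n > 0" for n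
  proof -
    have "complex_of_nat (\<Sum>d | d dvd n. num_divisors d ^ 2 * square_ind (n div d)) = complex_of_nat (\<Sum>d | d dvd n. num_divisors d * num_divisors (n div d))"
      using tau_squared_conv[OF that] by (simp add: dirichlet_conv_def)
    then have "(\<Sum>d | d dvd n. num_divisors d ^ 2 * square_ind (n div d)) = (\<Sum>d | d dvd n. num_divisors d * num_divisors (n div d))"
      using of_nat_eq_iff by blast
    then have "real (\<Sum>d | d dvd n. num_divisors d ^ 2 * square_ind (n div d)) = real (\<Sum>d | d dvd n. num_divisors d * num_divisors (n div d))"
      by simp
    then show ?thesis by simp
  qed
  \<comment> \<open>Only the term d = n of the identity \<open>id\<close> is kept, where the square
    indicator is taken at 1.\<close>
  have le: "tau n ^ 2 \<le> (\<Sum>d | d dvd n. tau d * tau (n div d))" if "n > 0" for n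
  proof -
    have "(\<Sum>d\<in>{n}. tau d ^ 2 * real (square_ind (n div d))) \<le> (\<Sum>d | d dvd n. tau d ^ 2 * real (square_ind (n div d)))"
      by (rule sum_mono2) (use that in auto)
    then show ?thesis using that id by (simp add: square_ind_def)
  qed
  have "(\<lambda>n. tau n ^ 2 * real n powr (-3/2)) summable_on {0<..}"
  proof (rule summable_on_comparison_test)
    show "(\<lambda>n. (\<Sum>d | d dvd n. tau d * tau (n div d)) * real n powr (-3/2)) summable_on {0<..}"
      using four by (auto simp: summable_on_def)
  qed (use le in \<open>auto intro: mult_right_mono\<close>)
  then obtain T where T: "((\<lambda>n. tau n ^ 2 * real n powr (-3/2)) has_sum T) {0<..}"
    by (auto simp: summable_on_def)
  have sq: "((\<lambda>n. real (square_ind n) * real n powr (-3/2)) has_sum zeta 3) {0<..}"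
  proof -
    have "((\<lambda>n. real n powr (-3)) has_sum zeta 3) {0<..}" by (rule has_sum_zeta) simp
    also have "?this \<longleftrightarrow> (((\<lambda>n. real (square_ind n) * real n powr (-3/2)) \<circ> (\<lambda>n. n ^ 2)) has_sum zeta 3) {0<..}"
    proof (rule has_sum_cong)
      fix n :: nat assume "n \<in> {0<..}"
      then have "real (n\<^sup>2) powr (-3/2) = real n powr (-3)"
        by (simp add: powr_powr flip: powr_numeral)
      then show "real n powr (-3) = ((\<lambda>n. real (square_ind n) * real n powr (-3/2)) \<circ> (\<lambda>n. n ^ 2)) n"
        by (simp add: square_ind_def)
    qed
    also have "\<dots> \<longleftrightarrow> ((\<lambda>n. real (square_ind n) * real n powr (-3/2)) has_sum zeta 3) ((\<lambda>n. n^2) ` {0<..})"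
      by (subst has_sum_reindex) (auto simp: inj_on_def)
    also have "\<dots> \<longleftrightarrow> ?thesis"
      by (rule has_sum_cong_neutral) (auto simp: square_ind_def is_nth_power_def image_iff)
    finally show ?thesis .
  qed
  have "((\<lambda>n. (\<Sum>d | d dvd n. tau d ^ 2 * real (square_ind (n div d))) * real n powr (-3/2)) has_sum (T * zeta 3)) {0<..}"
    by (rule has_sum_dirichlet_weighted[OF T sq]) auto
  also have "?this \<longleftrightarrow> ((\<lambda>n. (\<Sum>d | d dvd n. tau d * tau (n div d)) * real n powr (-3/2)) has_sum (T * zeta 3)) {0<..}"
    by (rule has_sum_cong) (simp add: id)
  finally have "T * zeta 3 = zeta (3/2) ^ 4" using four has_sum_unique by blast
  then have "T = zeta (3/2) ^ 4 / zeta 3" using zeta_pos[of 3] by (simp add: field_simps)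
  then show ?thesis using T by simp
qed

section \<open>Euler factors of the correlation series\<close>

lemma has_sum_split_prime:
  fixes u v F :: "nat \<Rightarrow> real"
  assumes p: "prime p" and u: "(u has_sum U) UNIV" and v: "(v has_sum V) {t. 0 < t \<and> \<not> p dvd t}"
    and nn: "\<And>n. u n \<ge> 0" "\<And>n. v n \<ge> 0"
    and F: "\<And>j t. 0 < t \<Longrightarrow> \<not> p dvd t \<Longrightarrow> F (p ^ j * t) = u j * v t"
  shows "(F has_sum (U * V)) {0<..}"
proof -
  have p0: "p > 0" "p \<noteq> 0" "\<not> is_unit p" using p prime_gt_0_nat not_prime_unit by auto
  have mult: "multiplicity p (p ^ j * t) = j" if "0 < t" "\<not> p dvd t" for j t
    using that p0 by (simp add: multiplicity_eqI)
  have "((\<lambda>(j,t). u j * v t) has_sum (U * V)) (UNIV \<times> {t. 0 < t \<and> \<not> p dvd t})"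
    by (rule has_sum_times[OF u v]) (use nn in auto)
  also have "?this \<longleftrightarrow> ?thesis"
  proof (rule has_sum_reindex_bij_witness[of _ "\<lambda>n. (multiplicity p n, n div p ^ multiplicity p n)" "\<lambda>(j,t). p ^ j * t"])
    fix n :: nat assume n: "n \<in> {0<..}"
    obtain m where m: "n = p ^ multiplicity p n * m" "\<not> p dvd m"
      using multiplicity_decompose'[of n p] n p0 by auto
    have "n div p ^ multiplicity p n = m" using m(1) p0 by (metis nonzero_mult_div_cancel_left power_not_zero)
    moreover have "m > 0" using m n by (cases m) auto
    ultimately show "(case (multiplicity p n, n div p ^ multiplicity p n) of (j, t) \<Rightarrow> p ^ j * t) = n"
      "(multiplicity p n, n div p ^ multiplicity p n) \<in> UNIV \<times> {t. 0 < t \<and> \<not> p dvd t}"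
      using m by auto
  qed (use p0 mult F in auto)
  finally show ?thesis .
qed

text \<open>The Euler factor at p of the correlation series: the coefficients are tau(p^(k+j))
  tau(p^j), and x stands for p^(-3/2).\<close>

lemma sums_quadratic_geometric:
  fixes x :: real
  assumes x: "0 \<le> x" "x < 1"
  shows "(\<lambda>j. (real k + real j + 1) * (real j + 1) * x ^ j) sums ((real k + 1 - (real k - 1) * x) / (1 - x) ^ 3)"
proof -
  have g: "(\<lambda>j. x ^ j) sums (1 / (1 - x))" using geometric_sums[of x] x by simp
  have g1: "(\<lambda>j. real (Suc j) * x ^ j) sums (1 / (1 - x)\<^sup>2)" using geometric_deriv_sums[of x] x by simp
  have "(\<lambda>j. \<Sum>i\<le>j. (real (Suc i) * x ^ i) * x ^ (j - i)) sums ((\<Sum>j. real (Suc j) * x ^ j) * (\<Sum>j. x ^ j))"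
    by (rule Cauchy_product_sums) (use x g g1 in \<open>auto simp: sums_iff abs_mult\<close>)
  moreover have "(\<Sum>i\<le>j. (real (Suc i) * x ^ i) * x ^ (j - i)) = (real j + 1) * (real j + 2) / 2 * x ^ j" for j
  proof -
    have "(\<Sum>i\<le>j. (real (Suc i) * x ^ i) * x ^ (j - i)) = (\<Sum>i\<le>j. real (Suc i)) * x ^ j"
      unfolding sum_distrib_right by (intro sum.cong refl) (simp add: mult.assoc flip: power_add)
    also have "(\<Sum>i\<le>j. real (Suc i)) = (real j + 1) * (real j + 2) / 2"
      by (induction j) (auto simp: field_simps)
    finally show ?thesis .
  qed
  ultimately have g2: "(\<lambda>j. (real j + 1) * (real j + 2) / 2 * x ^ j) sums (1 / (1 - x)\<^sup>2 * (1 / (1 - x)))"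
    using g g1 by (simp only: sums_iff conj_assoc)
  \<comment> \<open>(k+j+1)(j+1) = (j+1)(j+2) + (k-1)(j+1) reduces the series to those of (1-x)^(-3)
    and (1-x)^(-2).\<close>
  have "(\<lambda>j. 2 * ((real j + 1) * (real j + 2) / 2 * x ^ j) + (real k - 1) * (real (Suc j) * x ^ j))
     sums (2 * (1 / (1 - x)\<^sup>2 * (1 / (1 - x))) + (real k - 1) * (1 / (1 - x)\<^sup>2))"
    by (intro sums_add sums_mult g1 g2)
  moreover have "2 * ((real j + 1) * (real j + 2) / 2 * x ^ j) + (real k - 1) * (real (Suc j) * x ^ j)
    = (real k + real j + 1) * (real j + 1) * x ^ j" for j
    by (simp add: algebra_simps)
  moreover have "2 * (1 / (1 - x)\<^sup>2 * (1 / (1 - x))) + (real k - 1) * (1 / (1 - x)\<^sup>2) = (real k + 1 - (real k - 1) * x) / (1 - x) ^ 3"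
    using x by (simp add: divide_simps power2_eq_square power3_eq_cube) (simp add: algebra_simps)
  ultimately show ?thesis by simp
qed

lemma has_sum_quadratic_geometric:
  fixes x :: real
  assumes x: "0 \<le> x" "x < 1"
  shows "((\<lambda>j. (real k + real j + 1) * (real j + 1) * x ^ j) has_sum ((real k + 1 - (real k - 1) * x) / (1 - x) ^ 3)) UNIV"
  using sums_quadratic_geometric[OF x] x
  by (intro norm_summable_imp_has_sum) (auto simp: sums_iff abs_mult)

lemma local_product_mult:
  assumes p: "prime p" and k: "k \<ge> 1" and m: "m > 0" "\<not> p dvd m"
  shows "local_product (p ^ k * m) = local_factor p k * local_product m"
proof -
  have p0: "p > 0" "p \<noteq> 0" "\<not> is_unit p" using p prime_gt_0_nat not_prime_unit by auto
  have "prime_factors (p ^ k) = {p}" using p k by (simp add: prime_factorization_prime_power)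
  then have pf: "prime_factors (p ^ k * m) = insert p (prime_factors m)"
    using p0 m by (simp add: prime_factors_product)
  have notin: "p \<notin> prime_factors m" using m by (auto simp: in_prime_factors_iff)
  have mp: "multiplicity p (p ^ k * m) = k" using m p0 by (simp add: multiplicity_eqI)
  have "multiplicity r (p ^ k * m) = multiplicity r m" if r: "r \<in> prime_factors m" for r
  proof -
    have "\<not> r dvd p ^ k" using r notin p by (metis in_prime_factors_iff prime_dvd_power primes_dvd_imp_eq)
    moreover have "prime r" using r by (simp add: in_prime_factors_iff)
    ultimately show ?thesis by (simp add: multiplicity_prime_elem_times_other)
  qed
  then show ?thesis unfolding local_product_def pf using notin by (simp add: mp)
qed

text \<open>The part V of the series coming from t prime to p is the same for every k, so it cancels
  in the quotient by the case k = 0 and never needs evaluation. The quotient of the two Euler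
  factors is (k+1) times \<open>local_factor p k\<close>.\<close>

lemma has_sum_tau_tau_step:
  assumes p: "prime p" and k: "k \<ge> 1" and pos: "a > 0" "b > 0" and nd: "\<not> p dvd a" "\<not> p dvd b"
    and S: "((\<lambda>t. tau (a * t) * tau (b * t) * real t powr (-3/2)) has_sum S) {0<..}"
  shows "((\<lambda>t. tau (p ^ k * a * t) * tau (b * t) * real t powr (-3/2)) has_sum (S * (real k + 1) * local_factor p k)) {0<..}"
proof -
  define x where "x = real p powr (-3/2)"
  have p1: "real p > 1" using prime_gt_1_nat[OF p] by simp
  have x: "0 < x" "x < 1" using p1 unfolding x_def by (auto intro: powr_less_one)
  define v where "v = (\<lambda>t. tau (a * t) * tau (b * t) * real t powr (-3/2))"
  have "v summable_on {t. 0 < t \<and> \<not> p dvd t}"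
    by (rule summable_on_subset_banach[of _ "{0<..}"]) (use S in \<open>auto simp: v_def summable_on_def\<close>)
  then obtain V where V: "(v has_sum V) {t. 0 < t \<and> \<not> p dvd t}" by (auto simp: summable_on_def)
  have ppow: "real (p ^ j * t) powr (-3/2) = x ^ j * real t powr (-3/2)" for j t
  proof -
    have "real (p ^ j) powr (-3/2) = x ^ j" unfolding x_def using p1
      by (simp add: powr_realpow[symmetric] powr_powr mult.commute)
    then show ?thesis by (simp add: powr_mult)
  qed
  have gen: "((\<lambda>t. tau (p ^ k * a * t) * tau (b * t) * real t powr (-3/2)) has_sum
      ((real k + 1 - (real k - 1) * x) / (1 - x) ^ 3 * V)) {0<..}" for k
  proof (rule has_sum_split_prime[OF p has_sum_quadratic_geometric[of x k] V])
    fix j t assume t: "0 < t" "\<not> p dvd t"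
    have nda: "\<not> p dvd a * t" "\<not> p dvd b * t" using nd t p by (auto simp: prime_dvd_mult_iff)
    have c: "coprime (p ^ (k + j)) (a * t)" "coprime (p ^ j) (b * t)"
      using prime_imp_coprime[OF p nda(1)] prime_imp_coprime[OF p nda(2)] by (auto simp del: coprime_mult_right_iff)
    have "tau (p ^ k * a * (p ^ j * t)) = tau (p ^ (k + j) * (a * t))" by (simp add: power_add mult_ac)
    also have "\<dots> = (real k + real j + 1) * tau (a * t)"
      using tau_mult_coprime[OF c(1)] p1 pos t by (simp add: num_divisors_prime_power[OF p])
    finally have 1: "tau (p ^ k * a * (p ^ j * t)) = (real k + real j + 1) * tau (a * t)" .
    have "tau (b * (p ^ j * t)) = tau (p ^ j * (b * t))" by (simp add: mult_ac)
    also have "\<dots> = (real j + 1) * tau (b * t)"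
      using tau_mult_coprime[OF c(2)] p1 pos t by (simp add: num_divisors_prime_power[OF p])
    finally show "tau (p ^ k * a * (p ^ j * t)) * tau (b * (p ^ j * t)) * real (p ^ j * t) powr (-3/2)
       = (real k + real j + 1) * (real j + 1) * x ^ j * v t"
      unfolding 1 ppow v_def by simp
  qed (use x in \<open>auto simp: v_def\<close>)
  have "S = (1 + x) / (1 - x) ^ 3 * V"
    using has_sum_unique[OF S, of "(real 0 + 1 - (real 0 - 1) * x) / (1 - x) ^ 3 * V"] gen[of 0] by simp
  then have "S * (real k + 1) * local_factor p k = (real k + 1 - (real k - 1) * x) / (1 - x) ^ 3 * V"
    using x unfolding local_factor_def x_def[symmetric]
    by (simp add: divide_simps) (simp add: algebra_simps)?
  then show ?thesis using gen[of k] by simp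
qed

text \<open>Induction on ab removes one prime completely. By coprimality the prime divides only one
  of a and b, and the series is symmetric in them, so it is enough to treat a prime dividing the
  first argument.\<close>

theorem has_sum_tau_tau:
  assumes "coprime a b" "a > 0" "b > 0"
  shows "((\<lambda>t. tau (a * t) * tau (b * t) * real t powr (-3/2)) has_sum
     (zeta (3/2) ^ 4 / zeta 3 * (tau (a * b) * local_product (a * b)))) {0<..}"
  using assms
proof (induction "a * b" arbitrary: a b rule: less_induct)
  case less
  show ?case
  proof (cases "a * b = 1")
    case True
    then have "a = 1" "b = 1" by auto
    then show ?thesis using has_sum_tau_squared by (simp add: local_product_def power2_eq_square)
  next
    case False
    have step: "((\<lambda>t. tau (a * t) * tau (b * t) * real t powr (-3/2)) has_sum
       (zeta (3/2) ^ 4 / zeta 3 * (tau (a * b) * local_product (a * b)))) {0<..}"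
      if ab: "coprime a b" "a > 0" "b > 0" and p: "prime p" "p dvd a"
       and IH: "\<And>a'. coprime a' b \<Longrightarrow> a' > 0 \<Longrightarrow> a' * b < a * b \<Longrightarrow> ((\<lambda>t. tau (a' * t) * tau (b * t) * real t powr (-3/2)) has_sum
       (zeta (3/2) ^ 4 / zeta 3 * (tau (a' * b) * local_product (a' * b)))) {0<..}"
      for a b p
    proof -
      define k where "k = multiplicity p a"
      obtain a' where a': "a = p ^ k * a'" "\<not> p dvd a'"
        using multiplicity_decompose'[of a p] ab p(1) unfolding k_def
        by (metis not_prime_unit not_gr_zero)
      have k: "k \<ge> 1" using a' p by (cases k) auto
      have a'0: "a' > 0" using a' ab by (cases a') auto
      have pk: "p ^ k > 1" using k prime_gt_1_nat[OF p(1)] by (intro one_less_power) auto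
      have nb: "\<not> p dvd b" using ab(1) p by (metis coprime_common_divisor not_prime_unit)
      have nab: "\<not> p dvd a' * b" using a' nb p by (simp add: prime_dvd_mult_iff)
      have "coprime a' b" using ab(1) a'(1) by simp
      moreover have "a' * b < a * b" using a' a'0 ab pk by simp
      ultimately have "((\<lambda>t. tau (p ^ k * a' * t) * tau (b * t) * real t powr (-3/2)) has_sum
        (zeta (3/2) ^ 4 / zeta 3 * (tau (a' * b) * local_product (a' * b)) * (real k + 1) * local_factor p k)) {0<..}"
        by (intro has_sum_tau_tau_step p k a'0 ab a' nb IH)
      moreover have "tau (a * b) = (real k + 1) * tau (a' * b)"
        using tau_mult_coprime[OF coprime_power_left_iff[THEN iffD2, OF disjI1, OF prime_imp_coprime[OF p(1) nab]], of k] a'0 ab pk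
        by (simp add: a'(1) num_divisors_prime_power[OF p(1)] mult.assoc del: coprime_mult_right_iff)
      moreover have "local_product (a * b) = local_factor p k * local_product (a' * b)"
        using local_product_mult[OF p(1) k _ nab] a'0 ab by (simp add: a'(1) mult.assoc)
      ultimately show ?thesis by (simp add: a'(1) mult_ac)
    qed
    obtain p where p: "prime p" "p dvd a * b" using False prime_factor_nat by blast
    then consider "p dvd a" | "p dvd b" by (auto simp: prime_dvd_mult_iff)
    then show ?thesis
    proof cases
      case 1
      show ?thesis by (rule step[OF less.prems p(1) 1]) (use less in auto)
    next
      case 2
      have "((\<lambda>t. tau (b * t) * tau (a * t) * real t powr (-3/2)) has_sum
       (zeta (3/2) ^ 4 / zeta 3 * (tau (b * a) * local_product (b * a)))) {0<..}"
      proof (rule step[OF _ _ _ p(1) 2])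
        fix b' assume b': "coprime b' a" "b' > 0" "b' * a < b * a"
        then show "((\<lambda>t. tau (b' * t) * tau (a * t) * real t powr (-3/2)) has_sum
          (zeta (3/2) ^ 4 / zeta 3 * (tau (b' * a) * local_product (b' * a)))) {0<..}"
          using less.hyps[of a b'] less.prems by (simp add: mult_ac coprime_commute)
      qed (use less.prems in \<open>auto simp: coprime_commute\<close>)
      then show ?thesis by (simp add: mult_ac)
    qed
  qed
qed

section \<open>The Fresnel integral\<close>

text \<open>The signed interval integral makes FE an odd function on the whole line; negative
  arguments occur to the left of a stationary point.\<close>

definition FE :: "real \<Rightarrow> complex" where
  "FE x = (LBINT s=0..x. ee (s\<^sup>2))"

lemma FE_deriv: "(FE has_vector_derivative ee (x\<^sup>2)) (at x within S)"
proof -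
  define a where "a = - \<bar>x\<bar> - 1"
  define b where "b = \<bar>x\<bar> + 1"
  have "((\<lambda>u. LBINT s=ereal 0..u. ee (s\<^sup>2)) has_vector_derivative ee (x\<^sup>2)) (at x within {a..b})"
    by (rule interval_integral_FTC2) (auto simp: a_def b_def intro!: continuous_intros)
  then have "((\<lambda>u. LBINT s=ereal 0..u. ee (s\<^sup>2)) has_vector_derivative ee (x\<^sup>2)) (at x)"
    by (subst (asm) at_within_interior) (auto simp: a_def b_def abs_real_def)
  then show ?thesis unfolding FE_def by (simp add: zero_ereal_def has_vector_derivative_at_within)
qed

lemma FE_0 [simp]: "FE 0 = 0"
  by (simp add: FE_def zero_ereal_def)

lemma continuous_on_FE [continuous_intros]:
  assumes "continuous_on S f" shows "continuous_on S (\<lambda>x. FE (f x))"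
proof -
  have "continuous_on UNIV FE" by (rule continuous_on_vector_derivative) (rule FE_deriv)
  then show ?thesis using continuous_on_compose2[OF _ assms] by blast
qed

lemma FE_chain:
  assumes "(f has_real_derivative f') (at x within S)"
  shows "((\<lambda>x. FE (f x)) has_vector_derivative (complex_of_real f' * ee ((f x)\<^sup>2))) (at x within S)"
  using vector_diff_chain_within[OF assms[unfolded has_real_derivative_iff_has_vector_derivative] FE_deriv[of "f x"]]
  by (simp add: o_def scaleR_conv_of_real)

lemma FE_minus: "FE (- x) = - FE x"
proof -
  have "((\<lambda>x. FE (- x) + FE x) has_vector_derivative 0) (at x within UNIV)" for x
    by (rule derivative_eq_intros FE_chain FE_deriv | simp)+
  then obtain c where "\<And>x. FE (- x) + FE x = c"
    using has_vector_derivative_zero_constant[of UNIV "\<lambda>x. FE (- x) + FE x"] by auto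
  from this[of 0] this[of x] show ?thesis by (simp add: add_eq_0_iff)
qed

lemma FE_stretch: "x * integral {0..1} (\<lambda>v. ee ((x * v)\<^sup>2)) = FE x"
proof -
  have "((\<lambda>v. complex_of_real x * ee ((x * v)\<^sup>2)) has_integral (FE (x * 1) - FE (x * 0))) {0..1}"
    by (rule fundamental_theorem_of_calculus) (auto intro!: derivative_eq_intros FE_chain)
  then have "integral {0..1} (\<lambda>v. complex_of_real x * ee ((x * v)\<^sup>2)) = FE x"
    using integral_unique by force
  then show ?thesis by simp
qed

text \<open>Integrating by parts once takes the boundary term e(s^2)/(4 pi i s) out of FE. What is
  left has a derivative of modulus 1/(4 pi s^2), whose integral is the right-hand side.\<close>

lemma FE_cauchy:
  assumes "0 < a" "a \<le> b"
  shows "cmod ((FE b - ee (b\<^sup>2) / (of_real (4 * pi * b) * \<i>)) - (FE a - ee (a\<^sup>2) / (of_real (4 * pi * a) * \<i>))) \<le> 1 / (4 * pi * a) - 1 / (4 * pi * b)"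
proof -
  define B where "B = (\<lambda>s. FE s - ee (s\<^sup>2) * (of_real (1 / (4 * pi * s)) * (- \<i>)))"
  have eq: "FE s - ee (s\<^sup>2) / (of_real (4 * pi * s) * \<i>) = B s" for s
  proof -
    have "ee (s\<^sup>2) / (of_real (4 * pi * s) * \<i>) = ee (s\<^sup>2) / of_real (4 * pi * s) / \<i>"
      by (simp only: divide_divide_eq_left)
    also have "\<dots> = ee (s\<^sup>2) * (of_real (1 / (4 * pi * s)) * (- \<i>))"
      by (simp only: divide_i of_real_divide of_real_1 mult_minus_right mult_minus_left times_divide_eq_right times_divide_eq_left mult_1_left mult_1_right minus_divide_left mult.commute mult.assoc)
    finally show ?thesis by (simp only: B_def)
  qed
  define B' where "B' = (\<lambda>s. ee (s\<^sup>2) * (of_real (1 / (4 * pi * s\<^sup>2)) * (-\<i>)))"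
  have dB: "(B has_vector_derivative B' s) (at s within {a..b})" if "s \<in> {a..b}" for s
  proof -
    have s: "s > 0" using that assms by auto
    have 1: "((\<lambda>s. complex_of_real (1 / (4 * pi * s))) has_vector_derivative complex_of_real (- 1 / (4 * pi * s\<^sup>2))) (at s within {a..b})"
      by (rule of_real_has_vector_derivative)
         (use s in \<open>auto intro!: derivative_eq_intros simp: power2_eq_square divide_simps\<close>)
    have "(B has_vector_derivative (ee (s\<^sup>2) - (ee (s\<^sup>2) * (of_real (- 1 / (4 * pi * s\<^sup>2)) * (-\<i>) )
        + (of_real (2 * pi * (2 * s)) * \<i> * ee (s\<^sup>2)) * (of_real (1 / (4 * pi * s)) * (-\<i>))))) (at s within {a..b})"
      unfolding B_def
      by (intro has_vector_derivative_diff has_vector_derivative_mult FE_deriv has_vector_derivative_mult_left 1 ee_has_vector_derivative)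
         (auto intro!: derivative_eq_intros)
    moreover have "ee (s\<^sup>2) - (ee (s\<^sup>2) * (of_real (- 1 / (4 * pi * s\<^sup>2)) * (-\<i>) )
        + (of_real (2 * pi * (2 * s)) * \<i> * ee (s\<^sup>2)) * (of_real (1 / (4 * pi * s)) * (-\<i>))) = B' s"
      using s by (simp add: B'_def field_simps)
    ultimately show ?thesis by simp
  qed
  have i1: "(B' has_integral (B b - B a)) {a..b}"
    by (rule fundamental_theorem_of_calculus) (use assms dB in auto)
  have i2: "((\<lambda>s. 1 / (4 * pi * s\<^sup>2)) has_integral (- 1 / (4 * pi * b) - (- 1 / (4 * pi * a)))) {a..b}"
    by (rule fundamental_theorem_of_calculus)
       (use assms in \<open>auto intro!: derivative_eq_intros simp: power2_eq_square divide_simps has_real_derivative_iff_has_vector_derivative[symmetric]\<close>)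
  have "cmod (B b - B a) \<le> - 1 / (4 * pi * b) - (- 1 / (4 * pi * a))"
    unfolding integral_unique[OF i1, symmetric] integral_unique[OF i2, symmetric]
    by (rule integral_norm_bound_integral) (use i1 i2 in \<open>auto simp: B'_def norm_mult norm_divide norm_power simp flip: of_real_power\<close>)
  then show ?thesis unfolding eq by simp
qed

text \<open>The boundary term removed in \<open>FE_cauchy\<close> and the remaining tail are each at
  most 1/(4 pi x), together less than 1/x.\<close>

lemma FE_limit_exists: "\<exists>L. \<forall>x>0. cmod (FE x - L) \<le> 1 / x"
proof -
  define B where "B = (\<lambda>s. FE s - ee (s\<^sup>2) / (of_real (4 * pi * s) * \<i>))"
  have Bb: "cmod (B b - B a) \<le> 1 / a" if "0 < a" "a \<le> b" for a b
  proof -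
    have "cmod (B b - B a) \<le> 1 / (4 * pi * a) - 1 / (4 * pi * b)" unfolding B_def by (rule FE_cauchy[OF that])
    also have "\<dots> \<le> 1 / (4 * pi * a)" using that by simp
    also have "\<dots> \<le> 1 / a" using that pi_ge_two by (intro divide_left_mono) auto
    finally show ?thesis .
  qed
  have conv: "convergent (\<lambda>n. B (real (Suc n)))"
  proof (intro Cauchy_convergent CauchyI')
    fix e :: real assume "e > 0"
    obtain N where N: "1 / real (Suc N) < e" using \<open>e > 0\<close> nat_approx_posE by blast
    show "\<exists>M. \<forall>m\<ge>M. \<forall>n>m. dist (B (real (Suc m))) (B (real (Suc n))) < e"
    proof (intro exI allI impI)
      fix m n assume "m \<ge> N" "n > m"
      then have "norm (B (real (Suc m)) - B (real (Suc n))) \<le> 1 / real (Suc m)"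
        using Bb[of "real (Suc m)" "real (Suc n)"] by (simp add: norm_minus_commute)
      also have "\<dots> \<le> 1 / real (Suc N)" using \<open>m \<ge> N\<close> by (intro divide_left_mono) auto
      finally show "dist (B (real (Suc m))) (B (real (Suc n))) < e" using N by (simp add: dist_norm)
    qed
  qed
  then obtain L where L: "(\<lambda>n. B (real (Suc n))) \<longlonglongrightarrow> L" by (auto simp: convergent_def)
  have "cmod (FE x - L) \<le> 1 / x" if x: "x > 0" for x
  proof -
    have "cmod (L - B x) \<le> 1 / (4 * pi * x)"
    proof (rule tendsto_upperbound)
      show "(\<lambda>n. cmod (B (real (Suc n)) - B x)) \<longlonglongrightarrow> cmod (L - B x)"
        by (intro tendsto_intros L)
      show "\<forall>\<^sub>F n in sequentially. cmod (B (real (Suc n)) - B x) \<le> 1 / (4 * pi * x)"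
        using eventually_ge_at_top[of "nat \<lceil>x\<rceil>"]
      proof eventually_elim
        case (elim n)
        then have "x \<le> real (Suc n)" by linarith
        then have "cmod (B (real (Suc n)) - B x) \<le> 1 / (4 * pi * x) - 1 / (4 * pi * real (Suc n))"
          unfolding B_def by (rule FE_cauchy[OF x])
        also have "\<dots> \<le> 1 / (4 * pi * x)" by simp
        finally show ?case .
      qed
    qed simp
    moreover have "cmod (FE x - B x) \<le> 1 / (4 * pi * x)"
      using x by (simp add: B_def norm_divide norm_mult)
    ultimately have "cmod (FE x - L) \<le> 1 / (4 * pi * x) + 1 / (4 * pi * x)"
      using norm_triangle_ineq4[of "FE x - B x" "L - B x"] by simp
    also have "\<dots> \<le> 1 / x" using x pi_ge_two by (simp add: divide_simps)
    finally show ?thesis .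
  qed
  then show ?thesis by blast
qed

definition Fres :: complex where "Fres = (SOME L. \<forall>x>0. cmod (FE x - L) \<le> 1 / x)"

lemma FE_Fres: "x > 0 \<Longrightarrow> cmod (FE x - Fres) \<le> 1 / x"
  using someI_ex[OF FE_limit_exists] unfolding Fres_def by blast

lemma FE_tendsto: "(FE \<longlongrightarrow> Fres) at_top"
proof (rule Lim_null_comparison[THEN LIM_zero_cancel])
  show "\<forall>\<^sub>F x in at_top. norm (FE x - Fres) \<le> 1 / x"
    using eventually_gt_at_top[of 0] by eventually_elim (rule FE_Fres)
  show "((\<lambda>x::real. 1 / x) \<longlongrightarrow> 0) at_top" by real_asymp
qed

lemma FE_bounded: "\<exists>B. \<forall>x. cmod (FE x) \<le> B"
proof -
  have "bounded (FE ` {-1..1})"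
    by (intro compact_imp_bounded compact_continuous_image continuous_intros) auto
  then obtain B0 where "\<forall>y\<in>FE ` {-1..1}. norm y \<le> B0" unfolding bounded_iff by blast
  then have B0: "\<And>x. x \<in> {-1..1} \<Longrightarrow> cmod (FE x) \<le> B0" by blast
  have big: "cmod (FE x) \<le> cmod Fres + 1" if "x \<ge> 1" for x
  proof -
    have "cmod (FE x - Fres) \<le> 1 / x" using FE_Fres that by simp
    also have "\<dots> \<le> 1" using that by simp
    finally show ?thesis using norm_triangle_ineq2[of "FE x" Fres] by linarith
  qed
  have "cmod (FE x) \<le> max B0 (cmod Fres + 1)" for x
  proof -
    consider "x \<ge> 1" | "x \<in> {-1..1}" | "-x \<ge> 1" by fastforce
    then show ?thesis using big[of x] big[of "-x"] B0[of x] by cases (auto simp: FE_minus)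
  qed
  then show ?thesis by blast
qed

text \<open>The classical trick: the square of the Fresnel integral differs from a constant by an
  integral over $[0,1]$ that vanishes at infinity.\<close>

lemma FE_square:
  "(FE x)\<^sup>2 + \<i> / of_real (2 * pi) * integral {0..1} (\<lambda>v. ee (x\<^sup>2 * (1 + v\<^sup>2)) / of_real (1 + v\<^sup>2)) = \<i> / 8"
proof -
  define K where "K = (\<lambda>x. integral {0..1} (\<lambda>v. ee (x\<^sup>2 * (1 + v\<^sup>2)) / of_real (1 + v\<^sup>2)))"
  have pos: "1 + v\<^sup>2 > (0::real)" for v by (simp add: add_pos_nonneg)
  have nz: "complex_of_real (1 + v\<^sup>2) \<noteq> 0" for v using pos[of v] by (metis less_irrefl of_real_eq_0_iff)
  \<comment> \<open>Differentiation under the integral cancels the denominator 1 + v^2 and leaves x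
    times the integral of e((xv)^2), which is FE x. After multiplication by i/(2 pi) it is the
    negative of the derivative of the square of FE.\<close>
  have dK: "(K has_vector_derivative (of_real (4 * pi) * \<i> * ee (x\<^sup>2) * FE x)) (at x)" for x
  proof -
    have "((\<lambda>x. integral (cbox 0 1) (\<lambda>v. ee (x\<^sup>2 * (1 + v\<^sup>2)) / of_real (1 + v\<^sup>2))) has_vector_derivative
       integral (cbox 0 1) (\<lambda>v. of_real (4 * pi * x) * \<i> * ee (x\<^sup>2 * (1 + v\<^sup>2)))) (at x within UNIV)"
    proof (rule leibniz_rule_vector_derivative)
      fix x v :: real
      have "((\<lambda>x. ee (x\<^sup>2 * (1 + v\<^sup>2)) / of_real (1 + v\<^sup>2)) has_vector_derivative
         (of_real (2 * pi * (2 * x * (1 + v\<^sup>2))) * \<i> * ee (x\<^sup>2 * (1 + v\<^sup>2))) / of_real (1 + v\<^sup>2)) (at x within UNIV)"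
        by (intro has_vector_derivative_divide ee_has_vector_derivative) (auto intro!: derivative_eq_intros)
      moreover have "(of_real (2 * pi * (2 * x * (1 + v\<^sup>2))) * \<i> * ee (x\<^sup>2 * (1 + v\<^sup>2))) / of_real (1 + v\<^sup>2)
          = of_real (4 * pi * x) * \<i> * ee (x\<^sup>2 * (1 + v\<^sup>2))"
        using nz[of v] by (simp only: of_real_mult times_divide_eq_left divide_eq_eq) (simp add: field_simps)
      ultimately show "((\<lambda>x. ee (x\<^sup>2 * (1 + v\<^sup>2)) / of_real (1 + v\<^sup>2)) has_vector_derivative
         of_real (4 * pi * x) * \<i> * ee (x\<^sup>2 * (1 + v\<^sup>2))) (at x within UNIV)" by simp
    next
      show "(\<lambda>v. ee (x\<^sup>2 * (1 + v\<^sup>2)) / of_real (1 + v\<^sup>2)) integrable_on cbox 0 1" for x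
        unfolding cbox_interval using nz by (intro integrable_continuous_real continuous_intros) auto
      show "continuous_on (UNIV \<times> cbox 0 1) (\<lambda>(x, v). complex_of_real (4 * pi * x) * \<i> * ee (x\<^sup>2 * (1 + v\<^sup>2)))"
        unfolding case_prod_unfold by (intro continuous_intros)
    qed auto
    moreover have "integral (cbox 0 1) (\<lambda>v. of_real (4 * pi * x) * \<i> * ee (x\<^sup>2 * (1 + v\<^sup>2))) = of_real (4 * pi) * \<i> * ee (x\<^sup>2) * FE x"
    proof -
      have "integral {0..1} (\<lambda>v. of_real (4 * pi * x) * \<i> * ee (x\<^sup>2 * (1 + v\<^sup>2)))
         = integral {0..1} (\<lambda>v. (of_real (4 * pi) * \<i> * ee (x\<^sup>2) * of_real x) * ee ((x * v)\<^sup>2))"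
        by (intro integral_cong) (simp add: distrib_left ee_add power_mult_distrib)
      also have "\<dots> = (of_real (4 * pi) * \<i> * ee (x\<^sup>2) * of_real x) * integral {0..1} (\<lambda>v. ee ((x * v)\<^sup>2))"
        by (rule integral_mult_right)
      finally show ?thesis unfolding cbox_interval FE_stretch[of x, symmetric] by (simp only: mult.assoc)
    qed
    ultimately show ?thesis unfolding K_def by (simp only: cbox_interval)
  qed
  have "((\<lambda>x. FE x * FE x + \<i> / of_real (2 * pi) * K x) has_vector_derivative 0) (at x within UNIV)" for x
  proof -
    have "((\<lambda>x. FE x * FE x + \<i> / of_real (2 * pi) * K x) has_vector_derivative
       (FE x * ee (x\<^sup>2) + ee (x\<^sup>2) * FE x + \<i> / of_real (2 * pi) * (of_real (4 * pi) * \<i> * ee (x\<^sup>2) * FE x))) (at x within UNIV)"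
      by (intro has_vector_derivative_add has_vector_derivative_mult has_vector_derivative_mult_right FE_deriv dK)
    then show ?thesis by (simp add: field_simps)
  qed
  then obtain c where c: "\<And>x. FE x * FE x + \<i> / of_real (2 * pi) * K x = c"
    using has_vector_derivative_zero_constant[of UNIV "\<lambda>x. FE x * FE x + \<i> / of_real (2 * pi) * K x"] by auto
  \<comment> \<open>The constant is read off at x = 0, where FE vanishes and the integral is arctan
    1 = pi/4.\<close>
  have "((\<lambda>v::real. 1 / (1 + v\<^sup>2)) has_integral (arctan 1 - arctan 0)) {0..1}"
    by (rule fundamental_theorem_of_calculus)
       (auto intro!: derivative_eq_intros simp: has_real_derivative_iff_has_vector_derivative[symmetric] field_simps)
  then have "((\<lambda>v. complex_of_real (1 / (1 + v\<^sup>2))) has_integral complex_of_real (pi / 4)) {0..1}"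
    by (intro has_integral_of_real) (simp add: arctan_one)
  then have "K 0 = of_real (pi / 4)" unfolding K_def by (intro integral_unique) simp
  moreover have "\<i> / of_real (2 * pi) * K 0 = c" using c[of 0] by (simp only: FE_0 mult_zero_left add_0_left)
  ultimately have "c = \<i> / of_real (2 * pi) * of_real (pi / 4)" by metis
  also have "\<dots> = \<i> / 8" by (simp add: field_simps)
  finally have "c = \<i> / 8" .
  then show ?thesis using c[of x] by (simp only: K_def power2_eq_square)
qed

text \<open>In \<open>FE_square\<close> the correction integral is O(1/x): integrate by parts with
  the primitive FE(xv)/x of e((xv)^2), which is O(1/x) because FE is bounded. Taking the modulus of
  the limiting square avoids choosing a square root.\<close>

lemma norm_Fres: "(cmod Fres)\<^sup>2 = 1 / 8"
proof -
  define K where "K = (\<lambda>x. integral {0..1} (\<lambda>v. ee (x\<^sup>2 * (1 + v\<^sup>2)) / of_real (1 + v\<^sup>2)))"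
  obtain B where B: "\<And>x. cmod (FE x) \<le> B" using FE_bounded by blast
  have B0: "B \<ge> 0" using B[of 0] by simp
  have pos: "1 + v\<^sup>2 > (0::real)" for v by (simp add: add_pos_nonneg)
  have nz: "complex_of_real (1 + v\<^sup>2) \<noteq> 0" for v using pos[of v] by (metis less_irrefl of_real_eq_0_iff)
  have Kb: "cmod (K x) \<le> 4 * B / x" if x: "x > 0" for x
  proof -
    define q where "q = (\<lambda>v. complex_of_real (1 / (1 + v\<^sup>2)))"
    define q' where "q' = (\<lambda>v. complex_of_real (- 2 * v / (1 + v\<^sup>2)\<^sup>2))"
    define P where "P = (\<lambda>v. FE (x * v) / of_real x)"
    have I: "integral {0..1} (\<lambda>v. q v * ee ((x * v)\<^sup>2)) = q 1 * P 1 - q 0 * P 0 - integral {0..1} (\<lambda>v. q' v * P v)"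
    proof (rule integral_parts)
      fix v :: real
      show "(q has_vector_derivative q' v) (at v within {0..1})" unfolding q_def q'_def
        by (rule of_real_has_vector_derivative) (use pos[of v] in \<open>auto intro!: derivative_eq_intros simp: power2_eq_square\<close>)
      have "(P has_vector_derivative (of_real x * ee ((x * v)\<^sup>2)) / of_real x) (at v within {0..1})" unfolding P_def
        by (intro has_vector_derivative_divide FE_chain) (auto intro!: derivative_eq_intros)
      then show "(P has_vector_derivative ee ((x * v)\<^sup>2)) (at v within {0..1})" using x by simp
    next
      have ne: "1 + v\<^sup>2 \<noteq> 0" for v :: real using pos[of v] by simp
      show "continuous_on {0..1} q'" unfolding q'_def by (intro continuous_intros) (simp add: ne)
    qed (auto intro!: continuous_intros)
    have P: "cmod (P v) \<le> B / x" for v using B[of "x * v"] x by (simp add: P_def norm_divide divide_right_mono)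
    have q': "cmod (q' v) \<le> 2" if "v \<in> {0..1}" for v
    proof -
      have "1 \<le> (1 + v\<^sup>2)\<^sup>2" by (simp add: one_le_power)
      then show ?thesis using that unfolding q'_def norm_of_real by (auto simp: abs_mult divide_le_eq intro: order_trans)
    qed
    have "cmod (integral {0..1} (\<lambda>v. q' v * P v)) \<le> (2 * (B / x)) * (1 - 0)"
    proof (rule integral_norm_le)
      show "continuous_on {0..1} (\<lambda>v. q' v * P v)" unfolding q'_def P_def
        using x less_imp_neq[OF pos] by (intro continuous_intros) (simp_all add: eq_commute[of 0])
      fix v :: real assume "v \<in> {0..1}"
      then show "cmod (q' v * P v) \<le> 2 * (B / x)" unfolding norm_mult
        using P[of v] q'[of v] by (intro mult_mono) auto
    qed simp
    moreover have "cmod (q 1 * P 1) \<le> 1 * (B / x)" unfolding norm_mult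
      by (intro mult_mono P) (auto simp: q_def)
    moreover have "cmod (q 0 * P 0) = 0" by (simp add: P_def)
    moreover have "2 * (B / x) * (1 - 0) = 2 * (B / x)" "1 * (B / x) = B / x" "4 * B / x = 4 * (B / x)" "B / x \<ge> 0" using B0 x by auto
    ultimately have "cmod (integral {0..1} (\<lambda>v. q v * ee ((x * v)\<^sup>2))) \<le> 4 * B / x"
      unfolding I diff_zero mult_1_right mult_1_left using norm_triangle_ineq4[of "q 1 * P 1 - q 0 * P 0" "integral {0..1} (\<lambda>v. q' v * P v)"]
        norm_triangle_ineq4[of "q 1 * P 1" "q 0 * P 0"]
      by linarith
    moreover have "K x = ee (x\<^sup>2) * integral {0..1} (\<lambda>v. q v * ee ((x * v)\<^sup>2))"
      unfolding K_def integral_mult_right[symmetric]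
      by (intro integral_cong) (simp add: q_def distrib_left ee_add power_mult_distrib)
    ultimately show ?thesis by (simp add: norm_mult)
  qed
  have "(K \<longlongrightarrow> 0) at_top"
  proof (rule Lim_null_comparison)
    show "\<forall>\<^sub>F x in at_top. norm (K x) \<le> 4 * B / x"
      using eventually_gt_at_top[of 0] by eventually_elim (rule Kb)
    show "((\<lambda>x::real. 4 * B / x) \<longlongrightarrow> 0) at_top" by real_asymp
  qed
  then have "((\<lambda>x. (FE x)\<^sup>2 + \<i> / of_real (2 * pi) * K x) \<longlongrightarrow> Fres\<^sup>2 + \<i> / of_real (2 * pi) * 0) at_top"
    by (intro tendsto_intros FE_tendsto)
  moreover have "(FE x)\<^sup>2 + \<i> / of_real (2 * pi) * K x = \<i> / 8" for x using FE_square[of x] by (simp add: K_def)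
  ultimately have "((\<lambda>x::real. \<i> / 8) \<longlongrightarrow> Fres\<^sup>2) at_top" by (simp only: mult_zero_right add_0_right)
  then have "\<i> / 8 = Fres\<^sup>2"
    by (rule tendsto_unique[OF trivial_limit_at_top_linorder tendsto_const])
  then have "Fres\<^sup>2 = \<i> / 8" by simp
  then have "cmod (Fres\<^sup>2) = cmod (\<i> / 8)" by (simp only:)
  also have "\<dots> = 1 / 8" by (simp add: norm_divide)
  finally have "cmod (Fres\<^sup>2) = 1 / 8" .
  then show ?thesis by (simp add: norm_power)
qed

section \<open>The sawtooth function and Poisson summation\<close>

definition psi :: "real \<Rightarrow> real" where "psi x = frac x - 1/2"

definition sine_sum :: "nat \<Rightarrow> real \<Rightarrow> real" where
  "sine_sum K y = (\<Sum>k=1..K. sin (2 * pi * (real k * y)) / (pi * real k))"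

text \<open>The remainder after K terms of the Fourier series of -psi. For K = 0 it is -psi itself,
  so that one notation covers both the full sawtooth and its tail.\<close>

definition sine_rest :: "nat \<Rightarrow> real \<Rightarrow> real" where
  "sine_rest K y = - psi y - sine_sum K y"

lemma measurable_psi [measurable]: "psi \<in> borel_measurable borel"
  unfolding psi_def frac_def by measurable

lemma measurable_sine_sum [measurable]: "sine_sum K \<in> borel_measurable borel"
  unfolding sine_sum_def by measurable

lemma measurable_sine_rest [measurable]: "sine_rest K \<in> borel_measurable borel"
  unfolding sine_rest_def by measurable

lemma psi_bound: "\<bar>psi y\<bar> \<le> 1 / 2"
  unfolding psi_def using frac_ge_0[of y] frac_lt_1[of y] by linarith

lemma sine_sum_bound: "\<bar>sine_sum K y\<bar> \<le> real K"
proof -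
  have "\<bar>sine_sum K y\<bar> \<le> (\<Sum>k=1..K. \<bar>sin (2 * pi * (real k * y)) / (pi * real k)\<bar>)"
    unfolding sine_sum_def by (rule sum_abs)
  also have "\<dots> \<le> (\<Sum>k=1..K. 1)"
  proof (rule sum_mono)
    fix k assume "k \<in> {1..K}"
    then have "pi * real k \<ge> 1" using pi_ge_two mult_mono[of 1 pi 1 "real k"] by simp
    then show "\<bar>sin (2 * pi * (real k * y)) / (pi * real k)\<bar> \<le> 1"
      using order_trans[OF abs_sin_le_one[of "2 * pi * (real k * y)"]] by (simp add: divide_le_eq)
  qed
  finally show ?thesis by simp
qed

lemma sine_rest_bound: "\<bar>sine_rest K y\<bar> \<le> real K + 1"
  using psi_bound[of y] sine_sum_bound[of K y] unfolding sine_rest_def by linarith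

lemma sine_rest_periodic: "sine_rest K (y + of_int n) = sine_rest K y"
proof -
  have "sin (2 * pi * (real k * (y + of_int n))) = sin (2 * pi * (real k * y))" for k
  proof -
    have "2 * pi * (real k * (y + of_int n)) = 2 * pi * (real k * y) + of_int (int k * n) * (2 * pi)"
      by (simp add: algebra_simps)
    then show ?thesis using sin.plus_of_int[of "2 * pi * (real k * y)" "int k * n"]
      by (simp only: of_real_eq_id id_apply)
  qed
  then show ?thesis by (simp add: sine_rest_def sine_sum_def psi_def frac_def)
qed

lemma integrable_sine_rest: "(\<lambda>y. (sine_rest K y)\<^sup>2) integrable_on {a..b}"
proof (rule integrable_bounded_measurable[where B = "(real K + 1)\<^sup>2"])
  show "(\<lambda>y. (sine_rest K y)\<^sup>2) \<in> borel_measurable borel" by measurable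
  show "norm ((sine_rest K y)\<^sup>2) \<le> (real K + 1)\<^sup>2" for y
    using power_mono[OF sine_rest_bound[of K y], of 2] by simp
qed

section \<open>Mean square of the Fourier remainder of the sawtooth\<close>

lemma has_integral_sin_sin:
  assumes "k \<ge> 1" "l \<ge> 1"
  shows "((\<lambda>y. sin (2 * pi * (real k * y)) * sin (2 * pi * (real l * y))) has_integral (if k = l then 1/2 else 0)) {0..1}"
proof (cases "k = l")
  case True
  define c where "c = 2 * pi * real k"
  have c: "c \<noteq> 0" using assms by (simp add: c_def)
  have "((\<lambda>y. sin (c * y) * sin (c * y)) has_integral ((1 / 2 - sin (2 * c * 1) / (4 * c)) - (0 / 2 - sin (2 * c * 0) / (4 * c)))) {0..1}"
  proof (rule fundamental_theorem_of_calculus)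
    fix y :: real
    have "cos (2 * c * y) = 1 - 2 * (sin (c * y))\<^sup>2" using cos_double_sin[of "c * y"] by (simp add: mult_ac)
    moreover have "((\<lambda>y. y / 2 - sin (2 * c * y) / (4 * c)) has_real_derivative (1 - cos (2 * c * y)) / 2) (at y within {0..1})"
      using c by (auto intro!: derivative_eq_intros simp: field_simps)
    ultimately show "((\<lambda>y. y / 2 - sin (2 * c * y) / (4 * c)) has_vector_derivative sin (c * y) * sin (c * y)) (at y within {0..1})"
      by (simp add: has_real_derivative_iff_has_vector_derivative[symmetric] power2_eq_square)
  qed simp
  moreover have "sin (2 * c * 1) = 0"
    using sin_int_2pin[of "int (2 * k)"] by (simp add: c_def mult_ac)
  ultimately show ?thesis using True by (simp add: c_def mult.assoc)
next
  case False
  define c where "c = 2 * pi * real k"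
  define d where "d = 2 * pi * real l"
  have c: "c - d \<noteq> 0" "c + d \<noteq> 0" using assms False by (auto simp: c_def d_def right_diff_distrib[symmetric] distrib_left[symmetric] simp flip: of_nat_add)
  have "((\<lambda>y. sin (c * y) * sin (d * y)) has_integral ((sin ((c - d) * 1) / (2 * (c - d)) - sin ((c + d) * 1) / (2 * (c + d)))
     - (sin ((c - d) * 0) / (2 * (c - d)) - sin ((c + d) * 0) / (2 * (c + d))))) {0..1}"
  proof (rule fundamental_theorem_of_calculus)
    fix y :: real
    have "((\<lambda>y. sin ((c - d) * y) / (2 * (c - d)) - sin ((c + d) * y) / (2 * (c + d))) has_real_derivative
      cos ((c - d) * y) * (c - d) / (2 * (c - d)) - cos ((c + d) * y) * (c + d) / (2 * (c + d))) (at y within {0..1})"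
      by (intro DERIV_diff DERIV_cdivide) (auto intro!: derivative_eq_intros)
    moreover have "cos ((c - d) * y) * (c - d) / (2 * (c - d)) - cos ((c + d) * y) * (c + d) / (2 * (c + d)) = cos ((c - d) * y) / 2 - cos ((c + d) * y) / 2"
    proof -
      have "x * z / (2 * z) = x / 2" if "z \<noteq> 0" for x z :: real using that by simp
      then show ?thesis using c by (simp only: not_False_eq_True)
    qed
    moreover have "cos ((c - d) * y) / 2 - cos ((c + d) * y) / 2 = sin (c * y) * sin (d * y)"
      by (simp add: cos_add cos_diff left_diff_distrib distrib_right field_simps)
    ultimately show "((\<lambda>y. sin ((c - d) * y) / (2 * (c - d)) - sin ((c + d) * y) / (2 * (c + d))) has_vector_derivative sin (c * y) * sin (d * y)) (at y within {0..1})"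
      by (simp add: has_real_derivative_iff_has_vector_derivative)
  qed simp
  moreover have "sin (c - d) = 0"
    using sin_int_2pin[of "int k - int l"] by (simp add: c_def d_def algebra_simps)
  moreover have "sin (c + d) = 0"
    using sin_int_2pin[of "int k + int l"] by (simp add: c_def d_def algebra_simps)
  ultimately show ?thesis using False by (simp add: c_def d_def mult.assoc)
qed

lemma has_integral_linear_sin:
  assumes "k \<ge> 1"
  shows "((\<lambda>y. (1/2 - y) * sin (2 * pi * (real k * y))) has_integral (1 / (2 * pi * real k))) {0..1}"
proof -
  define c where "c = 2 * pi * real k"
  have c: "c \<noteq> 0" using assms by (simp add: c_def)
  have "((\<lambda>y. (1/2 - y) * sin (c * y)) has_integral ((- (1/2 - 1) * cos (c * 1) / c - sin (c * 1) / c\<^sup>2)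
     - (- (1/2 - 0) * cos (c * 0) / c - sin (c * 0) / c\<^sup>2))) {0..1}"
  proof (rule fundamental_theorem_of_calculus)
    fix y :: real
    show "((\<lambda>y. - (1/2 - y) * cos (c * y) / c - sin (c * y) / c\<^sup>2) has_vector_derivative (1/2 - y) * sin (c * y)) (at y within {0..1})"
      using c by (auto intro!: derivative_eq_intros simp: has_real_derivative_iff_has_vector_derivative[symmetric] power2_eq_square field_simps)
  qed simp
  moreover have "sin c = 0" "cos c = 1"
    using sin_int_2pin[of "int k"] cos_int_2pin[of "int k"] by (simp_all add: c_def)
  ultimately show ?thesis using c by (simp add: c_def mult.assoc)
qed

text \<open>Adding 1/n turns the increasing partial sums into a decreasing sequence with the same
  limit.\<close>

lemma sum_inverse_squares_tail:
  assumes "K \<ge> 1"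
  shows "pi\<^sup>2 / 6 - (\<Sum>k=1..K. 1 / (real k)\<^sup>2) \<le> 1 / real K"
proof -
  define t where "t = (\<lambda>n. (\<Sum>k=1..n. 1 / (real k)\<^sup>2) + 1 / real n)"
  have "(\<lambda>n. \<Sum>k<n. 1 / (real (k + 1))\<^sup>2) \<longlonglongrightarrow> pi\<^sup>2 / 6"
    using inverse_squares_sums by (simp add: sums_def)
  also have "(\<lambda>n. \<Sum>k<n. 1 / (real (k + 1))\<^sup>2) = (\<lambda>n. \<Sum>k=1..n. 1 / (real k)\<^sup>2)"
    by (intro ext sum.reindex_bij_witness[of _ "\<lambda>k. k - 1" Suc]) auto
  finally have "(\<lambda>n. \<Sum>k=1..n. 1 / (real k)\<^sup>2) \<longlonglongrightarrow> pi\<^sup>2 / 6" .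
  moreover have "(\<lambda>n. 1 / real n) \<longlonglongrightarrow> 0" by real_asymp
  ultimately have lim: "t \<longlonglongrightarrow> pi\<^sup>2 / 6 + 0" unfolding t_def by (intro tendsto_add)
  have step: "t (Suc n) \<le> t n" if "n \<ge> 1" for n
  proof -
    have "1 / (real (Suc n))\<^sup>2 + 1 / real (Suc n) \<le> 1 / real n"
      using that by (simp add: divide_simps power2_eq_square) (simp add: algebra_simps)
    then show ?thesis by (simp add: t_def)
  qed
  have "t n \<le> t K" if "n \<ge> K" for n
    using that
  proof (induction n rule: dec_induct)
    case (step n) then show ?case using assms \<open>\<And>n. n \<ge> 1 \<Longrightarrow> t (Suc n) \<le> t n\<close>[of n] by simp
  qed simp
  then have "pi\<^sup>2 / 6 + 0 \<le> t K"
    by (intro tendsto_upperbound[OF lim]) (auto simp: eventually_sequentially)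
  then show ?thesis by (simp add: t_def)
qed

text \<open>Parseval by direct expansion: 1/12 minus the sum of 1/(2 pi^2 k^2) for k up to K is the
  tail of pi^2/6 divided by 2 pi^2.\<close>

lemma integral_sine_rest_unit:
  assumes "K \<ge> 1"
  shows "integral {0..1} (\<lambda>y. (sine_rest K y)\<^sup>2) \<le> 1 / (2 * pi\<^sup>2 * real K)"
proof -
  define s where "s = (\<lambda>k y. sin (2 * pi * (real k * y)))"
  define c where "c = (\<lambda>k. 1 / (pi * real k))"
  have "((\<lambda>y::real. (1/2 - y)\<^sup>2) has_integral ((-1/3) * (1/2 - 1) ^ 3 - (-1/3) * (1/2 - 0) ^ 3)) {0..1}"
    by (rule fundamental_theorem_of_calculus)
       (auto intro!: derivative_eq_intros simp: has_real_derivative_iff_has_vector_derivative[symmetric])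
  then have I1: "((\<lambda>y::real. (1/2 - y)\<^sup>2) has_integral 1 / 12) {0..1}"
    by (simp add: power3_eq_cube)
  have I2: "((\<lambda>y. \<Sum>k=1..K. c k * ((1/2 - y) * s k y)) has_integral (\<Sum>k=1..K. c k * (1 / (2 * pi * real k)))) {0..1}"
    unfolding s_def by (intro has_integral_sum has_integral_mult_right has_integral_linear_sin) auto
  have I3: "((\<lambda>y. \<Sum>k=1..K. \<Sum>l=1..K. c k * (c l * (s k y * s l y))) has_integral (\<Sum>k=1..K. \<Sum>l=1..K. c k * (c l * (if k = l then 1/2 else 0)))) {0..1}"
    unfolding s_def by (intro has_integral_sum has_integral_mult_right has_integral_sin_sin) auto
  have "((\<lambda>y. (1/2 - y)\<^sup>2 - 2 * (\<Sum>k=1..K. c k * ((1/2 - y) * s k y)) + (\<Sum>k=1..K. \<Sum>l=1..K. c k * (c l * (s k y * s l y))))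
     has_integral (1 / 12 - 2 * (\<Sum>k=1..K. c k * (1 / (2 * pi * real k))) + (\<Sum>k=1..K. \<Sum>l=1..K. c k * (c l * (if k = l then 1/2 else 0))))) {0..1}"
    by (intro has_integral_add has_integral_diff has_integral_mult_right I1 I2 I3)
  also have "?this \<longleftrightarrow> ((\<lambda>y. (sine_rest K y)\<^sup>2) has_integral (1 / 12 - 2 * (\<Sum>k=1..K. c k * (1 / (2 * pi * real k))) + (\<Sum>k=1..K. \<Sum>l=1..K. c k * (c l * (if k = l then 1/2 else 0))))) {0..1}"
  proof (rule has_integral_spike_eq[of "{1}"])
    fix y :: real assume "y \<in> {0..1} - {1}"
    then have "frac y = y" by (simp add: frac_eq)
    then have "sine_rest K y = (1/2 - y) - (\<Sum>k=1..K. c k * s k y)"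
      by (simp add: sine_rest_def psi_def sine_sum_def c_def s_def)
    moreover have "(\<Sum>k=1..K. c k * s k y)\<^sup>2 = (\<Sum>k=1..K. \<Sum>l=1..K. c k * (c l * (s k y * s l y)))"
      by (simp add: power2_eq_square sum_product mult_ac)
    moreover have "(1/2 - y) * (\<Sum>k=1..K. c k * s k y) = (\<Sum>k=1..K. c k * ((1/2 - y) * s k y))"
      by (simp add: sum_distrib_left mult_ac)
    ultimately show "(sine_rest K y)\<^sup>2 = (1/2 - y)\<^sup>2 - 2 * (\<Sum>k=1..K. c k * ((1/2 - y) * s k y)) + (\<Sum>k=1..K. \<Sum>l=1..K. c k * (c l * (s k y * s l y)))"
      by (simp only: power2_diff mult.assoc)
  qed simp
  finally have "integral {0..1} (\<lambda>y. (sine_rest K y)\<^sup>2) = 1 / 12 - 2 * (\<Sum>k=1..K. c k * (1 / (2 * pi * real k))) + (\<Sum>k=1..K. \<Sum>l=1..K. c k * (c l * (if k = l then 1/2 else 0)))"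
    by (rule integral_unique)
  also have "(\<Sum>k=1..K. \<Sum>l=1..K. c k * (c l * (if k = l then 1/2 else 0))) = (\<Sum>k=1..K. c k * c k / 2)"
  proof (intro sum.cong refl)
    fix k assume "k \<in> {1..K}"
    then have "(\<Sum>l=1..K. c k * (c l * (if k = l then 1/2 else 0))) = (\<Sum>l=1..K. if k = l then c k * c k / 2 else 0)"
      by (intro sum.cong) auto
    then show "(\<Sum>l=1..K. c k * (c l * (if k = l then 1/2 else 0))) = c k * c k / 2" using \<open>k \<in> {1..K}\<close> by simp
  qed
  also have "1 / 12 - 2 * (\<Sum>k=1..K. c k * (1 / (2 * pi * real k))) + (\<Sum>k=1..K. c k * c k / 2)
     = 1 / 12 - (\<Sum>k=1..K. c k * c k / 2)"
    by (simp add: sum_distrib_left c_def sum_subtractf[symmetric] field_simps)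
       (simp add: sum_distrib_left[symmetric] sum_distrib_right[symmetric] sum_divide_distrib[symmetric] power2_eq_square)?
  also have "(\<Sum>k=1..K. c k * c k / 2) = (\<Sum>k=1..K. 1 / (real k)\<^sup>2) / (2 * pi\<^sup>2)"
    unfolding sum_divide_distrib by (intro sum.cong) (auto simp: c_def power2_eq_square)
  also have "1 / 12 - (\<Sum>k=1..K. 1 / (real k)\<^sup>2) / (2 * pi\<^sup>2) = (pi\<^sup>2 / 6 - (\<Sum>k=1..K. 1 / (real k)\<^sup>2)) / (2 * pi\<^sup>2)"
    by (simp add: diff_divide_distrib)
  also have "\<dots> \<le> (1 / real K) / (2 * pi\<^sup>2)"
    by (intro divide_right_mono sum_inverse_squares_tail assms) simp
  finally show ?thesis by (simp add: mult.commute)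
qed

text \<open>By periodicity each unit interval contributes the same amount, and at most b - a + 2
  unit intervals with integer ends, counted from the floor of a, cover the given one.\<close>

lemma integral_sine_rest:
  assumes K: "K \<ge> 1" and ab: "a \<le> b"
  shows "integral {a..b} (\<lambda>y. (sine_rest K y)\<^sup>2) \<le> (b - a + 2) / (2 * pi\<^sup>2 * real K)"
proof -
  define f where "f = (\<lambda>y. (sine_rest K y)\<^sup>2)"
  have int: "f integrable_on {a..b}" for a b unfolding f_def by (rule integrable_sine_rest)
  define m where "m = \<lfloor>a\<rfloor>"
  define n where "n = nat \<lceil>b - of_int m\<rceil>"
  have unit: "integral {of_int m + real j..of_int m + real (Suc j)} f = integral {0..1} f" for j
  proof -
    have "integral {of_int m + real j..of_int m + real (Suc j)} f = integral {0 + of_int (m + int j)..1 + of_int (m + int j)} f"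
      by (simp add: algebra_simps)
    also have "\<dots> = integral {0..1} (f \<circ> (\<lambda>y. y + of_int (m + int j)))"
      using integral_shift_Icc_real[of 0 1 f "of_int (m + int j)"] by (simp add: o_def add_ac)
    also have "f \<circ> (\<lambda>y. y + of_int (m + int j)) = f" unfolding f_def o_def sine_rest_periodic ..
    finally show ?thesis .
  qed
  have mult: "integral {of_int m..of_int m + real j} f = real j * integral {0..1} f" for j
  proof (induction j)
    case (Suc j)
    have "integral {of_int m..of_int m + real (Suc j)} f = integral {of_int m..of_int m + real j} f + integral {of_int m + real j..of_int m + real (Suc j)} f"
      by (rule Henstock_Kurzweil_Integration.integral_combine[symmetric]) (auto intro: int)
    then show ?case unfolding Suc.IH unit by (simp add: algebra_simps)
  qed simp
  have fnn: "0 \<le> f x" for x by (simp add: f_def)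
  have "integral {a..b} f \<le> integral {of_int m..of_int m + real n} f"
  proof (rule integral_subset_le)
    show "{a..b} \<subseteq> {of_int m..of_int m + real n}" unfolding m_def n_def using ab
      by (auto, linarith+)
  qed (auto simp: int fnn)
  also have "\<dots> = real n * integral {0..1} f" by (rule mult)
  also have "\<dots> \<le> (b - a + 2) * (1 / (2 * pi\<^sup>2 * real K))"
  proof (rule mult_mono)
    show "real n \<le> b - a + 2" using ab unfolding n_def m_def by linarith
    show "integral {0..1} f \<le> 1 / (2 * pi\<^sup>2 * real K)" unfolding f_def by (rule integral_sine_rest_unit[OF K])
    show "0 \<le> integral {0..1} f" by (rule integral_nonneg) (auto simp: int fnn)
  qed (use ab in auto)
  finally show ?thesis by (simp add: f_def)
qed

section \<open>Euler-Maclaurin and Poisson summation\<close>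

lemma euler_maclaurin_unit:
  fixes f f' :: "real \<Rightarrow> complex"
  assumes f: "\<And>x. x \<in> {real n..real n + 1} \<Longrightarrow> (f has_vector_derivative f' x) (at x within {real n..real n + 1})"
    and cont: "continuous_on {real n..real n + 1} f'"
  shows "integral {real n..real n + 1} (\<lambda>u. of_real (psi u) * f' u) = (f (real n) + f (real n + 1)) / 2 - integral {real n..real n + 1} f"
proof -
  have "integral {real n..real n + 1} (\<lambda>u. of_real (psi u) * f' u) = integral {real n..real n + 1} (\<lambda>u. of_real (u - real n - 1/2) * f' u)"
  proof (rule integral_spike[of "{real n + 1}"])
    fix u assume "u \<in> {real n..real n + 1} - {real n + 1}"
    then have "real n \<le> u" "u < real n + 1" by auto
    then have "\<lfloor>u\<rfloor> = int n" by (simp add: floor_eq_iff)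
    then show "complex_of_real (u - real n - 1/2) * f' u = of_real (psi u) * f' u"
      by (simp add: psi_def frac_def)
  qed simp
  also have "\<dots> = of_real (real n + 1 - real n - 1/2) * f (real n + 1) - of_real (real n - real n - 1/2) * f (real n)
      - integral {real n..real n + 1} (\<lambda>u. 1 * f u)"
    by (rule integral_parts) (use f cont in \<open>auto intro!: derivative_eq_intros of_real_has_vector_derivative[where f' = 1, simplified]\<close>)
  finally show ?thesis by (simp add: field_simps)
qed

lemma integrable_psi_mult:
  fixes h :: "real \<Rightarrow> complex"
  assumes "continuous_on {a..b} h" "\<phi> \<in> borel_measurable borel" "\<And>u. \<bar>\<phi> u\<bar> \<le> B"
  shows "(\<lambda>u. of_real (\<phi> u) * h u) integrable_on {a..b}"
proof -
  have "bounded (h ` {a..b})" by (intro compact_imp_bounded compact_continuous_image assms compact_Icc)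
  then obtain C where C: "\<forall>y\<in>h ` {a..b}. norm y \<le> C" unfolding bounded_iff by blast
  have "B \<ge> 0" using assms(3)[of 0] by linarith
  have "(\<lambda>u. indicator {a..b} u *\<^sub>R h u) \<in> borel_measurable borel"
    using borel_measurable_continuous_on_indicator[OF _ assms(1)] by simp
  then have "(\<lambda>u. of_real (\<phi> u) * (indicator {a..b} u *\<^sub>R h u)) \<in> borel_measurable borel"
    using assms(2) by measurable
  then have "(\<lambda>u. of_real (\<phi> u) * (indicator {a..b} u *\<^sub>R h u)) integrable_on {a..b}"
    by (rule integrable_bounded_measurable[where B = "B * C"])
       (use C assms(3) \<open>B \<ge> 0\<close> in \<open>auto simp: norm_mult intro!: mult_mono\<close>)
  then show ?thesis by (rule integrable_eq) auto
qed

lemma euler_maclaurin: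
  fixes f f' :: "real \<Rightarrow> complex"
  assumes "N \<ge> 1"
    and f: "\<And>x. x \<in> {1..real N} \<Longrightarrow> (f has_vector_derivative f' x) (at x within {1..real N})"
    and cont: "continuous_on {1..real N} f'"
  shows "(\<Sum>n=1..N. f (real n)) = integral {1..real N} f + integral {1..real N} (\<lambda>u. of_real (psi u) * f' u) + (f 1 + f (real N)) / 2"
  using assms
proof (induction N rule: dec_induct)
  case (step N)
  have sub: "{1..real N} \<subseteq> {1..real (Suc N)}" "{real N..real N + 1} \<subseteq> {1..real (Suc N)}" using step by auto
  have d1: "(f has_vector_derivative f' x) (at x within {1..real N})" if "x \<in> {1..real N}" for x
    using step.prems(1)[of x] sub that by (meson has_vector_derivative_within_subset subsetD)
  have d2: "(f has_vector_derivative f' x) (at x within {real N..real N + 1})" if "x \<in> {real N..real N + 1}" for x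
    using step.prems(1)[of x] sub that by (meson has_vector_derivative_within_subset subsetD)
  have c: "continuous_on {1..real N} f'" "continuous_on {real N..real N + 1} f'"
    using step.prems(2) sub continuous_on_subset by blast+
  have cf: "continuous_on {1..real (Suc N)} f" using step.prems(1) by (meson continuous_on_vector_derivative)
  have i1: "integral {1..real (Suc N)} f = integral {1..real N} f + integral {real N..real N + 1} f"
    using Henstock_Kurzweil_Integration.integral_combine[where a=1 and c="real N" and b="real (Suc N)" and f=f] step integrable_continuous_real[OF cf] by (simp add: add.commute)
  have i2: "integral {1..real (Suc N)} (\<lambda>u. of_real (psi u) * f' u) = integral {1..real N} (\<lambda>u. of_real (psi u) * f' u) + integral {real N..real N + 1} (\<lambda>u. of_real (psi u) * f' u)"
    using Henstock_Kurzweil_Integration.integral_combine[where a=1 and c="real N" and b="real (Suc N)" and f="\<lambda>u. of_real (psi u) * f' u"] step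
      integrable_psi_mult[OF step.prems(2) measurable_psi psi_bound] by (simp add: add.commute)
  have "integral {real N..real N + 1} (\<lambda>u. of_real (psi u) * f' u) = (f (real N) + f (real (Suc N))) / 2 - integral {real N..real N + 1} f"
    using euler_maclaurin_unit[OF d2 c(2)] by (simp add: add.commute)
  moreover have "(\<Sum>n=1..Suc N. f (real n)) = (\<Sum>n=1..N. f (real n)) + f (real (Suc N))" by simp
  moreover have "x + z / 2 = (x + y / 2) + (z - y) / 2" for x y z :: complex by (simp add: field_simps)
  ultimately show ?case unfolding i1 i2 using step.IH[OF d1 c(1)] by (simp add: add_divide_distrib)
qed simp

text \<open>The tail is controlled by the mean-square convergence of the Fourier series of \<open>psi\<close>.\<close>

lemma poisson_summation:
  fixes f f' :: "real \<Rightarrow> complex"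
  assumes N: "N \<ge> 1"
    and f: "\<And>x. x \<in> {1..real N} \<Longrightarrow> (f has_vector_derivative f' x) (at x within {1..real N})"
    and cont: "continuous_on {1..real N} f'"
    and zero: "f 1 = 0" "f (real N) = 0"
  shows "(\<lambda>L. integral {1..real N} f - (\<Sum>l=1..L. integral {1..real N} (\<lambda>u. of_real (sin (2 * pi * (real l * u)) / (pi * real l)) * f' u)))
     \<longlonglongrightarrow> (\<Sum>n=1..N. f (real n))"
proof -
  define R where "R = (\<lambda>L. integral {1..real N} (\<lambda>u. of_real (sine_rest L u) * f' u))"
  have "bounded (f' ` {1..real N})" by (intro compact_imp_bounded compact_continuous_image cont compact_Icc)
  then obtain C where C: "\<forall>y\<in>f' ` {1..real N}. norm y \<le> C" unfolding bounded_iff by blast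
  have "norm (f' 1) \<le> C" using C N by auto
  then have C0: "C \<ge> 0" using norm_ge_zero order_trans by blast
  have eq: "integral {1..real N} f - (\<Sum>l=1..L. integral {1..real N} (\<lambda>u. of_real (sin (2 * pi * (real l * u)) / (pi * real l)) * f' u))
     = (\<Sum>n=1..N. f (real n)) + R L" for L
  proof -
    have "integral {1..real N} (\<lambda>u. of_real (psi u) * f' u) = integral {1..real N} (\<lambda>u. - (of_real (sine_rest L u) * f' u) -
        (\<Sum>l=1..L. of_real (sin (2 * pi * (real l * u)) / (pi * real l)) * f' u))"
    proof (intro integral_cong)
      fix u
      have "complex_of_real (psi u) = - of_real (sine_rest L u) - of_real (sine_sum L u)" by (simp add: sine_rest_def)
      moreover have "of_real (sine_sum L u) * f' u = (\<Sum>l=1..L. of_real (sin (2 * pi * (real l * u)) / (pi * real l)) * f' u)"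
        unfolding sine_sum_def of_real_sum sum_distrib_right ..
      ultimately show "of_real (psi u) * f' u = - (of_real (sine_rest L u) * f' u) -
        (\<Sum>l=1..L. of_real (sin (2 * pi * (real l * u)) / (pi * real l)) * f' u)" by (simp only: left_diff_distrib mult_minus_left)
    qed
    also have "\<dots> = - R L - (\<Sum>l=1..L. integral {1..real N} (\<lambda>u. of_real (sin (2 * pi * (real l * u)) / (pi * real l)) * f' u))"
    proof -
      have i1: "(\<lambda>u. of_real (sine_rest L u) * f' u) integrable_on {1..real N}"
        by (rule integrable_psi_mult[OF cont measurable_sine_rest sine_rest_bound])
      have i2: "(\<lambda>u. of_real (sin (2 * pi * (real l * u)) / (pi * real l)) * f' u) integrable_on {1..real N}" if "l \<in> {1..L}" for l
        using that by (intro integrable_continuous_real continuous_intros cont) auto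
      show ?thesis unfolding R_def
        using integral_diff[OF integrable_neg[OF i1] integrable_sum[where I = "{1..L}", OF finite_atLeastAtMost i2]]
          integral_sum[where I = "{1..L}", OF finite_atLeastAtMost i2] integral_neg[of "{1..real N}" "\<lambda>u. of_real (sine_rest L u) * f' u"] by (simp only:)
    qed
    finally show ?thesis using euler_maclaurin[OF N f cont] zero by simp
  qed
  have Rb: "norm (R L) \<le> C * (real N + 1) / sqrt (real L)" if L: "L \<ge> 1" for L
  proof -
    \<comment> \<open>The inequality r <= (e + r^2/e)/2 takes the place of Cauchy-Schwarz for
      integrals. As the mean of r^2 is O(1/L), this e balances the two terms.\<close>
    define e where "e = 1 / sqrt (real L)"
    have e: "e > 0" "e * e = 1 / real L" using L by (auto simp: e_def)
    have i0: "(\<lambda>u. C / 2 * (e + (sine_rest L u)\<^sup>2 / e)) integrable_on {1..real N}"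
      by (rule integrable_on_mult_right integrable_add integrable_on_divide integrable_sine_rest integrable_const_ivl)+
    have "norm (R L) \<le> integral {1..real N} (\<lambda>u. C / 2 * (e + (sine_rest L u)\<^sup>2 / e))"
      unfolding R_def
    proof (rule integral_norm_bound_integral)
      show "(\<lambda>u. of_real (sine_rest L u) * f' u) integrable_on {1..real N}"
        by (rule integrable_psi_mult[OF cont measurable_sine_rest sine_rest_bound])
      fix u assume u: "u \<in> {1..real N}"
      define r where "r = \<bar>sine_rest L u\<bar>"
      have "0 \<le> (e - r)\<^sup>2" by simp
      then have "2 * r * e \<le> e\<^sup>2 + r\<^sup>2" by (simp add: power2_diff mult_ac)
      then have "r \<le> (e + r\<^sup>2 / e) / 2" using e(1) by (simp add: field_simps power2_eq_square)
      then have "r * norm (f' u) \<le> (e + r\<^sup>2 / e) / 2 * C"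
        using C u e(1) by (intro mult_mono) (auto simp: r_def)
      then show "norm (of_real (sine_rest L u) * f' u) \<le> C / 2 * (e + (sine_rest L u)\<^sup>2 / e)"
        by (simp add: norm_mult r_def mult.commute)
    qed (rule i0)
    also have "\<dots> = C / 2 * ((real N - 1) * e + integral {1..real N} (\<lambda>u. (sine_rest L u)\<^sup>2) / e)"
    proof -
      have "integral {1..real N} (\<lambda>u. e + (sine_rest L u)\<^sup>2 / e) = integral {1..real N} (\<lambda>u. e) + integral {1..real N} (\<lambda>u. (sine_rest L u)\<^sup>2 / e)"
        by (rule integral_add[OF integrable_const_ivl integrable_on_divide[OF integrable_sine_rest]])
      then show ?thesis using N by simp
    qed
    also have "\<dots> \<le> C / 2 * ((real N + 1) * e + ((real N + 1) * (1 / real L)) / e)"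
    proof -
      have "integral {1..real N} (\<lambda>u. (sine_rest L u)\<^sup>2) \<le> (real N - 1 + 2) / (2 * pi\<^sup>2 * real L)"
        by (rule integral_sine_rest) (use L N in auto)
      also have "\<dots> \<le> (real N + 1) / real L"
      proof -
        have "1 \<le> 2 * pi\<^sup>2" using pi_ge_two power_mono[of 2 pi 2] by simp
        then have "1 * real L \<le> 2 * pi\<^sup>2 * real L" by (intro mult_right_mono) auto
        then show ?thesis using L by (simp add: frac_le)
      qed
      finally show ?thesis using C0 e(1) by (intro mult_left_mono add_mono divide_right_mono mult_right_mono) auto
    qed
    also have "\<dots> = C * (real N + 1) * e"
      unfolding e(2)[symmetric] using e(1) by (simp add: field_simps)
    finally show ?thesis by (simp add: e_def)
  qed
  have "R \<longlonglongrightarrow> 0"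
  proof (rule Lim_null_comparison)
    show "\<forall>\<^sub>F L in sequentially. norm (R L) \<le> C * (real N + 1) / sqrt (real L)"
      using eventually_ge_at_top[of 1] by eventually_elim (rule Rb)
    have "(\<lambda>L. (C * (real N + 1)) * (1 / sqrt (real L))) \<longlonglongrightarrow> (C * (real N + 1)) * 0"
      by (intro tendsto_mult tendsto_const) real_asymp
    then show "(\<lambda>L. C * (real N + 1) / sqrt (real L)) \<longlonglongrightarrow> 0" by simp
  qed
  then have "(\<lambda>L. (\<Sum>n=1..N. f (real n)) + R L) \<longlonglongrightarrow> (\<Sum>n=1..N. f (real n)) + 0"
    by (intro tendsto_intros)
  then show ?thesis unfolding eq by simp
qed

section \<open>Amplitudes and smooth steps\<close>

text \<open>These bounds are invariant under dilations $z \mapsto cz$, so that a single constant serves all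
  cut-off parameters.\<close>

definition amp :: "real \<Rightarrow> (real \<Rightarrow> real) \<Rightarrow> bool" where
  "amp B h \<longleftrightarrow> (\<exists>h' h''. (\<forall>z>0. (h has_real_derivative h' z) (at z) \<and> (h' has_real_derivative h'' z) (at z) \<and>
     \<bar>h z\<bar> \<le> B \<and> \<bar>z * h' z\<bar> \<le> B \<and> \<bar>z\<^sup>2 * h'' z\<bar> \<le> B) \<and> continuous_on {0<..} h'')"

lemma ampI:
  assumes "\<And>z. z > 0 \<Longrightarrow> (h has_real_derivative h' z) (at z)"
    "\<And>z. z > 0 \<Longrightarrow> (h' has_real_derivative h'' z) (at z)"
    "\<And>z. z > 0 \<Longrightarrow> \<bar>h z\<bar> \<le> B" "\<And>z. z > 0 \<Longrightarrow> \<bar>z * h' z\<bar> \<le> B" "\<And>z. z > 0 \<Longrightarrow> \<bar>z\<^sup>2 * h'' z\<bar> \<le> B"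
    "continuous_on {0<..} h''"
  shows "amp B h"
  unfolding amp_def using assms by blast

definition amp_wit :: "real \<Rightarrow> (real \<Rightarrow> real) \<Rightarrow> (real \<Rightarrow> real) \<Rightarrow> (real \<Rightarrow> real) \<Rightarrow> bool" where
  "amp_wit B h h' h'' \<longleftrightarrow> (\<forall>z>0. (h has_real_derivative h' z) (at z) \<and> (h' has_real_derivative h'' z) (at z) \<and>
     \<bar>h z\<bar> \<le> B \<and> \<bar>z * h' z\<bar> \<le> B \<and> \<bar>z\<^sup>2 * h'' z\<bar> \<le> B) \<and> continuous_on {0<..} h'' \<and> continuous_on {0<..} h'"

lemma ampE:
  assumes "amp B h"
  obtains h' h'' where "amp_wit B h h' h''"
proof -
  obtain h' h'' where h: "\<forall>z>0. (h has_real_derivative h' z) (at z) \<and> (h' has_real_derivative h'' z) (at z) \<and>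
     \<bar>h z\<bar> \<le> B \<and> \<bar>z * h' z\<bar> \<le> B \<and> \<bar>z\<^sup>2 * h'' z\<bar> \<le> B" and c: "continuous_on {0<..} h''"
    using assms unfolding amp_def by blast
  have "continuous_on {0<..} h'"
    by (rule DERIV_continuous_on[where D = h'']) (use h in \<open>auto intro: has_field_derivative_at_within\<close>)
  then show ?thesis using that[of h' h''] h c unfolding amp_wit_def by blast
qed

lemma amp_witD:
  assumes "amp_wit B h h' h''"
  shows "z > 0 \<Longrightarrow> (h has_real_derivative h' z) (at z)"
    "z > 0 \<Longrightarrow> (h' has_real_derivative h'' z) (at z)"
    "z > 0 \<Longrightarrow> \<bar>h z\<bar> \<le> B" "z > 0 \<Longrightarrow> \<bar>z * h' z\<bar> \<le> B" "z > 0 \<Longrightarrow> \<bar>z\<^sup>2 * h'' z\<bar> \<le> B"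
    "continuous_on {0<..} h'" "continuous_on {0<..} h''"
  using assms unfolding amp_wit_def by auto

lemma amp_bound: "amp B h \<Longrightarrow> z > 0 \<Longrightarrow> \<bar>h z\<bar> \<le> B"
  by (auto simp: amp_def)

lemma amp_nonneg: "amp B h \<Longrightarrow> B \<ge> 0"
  using amp_bound[of B h 1] by simp

lemma amp_continuous: "amp B h \<Longrightarrow> continuous_on {0<..} h"
  by (erule ampE, rule DERIV_continuous_on) (auto intro: has_field_derivative_at_within amp_witD)

lemma amp_const: "amp \<bar>c\<bar> (\<lambda>_. c)"
  by (rule ampI[where h' = "\<lambda>_. 0" and h'' = "\<lambda>_. 0"]) auto

lemma amp_add:
  assumes f: "amp A f" and g: "amp B g" shows "amp (A + B) (\<lambda>z. f z + g z)"
proof -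
  obtain f' f'' where "amp_wit A f f' f''" by (rule ampE[OF f])
  note F = amp_witD[OF this]
  obtain g' g'' where "amp_wit B g g' g''" by (rule ampE[OF g])
  note G = amp_witD[OF this]
  show ?thesis
  proof (rule ampI[where h' = "\<lambda>z. f' z + g' z" and h'' = "\<lambda>z. f'' z + g'' z"])
    fix z :: real assume z: "z > 0"
    show "\<bar>f z + g z\<bar> \<le> A + B" using F(3)[OF z] G(3)[OF z] by linarith
    show "\<bar>z * (f' z + g' z)\<bar> \<le> A + B" using F(4)[OF z] G(4)[OF z] unfolding distrib_left by linarith
    show "\<bar>z\<^sup>2 * (f'' z + g'' z)\<bar> \<le> A + B" using F(5)[OF z] G(5)[OF z] unfolding distrib_left by linarith
  qed (auto intro!: DERIV_add F G continuous_intros)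
qed

text \<open>The factor 4 is 1 + 2 + 1, the coefficients in the Leibniz formula for the second
  derivative.\<close>

lemma amp_mult:
  assumes f: "amp A f" and g: "amp B g" shows "amp (4 * A * B) (\<lambda>z. f z * g z)"
proof -
  have A: "A \<ge> 0" and B: "B \<ge> 0" using f g amp_nonneg by auto
  obtain f' f'' where "amp_wit A f f' f''" by (rule ampE[OF f])
  note F = amp_witD[OF this]
  obtain g' g'' where "amp_wit B g g' g''" by (rule ampE[OF g])
  note G = amp_witD[OF this]
  have m: "\<bar>a * b\<bar> \<le> A * B" if "\<bar>a\<bar> \<le> A" "\<bar>b\<bar> \<le> B" for a b
    unfolding abs_mult using that A B by (intro mult_mono) auto
  show ?thesis
  proof (rule ampI[where h' = "\<lambda>z. f' z * g z + f z * g' z" and h'' = "\<lambda>z. f'' z * g z + 2 * (f' z * g' z) + f z * g'' z"])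
    fix z :: real assume z: "z > 0"
    have AB: "A * B \<ge> 0" using A B by simp
    show "\<bar>f z * g z\<bar> \<le> 4 * A * B" using m[OF F(3)[OF z] G(3)[OF z]] AB by linarith
    show "((\<lambda>z. f z * g z) has_real_derivative f' z * g z + f z * g' z) (at z)"
      using DERIV_mult[OF F(1)[OF z] G(1)[OF z]] by (simp add: mult.commute add.commute)
    show "((\<lambda>z. f' z * g z + f z * g' z) has_real_derivative f'' z * g z + 2 * (f' z * g' z) + f z * g'' z) (at z)"
      using DERIV_add[OF DERIV_mult[OF F(2)[OF z] G(1)[OF z]] DERIV_mult[OF F(1)[OF z] G(2)[OF z]]]
      by (simp add: algebra_simps)
    have "z * (f' z * g z + f z * g' z) = (z * f' z) * g z + f z * (z * g' z)" by (simp add: algebra_simps)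
    then show "\<bar>z * (f' z * g z + f z * g' z)\<bar> \<le> 4 * A * B"
      using m[OF F(4)[OF z] G(3)[OF z]] m[OF F(3)[OF z] G(4)[OF z]] AB by linarith
    have "z\<^sup>2 * (f'' z * g z + 2 * (f' z * g' z) + f z * g'' z) = (z\<^sup>2 * f'' z) * g z + 2 * ((z * f' z) * (z * g' z)) + f z * (z\<^sup>2 * g'' z)"
      by (simp add: algebra_simps power2_eq_square)
    then show "\<bar>z\<^sup>2 * (f'' z * g z + 2 * (f' z * g' z) + f z * g'' z)\<bar> \<le> 4 * A * B"
      using m[OF F(5)[OF z] G(3)[OF z]] m[OF F(4)[OF z] G(4)[OF z]] m[OF F(3)[OF z] G(5)[OF z]] by linarith
  next
    have "continuous_on {0<..} f" "continuous_on {0<..} g" using f g amp_continuous by auto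
    then show "continuous_on {0<..} (\<lambda>z. f'' z * g z + 2 * (f' z * g' z) + f z * g'' z)"
      by (intro continuous_intros F G)
  qed
qed

lemma amp_scale:
  assumes f: "amp A f" and c: "c > 0" shows "amp A (\<lambda>z. f (c * z))"
proof -
  obtain f' f'' where "amp_wit A f f' f''" by (rule ampE[OF f])
  note F = amp_witD[OF this]
  show ?thesis
  proof (rule ampI[where h' = "\<lambda>z. f' (c * z) * c" and h'' = "\<lambda>z. f'' (c * z) * c * c"])
    fix z :: real assume z: "z > 0"
    then have cz: "c * z > 0" using c by simp
    have d: "((\<lambda>z. c * z) has_real_derivative c) (at z)" by (auto intro!: derivative_eq_intros)
    show "((\<lambda>z. f (c * z)) has_real_derivative f' (c * z) * c) (at z)"
      using DERIV_chain2[OF F(1)[OF cz] d] .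
    show "((\<lambda>z. f' (c * z) * c) has_real_derivative f'' (c * z) * c * c) (at z)"
      by (rule DERIV_cmult_right[OF DERIV_chain2[OF F(2)[OF cz] d]])
    show "\<bar>f (c * z)\<bar> \<le> A" using F(3)[OF cz] .
    show "\<bar>z * (f' (c * z) * c)\<bar> \<le> A" using F(4)[OF cz] by (simp add: mult_ac)
    show "\<bar>z\<^sup>2 * (f'' (c * z) * c * c)\<bar> \<le> A" using F(5)[OF cz] by (simp add: mult_ac power2_eq_square)
  next
    show "continuous_on {0<..} (\<lambda>z. f'' (c * z) * c * c)"
      by (intro continuous_intros continuous_on_compose2[OF F(7)]) (use c in auto)
  qed
qed

text \<open>With y = 1/z, z^2 times the second derivative is y^2 f''(y) + 2 y f'(y); hence the
  factor 3.\<close>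

lemma amp_inverse:
  assumes f: "amp A f" shows "amp (3 * A) (\<lambda>z. f (1 / z))"
proof -
  have A: "A \<ge> 0" using f by (rule amp_nonneg)
  obtain f' f'' where "amp_wit A f f' f''" by (rule ampE[OF f])
  note F = amp_witD[OF this]
  show ?thesis
  proof (rule ampI[where h' = "\<lambda>z. f' (1 / z) * (- (1 / z\<^sup>2))" and h'' = "\<lambda>z. f'' (1 / z) * (1 / z ^ 4) + f' (1 / z) * (2 / z ^ 3)"])
    fix z :: real assume z: "z > 0"
    then have cz: "1 / z > 0" by simp
    have d: "((\<lambda>z. 1 / z) has_real_derivative - (1 / z\<^sup>2)) (at z)"
      using z by (auto intro!: derivative_eq_intros simp: power2_eq_square)
    have d2: "((\<lambda>z. - (1 / z\<^sup>2)) has_real_derivative (2 / z ^ 3)) (at z)"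
      using z by (auto intro!: derivative_eq_intros simp: power2_eq_square power3_eq_cube field_simps)
    show "((\<lambda>z. f (1 / z)) has_real_derivative f' (1 / z) * (- (1 / z\<^sup>2))) (at z)"
      using DERIV_chain2[OF F(1)[OF cz] d] .
    have "((\<lambda>z. f' (1 / z) * (- (1 / z\<^sup>2))) has_real_derivative (f'' (1 / z) * (- (1 / z\<^sup>2))) * (- (1 / z\<^sup>2)) + (2 / z ^ 3) * f' (1 / z)) (at z)"
      by (rule DERIV_mult[OF DERIV_chain2[OF F(2)[OF cz] d] d2])
    moreover have "(f'' (1 / z) * (- (1 / z\<^sup>2))) * (- (1 / z\<^sup>2)) + (2 / z ^ 3) * f' (1 / z) = f'' (1 / z) * (1 / z ^ 4) + f' (1 / z) * (2 / z ^ 3)"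
      by (simp add: power2_eq_square power4_eq_xxxx mult_ac)
    ultimately show "((\<lambda>z. f' (1 / z) * (- (1 / z\<^sup>2))) has_real_derivative f'' (1 / z) * (1 / z ^ 4) + f' (1 / z) * (2 / z ^ 3)) (at z)" by (simp only:)
    show "\<bar>f (1 / z)\<bar> \<le> 3 * A" using F(3)[OF cz] A by linarith
    have "z * (f' (1 / z) * (- (1 / z\<^sup>2))) = - (1 / z * f' (1 / z))" using z by (simp add: power2_eq_square)
    then show "\<bar>z * (f' (1 / z) * (- (1 / z\<^sup>2)))\<bar> \<le> 3 * A" using F(4)[OF cz] A by linarith
    have "z\<^sup>2 * (f'' (1 / z) * (1 / z ^ 4) + f' (1 / z) * (2 / z ^ 3)) = (1 / z)\<^sup>2 * f'' (1 / z) + 2 * (1 / z * f' (1 / z))"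
      using z by (simp add: power2_eq_square power3_eq_cube power4_eq_xxxx field_simps)
    then show "\<bar>z\<^sup>2 * (f'' (1 / z) * (1 / z ^ 4) + f' (1 / z) * (2 / z ^ 3))\<bar> \<le> 3 * A" using F(4)[OF cz] F(5)[OF cz] by linarith
  next
    show "continuous_on {0<..} (\<lambda>z. f'' (1 / z) * (1 / z ^ 4) + f' (1 / z) * (2 / z ^ 3))"
      by (intro continuous_intros continuous_on_compose2[OF F(7)] continuous_on_compose2[OF F(6)]) auto
  qed
qed

section \<open>A twice continuously differentiable step function\<close>

lemma DERIV_pos_part_power:
  assumes "n \<ge> 2"
  shows "((\<lambda>x::real. (max 0 x) ^ n) has_real_derivative real n * (max 0 x) ^ (n - 1)) (at x)"
proof -
  consider "x > 0" | "x < 0" | "x = 0" by linarith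
  then show ?thesis
  proof cases
    case 1
    have "((\<lambda>x::real. x ^ n) has_real_derivative real n * x ^ (n - 1)) (at x)"
      by (auto intro!: derivative_eq_intros)
    then have "((\<lambda>x::real. (max 0 x) ^ n) has_real_derivative real n * x ^ (n - 1)) (at x)"
      by (rule has_field_derivative_transform_within_open[where S = "{0<..}"]) (use 1 in auto)
    then show ?thesis using 1 by simp
  next
    case 2
    have "((\<lambda>x::real. 0) has_real_derivative 0) (at x)" by simp
    then have "((\<lambda>x::real. (max 0 x) ^ n) has_real_derivative 0) (at x)"
      by (rule has_field_derivative_transform_within_open[where S = "{..<0}"]) (use 2 assms in auto)
    moreover have "max 0 x = 0" using 2 by simp
    ultimately show ?thesis using assms by (simp add: zero_power)
  next
    case 3
    have "((\<lambda>h::real. ((max 0 h) ^ n) / h) \<longlongrightarrow> 0) (at 0)"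
    proof (rule Lim_null_comparison)
      show "\<forall>\<^sub>F h::real in at 0. norm ((max 0 h) ^ n / h) \<le> \<bar>h\<bar> ^ (n - 1)"
      proof (intro eventuallyI)
        fix h :: real
        obtain m where m: "n = Suc m" using assms by (cases n) auto
        show "norm ((max 0 h) ^ n / h) \<le> \<bar>h\<bar> ^ (n - 1)"
          by (cases "h > 0") (auto simp: m max_def)
      qed
      have "((\<lambda>h::real. \<bar>h\<bar> ^ (n - 1)) \<longlongrightarrow> \<bar>0\<bar> ^ (n - 1)) (at 0)" by (intro tendsto_intros)
      then show "((\<lambda>h::real. \<bar>h\<bar> ^ (n - 1)) \<longlongrightarrow> 0) (at 0)" using assms by (simp add: power_0_left)
    qed
    then show ?thesis using 3 assms by (simp add: DERIV_def power_0_left)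
  qed
qed

text \<open>Cubes of positive parts are the lowest powers with two continuous derivatives, which is
  all that \<open>amp\<close> demands. The quotient rises from 0 at z = 1 to 1 at z = 2.\<close>

definition stp :: "real \<Rightarrow> real" where
  "stp z = (max 0 (z - 1)) ^ 3 / ((max 0 (z - 1)) ^ 3 + (max 0 (2 - z)) ^ 3)"

definition stp' :: "real \<Rightarrow> real" where
  "stp' z = (3 * (max 0 (z - 1))\<^sup>2 * (max 0 (2 - z)) ^ 3 + (max 0 (z - 1)) ^ 3 * (3 * (max 0 (2 - z))\<^sup>2)) /
     ((max 0 (z - 1)) ^ 3 + (max 0 (2 - z)) ^ 3)\<^sup>2"

lemma stp_denom_pos: "(max 0 (z - 1)) ^ 3 + (max 0 (2 - z)) ^ 3 > (0::real)"
proof (cases "z > 1")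
  case True
  then have "(max 0 (z - 1)) ^ 3 > 0" by simp
  then show ?thesis by (simp add: add_pos_nonneg)
next
  case False
  then have "(max 0 (2 - z)) ^ 3 > 0" by simp
  then show ?thesis by (simp add: add_nonneg_pos)
qed

lemma stp_0: "z \<le> 1 \<Longrightarrow> stp z = 0" by (simp add: stp_def max_def)

lemma stp_1: "z \<ge> 2 \<Longrightarrow> stp z = 1" using stp_denom_pos[of z] by (simp add: stp_def max_def)

lemma stp_range: "0 \<le> stp z" "stp z \<le> 1"
  using stp_denom_pos[of z] by (simp_all add: stp_def)

lemma stp'_nonneg: "0 \<le> stp' z" by (simp add: stp'_def)

lemma continuous_on_stp': "continuous_on S stp'"
  unfolding stp'_def using less_imp_neq[OF stp_denom_pos, symmetric]
  by (intro continuous_intros) simp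

lemma DERIV_pos_part:
  "((\<lambda>z. (max 0 (z - 1)) ^ 3) has_real_derivative 3 * (max 0 (z - 1))\<^sup>2) (at z)"
  "((\<lambda>z. (max 0 (2 - z)) ^ 3) has_real_derivative - (3 * (max 0 (2 - z))\<^sup>2)) (at z)"
  "((\<lambda>z. 3 * (max 0 (z - 1))\<^sup>2) has_real_derivative 6 * (max 0 (z - 1))) (at z)"
  "((\<lambda>z. 3 * (max 0 (2 - z))\<^sup>2) has_real_derivative - (6 * (max 0 (2 - z)))) (at z)"
  for z :: real
proof -
  have p: "((\<lambda>x::real. (max 0 x) ^ 3) has_real_derivative 3 * (max 0 x)\<^sup>2) (at x)"
    "((\<lambda>x::real. 3 * (max 0 x)\<^sup>2) has_real_derivative 6 * (max 0 x)) (at x)" for x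
    using DERIV_pos_part_power[of 3 x] DERIV_cmult[OF DERIV_pos_part_power[of 2 x], of 3] by simp_all
  have d: "((\<lambda>z::real. z - 1) has_real_derivative 1) (at z)" "((\<lambda>z::real. 2 - z) has_real_derivative -1) (at z)"
    by (auto intro!: derivative_eq_intros)
  show "((\<lambda>z. (max 0 (z - 1)) ^ 3) has_real_derivative 3 * (max 0 (z - 1))\<^sup>2) (at z)"
    using DERIV_chain2[OF p(1) d(1)] by simp
  show "((\<lambda>z. (max 0 (2 - z)) ^ 3) has_real_derivative - (3 * (max 0 (2 - z))\<^sup>2)) (at z)"
    using DERIV_chain2[OF p(1) d(2)] by simp
  show "((\<lambda>z. 3 * (max 0 (z - 1))\<^sup>2) has_real_derivative 6 * (max 0 (z - 1))) (at z)"
    using DERIV_chain2[OF p(2) d(1)] by simp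
  show "((\<lambda>z. 3 * (max 0 (2 - z))\<^sup>2) has_real_derivative - (6 * (max 0 (2 - z)))) (at z)"
    using DERIV_chain2[OF p(2) d(2)] by simp
qed

lemma DERIV_stp: "(stp has_real_derivative stp' z) (at z)"
proof -
  have "(stp has_real_derivative ((3 * (max 0 (z - 1))\<^sup>2) * ((max 0 (z - 1)) ^ 3 + (max 0 (2 - z)) ^ 3)
     - (max 0 (z - 1)) ^ 3 * (3 * (max 0 (z - 1))\<^sup>2 + - (3 * (max 0 (2 - z))\<^sup>2))) /
     (((max 0 (z - 1)) ^ 3 + (max 0 (2 - z)) ^ 3) * ((max 0 (z - 1)) ^ 3 + (max 0 (2 - z)) ^ 3))) (at z)"
    unfolding stp_def [abs_def]
    using less_imp_neq[OF stp_denom_pos[of z], symmetric]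
    by (intro DERIV_divide DERIV_add DERIV_pos_part) 
  then show ?thesis unfolding stp'_def by (simp add: power2_eq_square algebra_simps)
qed

lemma amp_stp: "\<exists>B. amp B stp"
proof -
  define P where "P = (\<lambda>z::real. (max 0 (z - 1)) ^ 3)"
  define Q where "Q = (\<lambda>z::real. (max 0 (2 - z)) ^ 3)"
  define P1 where "P1 = (\<lambda>z::real. 3 * (max 0 (z - 1))\<^sup>2)"
  define Q1 where "Q1 = (\<lambda>z::real. 3 * (max 0 (2 - z))\<^sup>2)"
  define P2 where "P2 = (\<lambda>z::real. 6 * (max 0 (z - 1)))"
  define Q2 where "Q2 = (\<lambda>z::real. 6 * (max 0 (2 - z)))"
  note defs = P_def Q_def P1_def Q1_def P2_def Q2_def
  have d: "(P has_real_derivative P1 z) (at z)" "(Q has_real_derivative - Q1 z) (at z)"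
    "(P1 has_real_derivative P2 z) (at z)" "(Q1 has_real_derivative - Q2 z) (at z)" for z
    unfolding defs by (rule DERIV_pos_part)+
  have ne: "P z + Q z \<noteq> 0" for z unfolding P_def Q_def using stp_denom_pos[of z] by simp
  have stp': "stp' = (\<lambda>z. (P1 z * Q z + P z * Q1 z) / (P z + Q z)\<^sup>2)"
    by (simp add: fun_eq_iff stp'_def defs)
  define s2 where "s2 = (\<lambda>z. ((P2 z * Q z + - Q1 z * P1 z + (P1 z * Q1 z + - Q2 z * P z)) * (P z + Q z)\<^sup>2
     - (P1 z * Q z + P z * Q1 z) * (real 2 * ((P1 z + - Q1 z) * (P z + Q z) ^ (2 - Suc 0)))) / ((P z + Q z)\<^sup>2 * (P z + Q z)\<^sup>2))"
  have d2: "(stp' has_real_derivative s2 z) (at z)" for z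
    unfolding stp' s2_def
    by (intro DERIV_divide DERIV_add DERIV_mult DERIV_power d) (simp add: ne)
  have c2: "continuous_on S s2" for S
    unfolding s2_def defs using ne unfolding defs by (intro continuous_intros) auto
  have z1: "stp' z = 0" "s2 z = 0" if "z \<le> 1 \<or> z \<ge> 2" for z
    using that by (auto simp: stp' s2_def defs max_def)
  have "bounded (stp' ` {1..2})" "bounded (s2 ` {1..2})"
    by (intro compact_imp_bounded compact_continuous_image continuous_on_stp' c2 compact_Icc)+
  then obtain C1 C2 where C: "\<forall>y\<in>stp' ` {1..2}. norm y \<le> C1" "\<forall>y\<in>s2 ` {1..2}. norm y \<le> C2"
    unfolding bounded_iff by blast
  have C0: "C1 \<ge> 0" "C2 \<ge> 0" using C(1)[rule_format, of "stp' 1"] C(2)[rule_format, of "s2 1"] by (auto intro: order_trans[OF norm_ge_zero])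
  have b1: "\<bar>stp' z\<bar> \<le> C1" "\<bar>s2 z\<bar> \<le> C2" if "1 \<le> z" "z \<le> 2" for z
    using C that by auto
  show ?thesis
  proof (intro exI ampI[where h' = stp' and h'' = s2])
    fix z :: real assume z: "z > 0"
    show "(stp has_real_derivative stp' z) (at z)" by (rule DERIV_stp)
    show "(stp' has_real_derivative s2 z) (at z)" by (rule d2)
    \<comment> \<open>The three summands bound the function and its two weighted derivatives.
      Outside [1, 2] the derivatives vanish, and inside it the weights satisfy z <= 2 and z^2 <=
      4.\<close>
    show "\<bar>stp z\<bar> \<le> 1 + 2 * C1 + 4 * C2" using stp_range[of z] C0 by linarith
    show "\<bar>z * stp' z\<bar> \<le> 1 + 2 * C1 + 4 * C2"
    proof (cases "1 \<le> z \<and> z \<le> 2")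
      case True
      then have "\<bar>z * stp' z\<bar> \<le> 2 * C1" unfolding abs_mult using b1[of z] by (intro mult_mono) auto
      then show ?thesis using C0 by linarith
    qed (use z1[of z] C0 in auto)
    show "\<bar>z\<^sup>2 * s2 z\<bar> \<le> 1 + 2 * C1 + 4 * C2"
    proof (cases "1 \<le> z \<and> z \<le> 2")
      case True
      then have "z\<^sup>2 \<le> 4" using power_mono[of z 2 2] by simp
      then have "\<bar>z\<^sup>2 * s2 z\<bar> \<le> 4 * C2" unfolding abs_mult using b1[of z] True by (intro mult_mono) auto
      then show ?thesis using C0 by linarith
    qed (use z1[of z] C0 in auto)
  qed (rule c2)
qed

text \<open>Two integrations by parts. The interval [1/4, 5] is strictly wider than the support
  [1/2, 4], so W and W' both vanish at its ends and there are no boundary terms.\<close>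

lemma amp_fourier:
  fixes \<beta> :: real
  assumes W: "amp B W" and zero: "\<And>z. 0 < z \<Longrightarrow> z < 1/2 \<Longrightarrow> W z = 0" "\<And>z. 4 < z \<Longrightarrow> W z = 0"
  defines "I \<equiv> integral {1/4..5} (\<lambda>y. of_real (W y) * ee (\<beta> * y))"
  shows "cmod I \<le> 5 * B" and "cmod I * \<beta>\<^sup>2 \<le> 5 * B"
proof -
  have B: "B \<ge> 0" using W by (rule amp_nonneg)
  obtain W' W'' where "amp_wit B W W' W''" by (rule ampE[OF W])
  note F = amp_witD[OF this]
  have cW: "continuous_on {1/4..5} W" "continuous_on {1/4..5} W'" "continuous_on {1/4..5} W''"
    by (rule continuous_on_subset[OF amp_continuous[OF W]], force)
       (rule continuous_on_subset[OF F(6)], force, rule continuous_on_subset[OF F(7)], force)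
  have "cmod I \<le> B * (5 - 1/4)" unfolding I_def
    by (rule integral_norm_le) (use F(3) cW in \<open>auto intro!: continuous_intros simp: norm_mult\<close>)
  then show "cmod I \<le> 5 * B" using B by (simp add: field_simps)
  show "cmod I * \<beta>\<^sup>2 \<le> 5 * B"
  proof (cases "\<beta> = 0")
    case False
    have dz: "W' (1/4) = 0" "W' 5 = 0"
    proof -
      have "(W has_real_derivative 0) (at (1/4))"
        by (rule has_field_derivative_transform_within_open[where f = "\<lambda>_. 0" and S = "{0<..<1/2}"]) (use zero in auto)
      then show "W' (1/4) = 0" using DERIV_unique F(1)[of "1/4"] by force
      have "(W has_real_derivative 0) (at 5)"
        by (rule has_field_derivative_transform_within_open[where f = "\<lambda>_. 0" and S = "{4<..}"]) (use zero in auto)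
      then show "W' 5 = 0" using DERIV_unique F(1)[of 5] by force
    qed
    have wz: "W (1/4) = 0" "W 5 = 0" using zero by auto
    define c where "c = complex_of_real (2 * pi * \<beta>) * \<i>"
    have c: "c \<noteq> 0" using False by (simp add: c_def)
    define P where "P = (\<lambda>y. ee (\<beta> * y) / c)"
    have P: "(P has_vector_derivative ee (\<beta> * y)) (at y within {1/4..5})" for y
    proof -
      have "(P has_vector_derivative (c * ee (\<beta> * y)) / c) (at y within {1/4..5})" unfolding P_def c_def
        by (intro has_vector_derivative_divide ee_has_vector_derivative) (auto intro!: derivative_eq_intros)
      then show ?thesis using c by simp
    qed
    have parts: "integral {1/4..5} (\<lambda>y. of_real (h y) * ee (\<beta> * y)) = - integral {1/4..5} (\<lambda>y. of_real (h' y) * P y)"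
      if h: "\<And>z. z > 0 \<Longrightarrow> (h has_real_derivative h' z) (at z)" and c: "continuous_on {1/4..5} h'" and z: "h (1/4) = 0" "h 5 = 0" for h h'
    proof -
      have "integral {1/4..5} (\<lambda>y. of_real (h y) * ee (\<beta> * y)) = of_real (h 5) * P 5 - of_real (h (1/4)) * P (1/4) - integral {1/4..5} (\<lambda>y. of_real (h' y) * P y)"
      proof (rule integral_parts[where q = "\<lambda>y. of_real (h y)" and q' = "\<lambda>y. of_real (h' y)" and P = P and P' = "\<lambda>y. ee (\<beta> * y)"])
        fix y :: real assume "y \<in> {1/4..5}"
        then show "((\<lambda>y. complex_of_real (h y)) has_vector_derivative of_real (h' y)) (at y within {1/4..5})"
          by (intro of_real_has_vector_derivative has_field_derivative_at_within[OF h]) simp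
        show "(P has_vector_derivative ee (\<beta> * y)) (at y within {1/4..5})" by (rule P)
      next
        show "continuous_on {1/4..5} (\<lambda>y. complex_of_real (h' y))" using c by (rule continuous_on_of_real)
        show "continuous_on {1/4..5} (\<lambda>y. ee (\<beta> * y))" by (intro continuous_on_ee continuous_on_mult continuous_on_const continuous_on_id)
      qed simp
      then show ?thesis using z by simp
    qed
    have 1: "I = - integral {1/4..5} (\<lambda>y. of_real (W' y) * P y)"
      unfolding I_def by (rule parts[OF F(1) cW(2) wz])
    have 2: "integral {1/4..5} (\<lambda>y. of_real (W' y) * ee (\<beta> * y)) = - integral {1/4..5} (\<lambda>y. of_real (W'' y) * P y)"
      by (rule parts[OF F(2) cW(3) dz])
    have 3: "integral {1/4..5} (\<lambda>y. of_real (h y) * P y) = integral {1/4..5} (\<lambda>y. of_real (h y) * ee (\<beta> * y)) / c" for h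
      unfolding P_def by simp
    have "I = integral {1/4..5} (\<lambda>y. of_real (W'' y) * ee (\<beta> * y)) / c / c"
      unfolding 1 3 2 by simp
    then have "cmod I * (cmod c)\<^sup>2 = cmod (integral {1/4..5} (\<lambda>y. of_real (W'' y) * ee (\<beta> * y)))"
      using c by (simp add: norm_divide norm_mult power2_eq_square)
    also have "\<dots> \<le> (16 * B) * (5 - 1/4)"
    proof (rule integral_norm_le)
      fix y :: real assume y: "y \<in> {1/4..5}"
      have "(1/4)\<^sup>2 \<le> y\<^sup>2" by (rule power_mono) (use y in auto)
      then have "(1/4)\<^sup>2 * \<bar>W'' y\<bar> \<le> y\<^sup>2 * \<bar>W'' y\<bar>" by (rule mult_right_mono) simp
      also have "\<dots> \<le> B" using F(5)[of y] y by (simp add: abs_mult)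
      finally show "cmod (of_real (W'' y) * ee (\<beta> * y)) \<le> 16 * B" by (simp add: norm_mult power2_eq_square)
    qed (use cW in \<open>auto intro!: continuous_intros\<close>)
    also have "(cmod c)\<^sup>2 = 4 * pi\<^sup>2 * \<beta>\<^sup>2" by (simp add: c_def norm_mult power_mult_distrib)
    \<comment> \<open>76 = 16 * 19/4: the bound 16B for the second derivative on y >= 1/4, times the
      length of the interval. As 4 pi^2 >= 16, division gives less than 5B.\<close>
    finally have "(cmod I * \<beta>\<^sup>2) * (4 * pi\<^sup>2) \<le> 76 * B" by (simp add: mult_ac)
    moreover have "pi\<^sup>2 \<ge> 4" using pi_ge_two power_mono[of 2 pi 2] by simp
    then have "(cmod I * \<beta>\<^sup>2) * 16 \<le> (cmod I * \<beta>\<^sup>2) * (4 * pi\<^sup>2)" by (intro mult_left_mono) auto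
    ultimately show ?thesis using B by linarith
  qed (use B in auto)
qed

section \<open>The mean square of the high frequencies\<close>

text \<open>The shape of the bound for an oscillatory integral attached to j = km - ln: trivial for
  j = 0 and quadratically decaying otherwise.\<close>

definition kern :: "int \<Rightarrow> real" where
  "kern j = (if j = 0 then 1 else 1 / (real_of_int j)\<^sup>2)"

lemma kern_nonneg: "kern j \<ge> 0" by (simp add: kern_def)

lemma sum_inverse_squares_le: "(\<Sum>j=1..n. 1 / (real j)\<^sup>2) \<le> 2 - 1 / real n"
  proof (induction n)
    case (Suc n)
    show ?case
    proof (cases "n = 0")
      case False
      then have "1 / (real (Suc n))\<^sup>2 + 1 / real (Suc n) \<le> 1 / real n"
        by (simp add: divide_simps power2_eq_square) (simp add: algebra_simps)
      then show ?thesis using Suc by simp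
    qed simp
  qed simp

lemma sum_kern_le:
  assumes "finite J" shows "(\<Sum>j\<in>J. kern j) \<le> 5"
proof -
  obtain m :: nat where m: "\<And>j. j \<in> J \<Longrightarrow> \<bar>j\<bar> \<le> int m"
  proof -
    have "finite (nat ` abs ` J)" using assms by simp
    then obtain m where m: "\<forall>x\<in>nat ` abs ` J. x \<le> m" unfolding finite_nat_set_iff_bounded_le by blast
    show thesis
    proof (rule that[of m])
      fix j assume "j \<in> J"
      then have "nat \<bar>j\<bar> \<le> m" using m by blast
      then show "\<bar>j\<bar> \<le> int m" by linarith
    qed
  qed
  note t = sum_inverse_squares_le
  have "J \<subseteq> {0} \<union> (int ` {1..m} \<union> (\<lambda>k. - int k) ` {1..m})"
  proof
    fix j assume j: "j \<in> J"
    consider "j = 0" | "j > 0" | "j < 0" by linarith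
    then show "j \<in> {0} \<union> (int ` {1..m} \<union> (\<lambda>k. - int k) ` {1..m})"
    proof cases
      case 2
      then have "j = int (nat j)" "nat j \<in> {1..m}" using m[OF j] by auto
      then show ?thesis by blast
    next
      case 3
      then have "j = - int (nat (-j))" "nat (-j) \<in> {1..m}" using m[OF j] by auto
      then show ?thesis by blast
    qed simp
  qed
  then have "(\<Sum>j\<in>J. kern j) \<le> (\<Sum>j\<in>{0} \<union> (int ` {1..m} \<union> (\<lambda>k. - int k) ` {1..m}). kern j)"
    by (intro sum_mono2) (auto simp: kern_nonneg)
  also have "\<dots> \<le> (\<Sum>j\<in>{0}. kern j) + (\<Sum>j\<in>int ` {1..m} \<union> (\<lambda>k. - int k) ` {1..m}. kern j)"
    by (subst sum.union_disjoint) auto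
  also have "(\<Sum>j\<in>int ` {1..m} \<union> (\<lambda>k. - int k) ` {1..m}. kern j) = (\<Sum>j\<in>int ` {1..m}. kern j) + (\<Sum>j\<in>(\<lambda>k. - int k) ` {1..m}. kern j)"
    by (rule sum.union_disjoint) auto
  also have "(\<Sum>j\<in>int ` {1..m}. kern j) = (\<Sum>j=1..m. 1 / (real j)\<^sup>2)"
    by (subst sum.reindex) (auto simp: kern_def intro!: sum.cong)
  also have "(\<Sum>j\<in>(\<lambda>k. - int k) ` {1..m}. kern j) = (\<Sum>j=1..m. 1 / (real j)\<^sup>2)"
    by (subst sum.reindex) (auto simp: kern_def inj_on_def intro!: sum.cong)
  \<comment> \<open>1 for j = 0 and at most 2 for each sign of j.\<close>
  also have "(\<Sum>j\<in>{0}. kern j) + ((\<Sum>j=1..m. 1 / (real j)\<^sup>2) + (\<Sum>j=1..m. 1 / (real j)\<^sup>2)) \<le> 5"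
  proof -
    have "0 \<le> 1 / real m" by simp
    moreover have "(\<Sum>j\<in>{0}. kern j) = 1" by (simp add: kern_def)
    ultimately show ?thesis using t[of m] by linarith
  qed
  finally show ?thesis by simp
qed

section \<open>Counting solutions of km - ln = j\<close>

lemma card_congruent_le:
  fixes S :: "nat set"
  assumes S: "S \<subseteq> {1..N}" and q: "q \<ge> 1" and cong: "\<And>a b. a \<in> S \<Longrightarrow> b \<in> S \<Longrightarrow> int q dvd int a - int b"
  shows "real (card S) \<le> real N / real q + 1"
proof (cases "S = {}")
  case False
  have fin: "finite S" using S finite_subset by blast
  define m0 where "m0 = Min S"
  have m0: "m0 \<in> S" "\<And>m. m \<in> S \<Longrightarrow> m0 \<le> m" using fin False by (auto simp: m0_def)
  have div: "q dvd m - m0" if "m \<in> S" for m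
    using cong[OF that m0(1)] m0(2)[OF that] by (metis of_nat_diff int_dvd_int_iff)
  have "inj_on (\<lambda>m. (m - m0) div q) S"
  proof (rule inj_onI)
    fix a b assume ab: "a \<in> S" "b \<in> S" "(a - m0) div q = (b - m0) div q"
    then have "a - m0 = b - m0" using div by (metis dvd_div_mult_self)
    then show "a = b" using m0 ab by (metis le_add_diff_inverse2)
  qed
  moreover have "(\<lambda>m. (m - m0) div q) ` S \<subseteq> {0..N div q}"
  proof (rule image_subsetI)
    fix m assume "m \<in> S"
    then have "m \<in> {1..N}" using S by blast
    then have "m - m0 \<le> N" using le_trans[OF diff_le_self[of m m0], of N] by auto
    then show "(m - m0) div q \<in> {0..N div q}" by (simp add: div_le_mono)
  qed
  ultimately have "card S \<le> card {0..N div q}" by (intro card_inj_on_le) auto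
  then have "real (card S) \<le> real (N div q) + 1" by simp
  also have "real (N div q) \<le> real N / real q"
    using q by (simp add: le_divide_eq flip: of_nat_mult)
  finally show ?thesis by simp
qed simp

text \<open>A solution is determined by m, and for given j all admissible m lie in a single residue
  class modulo l / gcd(k, l).\<close>

lemma card_solutions_le:
  assumes k: "k \<ge> 1" and l: "l \<ge> (1::nat)"
  shows "real (card {(n,m). n \<in> {1..N} \<and> m \<in> {1..N} \<and> int k * int m - int l * int n = j}) \<le> real N * real (gcd k l) / real l + 1"
proof -
  define A where "A = {(n,m). n \<in> {1..N} \<and> m \<in> {1..N} \<and> int k * int m - int l * int n = j}"
  define g where "g = gcd k l"
  have g: "g \<ge> 1" using k by (simp add: g_def Suc_leI)
  obtain k' l' where kl: "k = g * k'" "l = g * l'" "coprime k' l'"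
    using k unfolding g_def by (metis gcd_coprime_exists gcd_eq_0_iff mult.commute not_one_le_zero)
  have l': "l' \<ge> 1" using l kl by (cases l') auto
  have fin: "finite A" unfolding A_def by (rule finite_subset[of _ "{1..N} \<times> {1..N}"]) auto
  have inj: "inj_on snd A"
  proof (rule inj_onI)
    fix x y assume xy: "x \<in> A" "y \<in> A" "snd x = snd y"
    then have "int k * int (snd x) - int l * int (fst x) = j" "int k * int (snd x) - int l * int (fst y) = j"
      by (auto simp: A_def split_beta)
    then have "int l * int (fst x) = int l * int (fst y)" by linarith
    then have "fst x = fst y" using l by simp
    then show "x = y" using xy(3) by (simp add: prod_eq_iff)
  qed
  have "real (card (snd ` A)) \<le> real N / real l' + 1"
  proof (rule card_congruent_le)
    show "snd ` A \<subseteq> {1..N}" by (auto simp: A_def)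
  next
    fix a b assume "a \<in> snd ` A" "b \<in> snd ` A"
    then obtain x y where xy: "x \<in> A" "y \<in> A" "a = snd x" "b = snd y" by blast
    define n n' where "n = fst x" and "n' = fst y"
    have "int k * int a - int l * int n = j" "int k * int b - int l * int n' = j"
      using xy by (auto simp: A_def split_beta n_def n'_def)
    then have "int k * (int a - int b) = int l * (int n - int n')" by (simp add: algebra_simps)
    then have "int g * (int k' * (int a - int b)) = int g * (int l' * (int n - int n'))"
      by (simp add: kl mult.assoc)
    then have "int k' * (int a - int b) = int l' * (int n - int n')" using g by simp
    then have "int l' dvd int k' * (int a - int b)" by simp
    moreover have "coprime (int l') (int k')" using kl(3) by (simp add: coprime_commute)
    ultimately show "int l' dvd int a - int b" by (simp add: coprime_dvd_mult_right_iff)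
  qed (use l' in auto)
  moreover have "card (snd ` A) = card A" by (rule card_image[OF inj])
  moreover have "real N / real l' = real N * real g / real l" using g by (simp add: kl(2))
  ultimately show ?thesis by (simp add: A_def g_def)
qed

text \<open>The bound with the larger of k and l in the denominator is used, and that number is at
  least sqrt(kl). Exchanging the roles of k and l replaces j by -j. The symmetric form makes the
  later double sum over k and l absolutely convergent.\<close>

lemma card_solutions_le_sqrt:
  assumes k: "k \<ge> 1" and l: "l \<ge> (1::nat)"
  shows "real (card {(n,m). n \<in> {1..N} \<and> m \<in> {1..N} \<and> int k * int m - int l * int n = j}) \<le> real N * real (gcd k l) / sqrt (real k * real l) + 1"
proof (cases "k \<le> l")
  case True
  have "sqrt (real k * real l) \<le> sqrt (real l * real l)" using True by (intro real_sqrt_le_mono mult_right_mono) auto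
  then have "sqrt (real k * real l) \<le> real l" by simp
  then have "real N * real (gcd k l) / real l \<le> real N * real (gcd k l) / sqrt (real k * real l)"
    using k l by (intro divide_left_mono) auto
  then show ?thesis using card_solutions_le[OF k l, of N j] by linarith
next
  case False
  have "{(n,m). n \<in> {1..N} \<and> m \<in> {1..N} \<and> int k * int m - int l * int n = j}
     = prod.swap ` {(n,m). n \<in> {1..N} \<and> m \<in> {1..N} \<and> int l * int m - int k * int n = - j}"
    by (auto simp: image_iff)
  then have c: "card {(n,m). n \<in> {1..N} \<and> m \<in> {1..N} \<and> int k * int m - int l * int n = j}
     = card {(n,m). n \<in> {1..N} \<and> m \<in> {1..N} \<and> int l * int m - int k * int n = - j}"
    by (simp add: card_image)
  have "sqrt (real k * real l) \<le> sqrt (real k * real k)" using False by (intro real_sqrt_le_mono mult_left_mono) auto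
  then have "sqrt (real k * real l) \<le> real k" by simp
  then have "real N * real (gcd k l) / real k \<le> real N * real (gcd k l) / sqrt (real k * real l)"
    using k l by (intro divide_left_mono) auto
  then show ?thesis using card_solutions_le[OF l k, of N "-j"] unfolding c by (simp add: gcd.commute)
qed

text \<open>The grid is grouped by the value j of km - ln: each class has boundedly many points,
  uniformly in j, and the kernel has total mass at most 5.\<close>

lemma sum_kern_grid_le:
  assumes k: "k \<ge> 1" and l: "l \<ge> (1::nat)"
  shows "(\<Sum>n=1..N. \<Sum>m=1..N. kern (int k * int m - int l * int n)) \<le> 5 * (real N * real (gcd k l) / sqrt (real k * real l) + 1)"
proof -
  define R where "R = real N * real (gcd k l) / sqrt (real k * real l) + 1"
  define P where "P = {1..N} \<times> {1..N}"
  define \<phi> where "\<phi> = (\<lambda>(n,m). int k * int m - int l * int n)"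
  have R: "R \<ge> 0" by (simp add: R_def)
  have "(\<Sum>n=1..N. \<Sum>m=1..N. kern (int k * int m - int l * int n)) = (\<Sum>x\<in>P. kern (\<phi> x))"
    by (simp add: P_def \<phi>_def sum.cartesian_product split_beta)
  also have "\<dots> = (\<Sum>j\<in>\<phi> ` P. \<Sum>x\<in>{x\<in>P. \<phi> x = j}. kern (\<phi> x))"
    by (rule sum.image_gen) (simp add: P_def)
  also have "\<dots> = (\<Sum>j\<in>\<phi> ` P. real (card {x\<in>P. \<phi> x = j}) * kern j)"
  proof (intro sum.cong refl)
    fix j
    have "(\<Sum>x\<in>{x\<in>P. \<phi> x = j}. kern (\<phi> x)) = (\<Sum>x\<in>{x\<in>P. \<phi> x = j}. kern j)" by (intro sum.cong) auto
    then show "(\<Sum>x\<in>{x\<in>P. \<phi> x = j}. kern (\<phi> x)) = real (card {x\<in>P. \<phi> x = j}) * kern j" by simp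
  qed
  also have "\<dots> \<le> (\<Sum>j\<in>\<phi> ` P. R * kern j)"
  proof (intro sum_mono mult_right_mono kern_nonneg)
    fix j
    have "{x\<in>P. \<phi> x = j} = {(n,m). n \<in> {1..N} \<and> m \<in> {1..N} \<and> int k * int m - int l * int n = j}"
      by (auto simp: P_def \<phi>_def)
    then show "real (card {x\<in>P. \<phi> x = j}) \<le> R" using card_solutions_le_sqrt[OF k l, of N j] by (simp add: R_def)
  qed
  also have "\<dots> = R * (\<Sum>j\<in>\<phi> ` P. kern j)" by (simp add: sum_distrib_left)
  also have "\<dots> \<le> R * 5" by (intro mult_left_mono sum_kern_le R) (simp add: P_def)
  also have "\<dots> = 5 * R" by simp
  finally show ?thesis unfolding R_def .
qed

text \<open>What the number of solutions, gcd(k, l)/sqrt(kl) per unit of N, becomes after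
  multiplication by the Fourier coefficients 1/k and 1/l.\<close>

definition gcd_weight :: "nat \<Rightarrow> nat \<Rightarrow> real" where
  "gcd_weight k l = real (gcd k l) * real (k * l) powr (-3/2)"

text \<open>Writing k = ga and l = gb with g the gcd turns the weight into g^(-2) a^(-3/2) b^(-3/2).
  The map to (g, a, b) is injective, so the sum is dominated by the one over all triples.\<close>

lemma gcd_weight_summable: "(\<lambda>(k,l). gcd_weight k l) summable_on ({0<..} \<times> {0<..})"
proof -
  define \<phi> where "\<phi> = (\<lambda>(g::nat, a::nat, b::nat). real g powr (-2) * (real a powr (-3/2) * real b powr (-3/2)))"
  have z: "((\<lambda>n. real n powr (-3/2)) has_sum zeta (3/2)) {0<..}" using has_sum_zeta[of "3/2"] by simp
  have z2: "((\<lambda>n. real n powr (-2)) has_sum zeta 2) {0<..}" using has_sum_zeta[of 2] by simp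
  have ab: "((\<lambda>(a,b). real a powr (-3/2) * real b powr (-3/2)) has_sum (zeta (3/2) * zeta (3/2))) ({0<..} \<times> {0<..})"
    by (rule has_sum_times[OF z z]) auto
  have "((\<lambda>(g,ab). real g powr (-2) * (case ab of (a,b) \<Rightarrow> real a powr (-3/2) * real b powr (-3/2))) has_sum (zeta 2 * (zeta (3/2) * zeta (3/2)))) ({0<..} \<times> ({0<..} \<times> {0<..}))"
    by (rule has_sum_times[OF z2 ab]) auto
  moreover have "\<phi> = (\<lambda>(g,ab). real g powr (-2) * (case ab of (a,b) \<Rightarrow> real a powr (-3/2) * real b powr (-3/2)))"
    by (auto simp: \<phi>_def fun_eq_iff)
  ultimately have "\<phi> summable_on ({0<..} \<times> {0<..} \<times> {0<..})"
    unfolding summable_on_def by metis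
  define j where "j = (\<lambda>(k::nat,l::nat). (gcd k l, k div gcd k l, l div gcd k l))"
  have inj: "inj_on j ({0<..} \<times> {0<..})"
    unfolding j_def inj_on_def by (auto, (metis dvd_mult_div_cancel gcd_dvd1), (metis dvd_mult_div_cancel gcd_dvd2))
  have sub: "j ` ({0<..} \<times> {0<..}) \<subseteq> {0<..} \<times> {0<..} \<times> {0<..}"
    by (auto simp: j_def div_greater_zero_iff gcd_le1_nat gcd_le2_nat dvd_imp_le)
  have "\<phi> summable_on (j ` ({0<..} \<times> {0<..}))"
    by (rule summable_on_subset_banach[OF \<open>\<phi> summable_on _\<close> sub])
  then have "(\<phi> \<circ> j) summable_on ({0<..} \<times> {0<..})" using summable_on_reindex[OF inj] by blast
  also have "?this \<longleftrightarrow> ?thesis"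
  proof (rule summable_on_cong)
    fix x :: "nat \<times> nat" assume x: "x \<in> {0<..} \<times> {0<..}"
    obtain k l where [simp]: "x = (k, l)" by (cases x)
    have kl: "k > 0" "l > 0" using x by auto
    define g where "g = gcd k l"
    obtain a b where ab: "k = g * a" "l = g * b" unfolding g_def by (metis dvdE gcd_dvd1 gcd_dvd2)
    have pos: "g > 0" "a > 0" "b > 0" using kl ab by auto
    have "real (k * l) powr (-3/2) = ((real g * real g) powr (-3/2)) * (real a * real b) powr (-3/2)"
      using pos by (simp add: ab powr_mult[symmetric] mult_ac)
    also have "(real g * real g) powr (-3/2) = real g powr (-3)"
      using pos by (simp add: powr_mult flip: powr_add)
    also have "real g * (real g powr (-3) * (real a * real b) powr (-3/2)) = (real g powr 1 * real g powr (-3)) * (real a powr (-3/2) * real b powr (-3/2))"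
      using pos by (simp add: powr_mult)
    also have "real g powr 1 * real g powr (-3) = real g powr (-2)" by (simp only: powr_add[symmetric]) simp
    finally have "gcd_weight k l = real g powr (-2) * (real a powr (-3/2) * real b powr (-3/2))"
      by (simp add: gcd_weight_def g_def)
    moreover have "j (k, l) = (g, a, b)" using pos by (simp add: j_def g_def[symmetric]) (simp add: ab)
    ultimately show "(\<phi> \<circ> j) x = (case x of (k, l) \<Rightarrow> gcd_weight k l)" by (simp add: \<phi>_def)
  qed
  finally show ?thesis .
qed

text \<open>This window equals 1 on [1, 2] and vanishes outside [1/2, 4]; it majorizes the sharp
  dyadic interval smoothly, as \<open>amp_fourier\<close> requires.\<close>

lemma stp_window_amp: "\<exists>B. amp B (\<lambda>y. stp (2 * y) * (1 - stp (1/2 * y)))"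
proof -
  obtain B where B: "amp B stp" using amp_stp by blast
  have "amp (\<bar>1\<bar> + 4 * \<bar>-1\<bar> * B) (\<lambda>z. 1 + (-1) * stp (1/2 * z))"
    by (rule amp_add[OF amp_const amp_mult[OF amp_const amp_scale[OF B]]]) simp
  then have *: "amp (1 + 4 * B) (\<lambda>z. 1 - stp (1/2 * z))" by simp
  have "amp (4 * B * (1 + 4 * B)) (\<lambda>z. stp (2 * z) * (1 - stp (1/2 * z)))"
    by (rule amp_mult[OF amp_scale[OF B] *]) simp
  then show ?thesis by blast
qed

text \<open>The oscillatory integrals in the expanded square decay quadratically in $km - ln$; this is
  what removes the logarithm that a sharp cut-off would cost.\<close>

lemma mean_square_bound:
  "\<exists>C>0. \<forall>(\<Theta>::real \<Rightarrow> real) (B::real) (z0::real) (S::nat set) (X::real) N. amp B \<Theta> \<longrightarrow> (\<forall>z. 0 < z \<longrightarrow> z < z0 \<longrightarrow> \<Theta> z = 0) \<longrightarrow> 1/2 \<le> z0 \<longrightarrow> 1 \<le> X \<longrightarrow>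
     finite S \<longrightarrow> S \<subseteq> {1..} \<longrightarrow>
     integral {1..2} (\<lambda>y. (\<Sum>n=1..N. \<Theta> (X * y / (real n)\<^sup>2) * (\<Sum>k\<in>S. sin (2 * pi * (real k * (X * y / real n))) / (pi * real k)))\<^sup>2)
       \<le> C * B\<^sup>2 * (sqrt (X / z0) * (\<Sum>k\<in>S. \<Sum>l\<in>S. gcd_weight k l) + (\<Sum>k\<in>S. 1 / real k)\<^sup>2)"
proof -
  define w where "w = (\<lambda>y. stp (2 * y) * (1 - stp (1/2 * y)))"
  obtain Bw where Bw: "amp Bw w" using stp_window_amp unfolding w_def by blast
  have w0: "w y = 0" if "0 < y" "y < 1/2 \<or> 4 < y" for y
    using that stp_0[of "2*y"] stp_1[of "1/2*y"] by (auto simp: w_def)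
  have w1: "w y = 1" if "1 \<le> y" "y \<le> 2" for y
    using that stp_1[of "2*y"] stp_0[of "1/2*y"] by (auto simp: w_def)
  have wnn: "w y \<ge> 0" for y using stp_range[of "2*y"] stp_range[of "1/2*y"] by (simp add: w_def)
  have Bw0: "Bw \<ge> 0" using Bw by (rule amp_nonneg)
  \<comment> \<open>500 = 5 * 100 comes from \<open>amp_fourier\<close> and from |beta| >= |d|/10
    below; 16 Bw B^2 bounds the product of the window with two weights; 5 comes from
    \<open>sum_kern_grid_le\<close>, and 3 exceeds sqrt 5. The summand 1 makes C positive.\<close>
  define C where "C = 1 + 500 * (16 * Bw) * 5 * 3"
  have C: "C > 0" using Bw0 by (simp add: C_def)
  show ?thesis
  proof (intro exI[of _ C] conjI allI impI C)
    fix \<Theta> :: "real \<Rightarrow> real" and B z0 X :: real and S :: "nat set" and N :: nat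
    assume \<Theta>: "amp B \<Theta>" and \<Theta>0: "\<forall>z. 0 < z \<longrightarrow> z < z0 \<longrightarrow> \<Theta> z = 0" and z0: "1/2 \<le> z0" and X: "1 \<le> X"
      and S: "finite S" "S \<subseteq> {1..}"
    \<comment> \<open>For y <= 5 and n > N0 the argument X y / n^2 is below z0, where the weight
      vanishes. The gain of 1/sqrt z0 in the final bound comes from this shortening of the
      sum.\<close>
    define N0 where "N0 = nat \<lfloor>sqrt (5 * X / z0)\<rfloor>"
    define A where "A = {1..min N N0}"
    define c where "c = (\<lambda>k::nat. 1 / (pi * real k))"
    have N0: "real N0 \<le> sqrt (5 * X / z0)" unfolding N0_def using z0 X by simp
    have A0: "\<Theta> (X * y / (real n)\<^sup>2) = 0" if "n \<in> {1..N} - A" "y \<in> {1/4..5}" for n y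
    proof -
      have "n > N0" using that by (auto simp: A_def)
      then have "sqrt (5 * X / z0) < real n" unfolding N0_def by linarith
      then have "5 * X / z0 < (real n)\<^sup>2" using real_sqrt_less_iff[of "5 * X / z0" "(real n)\<^sup>2"] by simp
      then have "5 * X / (real n)\<^sup>2 < z0" using z0 \<open>n > N0\<close> by (simp add: field_simps)
      moreover have "X * y / (real n)\<^sup>2 \<le> 5 * X / (real n)\<^sup>2" using that X by (intro divide_right_mono) auto
      moreover have "0 < X * y / (real n)\<^sup>2" using that X \<open>n > N0\<close> by auto
      ultimately show ?thesis using \<Theta>0 by auto
    qed
    define a where "a = (\<lambda>(n,k) y. c k * \<Theta> (X * y / (real n)\<^sup>2))"
    define f where "f = (\<lambda>(n,k). real k * X / real n)"
    define Z where "Z = (\<lambda>y. \<Sum>i\<in>A\<times>S. complex_of_real (a i y) * ee (f i * y))"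
    have T: "(\<Sum>n=1..N. \<Theta> (X * y / (real n)\<^sup>2) * (\<Sum>k\<in>S. sin (2 * pi * (real k * (X * y / real n))) / (pi * real k))) = Im (Z y)"
      if y: "y \<in> {1/4..5}" for y
    proof -
      have "(\<Sum>n=1..N. \<Theta> (X * y / (real n)\<^sup>2) * (\<Sum>k\<in>S. sin (2 * pi * (real k * (X * y / real n))) / (pi * real k)))
         = (\<Sum>n\<in>A. \<Theta> (X * y / (real n)\<^sup>2) * (\<Sum>k\<in>S. sin (2 * pi * (real k * (X * y / real n))) / (pi * real k)))"
        using A0 y by (intro sum.mono_neutral_right) (auto simp: A_def)
      also have "\<dots> = (\<Sum>(n,k)\<in>A\<times>S. Im (complex_of_real (a (n,k) y) * ee (f (n,k) * y)))"
        unfolding sum.cartesian_product[symmetric] sum_distrib_left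
        by (intro sum.cong refl) (simp add: a_def f_def c_def Im_ee mult_ac)
      also have "\<dots> = Im (Z y)" unfolding Z_def by (simp add: split_beta)
      finally show ?thesis .
    qed
    have cont: "continuous_on {1/4..5} (\<lambda>y. \<Theta> (X * y / (real n)\<^sup>2))" if "n \<in> A" for n
      by (rule continuous_on_compose2[OF amp_continuous[OF \<Theta>]]) (use that X in \<open>auto intro!: continuous_intros simp: A_def\<close>)
    have contw: "continuous_on {1/4..5} w"
      by (rule continuous_on_subset[OF amp_continuous[OF Bw]]) auto
    have conta: "continuous_on {1/4..5} (a i)" if "i \<in> A \<times> S" for i
      using that by (cases i) (auto simp: a_def intro!: continuous_intros cont)
    have contZ: "continuous_on {1/4..5} Z" unfolding Z_def
      by (intro continuous_on_sum continuous_on_mult continuous_on_of_real conta continuous_on_ee continuous_on_const continuous_on_id)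
    define J where "J = (\<lambda>i j. integral {1/4..5} (\<lambda>y. complex_of_real (w y * a i y * a j y) * ee ((f i - f j) * y)))"
    have intJ: "(\<lambda>y. complex_of_real (w y * a i y * a j y) * ee ((f i - f j) * y)) integrable_on {1/4..5}" if "i \<in> A \<times> S" "j \<in> A \<times> S" for i j
      by (intro integrable_continuous_real continuous_on_mult continuous_on_of_real conta contw continuous_on_ee continuous_on_const continuous_on_id that)
    have expand: "complex_of_real (w y * (cmod (Z y))\<^sup>2) = (\<Sum>i\<in>A\<times>S. \<Sum>j\<in>A\<times>S. complex_of_real (w y * a i y * a j y) * ee ((f i - f j) * y))" for y
    proof -
      have "ee (f i * y) * cnj (ee (f j * y)) = ee ((f i - f j) * y)" for i j
        by (simp add: cnj_ee ee_add[symmetric] left_diff_distrib)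
      then have "complex_of_real (a i y) * ee (f i * y) * cnj (complex_of_real (a j y) * ee (f j * y)) = complex_of_real (a i y) * complex_of_real (a j y) * ee ((f i - f j) * y)" for i j
        by (simp only: complex_cnj_mult complex_cnj_complex_of_real mult.assoc mult.left_commute mult.commute)
      then have "complex_of_real ((cmod (Z y))\<^sup>2) = (\<Sum>i\<in>A\<times>S. \<Sum>j\<in>A\<times>S. complex_of_real (a i y) * complex_of_real (a j y) * ee ((f i - f j) * y))"
        unfolding Z_def complex_norm_square sum_product cnj_sum by (simp only:)
      then show ?thesis unfolding of_real_mult sum_distrib_left by (simp only: mult.assoc sum_distrib_left)
    qed
    have "((\<lambda>y. complex_of_real (w y * (cmod (Z y))\<^sup>2)) has_integral (\<Sum>i\<in>A\<times>S. \<Sum>j\<in>A\<times>S. J i j)) {1/4..5}"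
      unfolding expand J_def by (intro has_integral_sum integrable_integral intJ finite_cartesian_product S) (auto simp: A_def)
    from has_integral_linear[OF this bounded_linear_Re]
    have "((\<lambda>y. w y * (cmod (Z y))\<^sup>2) has_integral Re (\<Sum>i\<in>A\<times>S. \<Sum>j\<in>A\<times>S. J i j)) {1/4..5}"
      by (simp add: o_def)
    then have I1: "integral {1/4..5} (\<lambda>y. w y * (cmod (Z y))\<^sup>2) = Re (\<Sum>i\<in>A\<times>S. \<Sum>j\<in>A\<times>S. J i j)" by (rule integral_unique)
    have "integral {1..2} (\<lambda>y. (\<Sum>n=1..N. \<Theta> (X * y / (real n)\<^sup>2) * (\<Sum>k\<in>S. sin (2 * pi * (real k * (X * y / real n))) / (pi * real k)))\<^sup>2)
       = integral {1..2} (\<lambda>y. (Im (Z y))\<^sup>2)"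
    proof (rule integral_cong)
      fix y :: real assume "y \<in> {1..2}"
      then have "y \<in> {1/4..5}" by auto
      then show "(\<Sum>n=1..N. \<Theta> (X * y / (real n)\<^sup>2) * (\<Sum>k\<in>S. sin (2 * pi * (real k * (X * y / real n))) / (pi * real k)))\<^sup>2 = (Im (Z y))\<^sup>2"
        by (simp only: T)
    qed
    \<comment> \<open>Passing from the imaginary part to the modulus leaves only differences of
      frequencies when the square is expanded.\<close>
    also have "\<dots> \<le> integral {1..2} (\<lambda>y. w y * (cmod (Z y))\<^sup>2)"
    proof (rule integral_le)
      have s: "{1..2} \<subseteq> {1/4..5::real}" by auto
      show "(\<lambda>y. (Im (Z y))\<^sup>2) integrable_on {1..2}" "(\<lambda>y. w y * (cmod (Z y))\<^sup>2) integrable_on {1..2}"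
        using continuous_on_subset[OF contZ s] continuous_on_subset[OF contw s]
        by (auto intro!: integrable_continuous_real continuous_intros)
      show "(Im (Z y))\<^sup>2 \<le> w y * (cmod (Z y))\<^sup>2" if "y \<in> {1..2}" for y
        using w1[of y] that by (simp add: cmod_power2)
    qed
    also have "\<dots> \<le> integral {1/4..5} (\<lambda>y. w y * (cmod (Z y))\<^sup>2)"
    proof (rule integral_subset_le)
      have s: "{1..2} \<subseteq> {1/4..5::real}" by auto
      show "(\<lambda>y. w y * (cmod (Z y))\<^sup>2) integrable_on {1..2}" "(\<lambda>y. w y * (cmod (Z y))\<^sup>2) integrable_on {1/4..5}"
        using continuous_on_subset[OF contZ s] continuous_on_subset[OF contw s] contZ contw
        by (auto intro!: integrable_continuous_real continuous_intros)
    qed (auto simp: wnn)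
    also have "\<dots> \<le> cmod (\<Sum>i\<in>A\<times>S. \<Sum>j\<in>A\<times>S. J i j)" unfolding I1 by (rule complex_Re_le_cmod)
    also have "\<dots> \<le> (\<Sum>i\<in>A\<times>S. \<Sum>j\<in>A\<times>S. cmod (J i j))"
      by (intro order_trans[OF norm_sum] sum_mono norm_sum)
    also have "\<dots> \<le> (\<Sum>i\<in>A\<times>S. \<Sum>j\<in>A\<times>S. 500 * (16 * Bw * B\<^sup>2) * (1 / real (snd i) * (1 / real (snd j)) * kern (int (snd i) * int (fst j) - int (snd j) * int (fst i))))"
    proof (intro sum_mono)
      fix i j assume i: "i \<in> A \<times> S" and j: "j \<in> A \<times> S"
      obtain n k where ik: "i = (n, k)" by (cases i)
      obtain m l where jl: "j = (m, l)" by (cases j)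
      have nm: "n \<ge> 1" "m \<ge> 1" "n \<le> N0" "m \<le> N0" "k \<ge> 1" "l \<ge> 1" using i j S(2) by (auto simp: ik jl A_def)
      define W where "W = (\<lambda>y. w y * (\<Theta> (X / (real n)\<^sup>2 * y) * \<Theta> (X / (real m)\<^sup>2 * y)))"
      have W: "amp (4 * Bw * (4 * B * B)) W" unfolding W_def
        by (intro amp_mult Bw amp_scale \<Theta>) (use X nm in auto)
      define \<beta> where "\<beta> = f i - f j"
      define I where "I = integral {1/4..5} (\<lambda>y. complex_of_real (W y) * ee (\<beta> * y))"
      have bnd: "cmod I \<le> 5 * (4 * Bw * (4 * B * B))" "cmod I * \<beta>\<^sup>2 \<le> 5 * (4 * Bw * (4 * B * B))"
        unfolding I_def by (rule amp_fourier[OF W]; use w0 in \<open>auto simp: W_def\<close>)+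
      have "J i j = (of_real (c k) * of_real (c l)) * I"
        unfolding J_def I_def integral_mult_right[symmetric]
        by (intro integral_cong) (simp add: W_def a_def ik jl \<beta>_def mult_ac)
      then have J: "cmod (J i j) = c k * c l * cmod I" using nm by (simp add: norm_mult norm_divide c_def)
      define d where "d = int k * int m - int l * int n"
      have "cmod I \<le> 500 * (16 * Bw * B\<^sup>2) * kern d"
      proof (cases "d = 0")
        case True
        moreover have "0 \<le> Bw * (B * B)" using Bw0 by simp
        ultimately show ?thesis using bnd(1) by (simp add: kern_def power2_eq_square)
      next
        case False
        \<comment> \<open>Since nm <= N0^2 <= 10 X, a nonzero integer d forces |beta| >=
          |d|/10.\<close>
        have \<beta>: "\<beta> = X * real_of_int d / (real n * real m)"
          using nm by (simp add: \<beta>_def f_def ik jl d_def field_simps)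
        have "real n * real m \<le> sqrt (5 * X / z0) * sqrt (5 * X / z0)"
          using nm N0 by (intro mult_mono) linarith+
        also have "\<dots> = 5 * X / z0" using X z0 by simp
        also have "\<dots> \<le> 5 * X / (1/2)" using X z0 by (intro divide_left_mono) auto
        finally have nmX: "real n * real m \<le> 10 * X" by simp
        have "\<bar>real_of_int d\<bar> / 10 \<le> \<bar>\<beta>\<bar>"
        proof -
          have "\<bar>\<beta>\<bar> = X * \<bar>real_of_int d\<bar> / (real n * real m)" using X nm by (simp add: \<beta> abs_mult)
          moreover have "X * \<bar>real_of_int d\<bar> / (10 * X) \<le> X * \<bar>real_of_int d\<bar> / (real n * real m)"
            using nmX X nm by (intro divide_left_mono) auto
          ultimately show ?thesis using X by simp
        qed
        then have "(\<bar>real_of_int d\<bar> / 10)\<^sup>2 \<le> \<bar>\<beta>\<bar>\<^sup>2" by (intro power_mono) auto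
        then have "cmod I * ((real_of_int d)\<^sup>2 / 100) \<le> cmod I * \<beta>\<^sup>2"
          by (intro mult_left_mono) (auto simp: power_divide)
        also have "\<dots> \<le> 5 * (4 * Bw * (4 * B * B))" by (rule bnd)
        finally have "cmod I * (real_of_int d)\<^sup>2 \<le> 500 * (16 * Bw * B\<^sup>2)"
          by (simp add: power2_eq_square)
        then have "cmod I \<le> 500 * (16 * Bw * B\<^sup>2) / (real_of_int d)\<^sup>2"
          using False by (simp add: pos_le_divide_eq)
        then show ?thesis using False by (simp add: kern_def)
      qed
      note h2 = this
      have h1: "c k * c l \<le> 1 / real k * (1 / real l)"
      proof -
        have cb: "c r \<le> 1 / real r" if "r \<ge> 1" for r
          unfolding c_def using that mult_right_mono[of 1 pi "real r"] pi_ge_two by (intro frac_le) auto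
        show ?thesis by (rule mult_mono[OF cb[OF nm(5)] cb[OF nm(6)]]) (auto simp: c_def)
      qed
      have "c k * c l * cmod I \<le> 1 / real k * (1 / real l) * (500 * (16 * Bw * B\<^sup>2) * kern d)"
        by (rule mult_mono[OF h1 h2]) auto
      then show "cmod (J i j) \<le> 500 * (16 * Bw * B\<^sup>2) * (1 / real (snd i) * (1 / real (snd j)) * kern (int (snd i) * int (fst j) - int (snd j) * int (fst i)))"
        unfolding J by (simp add: ik jl d_def mult_ac)
    qed
    also have "\<dots> = 500 * (16 * Bw * B\<^sup>2) * (\<Sum>i\<in>A\<times>S. \<Sum>j\<in>A\<times>S. 1 / real (snd i) * (1 / real (snd j)) * kern (int (snd i) * int (fst j) - int (snd j) * int (fst i)))"
      by (simp add: sum_distrib_left)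
    also have "(\<Sum>i\<in>A\<times>S. \<Sum>j\<in>A\<times>S. 1 / real (snd i) * (1 / real (snd j)) * kern (int (snd i) * int (fst j) - int (snd j) * int (fst i)))
      = (\<Sum>n\<in>A. \<Sum>k\<in>S. \<Sum>m\<in>A. \<Sum>l\<in>S. 1 / real k * (1 / real l) * kern (int k * int m - int l * int n))"
    proof -
      have cart: "(\<Sum>i\<in>A\<times>S. G (fst i) (snd i)) = (\<Sum>n\<in>A. \<Sum>k\<in>S. G n k)" for G :: "nat \<Rightarrow> nat \<Rightarrow> real"
        by (simp add: sum.cartesian_product split_beta)
      have "(\<Sum>i\<in>A\<times>S. \<Sum>j\<in>A\<times>S. H (fst i) (snd i) (fst j) (snd j)) = (\<Sum>n\<in>A. \<Sum>k\<in>S. \<Sum>m\<in>A. \<Sum>l\<in>S. H n k m l)"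
        for H :: "nat \<Rightarrow> nat \<Rightarrow> nat \<Rightarrow> nat \<Rightarrow> real"
        unfolding cart[of "\<lambda>n k. \<Sum>j\<in>A\<times>S. H n k (fst j) (snd j)"] by (intro sum.cong refl cart)
      then show ?thesis .
    qed
    also have "\<dots> = (\<Sum>k\<in>S. \<Sum>l\<in>S. \<Sum>n\<in>A. \<Sum>m\<in>A. 1 / real k * (1 / real l) * kern (int k * int m - int l * int n))"
    proof -
      have "(\<Sum>n\<in>A. \<Sum>k\<in>S. \<Sum>m\<in>A. \<Sum>l\<in>S. F n k m l) = (\<Sum>k\<in>S. \<Sum>l\<in>S. \<Sum>n\<in>A. \<Sum>m\<in>A. F n k m l)" for F :: "nat \<Rightarrow> nat \<Rightarrow> nat \<Rightarrow> nat \<Rightarrow> real"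
      proof -
        have "(\<Sum>n\<in>A. \<Sum>k\<in>S. \<Sum>m\<in>A. \<Sum>l\<in>S. F n k m l) = (\<Sum>k\<in>S. \<Sum>n\<in>A. \<Sum>m\<in>A. \<Sum>l\<in>S. F n k m l)" by (rule sum.swap)
        also have "\<dots> = (\<Sum>k\<in>S. \<Sum>n\<in>A. \<Sum>l\<in>S. \<Sum>m\<in>A. F n k m l)" by (intro sum.cong refl sum.swap)
        also have "\<dots> = (\<Sum>k\<in>S. \<Sum>l\<in>S. \<Sum>n\<in>A. \<Sum>m\<in>A. F n k m l)" by (intro sum.cong refl sum.swap)
        finally show ?thesis .
      qed
      then show ?thesis .
    qed
    also have "\<dots> \<le> (\<Sum>k\<in>S. \<Sum>l\<in>S. 1 / real k * (1 / real l) * (5 * (real N0 * real (gcd k l) / sqrt (real k * real l) + 1)))"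
    proof (intro sum_mono)
      fix k l assume kl: "k \<in> S" "l \<in> S"
      then have kl1: "k \<ge> 1" "l \<ge> 1" using S by auto
      have "(\<Sum>n\<in>A. \<Sum>m\<in>A. kern (int k * int m - int l * int n)) \<le> (\<Sum>n=1..N0. \<Sum>m\<in>A. kern (int k * int m - int l * int n))"
        by (rule sum_mono2) (auto simp: A_def kern_nonneg intro!: sum_nonneg)
      also have "\<dots> \<le> (\<Sum>n=1..N0. \<Sum>m=1..N0. kern (int k * int m - int l * int n))"
        by (intro sum_mono sum_mono2) (auto simp: A_def kern_nonneg)
      also have "\<dots> \<le> 5 * (real N0 * real (gcd k l) / sqrt (real k * real l) + 1)"
        by (rule sum_kern_grid_le[OF kl1])
      finally have "1 / real k * (1 / real l) * (\<Sum>n\<in>A. \<Sum>m\<in>A. kern (int k * int m - int l * int n)) \<le> 1 / real k * (1 / real l) * (5 * (real N0 * real (gcd k l) / sqrt (real k * real l) + 1))"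
        by (intro mult_left_mono) auto
      then show "(\<Sum>n\<in>A. \<Sum>m\<in>A. 1 / real k * (1 / real l) * kern (int k * int m - int l * int n)) \<le> 1 / real k * (1 / real l) * (5 * (real N0 * real (gcd k l) / sqrt (real k * real l) + 1))"
        by (simp add: sum_distrib_left)
    qed
    also have "\<dots> = 5 * (real N0 * (\<Sum>k\<in>S. \<Sum>l\<in>S. gcd_weight k l) + (\<Sum>k\<in>S. 1 / real k)\<^sup>2)"
    proof -
      have "1 / real k * (1 / real l) * (5 * (real N0 * real (gcd k l) / sqrt (real k * real l) + 1)) = 5 * (real N0 * gcd_weight k l) + 5 * (1 / real k * (1 / real l))"
        if "k \<in> S" "l \<in> S" for k l
      proof -
        have pos: "real k > 0" "real l > 0" using that S by auto
        have "(real k * real l) powr (-3/2) = (real k * real l) powr (- 1) * (real k * real l) powr (- (1/2))"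
          by (simp only: powr_add[symmetric]) simp
        also have "\<dots> = 1 / (real k * real l) * (1 / sqrt (real k * real l))"
          using pos by (simp add: powr_minus_divide powr_half_sqrt)
        finally show ?thesis using pos by (simp add: gcd_weight_def field_simps)
      qed
      then have "(\<Sum>k\<in>S. \<Sum>l\<in>S. 1 / real k * (1 / real l) * (5 * (real N0 * real (gcd k l) / sqrt (real k * real l) + 1)))
         = (\<Sum>k\<in>S. \<Sum>l\<in>S. 5 * (real N0 * gcd_weight k l) + 5 * (1 / real k * (1 / real l)))"
        by (intro sum.cong refl) auto
      also have "\<dots> = (\<Sum>k\<in>S. \<Sum>l\<in>S. 5 * (real N0 * gcd_weight k l)) + (\<Sum>k\<in>S. \<Sum>l\<in>S. 5 * (1 / real k * (1 / real l)))"
        by (simp only: sum.distrib)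
      also have "\<dots> = 5 * (real N0 * (\<Sum>k\<in>S. \<Sum>l\<in>S. gcd_weight k l)) + 5 * ((\<Sum>k\<in>S. 1 / real k) * (\<Sum>l\<in>S. 1 / real l))"
        by (simp only: sum_distrib_left[symmetric] sum_product)
      finally show ?thesis by (simp add: power2_eq_square)
    qed
    also have "500 * (16 * Bw * B\<^sup>2) * (5 * (real N0 * (\<Sum>k\<in>S. \<Sum>l\<in>S. gcd_weight k l) + (\<Sum>k\<in>S. 1 / real k)\<^sup>2))
       \<le> 500 * (16 * Bw * B\<^sup>2) * (5 * (3 * (sqrt (X / z0) * (\<Sum>k\<in>S. \<Sum>l\<in>S. gcd_weight k l)) + 3 * (\<Sum>k\<in>S. 1 / real k)\<^sup>2))"
    proof -
      have "real N0 \<le> sqrt 5 * sqrt (X / z0)" using N0 by (simp add: real_sqrt_mult[symmetric])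
      also have "\<dots> \<le> 3 * sqrt (X / z0)" using X z0 by (intro mult_right_mono) (auto simp: real_le_lsqrt)
      finally have "real N0 \<le> 3 * sqrt (X / z0)" .
      moreover have "0 \<le> (\<Sum>k\<in>S. \<Sum>l\<in>S. gcd_weight k l)" by (intro sum_nonneg) (simp add: gcd_weight_def)
      ultimately have "real N0 * (\<Sum>k\<in>S. \<Sum>l\<in>S. gcd_weight k l) \<le> 3 * (sqrt (X / z0) * (\<Sum>k\<in>S. \<Sum>l\<in>S. gcd_weight k l))"
        unfolding mult.assoc[symmetric] by (rule mult_right_mono)
      moreover have "(\<Sum>k\<in>S. 1 / real k)\<^sup>2 \<le> 3 * (\<Sum>k\<in>S. 1 / real k)\<^sup>2" by simp
      ultimately show ?thesis using Bw0 by (intro mult_left_mono add_mono) auto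
    qed
    also have "\<dots> = (C - 1) * B\<^sup>2 * (sqrt (X / z0) * (\<Sum>k\<in>S. \<Sum>l\<in>S. gcd_weight k l) + (\<Sum>k\<in>S. 1 / real k)\<^sup>2)"
      by (simp add: C_def algebra_simps)
    also have "\<dots> \<le> C * B\<^sup>2 * (sqrt (X / z0) * (\<Sum>k\<in>S. \<Sum>l\<in>S. gcd_weight k l) + (\<Sum>k\<in>S. 1 / real k)\<^sup>2)"
      using X z0 by (intro mult_right_mono add_nonneg_nonneg mult_nonneg_nonneg sum_nonneg) (auto simp: gcd_weight_def)
    \<comment> \<open>One inequality of the chain was applied below a constant factor, so the chain
      ends with the monotonicity of multiplication by that factor as a premise. It is discharged in
      the next step, where Bw >= 0 is used.\<close>
    finally have fin: "(\<And>x y. x \<le> y \<Longrightarrow> 500 * (16 * Bw * B\<^sup>2) * x \<le> 500 * (16 * Bw * B\<^sup>2) * y) \<Longrightarrow>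
       integral {1..2} (\<lambda>y. (\<Sum>n=1..N. \<Theta> (X * y / (real n)\<^sup>2) * (\<Sum>k\<in>S. sin (2 * pi * (real k * (X * y / real n))) / (pi * real k)))\<^sup>2)
       \<le> C * B\<^sup>2 * (sqrt (X / z0) * (\<Sum>k\<in>S. \<Sum>l\<in>S. gcd_weight k l) + (\<Sum>k\<in>S. 1 / real k)\<^sup>2)" .
    show "integral {1..2} (\<lambda>y. (\<Sum>n=1..N. \<Theta> (X * y / (real n)\<^sup>2) * (\<Sum>k\<in>S. sin (2 * pi * (real k * (X * y / real n))) / (pi * real k)))\<^sup>2)
       \<le> C * B\<^sup>2 * (sqrt (X / z0) * (\<Sum>k\<in>S. \<Sum>l\<in>S. gcd_weight k l) + (\<Sum>k\<in>S. 1 / real k)\<^sup>2)"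
      by (rule fin) (use Bw0 in \<open>auto intro!: mult_left_mono\<close>)
  qed
qed

section \<open>Stationary phase\<close>

text \<open>A single integration by parts: e(t theta) theta' has the primitive e(t theta)/(2 pi i
  t), and the hypothesis on Q bounds the derivative of the remaining factor Omega/theta'.\<close>

lemma nonstationary_bound:
  fixes \<Omega> \<Omega>' :: "real \<Rightarrow> complex" and \<theta> \<theta>' \<theta>'' :: "real \<Rightarrow> real"
  assumes ab: "a \<le> b" and t: "t > 0"
    and \<theta>: "\<And>v. v \<in> {a..b} \<Longrightarrow> (\<theta> has_real_derivative \<theta>' v) (at v within {a..b})"
    and \<theta>': "\<And>v. v \<in> {a..b} \<Longrightarrow> (\<theta>' has_real_derivative \<theta>'' v) (at v within {a..b})"
    and nz: "\<And>v. v \<in> {a..b} \<Longrightarrow> \<theta>' v \<noteq> 0"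
    and c\<theta>: "continuous_on {a..b} \<theta>''"
    and \<Omega>: "\<And>v. v \<in> {a..b} \<Longrightarrow> (\<Omega> has_vector_derivative \<Omega>' v) (at v within {a..b})"
    and c\<Omega>: "continuous_on {a..b} \<Omega>'"
    and zero: "\<Omega> a = 0" "\<Omega> b = 0"
    and Q: "\<And>v. v \<in> {a..b} \<Longrightarrow> cmod (\<Omega>' v) / \<bar>\<theta>' v\<bar> + cmod (\<Omega> v) * \<bar>\<theta>'' v\<bar> / (\<theta>' v)\<^sup>2 \<le> Q"
  shows "cmod (integral {a..b} (\<lambda>v. \<Omega> v * ee (t * \<theta> v))) \<le> Q * (b - a) / (2 * pi * t)"
proof -
  define q where "q = (\<lambda>v. \<Omega> v * of_real (1 / \<theta>' v))"
  define q' where "q' = (\<lambda>v. \<Omega> v * of_real (- \<theta>'' v / (\<theta>' v)\<^sup>2) + \<Omega>' v * of_real (1 / \<theta>' v))"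
  define c where "c = complex_of_real (2 * pi * t) * \<i>"
  have c: "c \<noteq> 0" using t by (simp add: c_def)
  define P where "P = (\<lambda>v. ee (t * \<theta> v) / c)"
  have c\<theta>0: "continuous_on {a..b} \<theta>" by (rule DERIV_continuous_on[where D = \<theta>'], rule \<theta>)
  have c\<theta>1: "continuous_on {a..b} \<theta>'" by (rule DERIV_continuous_on[where D = \<theta>''], rule \<theta>')
  have c\<Omega>0: "continuous_on {a..b} \<Omega>" using \<Omega> by (meson continuous_on_vector_derivative)
  have dq: "(q has_vector_derivative q' v) (at v within {a..b})" if v: "v \<in> {a..b}" for v
    unfolding q_def q'_def
  proof (rule has_vector_derivative_mult[OF \<Omega>[OF v] of_real_has_vector_derivative])
    show "((\<lambda>v. 1 / \<theta>' v) has_real_derivative - \<theta>'' v / (\<theta>' v)\<^sup>2) (at v within {a..b})"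
      using DERIV_divide[OF DERIV_const[of 1] \<theta>'[OF v] nz[OF v]] by (simp add: power2_eq_square)
  qed
  have dP: "(P has_vector_derivative (of_real (\<theta>' v) * ee (t * \<theta> v))) (at v within {a..b})" if v: "v \<in> {a..b}" for v
  proof -
    have "(P has_vector_derivative (of_real (2 * pi * (t * \<theta>' v)) * \<i> * ee (t * \<theta> v)) / c) (at v within {a..b})"
      unfolding P_def by (intro has_vector_derivative_divide ee_has_vector_derivative DERIV_cmult \<theta>[OF v])
    moreover have "(of_real (2 * pi * (t * \<theta>' v)) * \<i> * ee (t * \<theta> v)) / c = of_real (\<theta>' v) * ee (t * \<theta> v)"
    proof -
      have "of_real (2 * pi * (t * \<theta>' v)) * \<i> * ee (t * \<theta> v) = c * (of_real (\<theta>' v) * ee (t * \<theta> v))"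
        by (simp add: c_def mult_ac)
      then show ?thesis by (simp only: nonzero_mult_div_cancel_left[OF c])
    qed
    ultimately show ?thesis by (simp only:)
  qed
  have cq': "continuous_on {a..b} q'"
    unfolding q'_def by (intro continuous_intros c\<Omega>0 c\<Omega> c\<theta> c\<theta>1) (use nz in auto)
  have "integral {a..b} (\<lambda>v. \<Omega> v * ee (t * \<theta> v)) = integral {a..b} (\<lambda>v. q v * (of_real (\<theta>' v) * ee (t * \<theta> v)))"
    by (intro integral_cong) (use nz in \<open>simp add: q_def\<close>)
  also have "\<dots> = q b * P b - q a * P a - integral {a..b} (\<lambda>v. q' v * P v)"
  proof (rule integral_parts[where q = q and q' = q' and P = P and P' = "\<lambda>v. of_real (\<theta>' v) * ee (t * \<theta> v)", OF ab dq dP cq'])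
    show "continuous_on {a..b} (\<lambda>v. of_real (\<theta>' v) * ee (t * \<theta> v))" by (intro continuous_intros c\<theta>0 c\<theta>1)
  qed
  also have "\<dots> = - integral {a..b} (\<lambda>v. q' v * P v)" using zero by (simp add: q_def)
  finally have "cmod (integral {a..b} (\<lambda>v. \<Omega> v * ee (t * \<theta> v))) = cmod (integral {a..b} (\<lambda>v. q' v * P v))" by simp
  also have "\<dots> \<le> (Q / (2 * pi * t)) * (b - a)"
  proof (rule integral_norm_le[OF _ ab])
    show "continuous_on {a..b} (\<lambda>v. q' v * P v)" unfolding P_def using c by (intro continuous_intros cq' c\<theta>0) auto
    fix v assume v: "v \<in> {a..b}"
    have "cmod (q' v) \<le> cmod (\<Omega> v * of_real (- \<theta>'' v / (\<theta>' v)\<^sup>2)) + cmod (\<Omega>' v * of_real (1 / \<theta>' v))"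
      unfolding q'_def by (rule norm_triangle_ineq)
    also have "\<dots> = cmod (\<Omega>' v) / \<bar>\<theta>' v\<bar> + cmod (\<Omega> v) * \<bar>\<theta>'' v\<bar> / (\<theta>' v)\<^sup>2"
      unfolding norm_mult norm_of_real by (simp add: abs_divide)
    finally have "cmod (q' v) \<le> Q" using Q[OF v] by linarith
    moreover have "cmod (P v) = 1 / (2 * pi * t)" using t by (simp add: P_def c_def norm_divide norm_mult)
    ultimately show "cmod (q' v * P v) \<le> Q / (2 * pi * t)" using t by (simp add: norm_mult divide_right_mono)
  qed
  finally show ?thesis by simp
qed

lemma integral_support:
  fixes h :: "real \<Rightarrow> complex"
  assumes "p \<le> c" "c \<le> d" "d \<le> q" "continuous_on {p..q} h"
    and z: "\<And>x. p \<le> x \<Longrightarrow> x \<le> c \<Longrightarrow> h x = 0" "\<And>x. d \<le> x \<Longrightarrow> x \<le> q \<Longrightarrow> h x = 0"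
  shows "integral {p..q} h = integral {c..d} h"
proof -
  have i: "h integrable_on {p..q}" using assms(4) by (rule integrable_continuous_real)
  have i2: "h integrable_on {c..q}" by (rule integrable_on_subinterval[OF i]) (use assms in auto)
  have "integral {p..q} h = integral {p..c} h + integral {c..q} h"
    by (rule Henstock_Kurzweil_Integration.integral_combine[symmetric]) (use assms i in auto)
  also have "integral {c..q} h = integral {c..d} h + integral {d..q} h"
    by (rule Henstock_Kurzweil_Integration.integral_combine[symmetric]) (use assms i2 in auto)
  also have "integral {p..c} h = integral {p..c} (\<lambda>_. 0)" by (intro integral_cong) (use z in auto)
  also have "integral {d..q} h = integral {d..q} (\<lambda>_. 0)" by (intro integral_cong) (use z in auto)
  finally show ?thesis by simp
qed

lemma integral_dilate:
  fixes h :: "real \<Rightarrow> complex"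
  assumes "continuous_on {t * A..t * B} h" "t > 0" "A \<le> B"
  shows "integral {t * A..t * B} h = of_real t * integral {A..B} (\<lambda>v. h (t * v))"
proof -
  have "((\<lambda>v. t *\<^sub>R h (t * v)) has_integral (integral {t * A..t * B} h)) {A..B}"
    by (rule has_integral_substitution[where c = "t * A" and d = "t * B"])
       (use assms in \<open>auto intro!: derivative_eq_intros simp: has_real_derivative_iff_has_vector_derivative[symmetric]\<close>)
  then have "integral {A..B} (\<lambda>v. t *\<^sub>R h (t * v)) = integral {t * A..t * B} h" by (rule integral_unique)
  then show ?thesis by (simp add: scaleR_conv_of_real)
qed

text \<open>The phase is an exact square plus a constant: k/v + lv = y^2 + 2 sqrt(kl) with y =
  sqrt(lv) - sqrt(k/v). Integrating by parts against FE(sqrt t * y) moves all dependence on t into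
  FE, which stays bounded and tends to sgn(y) Fres. Dominated convergence then gives the limit
  without any Taylor expansion at the stationary point.\<close>

lemma stationary_phase:
  fixes \<Phi> \<Phi>' :: "real \<Rightarrow> real"
  assumes k: "k > 0" and l: "l > 0" and a: "0 < a" and v0: "a < sqrt (k / l)" "sqrt (k / l) < b"
    and \<Phi>: "\<And>v. v \<in> {a..b} \<Longrightarrow> (\<Phi> has_real_derivative \<Phi>' v) (at v within {a..b})"
    and c\<Phi>: "continuous_on {a..b} \<Phi>'" and zero: "\<Phi> a = 0" "\<Phi> b = 0"
  shows "((\<lambda>t. of_real (sqrt t) * integral {a..b} (\<lambda>v. of_real (\<Phi> v) * ee (t * (k / v + l * v)))
            - of_real (\<Phi> (sqrt (k / l)) * (k powr (1/4) * l powr (-3/4))) * (2 * Fres) * ee (2 * sqrt (k * l) * t)) \<longlongrightarrow> 0) at_top"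
proof -
  define w where "w = sqrt (k / l)"
  have ab: "a \<le> b" using v0 by linarith
  have w: "a < w" "w < b" "w > 0" using v0 a k l by (auto simp: w_def)
  define y where "y = (\<lambda>v. sqrt l * sqrt v - sqrt k / sqrt v)"
  \<comment> \<open>h is 1/y', the Jacobian of the change of variable from v to y.\<close>
  define h where "h = (\<lambda>v. 2 * (v * sqrt v) / (sqrt l * v + sqrt k))"
  define h' where "h' = (\<lambda>v. (3 * sqrt v * (sqrt l * v + sqrt k) - 2 * (v * sqrt v) * sqrt l) / (sqrt l * v + sqrt k)\<^sup>2)"
  have den: "sqrt l * v + sqrt k > 0" if "v > 0" for v using that k l by (simp add: add_pos_pos)
  have dy: "(y has_real_derivative 1 / h v) (at v within {a..b})" if "v > 0" for v
  proof -
    have s: "sqrt v > 0" using that by simp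
    have ds: "(sqrt has_real_derivative inverse (sqrt v) / 2) (at v within {a..b})"
      by (rule has_field_derivative_at_within[OF DERIV_real_sqrt[OF that]])
    have "(y has_real_derivative (sqrt l * (inverse (sqrt v) / 2) - (0 * sqrt v - sqrt k * (inverse (sqrt v) / 2)) / (sqrt v * sqrt v))) (at v within {a..b})"
      unfolding y_def using s by (intro DERIV_diff DERIV_cmult DERIV_divide DERIV_const ds) simp
    moreover have "sqrt l * (inverse (sqrt v) / 2) - (0 * sqrt v - sqrt k * (inverse (sqrt v) / 2)) / (sqrt v * sqrt v) = 1 / h v"
    proof -
      have v: "v = sqrt v * sqrt v" using that by simp
      define r where "r = sqrt v"
      have r: "r > 0" "v = r * r" using s v by (simp_all add: r_def)
      show ?thesis unfolding h_def r_def[symmetric] using r by (simp add: field_simps)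
    qed
    ultimately show ?thesis by simp
  qed
  have dh: "(h has_real_derivative h' v) (at v within {a..b})" if "v > 0" for v
  proof -
    have "((\<lambda>v. v * sqrt v) has_real_derivative (3/2) * sqrt v) (at v within {a..b})"
    proof -
      have "((\<lambda>v. v * sqrt v) has_real_derivative (1 * sqrt v + v * (inverse (sqrt v) / 2))) (at v within {a..b})"
        using that by (auto intro!: derivative_eq_intros)
      moreover have "v * (inverse (sqrt v) / 2) = sqrt v / 2" using that by (simp add: field_simps)
      ultimately show ?thesis by simp
    qed
    then have "((\<lambda>v. 2 * (v * sqrt v)) has_real_derivative 3 * sqrt v) (at v within {a..b})"
      using DERIV_cmult[of "\<lambda>v. v * sqrt v" "(3/2) * sqrt v" v "{a..b}" 2] by simp
    moreover have "((\<lambda>v. sqrt l * v + sqrt k) has_real_derivative sqrt l) (at v within {a..b})"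
      by (auto intro!: derivative_eq_intros)
    moreover have "sqrt l * v + sqrt k \<noteq> 0" using den[OF that] by simp
    ultimately show ?thesis unfolding h_def h'_def power2_eq_square by (rule DERIV_divide)
  qed
  have vpos: "v > 0" if "v \<in> {a..b}" for v using that a by auto
  have c\<Phi>0: "continuous_on {a..b} \<Phi>" by (rule DERIV_continuous_on[where D = \<Phi>'], rule \<Phi>)
  have ch: "continuous_on {a..b} h" by (rule DERIV_continuous_on[where D = h'], rule dh, rule vpos)
  have cy: "continuous_on {a..b} y" by (rule DERIV_continuous_on[where D = "\<lambda>v. 1 / h v"], rule dy, rule vpos)
  have ch': "continuous_on {a..b} h'" unfolding h'_def
    by (intro continuous_intros) (use den vpos in force)
  have hpos: "h v > 0" if "v > 0" for v unfolding h_def using that den[OF that] by simp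
  define q where "q = (\<lambda>v. complex_of_real (\<Phi> v * h v))"
  define q' where "q' = (\<lambda>v. complex_of_real (\<Phi>' v * h v + \<Phi> v * h' v))"
  have dq: "(q has_vector_derivative q' v) (at v within {a..b})" if v: "v \<in> {a..b}" for v
    unfolding q_def q'_def
    using DERIV_mult[OF \<Phi>[OF v] dh[OF vpos[OF v]]] by (intro of_real_has_vector_derivative) (simp add: mult.commute)
  have cq': "continuous_on {a..b} q'" unfolding q'_def by (intro continuous_intros c\<Phi> c\<Phi>0 ch ch')
  have ysq: "k / v + l * v = (y v)\<^sup>2 + 2 * sqrt (k * l)" if "v > 0" for v
  proof -
    have "(y v)\<^sup>2 = l * v + k / v - 2 * (sqrt l * sqrt v) * (sqrt k / sqrt v)"
      unfolding y_def power2_diff using that k l by (simp add: power_mult_distrib power_divide)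
    also have "2 * (sqrt l * sqrt v) * (sqrt k / sqrt v) = 2 * sqrt (k * l)" using that by (simp add: real_sqrt_mult)
    finally show ?thesis by simp
  qed
  have main: "of_real (sqrt t) * integral {a..b} (\<lambda>v. of_real (\<Phi> v) * ee (t * (k / v + l * v)))
     = - ee (2 * sqrt (k * l) * t) * integral {a..b} (\<lambda>v. q' v * FE (sqrt t * y v))" if t: "t > 0" for t
  proof -
    have st: "sqrt t > 0" using t by simp
    define P where "P = (\<lambda>v. FE (sqrt t * y v))"
    define P' where "P' = (\<lambda>v. complex_of_real (sqrt t * (1 / h v)) * ee ((sqrt t * y v)\<^sup>2))"
    have dP: "(P has_vector_derivative P' v) (at v within {a..b})" if "v \<in> {a..b}" for v
      unfolding P_def P'_def by (intro FE_chain DERIV_cmult dy vpos that)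
    have cP': "continuous_on {a..b} P'" unfolding P'_def
      by (intro continuous_intros ch cy) (use hpos vpos in force)
    have "integral {a..b} (\<lambda>v. q v * P' v) = q b * P b - q a * P a - integral {a..b} (\<lambda>v. q' v * P v)"
      by (rule integral_parts[OF ab dq dP cq' cP'])
    also have "\<dots> = - integral {a..b} (\<lambda>v. q' v * P v)" using zero by (simp add: q_def)
    finally have parts: "integral {a..b} (\<lambda>v. q v * P' v) = - integral {a..b} (\<lambda>v. q' v * P v)" .
    have "of_real (sqrt t) * integral {a..b} (\<lambda>v. of_real (\<Phi> v) * ee (t * (k / v + l * v)))
       = integral {a..b} (\<lambda>v. of_real (sqrt t) * (of_real (\<Phi> v) * ee (t * (k / v + l * v))))" by simp
    also have "\<dots> = integral {a..b} (\<lambda>v. ee (2 * sqrt (k * l) * t) * (q v * P' v))"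
    proof (rule integral_cong)
      fix v assume v: "v \<in> {a..b}"
      have hv: "h v > 0" using hpos vpos[OF v] by blast
      have "t * (k / v + l * v) = t * ((y v)\<^sup>2 + 2 * sqrt (k * l))" by (simp only: ysq[OF vpos[OF v]])
      also have "\<dots> = 2 * sqrt (k * l) * t + (sqrt t * y v)\<^sup>2"
        using t by (simp add: power_mult_distrib distrib_left)
      finally have "t * (k / v + l * v) = 2 * sqrt (k * l) * t + (sqrt t * y v)\<^sup>2" .
      then have "ee (t * (k / v + l * v)) = ee (2 * sqrt (k * l) * t) * ee ((sqrt t * y v)\<^sup>2)"
        by (simp only: ee_add)
      moreover have "q v * complex_of_real (sqrt t * (1 / h v)) = of_real (sqrt t) * of_real (\<Phi> v)"
        unfolding q_def of_real_mult[symmetric] of_real_eq_iff using hv by simp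
      ultimately show "of_real (sqrt t) * (of_real (\<Phi> v) * ee (t * (k / v + l * v))) = ee (2 * sqrt (k * l) * t) * (q v * P' v)"
        unfolding P'_def by (metis (no_types, lifting) mult.assoc mult.left_commute)
    qed
    also have "\<dots> = ee (2 * sqrt (k * l) * t) * integral {a..b} (\<lambda>v. q v * P' v)" by (rule integral_mult_right)
    finally show ?thesis unfolding parts P_def by simp
  qed
  obtain Bf where Bf: "\<And>x. cmod (FE x) \<le> Bf" using FE_bounded by blast
  have lim: "((\<lambda>t. integral {a..b} (\<lambda>v. q' v * FE (sqrt t * y v))) \<longlongrightarrow> integral {a..b} (\<lambda>v. q' v * (of_real (sgn (y v)) * Fres))) at_top"
  proof (rule tendsto_at_topI_sequentially)
    fix T :: "nat \<Rightarrow> real" assume T: "filterlim T at_top sequentially"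
    then have sT: "filterlim (\<lambda>n. sqrt (T n)) at_top sequentially"
      using filterlim_compose[OF sqrt_at_top] by blast
    show "(\<lambda>n. integral {a..b} (\<lambda>v. q' v * FE (sqrt (T n) * y v))) \<longlonglongrightarrow> integral {a..b} (\<lambda>v. q' v * (of_real (sgn (y v)) * Fres))"
    proof (rule dominated_convergence(2)[where h = "\<lambda>v. cmod (q' v) * Bf"])
      show "(\<lambda>v. q' v * FE (sqrt (T n) * y v)) integrable_on {a..b}" for n
        by (intro integrable_continuous_real continuous_intros cq' cy)
      show "(\<lambda>v. cmod (q' v) * Bf) integrable_on {a..b}"
        by (intro integrable_continuous_real continuous_intros cq')
      show "norm (q' v * FE (sqrt (T n) * y v)) \<le> cmod (q' v) * Bf" for n v
        unfolding norm_mult by (intro mult_left_mono Bf) simp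
      fix v assume "v \<in> {a..b}"
      have "(\<lambda>n. FE (sqrt (T n) * y v)) \<longlonglongrightarrow> of_real (sgn (y v)) * Fres"
      proof -
        have pos: "(\<lambda>n. FE (sqrt (T n) * z)) \<longlonglongrightarrow> Fres" if "z > 0" for z
          by (rule filterlim_compose[OF FE_tendsto]) (intro filterlim_at_top_mult_tendsto_pos[OF tendsto_const that sT])
        consider "y v > 0" | "y v = 0" | "y v < 0" by linarith
        then show ?thesis
        proof cases
          case 3
          then have "(\<lambda>n. - FE (sqrt (T n) * (- y v))) \<longlonglongrightarrow> - Fres" by (intro tendsto_minus pos) simp
          then show ?thesis using 3 by (simp add: FE_minus)
        qed (use pos[of "y v"] in auto)
      qed
      then show "(\<lambda>n. q' v * FE (sqrt (T n) * y v)) \<longlonglongrightarrow> q' v * (of_real (sgn (y v)) * Fres)"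
        by (intro tendsto_intros)
    qed
  qed
  have ysgn: "sgn (y v) = (if v < w then -1 else if v = w then 0 else 1)" if "v > 0" for v
  proof -
    have yv: "y v * sqrt v = sqrt l * v - sqrt k" using that by (simp add: y_def field_simps)
    have k2: "sqrt k = sqrt l * w" using k l by (simp add: w_def real_sqrt_divide)
    have "y v * sqrt v = sqrt l * (v - w)" unfolding yv k2 by (simp add: algebra_simps)
    then have "sgn (y v) * sgn (sqrt v) = sgn (sqrt l) * sgn (v - w)" by (metis sgn_mult)
    then show ?thesis using that l by (auto simp: sgn_if split: if_splits)
  qed
  have fund: "(q' has_integral (q d - q c)) {c..d}" if "a \<le> c" "c \<le> d" "d \<le> b" for c d
  proof (rule fundamental_theorem_of_calculus[OF that(2)])
    fix v assume "v \<in> {c..d}"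
    then show "(q has_vector_derivative q' v) (at v within {c..d})"
      using has_vector_derivative_within_subset[OF dq, of v "{c..d}"] that by auto
  qed
  \<comment> \<open>The sign of y changes only at the stationary point w, so on each side the
    integrand is the constant -Fres or Fres times q'. As q vanishes at a and b, the two parts add up
    to -2 Fres q(w).\<close>
  have "((\<lambda>v. q' v * (of_real (sgn (y v)) * Fres)) has_integral (q w - q a) * (- Fres)) {a..w}"
    by (rule has_integral_spike[of "{w}", OF _ _ has_integral_mult_left[OF fund[of a w]]])
       (use w vpos ysgn a in auto)
  moreover have "((\<lambda>v. q' v * (of_real (sgn (y v)) * Fres)) has_integral (q b - q w) * Fres) {w..b}"
    by (rule has_integral_spike[of "{w}", OF _ _ has_integral_mult_left[OF fund[of w b]]])
       (use w vpos ysgn a in auto)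
  ultimately have "((\<lambda>v. q' v * (of_real (sgn (y v)) * Fres)) has_integral ((q w - q a) * (- Fres) + (q b - q w) * Fres)) {a..b}"
    using w by (intro has_integral_combine[of a w b]) auto
  then have "integral {a..b} (\<lambda>v. q' v * (of_real (sgn (y v)) * Fres)) = (q w - q a) * (- Fres) + (q b - q w) * Fres"
    by (rule integral_unique)
  also have "\<dots> = - (q w * (2 * Fres))" using zero by (simp add: q_def)
  \<comment> \<open>At w = sqrt(k/l) the two terms in the denominator of h coincide, so h(w) =
    w^(3/2) k^(-1/2).\<close>
  also have "q w = of_real (\<Phi> w * (k powr (1/4) * l powr (-3/4)))"
  proof -
    have k2: "sqrt l * w = sqrt k" using k l by (simp add: w_def real_sqrt_divide)
    have "h w = w * sqrt w / sqrt k" unfolding h_def k2 using k by simp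
    also have "\<dots> = w powr (3/2) * k powr (- (1/2))"
    proof -
      have "w * sqrt w = w powr (3/2)" using w powr_add[of w 1 "1/2"] by (simp add: powr_half_sqrt)
      moreover have "1 / sqrt k = k powr (- (1/2))" using k by (simp add: powr_minus_divide powr_half_sqrt)
      ultimately show ?thesis by (metis times_divide_eq_right mult.right_neutral)
    qed
    also have "w powr (3/2) = k powr (3/4) * l powr (-3/4)"
    proof -
      have "w = (k / l) powr (1/2)" using k l by (simp add: w_def powr_half_sqrt)
      then show ?thesis using k l by (simp add: powr_powr powr_divide powr_minus_divide)
    qed
    also have "k powr (3/4) * l powr (-3/4) * k powr (- (1/2)) = (k powr (3/4) * k powr (- (1/2))) * l powr (-3/4)" by simp
    also have "k powr (3/4) * k powr (- (1/2)) = k powr (1/4)" by (simp only: powr_add[symmetric]) simp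
    finally show ?thesis by (simp add: q_def)
  qed
  finally have lim0: "((\<lambda>t. integral {a..b} (\<lambda>v. q' v * FE (sqrt t * y v))) \<longlongrightarrow> - (of_real (\<Phi> w * (k powr (1/4) * l powr (-3/4))) * (2 * Fres))) at_top"
    using lim by simp
  define c where "c = of_real (\<Phi> w * (k powr (1/4) * l powr (-3/4))) * (2 * Fres)"
  define R where "R = (\<lambda>t. integral {a..b} (\<lambda>v. q' v * FE (sqrt t * y v)) + c)"
  have "(R \<longlongrightarrow> - c + c) at_top" unfolding R_def by (intro tendsto_add lim0[folded c_def] tendsto_const)
  then have "(R \<longlongrightarrow> 0) at_top" by simp
  then have "((\<lambda>t. - ee (2 * sqrt (k * l) * t) * R t) \<longlongrightarrow> 0) at_top"
    by (rule tendsto_norm_zero_cancel[OF Lim_transform_eventually[OF tendsto_norm_zero]]) (simp add: norm_mult)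
  then show ?thesis
  proof (rule Lim_transform_eventually)
    show "\<forall>\<^sub>F t in at_top. - ee (2 * sqrt (k * l) * t) * R t = of_real (sqrt t) * integral {a..b} (\<lambda>v. of_real (\<Phi> v) * ee (t * (k / v + l * v)))
            - of_real (\<Phi> (sqrt (k / l)) * (k powr (1/4) * l powr (-3/4))) * (2 * Fres) * ee (2 * sqrt (k * l) * t)"
      using eventually_gt_at_top[of 0]
    proof eventually_elim
      case (elim t)
      then show ?case unfolding main[OF elim] w_def[symmetric] c_def[symmetric] by (simp add: R_def algebra_simps)
    qed
  qed
qed

section \<open>Dirichlet's divisor problem by a smoothed hyperbola method\<close>

definition Dsum :: "real \<Rightarrow> real" where
  "Dsum x = (\<Sum>n | 0 < n \<and> real n \<le> x. tau n)"

definition Delta :: "real \<Rightarrow> real" where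
  "Delta x = Dsum x - x * ln x - (2 * euler_mascheroni - 1) * x"

lemma finite_le_real: "finite {n::nat. 0 < n \<and> real n \<le> x}"
  by (rule finite_subset[of _ "{..nat \<lfloor>x\<rfloor>}"]) (auto simp: le_nat_floor)

lemma set_le_real: "{n::nat. 0 < n \<and> real n \<le> x} = {1..nat \<lfloor>x\<rfloor>}"
proof (intro set_eqI iffI)
  fix n assume "n \<in> {1..nat \<lfloor>x\<rfloor>}"
  then have "1 \<le> n" "n \<le> nat \<lfloor>x\<rfloor>" by auto
  then have "int n \<le> \<lfloor>x\<rfloor>" by linarith
  then show "n \<in> {n. 0 < n \<and> real n \<le> x}" using \<open>1 \<le> n\<close> by (auto simp: le_floor_iff)
qed (auto simp: le_nat_floor)

section \<open>Lattice points under the hyperbola\<close>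

definition hyp_points :: "real \<Rightarrow> (nat \<times> nat) set" where
  "hyp_points x = {(a,b). 0 < a \<and> 0 < b \<and> real a * real b \<le> x}"

lemma finite_hyp_points: "finite (hyp_points x)"
proof (rule finite_subset)
  show "hyp_points x \<subseteq> {1..nat \<lfloor>x\<rfloor>} \<times> {1..nat \<lfloor>x\<rfloor>}"
  proof
    fix p assume "p \<in> hyp_points x"
    then obtain a b where p: "p = (a, b)" "0 < a" "0 < b" "real a * real b \<le> x" by (auto simp: hyp_points_def)
    have "real a * 1 \<le> real a * real b" "1 * real b \<le> real a * real b" using p by (intro mult_mono; simp)+
    then have "real a \<le> x" "real b \<le> x" using p(4) by linarith+
    then have "a \<in> {1..nat \<lfloor>x\<rfloor>}" "b \<in> {1..nat \<lfloor>x\<rfloor>}" unfolding set_le_real[symmetric] using p by simp_all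
    then show "p \<in> {1..nat \<lfloor>x\<rfloor>} \<times> {1..nat \<lfloor>x\<rfloor>}" using p by simp
  qed
qed simp

lemma Dsum_eq_card: "Dsum x = real (card (hyp_points x))"
proof -
  define A where "A = {n::nat. 0 < n \<and> real n \<le> x}"
  have fin: "finite A" unfolding A_def by (rule finite_le_real)
  have "Dsum x = real (\<Sum>n\<in>A. card {d. d dvd n})" by (simp add: Dsum_def A_def num_divisors_def)
  also have "(\<Sum>n\<in>A. card {d. d dvd n}) = card (SIGMA n:A. {d. d dvd n})"
    by (rule card_SigmaI[symmetric]) (use fin in \<open>auto simp: A_def\<close>)
  also have "\<dots> = card (hyp_points x)"
  proof (rule bij_betw_same_card[of "\<lambda>(n,d). (d, n div d)"], rule bij_betw_byWitness[where f' = "\<lambda>(a,b). (a*b, a)"])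
    show "(\<lambda>(n,d). (d, n div d)) ` (SIGMA n:A. {d. d dvd n}) \<subseteq> hyp_points x"
      by (auto simp: A_def hyp_points_def elim!: dvdE)
    show "(\<lambda>(a,b). (a*b, a)) ` hyp_points x \<subseteq> (SIGMA n:A. {d. d dvd n})"
      by (auto simp: A_def hyp_points_def)
  qed (auto simp: hyp_points_def A_def)
  finally show ?thesis .
qed

lemma card_left_part:
  assumes "U > 0"
  shows "card {(a,b)\<in>hyp_points x. real a \<le> U} = (\<Sum>a=1..nat \<lfloor>U\<rfloor>. nat \<lfloor>x / real a\<rfloor>)"
proof -
  have "{(a,b)\<in>hyp_points x. real a \<le> U} = (SIGMA a:{1..nat \<lfloor>U\<rfloor>}. {1..nat \<lfloor>x / real a\<rfloor>})"
  proof (intro set_eqI iffI)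
    fix p assume "p \<in> {(a,b)\<in>hyp_points x. real a \<le> U}"
    then obtain a b where p: "p = (a, b)" "0 < a" "0 < b" "real a * real b \<le> x" "real a \<le> U" by (auto simp: hyp_points_def)
    then have "real b \<le> x / real a" by (simp add: field_simps)
    then have "a \<in> {1..nat \<lfloor>U\<rfloor>}" "b \<in> {1..nat \<lfloor>x / real a\<rfloor>}" unfolding set_le_real[symmetric] using p by simp_all
    then show "p \<in> (SIGMA a:{1..nat \<lfloor>U\<rfloor>}. {1..nat \<lfloor>x / real a\<rfloor>})" using p by simp
  next
    fix p assume "p \<in> (SIGMA a:{1..nat \<lfloor>U\<rfloor>}. {1..nat \<lfloor>x / real a\<rfloor>})"
    then obtain a b where p: "p = (a, b)" "a \<in> {1..nat \<lfloor>U\<rfloor>}" "b \<in> {1..nat \<lfloor>x / real a\<rfloor>}" by auto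
    then have "0 < a" "real a \<le> U" "0 < b" "real b \<le> x / real a"
      unfolding set_le_real[symmetric] by simp_all
    then show "p \<in> {(a,b)\<in>hyp_points x. real a \<le> U}" using p by (simp add: hyp_points_def field_simps)
  qed
  then show ?thesis by (simp add: card_SigmaI)
qed

text \<open>The cut U, V is arbitrary with UV = x, instead of U = V = sqrt x, because its position
  is averaged later. A point outside both strips would have product above UV.\<close>

lemma hyperbola_count:
  assumes U: "U > 0" and V: "V > 0" and UV: "U * V = x"
  shows "Dsum x = (\<Sum>a=1..nat \<lfloor>U\<rfloor>. real (nat \<lfloor>x / real a\<rfloor>)) + (\<Sum>b=1..nat \<lfloor>V\<rfloor>. real (nat \<lfloor>x / real b\<rfloor>)) - real (nat \<lfloor>U\<rfloor>) * real (nat \<lfloor>V\<rfloor>)"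
proof -
  define H1 where "H1 = {(a,b)\<in>hyp_points x. real a \<le> U}"
  define H2 where "H2 = {(a,b)\<in>hyp_points x. real b \<le> V}"
  have fin: "finite H1" "finite H2" unfolding H1_def H2_def
    by (rule finite_subset[OF _ finite_hyp_points[of x]]; auto)+
  have un: "H1 \<union> H2 = hyp_points x"
  proof -
    have "real a \<le> U \<or> real b \<le> V" if "real a * real b \<le> x" for a b :: nat
    proof (rule ccontr)
      assume "\<not> (real a \<le> U \<or> real b \<le> V)"
      then have "U * V < real a * real b" using U V by (intro mult_strict_mono) auto
      then show False using that UV by simp
    qed
    then show ?thesis by (auto simp: H1_def H2_def hyp_points_def)
  qed
  have int: "H1 \<inter> H2 = {1..nat \<lfloor>U\<rfloor>} \<times> {1..nat \<lfloor>V\<rfloor>}"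
  proof -
    have "real a * real b \<le> x" if "real a \<le> U" "real b \<le> V" for a b :: nat
      unfolding UV[symmetric] using that U V by (intro mult_mono) auto
    then have "H1 \<inter> H2 = {n::nat. 0 < n \<and> real n \<le> U} \<times> {n::nat. 0 < n \<and> real n \<le> V}"
      by (auto simp: H1_def H2_def hyp_points_def)
    then show ?thesis by (simp only: set_le_real)
  qed
  have c1: "card H1 = (\<Sum>a=1..nat \<lfloor>U\<rfloor>. nat \<lfloor>x / real a\<rfloor>)" unfolding H1_def by (rule card_left_part[OF U])
  have "H2 = prod.swap ` {(a,b)\<in>hyp_points x. real a \<le> V}"
    by (auto simp: H2_def hyp_points_def image_iff mult.commute)
  then have "card H2 = card {(a,b)\<in>hyp_points x. real a \<le> V}" by (simp add: card_image)
  then have c2: "card H2 = (\<Sum>b=1..nat \<lfloor>V\<rfloor>. nat \<lfloor>x / real b\<rfloor>)" by (simp only: card_left_part[OF V])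
  have "card H1 + card H2 = card (hyp_points x) + nat \<lfloor>U\<rfloor> * nat \<lfloor>V\<rfloor>"
    using card_Un_Int[OF fin] unfolding un int by (simp add: card_cartesian_product)
  then have "real (card (hyp_points x)) = real (card H1) + real (card H2) - real (nat \<lfloor>U\<rfloor>) * real (nat \<lfloor>V\<rfloor>)"
    by (simp flip: of_nat_add of_nat_mult)
  then show ?thesis unfolding Dsum_eq_card c1 c2 by (simp only: of_nat_sum)
qed

text \<open>The second-order term psi(U)/U has to be kept: multiplied by x it has size V. The bounds
  come from the two-sided estimates for Euler's constant at the integer part of U, together with
  ln(1 + w/U) = w/U + O(U^(-2)).\<close>

lemma harmonic_psi:
  assumes U: "U \<ge> 1"
  shows "\<bar>(\<Sum>a=1..nat \<lfloor>U\<rfloor>. 1 / real a) - ln U - euler_mascheroni + psi U / U\<bar> \<le> 2 / U\<^sup>2"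
proof -
  define m where "m = nat \<lfloor>U\<rfloor>"
  have m: "m \<ge> 1" "real m \<le> U" "U < real m + 1" using U unfolding m_def by linarith+
  have fl: "\<lfloor>U\<rfloor> = int m" using U by (simp add: m_def)
  obtain n where n: "m = Suc n" using m(1) by (cases m) auto
  define \<delta> where "\<delta> = harm m - ln (real m + 1) - (euler_mascheroni::real)"
  have e: "- (1 / (2 * real m)) \<le> \<delta>" "\<delta> \<le> - (1 / (2 * (real m + 1)))"
    using euler_mascheroni_lower[of n] euler_mascheroni_upper[of n] by (simp_all add: \<delta>_def n algebra_simps)
  have hs: "(\<Sum>a=1..m. 1 / real a) = harm m" by (simp add: harm_def divide_inverse)
  define w where "w = real m + 1 - U"
  have w: "0 < w" "w \<le> 1" using m by (auto simp: w_def)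
  have U2: "1 / U\<^sup>2 > 0" using U by simp
  have ln: "ln (real m + 1) - ln U = ln (1 + w / U)"
  proof -
    have "(real m + 1) / U = 1 + w / U" using U by (simp add: w_def field_simps)
    moreover have "ln ((real m + 1) / U) = ln (real m + 1) - ln U" using U m by (intro ln_divide_pos) auto
    ultimately show ?thesis by simp
  qed
  have wU: "0 \<le> w / U" "w / U \<le> 1" using w U by (auto simp: divide_le_eq)
  have l1: "ln (1 + w / U) \<le> w / U" using wU by (intro ln_add_one_self_le_self)
  have "w / U - (w / U)\<^sup>2 \<le> ln (1 + w / U)" using wU by (intro ln_one_plus_pos_lower_bound)
  moreover have "(w / U)\<^sup>2 \<le> 1 / U\<^sup>2" using w U by (simp add: power_divide divide_right_mono power_le_one)
  ultimately have l2: "w / U - 1 / U\<^sup>2 \<le> ln (1 + w / U)" by linarith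
  have p: "psi U / U = 1 / (2 * U) - w / U"
    using U by (simp add: psi_def frac_def fl w_def field_simps)
  have d: "1 / (2 * real m) - 1 / (2 * (real m + 1)) \<le> 1 / U\<^sup>2"
  proof -
    have "1 \<le> real m" using m(1) by simp
    then have "U \<le> 2 * real m" "U \<le> real m + 1" using m by linarith+
    then have "U * U \<le> (2 * real m) * (real m + 1)" using U by (intro mult_mono) auto
    then have "1 / ((2 * real m) * (real m + 1)) \<le> 1 / (U * U)" using U by (intro frac_le) auto
    moreover have "1 / (2 * real m) - 1 / (2 * (real m + 1)) = 1 / ((2 * real m) * (real m + 1))"
      using m(1) by (simp add: field_simps)
    ultimately show ?thesis by (simp add: power2_eq_square)
  qed
  have u1: "1 / (2 * (real m + 1)) \<le> 1 / (2 * U)" "1 / (2 * U) \<le> 1 / (2 * real m)"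
    using m U by (auto intro!: divide_left_mono)
  have "(\<Sum>a=1..nat \<lfloor>U\<rfloor>. 1 / real a) - ln U - euler_mascheroni + psi U / U = (ln (1 + w / U) - w / U) + (\<delta> + 1 / (2 * U))"
    unfolding m_def[symmetric] hs p ln[symmetric] \<delta>_def by simp
  moreover have "- (1 / U\<^sup>2) \<le> ln (1 + w / U) - w / U" "ln (1 + w / U) - w / U \<le> 0" using l1 l2 by auto
  moreover have "- (1 / U\<^sup>2) \<le> \<delta> + 1 / (2 * U)" "\<delta> + 1 / (2 * U) \<le> 1 / U\<^sup>2" using e u1 d by linarith+
  moreover have "2 / U\<^sup>2 = 1 / U\<^sup>2 + 1 / U\<^sup>2" by simp
  ultimately show ?thesis using U2 by linarith
qed

lemma nat_floor_psi:
  assumes "y \<ge> 0" shows "real (nat \<lfloor>y\<rfloor>) = y - 1/2 - psi y"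
  using assms by (simp add: psi_def frac_def)

text \<open>The terms V psi(U) and U psi(V) cancel against the product of the two integer parts,
  leaving 1/4 - psi(U) psi(V). The errors x * 2/U^2 and x * 2/V^2 are at most 4 each, which together
  with 1/4 + 1/4 stays below 9.\<close>

lemma Delta_hyperbola:
  assumes U: "U \<ge> 1" and V: "V \<ge> 1" and UV: "U * V = x" and Ux: "2 * U\<^sup>2 \<ge> x" and Vx: "2 * V\<^sup>2 \<ge> x"
  shows "\<bar>Delta x + (\<Sum>a=1..nat \<lfloor>U\<rfloor>. psi (x / real a)) + (\<Sum>b=1..nat \<lfloor>V\<rfloor>. psi (x / real b))\<bar> \<le> 9"
proof -
  define \<gamma> where "\<gamma> = (euler_mascheroni :: real)"
  define SU where "SU = (\<Sum>a=1..nat \<lfloor>U\<rfloor>. psi (x / real a))"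
  define SV where "SV = (\<Sum>b=1..nat \<lfloor>V\<rfloor>. psi (x / real b))"
  define p where "p = psi U"
  define q where "q = psi V"
  define eU where "eU = (\<Sum>a=1..nat \<lfloor>U\<rfloor>. 1 / real a) - ln U - \<gamma> + p / U"
  define eV where "eV = (\<Sum>a=1..nat \<lfloor>V\<rfloor>. 1 / real a) - ln V - \<gamma> + q / V"
  define u where "u = real (nat \<lfloor>U\<rfloor>)"
  define v where "v = real (nat \<lfloor>V\<rfloor>)"
  have x1: "x > 0" using U V UV by (metis mult_pos_pos less_le_trans zero_less_one)
  have uv: "u = U - 1/2 - p" "v = V - 1/2 - q" 
    using nat_floor_psi[of U] nat_floor_psi[of V] U V unfolding u_def v_def p_def q_def by auto
  have S: "(\<Sum>a=1..nat \<lfloor>W\<rfloor>. real (nat \<lfloor>x / real a\<rfloor>)) = x * (\<Sum>a=1..nat \<lfloor>W\<rfloor>. 1 / real a) - real (nat \<lfloor>W\<rfloor>) / 2 - (\<Sum>a=1..nat \<lfloor>W\<rfloor>. psi (x / real a))" for W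
  proof -
    have "(\<Sum>a=1..nat \<lfloor>W\<rfloor>. real (nat \<lfloor>x / real a\<rfloor>)) = (\<Sum>a=1..nat \<lfloor>W\<rfloor>. x * (1 / real a) - 1/2 - psi (x / real a))"
    proof (intro sum.cong refl)
      fix a :: nat
      show "real (nat \<lfloor>x / real a\<rfloor>) = x * (1 / real a) - 1/2 - psi (x / real a)"
        by (subst nat_floor_psi) (use x1 in auto)
    qed
    then show ?thesis by (simp add: sum_subtractf sum_distrib_left)
  qed
  have "Dsum x = (x * (eU + ln U + \<gamma> - p / U) - u / 2 - SU) + (x * (eV + ln V + \<gamma> - q / V) - v / 2 - SV) - u * v"
    using hyperbola_count[of U V x] U V UV unfolding S by (simp add: eU_def eV_def u_def v_def SU_def SV_def)
  moreover have "x * ln x = x * ln U + x * ln V" using U V unfolding UV[symmetric] by (simp add: ln_mult algebra_simps)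
  moreover have "x * (eU + ln U + \<gamma> - p / U) = x * eU + x * ln U + x * \<gamma> - V * p"
    using U unfolding UV[symmetric] by (simp add: field_simps)
  moreover have "x * (eV + ln V + \<gamma> - q / V) = x * eV + x * ln V + x * \<gamma> - U * q"
    using V unfolding UV[symmetric] by (simp add: field_simps)
  ultimately have "Delta x + SU + SV = x * eU + x * eV + (x - V * p - U * q - u / 2 - v / 2 - u * v)"
    unfolding Delta_def \<gamma>_def[symmetric] by (simp add: algebra_simps)
  also have "x - V * p - U * q - u / 2 - v / 2 - u * v = 1/4 - p * q"
    unfolding uv UV[symmetric] by (simp add: field_simps)
  finally have eq: "Delta x + SU + SV = x * eU + x * eV + (1/4 - p * q)" .
  have "\<bar>x * eU\<bar> \<le> x * (2 / U\<^sup>2)"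
    unfolding abs_mult using x1 harmonic_psi[OF U, folded \<gamma>_def p_def, folded eU_def] by (intro mult_mono) auto
  also have "\<dots> \<le> 4" using Ux U by (simp add: divide_le_eq)
  finally have 1: "\<bar>x * eU\<bar> \<le> 4" .
  have "\<bar>x * eV\<bar> \<le> x * (2 / V\<^sup>2)"
    unfolding abs_mult using x1 harmonic_psi[OF V, folded \<gamma>_def q_def, folded eV_def] by (intro mult_mono) auto
  also have "\<dots> \<le> 4" using Vx V by (simp add: divide_le_eq)
  finally have 2: "\<bar>x * eV\<bar> \<le> 4" .
  have "\<bar>p * q\<bar> \<le> (1/2) * (1/2)" unfolding abs_mult p_def q_def by (intro mult_mono psi_bound) auto
  then have "\<bar>Delta x + SU + SV\<bar> \<le> 9" unfolding eq using 1 2 by linarith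
  then show ?thesis by (simp add: SU_def SV_def)
qed

text \<open>For z = x/n^2 the two summands are the probabilities that n lies below the first and
  below the second cut, when the ratio of the cuts has density \<open>stp'\<close>. This origin
  accounts for the relation between z and 1/z.\<close>

definition omega :: "real \<Rightarrow> real" where
  "omega z = stp z + (1 - stp (1 / z))"

lemma omega_0: "0 < z \<Longrightarrow> z \<le> 1/2 \<Longrightarrow> omega z = 0"
  unfolding omega_def using stp_0[of z] stp_1[of "1/z"] by (simp add: field_simps)

lemma omega_range: "0 \<le> omega z" "omega z \<le> 2"
  unfolding omega_def using stp_range[of z] stp_range[of "1/z"] by linarith+

lemma omega_symmetric: "omega z + omega (1 / z) = 2"
  by (simp add: omega_def)

lemma amp_omega: "\<exists>B. amp B omega"
proof -
  obtain B where B: "amp B stp" using amp_stp by blast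
  have "amp (B + (\<bar>1\<bar> + 4 * \<bar>-1\<bar> * (3 * B))) (\<lambda>z. stp z + (1 + (-1) * stp (1 / z)))"
    by (rule amp_add[OF B amp_add[OF amp_const amp_mult[OF amp_const amp_inverse[OF B]]]])
  moreover have "(\<lambda>z. stp z + (1 + (-1) * stp (1 / z))) = omega" by (simp add: omega_def fun_eq_iff)
  ultimately show ?thesis by auto
qed

lemma has_integral_stp'_le:
  "((\<lambda>z. stp' z * (if z \<le> c then 1 else 0)) has_integral stp c) {1..2}"
proof -
  have ftc: "(stp' has_integral (stp b - stp a)) {a..b}" if "a \<le> b" for a b
    by (rule fundamental_theorem_of_calculus[OF that])
       (simp add: has_real_derivative_iff_has_vector_derivative[symmetric] DERIV_stp has_field_derivative_at_within)
  consider "c \<le> 1" | "1 < c" "c < 2" | "2 \<le> c" by linarith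
  then show ?thesis
  proof cases
    case 1
    have "((\<lambda>z. stp' z * (if z \<le> c then 1 else 0)) has_integral 0) {1..2}"
      by (rule has_integral_spike[of "{c}" _ _ "\<lambda>_. 0"]) (use 1 in auto)
    then show ?thesis using 1 stp_0[of c] by simp
  next
    case 2
    have "((\<lambda>z. stp' z * (if z \<le> c then 1 else 0)) has_integral (stp c - stp 1)) {1..c}"
      by (rule has_integral_eq[OF _ ftc]) (use 2 in auto)
    moreover have "((\<lambda>z. stp' z * (if z \<le> c then 1 else 0)) has_integral 0) {c..2}"
      by (rule has_integral_spike[of "{c}" _ _ "\<lambda>_. 0"]) (use 2 in auto)
    ultimately have "((\<lambda>z. stp' z * (if z \<le> c then 1 else 0)) has_integral (stp c - stp 1 + 0)) {1..2}"
      using 2 by (intro has_integral_combine[of 1 c 2]) auto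
    then show ?thesis using stp_0[of 1] by simp
  next
    case 3
    have "((\<lambda>z. stp' z * (if z \<le> c then 1 else 0)) has_integral (stp 2 - stp 1)) {1..2}"
      by (rule has_integral_eq[OF _ ftc]) (use 3 in auto)
    then show ?thesis using 3 stp_0[of 1] stp_1[of 2] stp_1[of c] by simp
  qed
qed

lemma has_integral_stp': "(stp' has_integral 1) {1..2}"
proof -
  have "((\<lambda>z. stp' z * (if z \<le> 2 then 1 else 0)) has_integral 1) {1..2}"
    using has_integral_stp'_le[of 2] stp_1[of 2] by simp
  then show ?thesis by (rule has_integral_eq[rotated]) auto
qed

lemma has_integral_stp'_ge:
  "((\<lambda>z. stp' z * (if c \<le> z then 1 else 0)) has_integral (1 - stp c)) {1..2}"
  by (rule has_integral_spike[of "{c}" _ _ "\<lambda>z. stp' z - stp' z * (if z \<le> c then 1 else 0)"])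
     (auto intro!: has_integral_diff has_integral_stp' has_integral_stp'_le)

text \<open>Averaging the hyperbola identity over the position of the cut, with density \<open>stp'\<close>, replaces
  the two sharp cut-offs by the smooth weight \<open>omega\<close>.\<close>

lemma Delta_smooth:
  assumes x: "x \<ge> 2" and N: "real N \<ge> sqrt (2 * x)"
  shows "\<bar>Delta x + (\<Sum>n=1..N. psi (x / real n) * omega (x / (real n)\<^sup>2))\<bar> \<le> 9"
proof -
  define F where "F = (\<lambda>n z. psi (x / real n) * (stp' z * (if z \<le> x / (real n)\<^sup>2 then 1 else 0)) + psi (x / real n) * (stp' z * (if (real n)\<^sup>2 / x \<le> z then 1 else 0)))"
  define G where "G = (\<lambda>z. Delta x * stp' z + (\<Sum>n=1..N. F n z))"
  have I: "(G has_integral (Delta x * 1 + (\<Sum>n=1..N. psi (x / real n) * stp (x / (real n)\<^sup>2) + psi (x / real n) * (1 - stp ((real n)\<^sup>2 / x))))) {1..2}"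
    unfolding G_def F_def
    by (intro has_integral_add has_integral_mult_right has_integral_sum has_integral_stp' has_integral_stp'_le has_integral_stp'_ge) auto
  have om: "psi (x / real n) * stp (x / (real n)\<^sup>2) + psi (x / real n) * (1 - stp ((real n)\<^sup>2 / x)) = psi (x / real n) * omega (x / (real n)\<^sup>2)" for n
    by (simp add: omega_def algebra_simps)
  have bound: "\<bar>G z\<bar> \<le> 9 * stp' z" if z: "z \<in> {1..2}" for z
  proof -
    \<comment> \<open>UV = x and V/U = z, so z is the ratio of the cuts. Then n <= U means z <=
      x/n^2, and n <= V means n^2/x <= z; since V <= sqrt(2x), the range up to N contains both
      sums.\<close>
    define U where "U = sqrt (x / z)"
    define V where "V = sqrt (x * z)"
    have z12: "1 \<le> z" "z \<le> 2" using z by auto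
    have U1: "U \<ge> 1" unfolding U_def using x z12 by simp
    have V1: "V \<ge> 1" unfolding V_def using x z12 mult_mono[of 1 x 1 z] by simp
    have U2: "U\<^sup>2 = x / z" "V\<^sup>2 = x * z" using x z12 by (simp_all add: U_def V_def)
    have UV: "U * V = x"
      unfolding U_def V_def real_sqrt_mult[symmetric] using x z12 by simp
    have VN: "V \<le> real N"
    proof -
      have "V \<le> sqrt (2 * x)" unfolding V_def using x z12 by (intro real_sqrt_le_mono) simp
      then show ?thesis using N by linarith
    qed
    have UVle: "U \<le> V" unfolding U_def V_def
    proof (rule real_sqrt_le_mono)
      have "x / z \<le> x / 1" using x z12 by (intro divide_left_mono) auto
      also have "x / 1 \<le> x * z" using x z12 by simp
      finally show "x / z \<le> x * z" .
    qed
    have cU: "(z \<le> x / (real n)\<^sup>2) = (real n \<le> U)" if "n \<ge> 1" for n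
    proof -
      have "(z \<le> x / (real n)\<^sup>2) = ((real n)\<^sup>2 \<le> x / z)" using that z12 by (simp add: field_simps)
      also have "\<dots> = (real n \<le> U)" unfolding U2(1)[symmetric] using U1 by (simp add: power2_le_iff_abs_le)
      finally show ?thesis .
    qed
    have cV: "((real n)\<^sup>2 / x \<le> z) = (real n \<le> V)" if "n \<ge> 1" for n
    proof -
      have "((real n)\<^sup>2 / x \<le> z) = ((real n)\<^sup>2 \<le> x * z)" using x by (simp add: field_simps)
      also have "\<dots> = (real n \<le> V)" unfolding U2(2)[symmetric] using V1 by (simp add: power2_le_iff_abs_le)
      finally show ?thesis .
    qed
    have sub: "(\<Sum>n=1..N. psi (x / real n) * (if real n \<le> W then 1 else 0)) = (\<Sum>n=1..nat \<lfloor>W\<rfloor>. psi (x / real n))" if "W \<le> real N" for W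
    proof -
      have s: "{n\<in>{1..N}. real n \<le> W} = {1..nat \<lfloor>W\<rfloor>}"
      proof -
        have "{n\<in>{1..N}. real n \<le> W} = {n::nat. 0 < n \<and> real n \<le> W}" using that by auto
        then show ?thesis by (simp only: set_le_real)
      qed
      have "(\<Sum>n=1..N. psi (x / real n) * (if real n \<le> W then 1 else 0)) = (\<Sum>n=1..N. if real n \<le> W then psi (x / real n) else 0)"
        by (intro sum.cong) auto
      also have "\<dots> = (\<Sum>n\<in>{n\<in>{1..N}. real n \<le> W}. psi (x / real n))" by (rule sum.inter_filter[symmetric]) simp
      finally show ?thesis unfolding s .
    qed
    have "G z = stp' z * (Delta x + (\<Sum>n=1..N. psi (x / real n) * (if real n \<le> U then 1 else 0)) + (\<Sum>n=1..N. psi (x / real n) * (if real n \<le> V then 1 else 0)))"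
    proof -
      have "(\<Sum>n=1..N. F n z) = (\<Sum>n=1..N. stp' z * (psi (x / real n) * (if real n \<le> U then 1 else 0)) + stp' z * (psi (x / real n) * (if real n \<le> V then 1 else 0)))"
        by (intro sum.cong refl) (simp add: F_def cU cV)
      then show ?thesis unfolding G_def by (simp add: sum.distrib sum_distrib_left distrib_left)
    qed
    also have "\<dots> = stp' z * (Delta x + (\<Sum>a=1..nat \<lfloor>U\<rfloor>. psi (x / real a)) + (\<Sum>b=1..nat \<lfloor>V\<rfloor>. psi (x / real b)))"
      using VN UVle by (simp only: sub)
    finally have Gz: "G z = stp' z * (Delta x + (\<Sum>a=1..nat \<lfloor>U\<rfloor>. psi (x / real a)) + (\<Sum>b=1..nat \<lfloor>V\<rfloor>. psi (x / real b)))" .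
    have "\<bar>Delta x + (\<Sum>a=1..nat \<lfloor>U\<rfloor>. psi (x / real a)) + (\<Sum>b=1..nat \<lfloor>V\<rfloor>. psi (x / real b))\<bar> \<le> 9"
    proof (rule Delta_hyperbola[OF U1 V1 UV])
      show "2 * U\<^sup>2 \<ge> x" unfolding U2 using x z12 by (simp add: field_simps)
      show "2 * V\<^sup>2 \<ge> x" unfolding U2 using x z12 mult_left_mono[of 1 z x] by simp
    qed
    then show ?thesis unfolding Gz abs_mult using stp'_nonneg[of z] by (simp add: mult_left_mono mult.commute)
  qed
  have "norm (integral {1..2} G) \<le> integral {1..2} (\<lambda>z. 9 * stp' z)"
    by (rule integral_norm_bound_integral) (use I bound has_integral_mult_right[OF has_integral_stp', of 9] in auto)
  also have "\<dots> = 9" using integral_unique[OF has_integral_mult_right[OF has_integral_stp', of 9]] by simp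
  finally show ?thesis unfolding integral_unique[OF I] om by simp
qed

section \<open>Mean squares of trigonometric sums\<close>

lemma cis_has_vector_derivative:
  assumes "(f has_real_derivative f') (at x within S)"
  shows "((\<lambda>x. cis (f x)) has_vector_derivative (complex_of_real f' * \<i> * cis (f x))) (at x within S)"
  unfolding has_vector_derivative_def
  by (rule derivative_eq_intros assms[unfolded has_field_derivative_def] | simp)+
     (auto simp: fun_eq_iff scaleR_conv_of_real)

text \<open>For a nonzero frequency there is an antiderivative of size O(x), which is negligible
  against X^(3/2).\<close>

lemma trig_single:
  "((\<lambda>X. of_real (X powr (-3/2)) * integral {1..X} (\<lambda>x. of_real (sqrt x) * cis (\<mu> * sqrt x)))
     \<longlongrightarrow> (if \<mu> = 0 then 2/3 else 0)) at_top"
proof (cases "\<mu> = 0")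
  case True
  have I: "integral {1..X} (\<lambda>x. complex_of_real (sqrt x) * cis (\<mu> * sqrt x)) = of_real (2/3 * (X powr (3/2) - 1))" if X: "X \<ge> 1" for X
  proof -
    have "((\<lambda>x. sqrt x) has_integral (2/3 * X powr (3/2) - 2/3 * 1 powr (3/2))) {1..X}"
    proof (rule fundamental_theorem_of_calculus[OF X])
      fix x assume x: "x \<in> {1..X}"
      then show "((\<lambda>x. 2/3 * x powr (3/2)) has_vector_derivative sqrt x) (at x within {1..X})"
        by (auto intro!: derivative_eq_intros simp: has_real_derivative_iff_has_vector_derivative[symmetric] powr_half_sqrt)
    qed
    then have "((\<lambda>x. complex_of_real (sqrt x)) has_integral of_real (2/3 * X powr (3/2) - 2/3 * 1 powr (3/2))) {1..X}"
      by (rule has_integral_of_real)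
    then have "integral {1..X} (\<lambda>x. complex_of_real (sqrt x)) = of_real (2/3 * X powr (3/2) - 2/3 * 1 powr (3/2))"
      by (rule integral_unique)
    then show ?thesis using True by (simp add: right_diff_distrib)
  qed
  have "((\<lambda>X. complex_of_real (X powr (-3/2) * (2/3 * (X powr (3/2) - 1)))) \<longlongrightarrow> of_real (2/3)) at_top"
    by (intro tendsto_of_real) real_asymp
  moreover have "\<forall>\<^sub>F X in at_top. complex_of_real (X powr (-3/2) * (2/3 * (X powr (3/2) - 1))) = of_real (X powr (-3/2)) * integral {1..X} (\<lambda>x. of_real (sqrt x) * cis (\<mu> * sqrt x))"
    using eventually_ge_at_top[of 1] by eventually_elim (simp add: I)
  ultimately have "((\<lambda>X. of_real (X powr (-3/2)) * integral {1..X} (\<lambda>x. of_real (sqrt x) * cis (\<mu> * sqrt x))) \<longlongrightarrow> complex_of_real (2/3)) at_top"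
    by (rule Lim_transform_eventually)
  then show ?thesis using True by simp
next
  case False
  define c where "c = complex_of_real \<mu> * \<i>"
  have c: "c \<noteq> 0" using False by (simp add: c_def)
  \<comment> \<open>The substitution s = sqrt x gives the integral of 2 s^2 e^(cs), whose
    antiderivative is (2 s^2/c - 4 s/c^2 + 4/c^3) e^(cs).\<close>
  define q where "q = (\<lambda>x. of_real (2 * x) / c - of_real (4 * sqrt x) / c\<^sup>2 + 4 / c ^ 3)"
  define C where "C = 2 / cmod c + 4 / (cmod c)\<^sup>2 + 4 / (cmod c) ^ 3"
  have qb: "cmod (q x) \<le> C * x" if x: "x \<ge> 1" for x
  proof -
    have sx: "sqrt x \<le> x" using x by (simp add: real_le_lsqrt sqrt_le_D power2_eq_square)
    have "cmod (q x) \<le> cmod (of_real (2 * x) / c) + cmod (of_real (4 * sqrt x) / c\<^sup>2) + cmod (4 / c ^ 3)"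
      unfolding q_def by (intro order_trans[OF norm_triangle_ineq] add_mono norm_triangle_ineq4) auto
    also have "\<dots> = 2 / cmod c * x + 4 / (cmod c)\<^sup>2 * sqrt x + 4 / (cmod c) ^ 3 * 1"
      using x by (simp add: norm_divide norm_power norm_mult)
    also have "\<dots> \<le> 2 / cmod c * x + 4 / (cmod c)\<^sup>2 * x + 4 / (cmod c) ^ 3 * x"
      using x sx by (intro add_mono mult_left_mono) auto
    finally show ?thesis by (simp add: C_def algebra_simps)
  qed
  have C0: "C \<ge> 0" by (simp add: C_def)
  have I: "cmod (integral {1..X} (\<lambda>x. complex_of_real (sqrt x) * cis (\<mu> * sqrt x))) \<le> C * X + C" if X: "X \<ge> 1" for X
  proof -
    have "((\<lambda>x. complex_of_real (sqrt x) * cis (\<mu> * sqrt x)) has_integral (q X * cis (\<mu> * sqrt X) - q 1 * cis (\<mu> * sqrt 1))) {1..X}"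
    proof (rule fundamental_theorem_of_calculus[OF X])
      fix x assume x: "x \<in> {1..X}"
      have s: "sqrt x > 0" using x by simp
      have "((\<lambda>x. cis (\<mu> * sqrt x)) has_vector_derivative (of_real (\<mu> / (2 * sqrt x)) * \<i> * cis (\<mu> * sqrt x))) (at x within {1..X})"
        by (rule cis_has_vector_derivative) (use x in \<open>auto intro!: derivative_eq_intros simp: divide_simps\<close>)
      moreover have "(q has_vector_derivative (of_real 2 / c - of_real (2 / sqrt x) / c\<^sup>2 + 0)) (at x within {1..X})"
        unfolding q_def
        by (intro has_vector_derivative_add has_vector_derivative_diff has_vector_derivative_divide of_real_has_vector_derivative has_vector_derivative_const)
           (use x in \<open>auto intro!: derivative_eq_intros simp: divide_simps\<close>)
      ultimately have "((\<lambda>x. q x * cis (\<mu> * sqrt x)) has_vector_derivative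
         (q x * (of_real (\<mu> / (2 * sqrt x)) * \<i> * cis (\<mu> * sqrt x)) + (of_real 2 / c - of_real (2 / sqrt x) / c\<^sup>2 + 0) * cis (\<mu> * sqrt x))) (at x within {1..X})"
        by (intro has_vector_derivative_mult)
      moreover have "q x * (of_real (\<mu> / (2 * sqrt x)) * \<i> * cis (\<mu> * sqrt x)) + (of_real 2 / c - of_real (2 / sqrt x) / c\<^sup>2 + 0) * cis (\<mu> * sqrt x)
         = of_real (sqrt x) * cis (\<mu> * sqrt x)"
      proof -
        define r where "r = complex_of_real (sqrt x)"
        have r: "r \<noteq> 0" "complex_of_real x = r * r" using s x by (auto simp: r_def simp flip: of_real_mult)
        have "q x = 2 * (r * r) / c - 4 * r / c\<^sup>2 + 4 / c ^ 3" by (simp add: q_def r(2) r_def[symmetric])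
        moreover have "of_real (\<mu> / (2 * sqrt x)) * \<i> = c / (2 * r)" by (simp add: c_def r_def)
        moreover have "(2 * (r * r) / c - 4 * r / c\<^sup>2 + 4 / c ^ 3) * (c / (2 * r)) + (2 / c - (2 / r) / c\<^sup>2) = r"
          using c r(1) by (simp add: field_simps power2_eq_square power3_eq_cube)
        moreover have "complex_of_real (2 / sqrt x) = 2 / r" by (simp add: r_def)
        ultimately have "q x * (of_real (\<mu> / (2 * sqrt x)) * \<i>) + (of_real 2 / c - of_real (2 / sqrt x) / c\<^sup>2 + 0) = r"
          by (simp only: of_real_numeral add_0_right)
        then have "(q x * (of_real (\<mu> / (2 * sqrt x)) * \<i>) + (of_real 2 / c - of_real (2 / sqrt x) / c\<^sup>2 + 0)) * cis (\<mu> * sqrt x) = r * cis (\<mu> * sqrt x)" by simp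
        then show ?thesis unfolding r_def distrib_right by (simp only: mult.assoc)
      qed
      ultimately show "((\<lambda>x. q x * cis (\<mu> * sqrt x)) has_vector_derivative of_real (sqrt x) * cis (\<mu> * sqrt x)) (at x within {1..X})" by simp
    qed
    then have "integral {1..X} (\<lambda>x. complex_of_real (sqrt x) * cis (\<mu> * sqrt x)) = q X * cis (\<mu> * sqrt X) - q 1 * cis (\<mu> * sqrt 1)"
      by (rule integral_unique)
    then have "cmod (integral {1..X} (\<lambda>x. complex_of_real (sqrt x) * cis (\<mu> * sqrt x))) \<le> cmod (q X) + cmod (q 1)"
      using norm_triangle_ineq4[of "q X * cis (\<mu> * sqrt X)" "q 1 * cis (\<mu> * sqrt 1)"] by (simp add: norm_mult)
    then show ?thesis using qb[OF X] qb[of 1] by simp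
  qed
  have "((\<lambda>X. of_real (X powr (-3/2)) * integral {1..X} (\<lambda>x. of_real (sqrt x) * cis (\<mu> * sqrt x))) \<longlongrightarrow> 0) at_top"
  proof (rule Lim_null_comparison)
    show "\<forall>\<^sub>F X in at_top. norm (of_real (X powr (-3/2)) * integral {1..X} (\<lambda>x. complex_of_real (sqrt x) * cis (\<mu> * sqrt x))) \<le> X powr (-3/2) * (C * X + C)"
      using eventually_ge_at_top[of 1]
      by eventually_elim (auto simp: norm_mult intro!: mult_left_mono I)
    show "((\<lambda>X. X powr (-3/2) * (C * X + C)) \<longlongrightarrow> 0) at_top" by real_asymp
  qed
  then show ?thesis using False by simp
qed

lemma trig_mean_square:
  fixes a :: "'i \<Rightarrow> complex" and fr :: "'i \<Rightarrow> real"
  assumes fin: "finite I"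
  shows "((\<lambda>X. X powr (-3/2) * integral {1..X} (\<lambda>x. sqrt x * (cmod (\<Sum>i\<in>I. a i * cis (fr i * sqrt x)))\<^sup>2))
     \<longlongrightarrow> 2/3 * Re (\<Sum>i\<in>I. \<Sum>j\<in>I. if fr i = fr j then a i * cnj (a j) else 0)) at_top"
proof -
  define F where "F = (\<lambda>i j X. integral {1..X} (\<lambda>x. complex_of_real (sqrt x) * cis ((fr i - fr j) * sqrt x)))"
  have int: "(\<lambda>x. complex_of_real (sqrt x) * cis (\<mu> * sqrt x)) integrable_on {1..X}" for \<mu> X
    by (intro integrable_continuous_real continuous_intros)
  have eq: "complex_of_real (integral {1..X} (\<lambda>x. sqrt x * (cmod (\<Sum>i\<in>I. a i * cis (fr i * sqrt x)))\<^sup>2)) = (\<Sum>i\<in>I. \<Sum>j\<in>I. a i * cnj (a j) * F i j X)" for X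
  proof -
    have pt: "complex_of_real (sqrt x * (cmod (\<Sum>i\<in>I. a i * cis (fr i * sqrt x)))\<^sup>2) =
       (\<Sum>i\<in>I. \<Sum>j\<in>I. a i * cnj (a j) * (complex_of_real (sqrt x) * cis ((fr i - fr j) * sqrt x)))" for x
    proof -
      have "cis (fr i * sqrt x) * cnj (cis (fr j * sqrt x)) = cis ((fr i - fr j) * sqrt x)" for i j
        by (simp add: cis_cnj cis_mult left_diff_distrib)
      then have *: "a i * cis (fr i * sqrt x) * cnj (a j * cis (fr j * sqrt x)) = a i * cnj (a j) * cis ((fr i - fr j) * sqrt x)" for i j
        by (simp only: complex_cnj_mult mult.assoc mult.left_commute mult.commute)
      have "complex_of_real ((cmod (\<Sum>i\<in>I. a i * cis (fr i * sqrt x)))\<^sup>2) = (\<Sum>i\<in>I. \<Sum>j\<in>I. a i * cnj (a j) * cis ((fr i - fr j) * sqrt x))"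
        unfolding complex_norm_square sum_product cnj_sum by (simp only: *)
      then show ?thesis by (simp add: sum_distrib_left mult_ac)
    qed
    have h: "((\<lambda>x. \<Sum>i\<in>I. \<Sum>j\<in>I. a i * cnj (a j) * (complex_of_real (sqrt x) * cis ((fr i - fr j) * sqrt x))) has_integral (\<Sum>i\<in>I. \<Sum>j\<in>I. a i * cnj (a j) * F i j X)) {1..X}"
      unfolding F_def by (intro has_integral_sum fin has_integral_mult_right integrable_integral int)
    have "(\<lambda>x. sqrt x * (cmod (\<Sum>i\<in>I. a i * cis (fr i * sqrt x)))\<^sup>2) integrable_on {1..X}"
      by (intro integrable_continuous_real continuous_intros)
    then have "((\<lambda>x. complex_of_real (sqrt x * (cmod (\<Sum>i\<in>I. a i * cis (fr i * sqrt x)))\<^sup>2)) has_integral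
       of_real (integral {1..X} (\<lambda>x. sqrt x * (cmod (\<Sum>i\<in>I. a i * cis (fr i * sqrt x)))\<^sup>2))) {1..X}"
      by (intro has_integral_of_real integrable_integral)
    then show ?thesis unfolding pt using h has_integral_unique by blast
  qed
  have "((\<lambda>X. \<Sum>i\<in>I. \<Sum>j\<in>I. a i * cnj (a j) * (of_real (X powr (-3/2)) * F i j X)) \<longlongrightarrow>
     (\<Sum>i\<in>I. \<Sum>j\<in>I. a i * cnj (a j) * (if fr i - fr j = 0 then 2/3 else 0))) at_top"
    unfolding F_def by (intro tendsto_sum tendsto_mult_left trig_single)
  also have "(\<lambda>X. \<Sum>i\<in>I. \<Sum>j\<in>I. a i * cnj (a j) * (of_real (X powr (-3/2)) * F i j X)) =
     (\<lambda>X. complex_of_real (X powr (-3/2) * integral {1..X} (\<lambda>x. sqrt x * (cmod (\<Sum>i\<in>I. a i * cis (fr i * sqrt x)))\<^sup>2)))"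
    unfolding of_real_mult eq by (simp add: sum_distrib_left mult_ac)
  finally have "((\<lambda>X. X powr (-3/2) * integral {1..X} (\<lambda>x. sqrt x * (cmod (\<Sum>i\<in>I. a i * cis (fr i * sqrt x)))\<^sup>2))
    \<longlongrightarrow> Re (\<Sum>i\<in>I. \<Sum>j\<in>I. a i * cnj (a j) * (if fr i - fr j = 0 then 2/3 else 0))) at_top"
    using tendsto_Re by fastforce
  also have "(\<Sum>i\<in>I. \<Sum>j\<in>I. a i * cnj (a j) * (if fr i - fr j = 0 then 2/3 else 0)) = of_real (2/3) * (\<Sum>i\<in>I. \<Sum>j\<in>I. if fr i = fr j then a i * cnj (a j) else 0)"
    unfolding sum_distrib_left by (intro sum.cong refl) auto
  finally show ?thesis by simp
qed

text \<open>Grouped by frequency, the double sum is a sum of squares |sum of a_i|^2 over the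
  distinct frequencies; all but one of these nonnegative terms are dropped.\<close>

lemma sum_same_frequency_ge:
  fixes a :: "'i \<Rightarrow> complex" and fr :: "'i \<Rightarrow> real"
  assumes fin: "finite I"
  shows "Re (\<Sum>i\<in>I. \<Sum>j\<in>I. if fr i = fr j then a i * cnj (a j) else 0) \<ge> (cmod (\<Sum>i\<in>{i\<in>I. fr i = \<rho>}. a i))\<^sup>2"
proof -
  have "(\<Sum>i\<in>I. \<Sum>j\<in>I. if fr i = fr j then a i * cnj (a j) else 0) = (\<Sum>i\<in>I. a i * cnj (\<Sum>j\<in>{j\<in>I. fr j = fr i}. a j))"
  proof (intro sum.cong refl)
    fix i
    have "(\<Sum>j\<in>I. if fr i = fr j then a i * cnj (a j) else 0) = (\<Sum>j\<in>I. if fr j = fr i then a i * cnj (a j) else 0)"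
      by (intro sum.cong) auto
    also have "\<dots> = (\<Sum>j\<in>{j\<in>I. fr j = fr i}. a i * cnj (a j))" using fin by (simp add: sum.inter_filter)
    finally show "(\<Sum>j\<in>I. if fr i = fr j then a i * cnj (a j) else 0) = a i * cnj (\<Sum>j\<in>{j\<in>I. fr j = fr i}. a j)"
      by (simp add: sum_distrib_left)
  qed
  also have "\<dots> = (\<Sum>r\<in>fr ` I. \<Sum>i\<in>{i\<in>I. fr i = r}. a i * cnj (\<Sum>j\<in>{j\<in>I. fr j = fr i}. a j))"
    by (rule sum.image_gen[OF fin])
  also have "\<dots> = (\<Sum>r\<in>fr ` I. complex_of_real ((cmod (\<Sum>i\<in>{i\<in>I. fr i = r}. a i))\<^sup>2))"
  proof (intro sum.cong refl)
    fix r
    have "(\<Sum>i\<in>{i\<in>I. fr i = r}. a i * cnj (\<Sum>j\<in>{j\<in>I. fr j = fr i}. a j)) = (\<Sum>i\<in>{i\<in>I. fr i = r}. a i * cnj (\<Sum>j\<in>{j\<in>I. fr j = r}. a j))"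
      by (intro sum.cong) auto
    also have "\<dots> = (\<Sum>i\<in>{i\<in>I. fr i = r}. a i) * cnj (\<Sum>j\<in>{j\<in>I. fr j = r}. a j)" by (simp add: sum_distrib_right)
    finally show "(\<Sum>i\<in>{i\<in>I. fr i = r}. a i * cnj (\<Sum>j\<in>{j\<in>I. fr j = fr i}. a j)) = complex_of_real ((cmod (\<Sum>i\<in>{i\<in>I. fr i = r}. a i))\<^sup>2)"
      by (simp only: complex_norm_square)
  qed
  finally have eq: "Re (\<Sum>i\<in>I. \<Sum>j\<in>I. if fr i = fr j then a i * cnj (a j) else 0) = (\<Sum>r\<in>fr ` I. (cmod (\<Sum>i\<in>{i\<in>I. fr i = r}. a i))\<^sup>2)"
    by (simp only: of_real_sum[symmetric] Re_complex_of_real)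
  show ?thesis
  proof (cases "\<rho> \<in> fr ` I")
    case True
    then show ?thesis unfolding eq using fin by (intro member_le_sum) auto
  next
    case False
    then have "{i\<in>I. fr i = \<rho>} = {}" by auto
    then have 0: "(\<Sum>i\<in>{i\<in>I. fr i = \<rho>}. a i) = 0" by (simp only: sum.empty)
    show ?thesis unfolding eq 0 by (simp add: sum_nonneg)
  qed
qed

section \<open>The B-process\<close>

text \<open>With t = sqrt x the summand f t n below is the amplitude at n/t times e(kx/n). Scaling n
  by t puts both the support and the stationary points at fixed places.\<close>

locale bump =
  fixes \<Phi> \<Phi>' \<Phi>'' :: "real \<Rightarrow> real" and a b :: real and k :: nat
  assumes a: "0 < a" and ab: "a < b" and k: "k \<ge> 1"
    and d1: "\<And>v. v > 0 \<Longrightarrow> (\<Phi> has_real_derivative \<Phi>' v) (at v)"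
    and d2: "\<And>v. v > 0 \<Longrightarrow> (\<Phi>' has_real_derivative \<Phi>'' v) (at v)"
    and c2: "continuous_on {0<..} \<Phi>''"
    and zero: "\<And>v. 0 < v \<Longrightarrow> v \<le> a \<or> b \<le> v \<Longrightarrow> \<Phi> v = 0"
begin

lemma zero': "\<Phi>' v = 0" if "0 < v" "v < a \<or> b < v"
proof -
  have "(\<Phi> has_real_derivative 0) (at v)"
    by (rule has_field_derivative_transform_within_open[where f = "\<lambda>_. 0" and S = "{0<..<a} \<union> {b<..}"])
       (use that zero a ab in auto)
  then show ?thesis using DERIV_unique d1[OF that(1)] by blast
qed

lemma c0: "continuous_on {0<..} \<Phi>"
  by (rule DERIV_continuous_on[where D = \<Phi>']) (auto intro: has_field_derivative_at_within d1)

lemma c1: "continuous_on {0<..} \<Phi>'"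
  by (rule DERIV_continuous_on[where D = \<Phi>'']) (auto intro: has_field_derivative_at_within d2)

text \<open>A < p < a < b < q < B: \<open>zero'\<close> gives vanishing derivatives only strictly
  outside [a, b], hence the margins p and q; [A, B] is a still larger fixed interval on which all
  bounds are taken.\<close>

definition "A = a / 4"
definition "B = b + 1"
definition "p = a / 2"
definition "q = b + 1/2"

lemma AB: "0 < A" "A < p" "p < a" "b < q" "q < B" "0 < B" "p < q"
  using a ab by (auto simp: A_def B_def p_def q_def)

definition f :: "real \<Rightarrow> real \<Rightarrow> complex" where
  "f t u = of_real (\<Phi> (u / t)) * ee (real k * t\<^sup>2 / u)"

text \<open>The amplitude of the derivative of f t. It stays bounded as t grows, because
  differentiating the phase k t^2/u yields k/v^2 in the scaled variable v = u/t.\<close>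

definition \<Omega> :: "real \<Rightarrow> real \<Rightarrow> complex" where
  "\<Omega> t v = of_real (\<Phi>' v / t) - of_real (2 * pi * real k / v\<^sup>2 * \<Phi> v) * \<i>"

definition \<Omega>' :: "real \<Rightarrow> real \<Rightarrow> complex" where
  "\<Omega>' t v = of_real (\<Phi>'' v / t) - of_real (2 * pi * real k * (\<Phi>' v / v\<^sup>2 - 2 * \<Phi> v / v ^ 3)) * \<i>"

definition f' :: "real \<Rightarrow> real \<Rightarrow> complex" where
  "f' t u = \<Omega> t (u / t) * ee (real k * t\<^sup>2 / u)"

lemma f_deriv:
  assumes t: "t > 0" and u: "u > 0"
  shows "(f t has_vector_derivative f' t u) (at u within S)"
proof -
  have 1: "((\<lambda>u. \<Phi> (u / t)) has_real_derivative \<Phi>' (u / t) * (1 / t)) (at u within S)"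
  proof (rule DERIV_chain2[of \<Phi> "\<Phi>' (u / t)" "\<lambda>u. u / t"])
    show "(\<Phi> has_real_derivative \<Phi>' (u / t)) (at (u / t))" using t u by (intro d1) simp
    show "((\<lambda>u. u / t) has_real_derivative 1 / t) (at u within S)" using t by (auto intro!: derivative_eq_intros)
  qed
  have 2: "((\<lambda>u. real k * t\<^sup>2 / u) has_real_derivative - (real k * t\<^sup>2) / u\<^sup>2) (at u within S)"
    using u by (auto intro!: derivative_eq_intros simp: power2_eq_square)
  have "(f t has_vector_derivative (of_real (\<Phi> (u / t)) * (of_real (2 * pi * (- (real k * t\<^sup>2) / u\<^sup>2)) * \<i> * ee (real k * t\<^sup>2 / u))
     + of_real (\<Phi>' (u / t) * (1 / t)) * ee (real k * t\<^sup>2 / u))) (at u within S)"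
    unfolding f_def by (intro has_vector_derivative_mult of_real_has_vector_derivative ee_has_vector_derivative 1 2)
  moreover have "of_real (\<Phi> (u / t)) * (of_real (2 * pi * (- (real k * t\<^sup>2) / u\<^sup>2)) * \<i> * ee (real k * t\<^sup>2 / u))
     + of_real (\<Phi>' (u / t) * (1 / t)) * ee (real k * t\<^sup>2 / u) = f' t u"
  proof -
    have "2 * pi * real k / (u / t)\<^sup>2 * \<Phi> (u / t) = - (\<Phi> (u / t) * (2 * pi * (- (real k * t\<^sup>2) / u\<^sup>2)))"
      using t u by (simp add: power_divide)
    then show ?thesis unfolding f'_def \<Omega>_def by (simp add: algebra_simps)
  qed
  ultimately show ?thesis by (simp only:)
qed

lemma cont_\<Omega>: "t > 0 \<Longrightarrow> continuous_on {0<..} (\<Omega> t)"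
  unfolding \<Omega>_def by (intro continuous_intros c0 c1) auto

lemma \<Omega>_deriv:
  assumes v: "v > 0"
  shows "(\<Omega> t has_vector_derivative \<Omega>' t v) (at v within S)"
proof -
  have 1: "((\<lambda>v. \<Phi>' v / t) has_real_derivative \<Phi>'' v / t) (at v within S)"
    by (rule DERIV_cdivide) (rule has_field_derivative_at_within[OF d2[OF v]])
  have 3: "((\<lambda>v. 2 * pi * real k / v\<^sup>2 * \<Phi> v) has_real_derivative 2 * pi * real k * (\<Phi>' v / v\<^sup>2 - 2 * \<Phi> v / v ^ 3)) (at v within S)"
  proof -
    have "((\<lambda>v. 2 * pi * real k / v\<^sup>2) has_real_derivative - (2 * (2 * pi * real k)) / v ^ 3) (at v within S)"
      using v by (auto intro!: derivative_eq_intros simp: power2_eq_square power3_eq_cube)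
    from DERIV_mult[OF this has_field_derivative_at_within[OF d1[OF v]]]
    show ?thesis by (simp add: algebra_simps)
  qed
  show ?thesis unfolding \<Omega>_def \<Omega>'_def
    by (intro has_vector_derivative_diff has_vector_derivative_mult_left of_real_has_vector_derivative 1 3)
qed

lemma \<Omega>_zero: "0 < v \<Longrightarrow> v \<le> p \<or> q \<le> v \<Longrightarrow> \<Omega> t v = 0"
  using zero[of v] zero'[of v] AB by (auto simp: \<Omega>_def)

lemma bounds: "\<exists>M\<ge>0. \<forall>v\<in>{A..B}. \<bar>\<Phi> v\<bar> \<le> M \<and> \<bar>\<Phi>' v\<bar> \<le> M \<and> \<bar>\<Phi>'' v\<bar> \<le> M"
proof -
  have s: "{A..B} \<subseteq> {0<..}" using AB by auto
  have "bounded (\<Phi> ` {A..B})" "bounded (\<Phi>' ` {A..B})" "bounded (\<Phi>'' ` {A..B})"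
    by (intro compact_imp_bounded compact_continuous_image compact_Icc continuous_on_subset[OF _ s] c0 c1 c2)+
  then obtain M0 M1 M2 where "\<forall>y\<in>\<Phi> ` {A..B}. norm y \<le> M0" "\<forall>y\<in>\<Phi>' ` {A..B}. norm y \<le> M1" "\<forall>y\<in>\<Phi>'' ` {A..B}. norm y \<le> M2"
    unfolding bounded_iff by blast
  then have "\<forall>v\<in>{A..B}. \<bar>\<Phi> v\<bar> \<le> max 0 (max M0 (max M1 M2)) \<and> \<bar>\<Phi>' v\<bar> \<le> max 0 (max M0 (max M1 M2)) \<and> \<bar>\<Phi>'' v\<bar> \<le> max 0 (max M0 (max M1 M2))"
    by (auto simp: le_max_iff_disj)
  then show ?thesis by (intro exI[of _ "max 0 (max M0 (max M1 M2))"]) simp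
qed

lemma scale:
  fixes h :: "real \<Rightarrow> complex"
  assumes h: "continuous_on {0<..} h" and z: "\<And>v. 0 < v \<Longrightarrow> v \<le> p \<or> q \<le> v \<Longrightarrow> h v = 0"
    and t: "1 \<le> p * t" and N: "q * t \<le> real N" and A': "0 < A'" "A' \<le> p" and B': "q \<le> B'"
  shows "integral {1..real N} (\<lambda>u. h (u / t) * ee (real k * t\<^sup>2 / u) * ee (s * u))
       = of_real t * integral {A'..B'} (\<lambda>v. h v * ee (t * (real k / v + s * v)))"
proof -
  have t0: "t > 0" using t AB by (metis mult_nonneg_nonpos not_less not_one_le_zero order.trans less_le less_trans)
  define G where "G = (\<lambda>u. h (u / t) * ee (real k * t\<^sup>2 / u) * ee (s * u))"
  define H where "H = (\<lambda>v. h v * ee (t * (real k / v + s * v)))"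
  have cG: "continuous_on {0<..} G" unfolding G_def
    by (intro continuous_intros continuous_on_compose2[OF h]) (use t0 in auto)
  have cH: "continuous_on {0<..} H" unfolding H_def
    by (intro continuous_intros h) auto
  have "integral {1..real N} G = integral {t * p..t * q} G"
  proof (rule integral_support)
    show "1 \<le> t * p" "t * p \<le> t * q" "t * q \<le> real N" using t N AB t0 by (auto simp: mult.commute)
    show "continuous_on {1..real N} G" by (rule continuous_on_subset[OF cG]) auto
    fix u assume "1 \<le> u" "u \<le> t * p"
    then have "u / t \<le> p" "0 < u / t" using t0 by (auto simp: field_simps)
    then show "G u = 0" using z[of "u / t"] by (simp add: G_def)
  next
    fix u assume u: "t * q \<le> u" "u \<le> real N"
    then have "q \<le> u / t" using t0 by (simp add: field_simps)
    moreover from this have "0 < u / t" using AB by linarith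
    ultimately show "G u = 0" using z[of "u / t"] by (simp add: G_def)
  qed
  also have "\<dots> = of_real t * integral {p..q} (\<lambda>v. G (t * v))"
  proof (rule integral_dilate[OF _ t0])
    show "continuous_on {t * p..t * q} G"
      by (rule continuous_on_subset[OF cG]) (use t0 AB in \<open>auto intro: less_le_trans[of 0 "t * p"]\<close>)
  qed (use AB in auto)
  also have "integral {p..q} (\<lambda>v. G (t * v)) = integral {p..q} H"
  proof (rule integral_cong)
    fix v assume "v \<in> {p..q}"
    then have v: "v > 0" using AB by auto
    have "real k * t\<^sup>2 / (t * v) + s * (t * v) = t * (real k / v + s * v)"
      using t0 v by (simp add: power2_eq_square field_simps)
    then have "ee (real k * t\<^sup>2 / (t * v)) * ee (s * (t * v)) = ee (t * (real k / v + s * v))" by (simp only: ee_add[symmetric])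
    then show "G (t * v) = H v" unfolding G_def H_def using t0 by (simp only: mult.assoc) simp
  qed
  also have "integral {p..q} H = integral {A'..B'} H"
  proof (rule integral_support[symmetric])
    show "continuous_on {A'..B'} H" by (rule continuous_on_subset[OF cH]) (use A' in auto)
    fix v assume "A' \<le> v" "v \<le> p" then show "H v = 0" using z[of v] A' by (simp add: H_def)
  next
    fix v assume "q \<le> v" "v \<le> B'" then show "H v = 0" using z[of v] AB a by (simp add: H_def)
  qed (use A' B' AB in auto)
  finally show ?thesis unfolding G_def H_def .
qed

text \<open>From l = 2k/A^2 on, the derivative s - k/v^2 of the phase, s = l or s = -l, is at least
  l/2 in size on [A, B]: no stationary point remains.\<close>

lemma tail_bound:
  "\<exists>C\<ge>0. \<forall>t\<ge>1. \<forall>l::real. l \<ge> 2 * real k / A\<^sup>2 \<longrightarrow> l > 0 \<longrightarrow> (\<forall>s\<in>{l, - l}.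
     cmod (integral {A..B} (\<lambda>v. \<Omega> t v * ee (t * (real k / v + s * v)))) \<le> C / (t * l))"
proof -
  obtain M where M0: "M \<ge> 0" and M: "\<And>v. v \<in> {A..B} \<Longrightarrow> \<bar>\<Phi> v\<bar> \<le> M \<and> \<bar>\<Phi>' v\<bar> \<le> M \<and> \<bar>\<Phi>'' v\<bar> \<le> M" using bounds by blast
  define C1 where "C1 = M + 2 * pi * real k / A\<^sup>2 * M"
  define C2 where "C2 = M + 2 * pi * real k * (M / A\<^sup>2 + 2 * M / A ^ 3)"
  \<comment> \<open>In the second summand only one of the two factors l/2 in the squared denominator
    is kept, the other being bounded below by k/A^2; both summands then have the form
    constant/l.\<close>
  define C3 where "C3 = 2 * C2 + C1 * (2 * real k / A ^ 3) * 2 * A\<^sup>2 / real k"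
  have C: "C1 \<ge> 0" "C2 \<ge> 0" using M0 AB by (auto simp: C1_def C2_def)
  have C3: "C3 \<ge> 0" using C AB by (auto simp: C3_def)
  have s: "{A..B} \<subseteq> {0<..}" using AB by auto
  show ?thesis
  proof (intro exI[of _ "C3 * (B - A) / (2 * pi)"] conjI allI impI ballI)
    show "0 \<le> C3 * (B - A) / (2 * pi)" using C3 AB by auto
    fix t l s' :: real assume t: "1 \<le> t" and l: "2 * real k / A\<^sup>2 \<le> l" "l > 0" and s': "s' \<in> {l, - l}"
    have "cmod (integral {A..B} (\<lambda>v. \<Omega> t v * ee (t * (real k / v + s' * v)))) \<le> (C3 / l) * (B - A) / (2 * pi * t)"
    proof (rule nonstationary_bound[where \<theta>' = "\<lambda>v. s' - real k / v\<^sup>2" and \<theta>'' = "\<lambda>v. 2 * real k / v ^ 3" and \<Omega>' = "\<Omega>' t"])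
      show "A \<le> B" "0 < t" using AB t by auto
      show "\<Omega> t A = 0" "\<Omega> t B = 0" using \<Omega>_zero AB by auto
      show "continuous_on {A..B} (\<lambda>v. 2 * real k / v ^ 3)" using AB by (intro continuous_intros) auto
      show "continuous_on {A..B} (\<Omega>' t)" unfolding \<Omega>'_def divide_inverse using s
        by (intro continuous_intros continuous_on_subset[OF c0] continuous_on_subset[OF c1] continuous_on_subset[OF c2]) (use AB in auto)
    next
      fix v assume v: "v \<in> {A..B}"
      have v0: "v > 0" "A \<le> v" using v AB by auto
      show "((\<lambda>v. real k / v + s' * v) has_real_derivative s' - real k / v\<^sup>2) (at v within {A..B})"
        using v0 by (auto intro!: derivative_eq_intros simp: power2_eq_square)
      show "((\<lambda>v. s' - real k / v\<^sup>2) has_real_derivative 2 * real k / v ^ 3) (at v within {A..B})"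
        using v0 by (auto intro!: derivative_eq_intros simp: power2_eq_square power3_eq_cube mult_ac)
      show "(\<Omega> t has_vector_derivative \<Omega>' t v) (at v within {A..B})" by (rule \<Omega>_deriv[OF v0(1)])
      have A2: "A\<^sup>2 \<le> v\<^sup>2" "A ^ 3 \<le> v ^ 3" using v0 AB by (auto intro: power_mono)
      have kv: "real k / v\<^sup>2 \<le> real k / A\<^sup>2" using A2 AB v0 by (intro divide_left_mono) auto
      have th: "l / 2 \<le> \<bar>s' - real k / v\<^sup>2\<bar>"
      proof -
        have "2 * (real k / A\<^sup>2) \<le> l" using l by simp
        then have "real k / v\<^sup>2 \<le> l / 2" using kv by linarith
        moreover have "0 \<le> real k / v\<^sup>2" by simp
        moreover have "s' = l \<or> s' = - l" using s' by simp
        ultimately show ?thesis using l(2) by linarith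
      qed
      then show "s' - real k / v\<^sup>2 \<noteq> 0" using l(2) by auto
      have k3: "2 * real k / v ^ 3 \<le> 2 * real k / A ^ 3" using A2 AB v0 by (intro divide_left_mono) auto
      have o1: "cmod (\<Omega> t v) \<le> C1"
      proof -
        have "cmod (\<Omega> t v) \<le> \<bar>\<Phi>' v / t\<bar> + \<bar>2 * pi * real k / v\<^sup>2 * \<Phi> v\<bar>"
          unfolding \<Omega>_def by (rule order_trans[OF norm_triangle_ineq4]) (simp only: norm_mult norm_of_real norm_ii mult_1_right order.refl)
        also have "\<bar>\<Phi>' v / t\<bar> \<le> M / 1" unfolding abs_divide using M[OF v] t M0 by (intro frac_le) auto
        also have "\<bar>2 * pi * real k / v\<^sup>2 * \<Phi> v\<bar> \<le> 2 * pi * real k / A\<^sup>2 * M"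
          unfolding abs_mult using M[OF v] M0 A2 AB v0 by (intro mult_mono) (auto intro!: divide_left_mono)
        finally show ?thesis by (simp add: C1_def)
      qed
      have o2: "cmod (\<Omega>' t v) \<le> C2"
      proof -
        have "cmod (\<Omega>' t v) \<le> \<bar>\<Phi>'' v / t\<bar> + \<bar>2 * pi * real k * (\<Phi>' v / v\<^sup>2 - 2 * \<Phi> v / v ^ 3)\<bar>"
          unfolding \<Omega>'_def by (rule order_trans[OF norm_triangle_ineq4]) (simp only: norm_mult norm_of_real norm_ii mult_1_right order.refl)
        also have "\<bar>\<Phi>'' v / t\<bar> \<le> M / 1" unfolding abs_divide using M[OF v] t M0 by (intro frac_le) auto
        also have "\<bar>2 * pi * real k * (\<Phi>' v / v\<^sup>2 - 2 * \<Phi> v / v ^ 3)\<bar> \<le> 2 * pi * real k * (M / A\<^sup>2 + 2 * M / A ^ 3)"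
        proof -
          have "\<bar>\<Phi>' v / v\<^sup>2\<bar> \<le> M / A\<^sup>2" unfolding abs_divide using M[OF v] M0 A2 AB by (intro frac_le) auto
          moreover have "\<bar>2 * \<Phi> v / v ^ 3\<bar> \<le> 2 * M / A ^ 3" unfolding abs_divide using M[OF v] M0 A2 AB v0 by (intro frac_le) auto
          ultimately have "\<bar>\<Phi>' v / v\<^sup>2 - 2 * \<Phi> v / v ^ 3\<bar> \<le> M / A\<^sup>2 + 2 * M / A ^ 3" by linarith
          then show ?thesis unfolding abs_mult by (intro mult_mono) auto
        qed
        finally show ?thesis by (simp add: C2_def)
      qed
      have "cmod (\<Omega>' t v) / \<bar>s' - real k / v\<^sup>2\<bar> \<le> C2 / (l / 2)"
        using o2 th C l by (intro frac_le) auto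
      moreover have "cmod (\<Omega> t v) * \<bar>2 * real k / v ^ 3\<bar> / (s' - real k / v\<^sup>2)\<^sup>2 \<le> (C1 * (2 * real k / A ^ 3)) / ((l / 2) * (real k / A\<^sup>2))"
      proof (rule frac_le)
        show "cmod (\<Omega> t v) * \<bar>2 * real k / v ^ 3\<bar> \<le> C1 * (2 * real k / A ^ 3)"
          using o1 k3 C v0 by (intro mult_mono) auto
        have "2 * (real k / A\<^sup>2) \<le> l" using l by simp
        then have "real k / A\<^sup>2 \<le> l / 2" by linarith
        then have "(l / 2) * (real k / A\<^sup>2) \<le> (l / 2) * (l / 2)" using l by (intro mult_left_mono) auto
        also have "\<dots> \<le> \<bar>s' - real k / v\<^sup>2\<bar> * \<bar>s' - real k / v\<^sup>2\<bar>" using th l by (intro mult_mono) auto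
        finally show "(l / 2) * (real k / A\<^sup>2) \<le> (s' - real k / v\<^sup>2)\<^sup>2" by (simp add: power2_eq_square abs_mult_self_eq)
        show "0 < (l / 2) * (real k / A\<^sup>2)" using l k AB by auto
        show "0 \<le> C1 * (2 * real k / A ^ 3)" using C AB by auto
      qed
      moreover have "C2 / (l / 2) + (C1 * (2 * real k / A ^ 3)) / ((l / 2) * (real k / A\<^sup>2)) = C3 / l"
        using l k AB by (simp add: C3_def field_simps)
      ultimately show "cmod (\<Omega>' t v) / \<bar>s' - real k / v\<^sup>2\<bar> + cmod (\<Omega> t v) * \<bar>2 * real k / v ^ 3\<bar> / (s' - real k / v\<^sup>2)\<^sup>2 \<le> C3 / l"
        by linarith
    qed
    also have "\<dots> = C3 * (B - A) / (2 * pi) / (t * l)" using t l by (simp add: field_simps)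
    finally show "cmod (integral {A..B} (\<lambda>v. \<Omega> t v * ee (t * (real k / v + s' * v)))) \<le> C3 * (B - A) / (2 * pi) / (t * l)" .
  qed
qed

text \<open>Here -l - k/v^2 has two terms of the same sign, so it is at least k/B^2 in size. The
  case l = 0 covers the zero frequency.\<close>

lemma nonstationary_part:
  assumes l: "l \<ge> 0"
  shows "\<exists>C. \<forall>t>0. cmod (integral {A..B} (\<lambda>v. of_real (\<Phi> v) * ee (t * (real k / v + (- l) * v)))) \<le> C / t"
proof -
  obtain M where M0: "M \<ge> 0" and M: "\<And>v. v \<in> {A..B} \<Longrightarrow> \<bar>\<Phi> v\<bar> \<le> M \<and> \<bar>\<Phi>' v\<bar> \<le> M \<and> \<bar>\<Phi>'' v\<bar> \<le> M" using bounds by blast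
  define Q where "Q = M / (real k / B\<^sup>2) + M * (2 * real k / A ^ 3) / (real k / B\<^sup>2)\<^sup>2"
  have s: "{A..B} \<subseteq> {0<..}" using AB by auto
  show ?thesis
  proof (intro exI[of _ "Q * (B - A) / (2 * pi)"] allI impI)
    fix t :: real assume t: "t > 0"
    have "cmod (integral {A..B} (\<lambda>v. of_real (\<Phi> v) * ee (t * (real k / v + (- l) * v)))) \<le> Q * (B - A) / (2 * pi * t)"
    proof (rule nonstationary_bound[where \<theta>' = "\<lambda>v. - l - real k / v\<^sup>2" and \<theta>'' = "\<lambda>v. 2 * real k / v ^ 3" and \<Omega>' = "\<lambda>v. of_real (\<Phi>' v)"])
      show "A \<le> B" "0 < t" using AB t by auto
      show "complex_of_real (\<Phi> A) = 0" "complex_of_real (\<Phi> B) = 0" using zero[of A] zero[of B] AB by auto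
      show "continuous_on {A..B} (\<lambda>v. 2 * real k / v ^ 3)" using AB by (intro continuous_intros) auto
      show "continuous_on {A..B} (\<lambda>v. complex_of_real (\<Phi>' v))" by (intro continuous_on_of_real continuous_on_subset[OF c1 s])
    next
      fix v assume v: "v \<in> {A..B}"
      have v0: "v > 0" "A \<le> v" "v \<le> B" using v AB by auto
      show "((\<lambda>v. real k / v + (- l) * v) has_real_derivative - l - real k / v\<^sup>2) (at v within {A..B})"
        using v0 by (auto intro!: derivative_eq_intros simp: power2_eq_square)
      show "((\<lambda>v. - l - real k / v\<^sup>2) has_real_derivative 2 * real k / v ^ 3) (at v within {A..B})"
        using v0 by (auto intro!: derivative_eq_intros simp: power2_eq_square power3_eq_cube mult_ac)
      show "((\<lambda>v. complex_of_real (\<Phi> v)) has_vector_derivative of_real (\<Phi>' v)) (at v within {A..B})"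
        by (intro of_real_has_vector_derivative has_field_derivative_at_within[OF d1[OF v0(1)]])
      have A2: "A ^ 3 \<le> v ^ 3" "v\<^sup>2 \<le> B\<^sup>2" using v0 AB by (auto intro: power_mono)
      have kB: "0 < real k / B\<^sup>2" using k AB by auto
      have th: "real k / B\<^sup>2 \<le> \<bar>- l - real k / v\<^sup>2\<bar>"
      proof -
        have "real k / B\<^sup>2 \<le> real k / v\<^sup>2" using A2 v0 by (intro divide_left_mono) auto
        then show ?thesis using l kB by linarith
      qed
      then show "- l - real k / v\<^sup>2 \<noteq> 0" using kB by auto
      have k3: "2 * real k / v ^ 3 \<le> 2 * real k / A ^ 3" using A2 AB v0 by (intro divide_left_mono) auto
      have "cmod (of_real (\<Phi>' v)) / \<bar>- l - real k / v\<^sup>2\<bar> \<le> M / (real k / B\<^sup>2)"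
        using M[OF v] M0 th kB by (intro frac_le) auto
      moreover have "cmod (of_real (\<Phi> v)) * \<bar>2 * real k / v ^ 3\<bar> / (- l - real k / v\<^sup>2)\<^sup>2 \<le> M * (2 * real k / A ^ 3) / (real k / B\<^sup>2)\<^sup>2"
      proof (rule frac_le)
        show "cmod (of_real (\<Phi> v)) * \<bar>2 * real k / v ^ 3\<bar> \<le> M * (2 * real k / A ^ 3)"
          using M[OF v] k3 M0 v0 by (intro mult_mono) auto
        show "(real k / B\<^sup>2)\<^sup>2 \<le> (- l - real k / v\<^sup>2)\<^sup>2"
          using power_mono[OF th, of 2] kB by (simp only: power2_abs)
        show "0 < (real k / B\<^sup>2)\<^sup>2" by (rule zero_less_power[OF kB])
        show "0 \<le> M * (2 * real k / A ^ 3)" using M0 AB by auto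
      qed
      ultimately show "cmod (of_real (\<Phi>' v)) / \<bar>- l - real k / v\<^sup>2\<bar> + cmod (of_real (\<Phi> v)) * \<bar>2 * real k / v ^ 3\<bar> / (- l - real k / v\<^sup>2)\<^sup>2 \<le> Q"
        unfolding Q_def by linarith
    qed
    then show "cmod (integral {A..B} (\<lambda>v. of_real (\<Phi> v) * ee (t * (real k / v + (- l) * v)))) \<le> Q * (B - A) / (2 * pi) / t"
      by simp
  qed
qed

definition osc :: "nat \<Rightarrow> real \<Rightarrow> real \<Rightarrow> complex" where
  "osc N t s = integral {1..real N} (\<lambda>u. f t u * ee (s * u))"

lemma osc_scale:
  assumes "1 \<le> p * t" "q * t \<le> real N" "0 < A'" "A' \<le> p" "q \<le> B'"
  shows "osc N t s = of_real t * integral {A'..B'} (\<lambda>v. of_real (\<Phi> v) * ee (t * (real k / v + s * v)))"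
  unfolding osc_def f_def
  by (rule scale) (use zero AB assms in \<open>auto intro!: continuous_intros c0\<close>)

lemma cont_f: "t > 0 \<Longrightarrow> continuous_on {1..real N} (f t)"
  by (rule continuous_on_vector_derivative) (rule f_deriv, auto)

lemma cont_f': "t > 0 \<Longrightarrow> continuous_on {1..real N} (f' t)"
  unfolding f'_def
  by (intro continuous_intros continuous_on_compose2[OF cont_\<Omega>]) (auto intro: less_le_trans[of 0 "1 / t"])

definition J :: "nat \<Rightarrow> real \<Rightarrow> nat \<Rightarrow> complex" where
  "J N t l = integral {1..real N} (\<lambda>u. of_real (sin (2 * pi * (real l * u)) / (pi * real l)) * f' t u)"

lemma f_ends:
  assumes "1 \<le> p * t" "q * t \<le> real N"
  shows "f t 1 = 0" "f t (real N) = 0" "t > 0" "N \<ge> 1"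
proof -
  show t: "t > 0" using assms(1) AB by (metis less_le_trans less_trans mult_nonneg_nonpos not_less zero_less_one less_imp_le order.trans)
  have "1 / t \<le> p" using assms t by (simp add: field_simps)
  then have "1 / t \<le> a" using AB by linarith
  then show "f t 1 = 0" using zero[of "1 / t"] t by (simp add: f_def)
  have "q \<le> real N / t" using assms t by (simp add: field_simps)
  then have "b \<le> real N / t" "0 < real N / t" using AB a ab by linarith+
  then show "f t (real N) = 0" using zero[of "real N / t"] by (simp add: f_def)
  show "N \<ge> 1" using \<open>0 < real N / t\<close> by (cases N) auto
qed

lemma J_parts:
  assumes "1 \<le> p * t" "q * t \<le> real N" and l: "l \<ge> 1"
  shows "J N t l = - (osc N t (real l) + osc N t (- real l))"
proof -
  note e = f_ends[OF assms(1,2)]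
  have N1: "1 \<le> real N" using e(4) by simp
  define Q where "Q = (\<lambda>u. complex_of_real (sin (2 * pi * (real l * u)) / (pi * real l)))"
  define Q' where "Q' = (\<lambda>u. complex_of_real (2 * cos (2 * pi * (real l * u))))"
  have "J N t l = integral {1..real N} (\<lambda>u. Q u * f' t u)" by (simp only: J_def Q_def)
  also have "\<dots> = Q (real N) * f t (real N) - Q 1 * f t 1 - integral {1..real N} (\<lambda>u. Q' u * f t u)"
  proof (rule integral_parts[where q = Q and q' = Q' and P = "f t" and P' = "f' t"])
    fix u assume u: "u \<in> {1..real N}"
    show "(Q has_vector_derivative Q' u) (at u within {1..real N})" unfolding Q_def Q'_def
      by (rule of_real_has_vector_derivative) (use l in \<open>auto intro!: derivative_eq_intros\<close>)
    show "(f t has_vector_derivative f' t u) (at u within {1..real N})" using u by (intro f_deriv e(3)) auto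
  next
    show "continuous_on {1..real N} Q'" unfolding Q'_def by (intro continuous_intros)
    show "continuous_on {1..real N} (f' t)" by (rule cont_f'[OF e(3)])
  qed (rule N1)
  also have "\<dots> = - integral {1..real N} (\<lambda>u. f t u * ee (real l * u) + f t u * ee (- real l * u))"
  proof -
    have "Q' u = ee (real l * u) + ee (- real l * u)" for u
      unfolding Q'_def ee_def by (simp add: complex_eq_iff)
    then show ?thesis using e by (simp add: algebra_simps)
  qed
  also have "integral {1..real N} (\<lambda>u. f t u * ee (real l * u) + f t u * ee (- real l * u)) = osc N t (real l) + osc N t (- real l)"
    unfolding osc_def
    by (rule integral_add) (intro integrable_continuous_real continuous_intros cont_f[OF e(3)])+
  finally show ?thesis .
qed

text \<open>One factor 1/l is the Fourier coefficient of the sawtooth, the other comes from the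
  nonstationary phase. The resulting decay makes the sum over l converge uniformly in t.\<close>

lemma J_bound:
  "\<exists>C\<ge>0. \<forall>t N l. 1 \<le> t \<longrightarrow> 1 \<le> p * t \<longrightarrow> q * t \<le> real N \<longrightarrow> 1 \<le> l \<longrightarrow> real l \<ge> 2 * real k / A\<^sup>2 \<longrightarrow> cmod (J N t l) \<le> C / (real l)\<^sup>2"
proof -
  obtain C where C0: "C \<ge> 0" and C: "\<And>t l s. t \<ge> 1 \<Longrightarrow> l \<ge> 2 * real k / A\<^sup>2 \<Longrightarrow> l > 0 \<Longrightarrow> s \<in> {l, - l} \<Longrightarrow>
     cmod (integral {A..B} (\<lambda>v. \<Omega> t v * ee (t * (real k / v + s * v)))) \<le> C / (t * l)"
    using tail_bound by blast
  show ?thesis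
  proof (intro exI[of _ C] conjI allI impI C0)
    fix t N and l :: nat assume t: "1 \<le> t" "1 \<le> p * t" "q * t \<le> real N" and l: "1 \<le> l" "real l \<ge> 2 * real k / A\<^sup>2"
    define E where "E = (\<lambda>s. integral {1..real N} (\<lambda>u. f' t u * ee (s * u)))"
    have E: "cmod (E s) \<le> C / real l" if s: "s \<in> {real l, - real l}" for s
    proof -
      have "E s = of_real t * integral {A..B} (\<lambda>v. \<Omega> t v * ee (t * (real k / v + s * v)))"
        unfolding E_def f'_def
        by (rule scale) (use \<Omega>_zero AB t cont_\<Omega> in auto)
      then have "cmod (E s) = t * cmod (integral {A..B} (\<lambda>v. \<Omega> t v * ee (t * (real k / v + s * v))))"
        using t by (simp add: norm_mult)
      also have "\<dots> \<le> t * (C / (t * real l))" using C[OF t(1) l(2) _ s] l t by (intro mult_left_mono) auto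
      also have "\<dots> = C / real l" using t by simp
      finally show ?thesis .
    qed
    have "J N t l = (E (real l) - E (- real l)) / (of_real (2 * pi * real l) * \<i>)"
    proof -
      have i: "(\<lambda>u. f' t u * ee (s * u)) integrable_on {1..real N}" for s
        using t by (intro integrable_continuous_real continuous_intros cont_f') auto
      have "J N t l = integral {1..real N} (\<lambda>u. (f' t u * ee (real l * u) - f' t u * ee (- real l * u)) / (of_real (2 * pi * real l) * \<i>))"
        unfolding J_def
      proof (rule integral_cong)
        fix u
        have "complex_of_real (sin (2 * pi * (real l * u))) * (2 * \<i>) = ee (real l * u) - ee (- real l * u)"
          unfolding ee_def by (simp add: complex_eq_iff)
        then have "complex_of_real (sin (2 * pi * (real l * u)) / (pi * real l)) = (ee (real l * u) - ee (- real l * u)) / (of_real (2 * pi * real l) * \<i>)"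
          using l by (simp add: field_simps)
        then show "complex_of_real (sin (2 * pi * (real l * u)) / (pi * real l)) * f' t u = (f' t u * ee (real l * u) - f' t u * ee (- real l * u)) / (of_real (2 * pi * real l) * \<i>)"
        proof -
          have "(x - y) / c * F = (F * x - F * y) / c" for x y c F :: complex
            by (simp add: algebra_simps diff_divide_distrib)
          then show ?thesis using \<open>complex_of_real (sin (2 * pi * (real l * u)) / (pi * real l)) = _\<close> by (simp only:)
        qed
      qed
      also have "\<dots> = (E (real l) - E (- real l)) / (of_real (2 * pi * real l) * \<i>)"
        unfolding integral_divide E_def integral_diff[OF i i] ..
      finally show ?thesis .
    qed
    then have "cmod (J N t l) = cmod (E (real l) - E (- real l)) / (2 * pi * real l)"
      by (simp add: norm_divide norm_mult)
    also have "\<dots> \<le> (C / real l + C / real l) / (2 * pi * real l)"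
      by (intro divide_right_mono order_trans[OF norm_triangle_ineq4] add_mono E) auto
    also have "\<dots> = C / (real l)\<^sup>2 / pi" using l by (simp add: field_simps power2_eq_square)
    also have "\<dots> \<le> C / (real l)\<^sup>2 / 1" using C0 pi_ge_two by (intro divide_left_mono) auto
    finally show "cmod (J N t l) \<le> C / (real l)\<^sup>2" by simp
  qed
qed

text \<open>The zero and negative frequencies up to L are bounded one by one, and the frequencies
  beyond L sum to at most 2C. The error is O(1), while the positive frequencies up to L may
  contribute terms of size sqrt t.\<close>

lemma poisson_truncated:
  assumes L: "real L \<ge> 2 * real k / A\<^sup>2"
  shows "\<exists>K. \<forall>t N. 1 \<le> t \<longrightarrow> 1 \<le> p * t \<longrightarrow> q * t \<le> real N \<longrightarrow> cmod ((\<Sum>n=1..N. f t (real n)) - (\<Sum>l=1..L. osc N t (real l))) \<le> K"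
proof -
  obtain C where C0: "C \<ge> 0" and C: "\<And>t N l. 1 \<le> t \<Longrightarrow> 1 \<le> p * t \<Longrightarrow> q * t \<le> real N \<Longrightarrow> 1 \<le> l \<Longrightarrow> real l \<ge> 2 * real k / A\<^sup>2 \<Longrightarrow> cmod (J N t l) \<le> C / (real l)\<^sup>2"
    using J_bound by blast
  have "\<forall>l::nat. \<exists>D. \<forall>t>0. cmod (integral {A..B} (\<lambda>v. of_real (\<Phi> v) * ee (t * (real k / v + (- real l) * v)))) \<le> D / t"
    using nonstationary_part by simp
  then obtain D where D: "\<And>l t. t > 0 \<Longrightarrow> cmod (integral {A..B} (\<lambda>v. of_real (\<Phi> v) * ee (t * (real k / v + (- real l) * v)))) \<le> D l / t"
    by metis
  show ?thesis
  proof (intro exI[of _ "D 0 + (\<Sum>l=1..L. D l) + 2 * C"] allI impI)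
    fix t N assume t: "1 \<le> t" "1 \<le> p * t" "q * t \<le> real N"
    have oscD: "cmod (osc N t (- real l)) \<le> D l" for l
    proof -
      have "cmod (osc N t (- real l)) = t * cmod (integral {A..B} (\<lambda>v. of_real (\<Phi> v) * ee (t * (real k / v + (- real l) * v))))"
        using osc_scale[OF t(2,3), of A B "- real l"] AB t by (simp add: norm_mult)
      also have "\<dots> \<le> t * (D l / t)" using D[of t l] t by (intro mult_left_mono) auto
      finally show ?thesis using t by simp
    qed
    have I0: "integral {1..real N} (f t) = osc N t (- real 0)" by (simp add: osc_def)
    have lim: "(\<lambda>m. integral {1..real N} (f t) - (\<Sum>l=1..m. J N t l)) \<longlonglongrightarrow> (\<Sum>n=1..N. f t (real n))"
      unfolding J_def
      by (rule poisson_summation) (use f_ends[OF t(2,3)] f_deriv cont_f' in auto)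
    show "cmod ((\<Sum>n=1..N. f t (real n)) - (\<Sum>l=1..L. osc N t (real l))) \<le> D 0 + (\<Sum>l=1..L. D l) + 2 * C"
    proof (rule tendsto_upperbound)
      show "(\<lambda>m. cmod (integral {1..real N} (f t) - (\<Sum>l=1..m. J N t l) - (\<Sum>l=1..L. osc N t (real l)))) \<longlonglongrightarrow> cmod ((\<Sum>n=1..N. f t (real n)) - (\<Sum>l=1..L. osc N t (real l)))"
        by (intro tendsto_intros lim)
      show "\<forall>\<^sub>F m in sequentially. cmod (integral {1..real N} (f t) - (\<Sum>l=1..m. J N t l) - (\<Sum>l=1..L. osc N t (real l))) \<le> D 0 + (\<Sum>l=1..L. D l) + 2 * C"
        using eventually_ge_at_top[of L]
      proof eventually_elim
        case (elim m)
        have split: "(\<Sum>l=1..m. J N t l) = (\<Sum>l=1..L. J N t l) + (\<Sum>l=L+1..m. J N t l)"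
        proof -
          obtain d where "m = L + d" using elim le_Suc_ex by blast
          then show ?thesis using sum.ub_add_nat[of 1 L "J N t" d] by simp
        qed
        have "(\<Sum>l=1..L. J N t l) = (\<Sum>l=1..L. - (osc N t (real l) + osc N t (- real l)))"
          by (intro sum.cong refl J_parts t) auto
        also have "\<dots> = - (\<Sum>l=1..L. osc N t (real l)) - (\<Sum>l=1..L. osc N t (- real l))"
          by (simp only: sum_negf sum.distrib minus_add_distrib) simp
        finally have "integral {1..real N} (f t) - (\<Sum>l=1..m. J N t l) - (\<Sum>l=1..L. osc N t (real l))
           = osc N t (- real 0) + (\<Sum>l=1..L. osc N t (- real l)) - (\<Sum>l=L+1..m. J N t l)"
          unfolding split I0 by simp
        also have "cmod \<dots> \<le> cmod (osc N t (- real 0)) + cmod (\<Sum>l=1..L. osc N t (- real l)) + cmod (\<Sum>l=L+1..m. J N t l)"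
          by (intro order_trans[OF norm_triangle_ineq4] add_mono norm_triangle_ineq order.refl)
        also have "cmod (\<Sum>l=1..L. osc N t (- real l)) \<le> (\<Sum>l=1..L. D l)"
          by (intro order_trans[OF norm_sum] sum_mono oscD)
        also have "cmod (\<Sum>l=L+1..m. J N t l) \<le> 2 * C"
        proof -
          have "cmod (\<Sum>l=L+1..m. J N t l) \<le> (\<Sum>l=L+1..m. C / (real l)\<^sup>2)"
          proof (intro order_trans[OF norm_sum] sum_mono C t)
            fix l assume "l \<in> {L+1..m}"
            then show "1 \<le> l" "real l \<ge> 2 * real k / A\<^sup>2" using L by auto
          qed
          also have "\<dots> \<le> (\<Sum>l=1..m. C / (real l)\<^sup>2)" using C0 by (intro sum_mono2) auto
          also have "\<dots> = C * (\<Sum>l=1..m. 1 / (real l)\<^sup>2)" by (simp add: sum_distrib_left)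
          also have "\<dots> \<le> C * 2"
          proof (rule mult_left_mono[OF _ C0])
            have "0 \<le> 1 / real m" by simp
            then show "(\<Sum>l=1..m. 1 / (real l)\<^sup>2) \<le> 2" using sum_inverse_squares_le[of m] by linarith
          qed
          finally show ?thesis by simp
        qed
        finally show ?case using oscD[of 0] by simp
      qed
    qed simp
  qed
qed

text \<open>The van der Corput B-process: only the dual frequencies with a stationary point in the
  support of the amplitude contribute.\<close>

theorem b_process:
  assumes L: "real L \<ge> 2 * real k / A\<^sup>2" and N: "\<And>t. q * t \<le> real (N t)"
  shows "((\<lambda>t. (\<Sum>n=1..N t. f t (real n)) / of_real (sqrt t) -
     (\<Sum>l=1..L. of_real (\<Phi> (sqrt (real k / real l)) * (real k powr (1/4) * real l powr (-3/4))) * (2 * Fres) * ee (2 * sqrt (real k * real l) * t))) \<longlongrightarrow> 0) at_top"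
proof -
  obtain K where K: "\<And>t N. 1 \<le> t \<Longrightarrow> 1 \<le> p * t \<Longrightarrow> q * t \<le> real N \<Longrightarrow> cmod ((\<Sum>n=1..N. f t (real n)) - (\<Sum>l=1..L. osc N t (real l))) \<le> K"
    using poisson_truncated[OF L] by blast
  have large: "\<forall>\<^sub>F t in at_top. 1 \<le> t \<and> 1 \<le> p * t"
    using eventually_ge_at_top[of "max 1 (1 / p)"]
  proof eventually_elim
    case (elim t)
    then have "1 / p \<le> t" "1 \<le> t" by auto
    then show ?case using AB by (simp add: field_simps)
  qed
  define R where "R = (\<lambda>t. ((\<Sum>n=1..N t. f t (real n)) - (\<Sum>l=1..L. osc (N t) t (real l))) / of_real (sqrt t))"
  have R: "(R \<longlongrightarrow> 0) at_top"
  proof (rule Lim_null_comparison)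
    show "\<forall>\<^sub>F t in at_top. norm (R t) \<le> K / sqrt t"
      using large
    proof eventually_elim
      case (elim t)
      then show ?case unfolding R_def norm_divide using K[of t "N t"] N by (simp add: divide_right_mono)
    qed
    show "((\<lambda>t. K / sqrt t) \<longlongrightarrow> 0) at_top" by real_asymp
  qed
  define c where "c = (\<lambda>l t. of_real (\<Phi> (sqrt (real k / real l)) * (real k powr (1/4) * real l powr (-3/4))) * (2 * Fres) * ee (2 * sqrt (real k * real l) * t))"
  have S: "((\<lambda>t. osc (N t) t (real l) / of_real (sqrt t) - c l t) \<longlongrightarrow> 0) at_top" if l: "l \<in> {1..L}" for l
  proof -
    define w where "w = sqrt (real k / real l)"
    \<comment> \<open>The interval is widened to contain the point w = sqrt(k/l) even when it lies
      outside the support, so that one lemma serves every l; in that case the value of the amplitude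
      at w is simply 0.\<close>
    define A' where "A' = min (a / 2) (w / 2)"
    define B' where "B' = max B (w + 1)"
    have v0: "w > 0" using k l by (simp add: w_def)
    have A': "0 < A'" "A' \<le> p" "A' < a" "A' < w" using v0 a by (auto simp: A'_def p_def)
    have B': "q \<le> B'" "b < B'" "w < B'" using AB by (auto simp: B'_def)
    have "((\<lambda>t. of_real (sqrt t) * integral {A'..B'} (\<lambda>v. of_real (\<Phi> v) * ee (t * (real k / v + real l * v))) - c l t) \<longlongrightarrow> 0) at_top"
      unfolding c_def
    proof (rule stationary_phase[where \<Phi>' = \<Phi>'])
      show "(\<Phi> has_real_derivative \<Phi>' v) (at v within {A'..B'})" if "v \<in> {A'..B'}" for v
        using that A' by (intro has_field_derivative_at_within[OF d1]) auto
      show "continuous_on {A'..B'} \<Phi>'" by (rule continuous_on_subset[OF c1]) (use A' in auto)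
      show "\<Phi> A' = 0" "\<Phi> B' = 0" using zero[of A'] zero[of B'] A' B' v0 by auto
    qed (use k l A' B' w_def in auto)
    then show ?thesis
    proof (rule Lim_transform_eventually)
      show "\<forall>\<^sub>F t in at_top. of_real (sqrt t) * integral {A'..B'} (\<lambda>v. of_real (\<Phi> v) * ee (t * (real k / v + real l * v))) - c l t
         = osc (N t) t (real l) / of_real (sqrt t) - c l t"
        using large
      proof eventually_elim
        case (elim t)
        have st: "complex_of_real t = of_real (sqrt t) * of_real (sqrt t)" "sqrt t \<noteq> 0"
          using elim by (simp_all flip: of_real_mult)
        have "osc (N t) t (real l) = of_real (sqrt t) * (of_real (sqrt t) * integral {A'..B'} (\<lambda>v. of_real (\<Phi> v) * ee (t * (real k / v + real l * v))))"
          using osc_scale[of t "N t" A' B' "real l"] elim N[of t] A' B' by (simp only: st(1) mult.assoc)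
        then show ?case using st(2) by simp
      qed
    qed
  qed
  have "((\<lambda>t. R t + (\<Sum>l=1..L. (osc (N t) t (real l) / of_real (sqrt t) - c l t))) \<longlongrightarrow> 0 + (\<Sum>l=1..L. 0)) at_top"
    by (intro tendsto_add R tendsto_sum S)
  moreover have "R t + (\<Sum>l=1..L. (osc (N t) t (real l) / of_real (sqrt t) - c l t)) = (\<Sum>n=1..N t. f t (real n)) / of_real (sqrt t) - (\<Sum>l=1..L. c l t)" for t
    by (simp add: R_def sum_subtractf diff_divide_distrib sum_divide_distrib)
  ultimately show ?thesis unfolding c_def by simp
qed

end

section \<open>Mean square approximation of the divisor problem\<close>

lemma summable_tail_le:
  fixes f :: "'a \<Rightarrow> real"
  assumes "f summable_on A" "\<And>x. x \<in> A \<Longrightarrow> f x \<ge> 0" "e > 0"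
  obtains F where "finite F" "F \<subseteq> A" "\<And>S. finite S \<Longrightarrow> S \<subseteq> A - F \<Longrightarrow> sum f S \<le> e"
proof -
  obtain T where T: "(f has_sum T) A" using assms(1) by (auto simp: summable_on_def)
  obtain F where F: "finite F" "F \<subseteq> A" "dist (sum f F) T \<le> e"
    using has_sum_finite_approximation[OF T assms(3)] by blast
  have "sum f S \<le> e" if S: "finite S" "S \<subseteq> A - F" for S
  proof -
    have "sum f F + sum f S = sum f (F \<union> S)" using F S by (intro sum.union_disjoint[symmetric]) auto
    also have "\<dots> \<le> T" by (rule finite_sum_le_has_sum[OF T]) (use F S assms(2) in auto)
    finally show ?thesis using F(3) by (simp add: dist_real_def)
  qed
  then show ?thesis using that F by blast
qed

lemma gcd_weight_nonneg: "gcd_weight k l \<ge> 0"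
  by (simp add: gcd_weight_def)

lemma gcd_weight_bounded:
  "\<exists>T\<ge>0. \<forall>S. finite S \<longrightarrow> S \<subseteq> {0<..} \<longrightarrow> (\<Sum>k\<in>S. \<Sum>l\<in>S. gcd_weight k l) \<le> T"
proof -
  obtain T where T: "((\<lambda>(k,l). gcd_weight k l) has_sum T) ({0<..} \<times> {0<..})"
    using gcd_weight_summable by (auto simp: summable_on_def)
  have "(\<Sum>k\<in>S. \<Sum>l\<in>S. gcd_weight k l) \<le> T" if "finite S" "S \<subseteq> {0<..}" for S
    unfolding sum.cartesian_product
    by (rule finite_sum_le_has_sum[OF T]) (use that gcd_weight_nonneg in auto)
  from this this[of "{}"] show ?thesis by auto
qed

lemma gcd_weight_tail:
  assumes "e > 0"
  shows "\<exists>K0. \<forall>K\<ge>K0. \<forall>S. finite S \<longrightarrow> S \<subseteq> {K<..} \<longrightarrow> (\<Sum>k\<in>S. \<Sum>l\<in>S. gcd_weight k l) \<le> e"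
proof -
  obtain F where F: "finite F" "F \<subseteq> {0<..} \<times> {0<..}"
    and tail: "\<And>S. finite S \<Longrightarrow> S \<subseteq> {0<..} \<times> {0<..} - F \<Longrightarrow> sum (\<lambda>(k,l). gcd_weight k l) S \<le> e"
    using summable_tail_le[OF gcd_weight_summable _ assms] gcd_weight_nonneg by (auto simp: split_beta)
  obtain K0 where K0: "\<forall>x\<in>fst ` F. x \<le> K0" using F(1) finite_nat_set_iff_bounded_le by (metis finite_imageI)
  show ?thesis
  proof (intro exI[of _ K0] allI impI)
    fix K S assume "K0 \<le> K" "finite S" "S \<subseteq> {K<..}"
    then show "(\<Sum>k\<in>S. \<Sum>l\<in>S. gcd_weight k l) \<le> e"
      unfolding sum.cartesian_product using K0 by (intro tail) force+
  qed
qed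

lemma sum_inverse_le_ln:
  assumes "m \<ge> 1" shows "(\<Sum>k=1..m. 1 / real k) \<le> 1 + ln (real m)"
proof -
  have "harm m - ln (of_nat m) \<le> harm 1 - ln (of_nat 1 :: real)"
    by (rule euler_mascheroni_sequence_decreasing) (use assms in auto)
  then have "harm m \<le> 1 + ln (real m)" by (simp add: harm_def)
  then show ?thesis by (simp add: harm_def divide_inverse)
qed

lemma integral_stretch_pos:
  fixes h :: "real \<Rightarrow> real"
  assumes h: "h integrable_on {c * a..c * b}" and c: "c > 0"
  shows "integral {a..b} (\<lambda>y. h (c * y)) = integral {c * a..c * b} h / c"
    and "(\<lambda>y. h (c * y)) integrable_on {a..b}"
proof -
  have "((\<lambda>x. h (c *\<^sub>R x + 0)) has_integral (1 / \<bar>c\<bar> ^ DIM(real)) *\<^sub>R integral {c * a..c * b} h) ((\<lambda>x. (1 / c) *\<^sub>R x + - ((1 / c) *\<^sub>R 0)) ` cbox (c * a) (c * b))"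
    by (rule has_integral_affinity) (use h c in \<open>auto simp: cbox_interval\<close>)
  moreover have "(\<lambda>x. (1 / c) *\<^sub>R x + - ((1 / c) *\<^sub>R 0)) ` cbox (c * a) (c * b) = {a..b}"
  proof (intro set_eqI iffI)
    fix x assume "x \<in> {a..b}"
    then show "x \<in> (\<lambda>x. (1 / c) *\<^sub>R x + - ((1 / c) *\<^sub>R 0)) ` cbox (c * a) (c * b)"
      using c by (intro image_eqI[of _ _ "c * x"]) (auto simp: cbox_interval)
  qed (use c in \<open>auto simp: cbox_interval field_simps\<close>)
  ultimately have "((\<lambda>y. h (c * y)) has_integral integral {c * a..c * b} h / c) {a..b}" using c by simp
  then show "integral {a..b} (\<lambda>y. h (c * y)) = integral {c * a..c * b} h / c"
    and "(\<lambda>y. h (c * y)) integrable_on {a..b}" by (auto simp: has_integral_iff)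
qed

lemma integral_window:
  fixes h :: "real \<Rightarrow> real"
  assumes h: "h integrable_on {X..2 * X}" and X: "X > 0"
  shows "integral {X..2 * X} h = X * integral {1..2} (\<lambda>y. h (X * y))"
  using integral_stretch_pos(1)[of h X 1 2] h X by (simp add: mult.commute)

lemma integrable_measurable_mult:
  fixes h :: "real \<Rightarrow> real"
  assumes "continuous_on {a..b} h" "\<phi> \<in> borel_measurable borel" "\<And>u. \<bar>\<phi> u\<bar> \<le> B"
  shows "(\<lambda>u. \<phi> u * h u) integrable_on {a..b}"
proof -
  have "(\<lambda>u. of_real (\<phi> u) * complex_of_real (h u)) integrable_on {a..b}"
    by (rule integrable_psi_mult[OF _ assms(2,3)]) (intro continuous_on_of_real assms(1))
  from integrable_linear[OF this bounded_linear_Re] show ?thesis by (simp add: o_def)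
qed

section \<open>Bounding the discarded frequencies on a dyadic window\<close>

definition rest_sum :: "(real \<Rightarrow> real) \<Rightarrow> nat \<Rightarrow> nat \<Rightarrow> real \<Rightarrow> real" where
  "rest_sum \<Theta> K N x = (\<Sum>n=1..N. \<Theta> (x / (real n)\<^sup>2) * sine_rest K (x / real n))"

lemma integrable_rest_sum:
  assumes \<Theta>: "amp B \<Theta>" and a: "a > 0" and X: "X > 0"
  shows "(\<lambda>y. (rest_sum \<Theta> K N (X * y))\<^sup>2) integrable_on {a..b}"
proof -
  have eq: "(rest_sum \<Theta> K N (X * y))\<^sup>2 = (\<Sum>n=1..N. \<Sum>m=1..N. (sine_rest K (X * y / real n) * sine_rest K (X * y / real m)) * (\<Theta> (X * y / (real n)\<^sup>2) * \<Theta> (X * y / (real m)\<^sup>2)))" for y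
    unfolding rest_sum_def power2_eq_square sum_product by (intro sum.cong refl) (simp add: mult_ac)
  have c: "continuous_on {a..b} (\<lambda>y. \<Theta> (X * y / (real n)\<^sup>2))" if "n \<in> {1..N}" for n
    by (rule continuous_on_compose2[OF amp_continuous[OF \<Theta>]]) (use that a X in \<open>auto intro!: continuous_intros\<close>)
  show ?thesis unfolding eq
  proof (intro integrable_sum integrable_measurable_mult[where B = "(real K + 1) * (real K + 1)"])
    fix n m assume "n \<in> {1..N}" "m \<in> {1..N}"
    then show "continuous_on {a..b} (\<lambda>y. \<Theta> (X * y / (real n)\<^sup>2) * \<Theta> (X * y / (real m)\<^sup>2))"
      by (intro continuous_on_mult c)
    show "(\<lambda>y. sine_rest K (X * y / real n) * sine_rest K (X * y / real m)) \<in> borel_measurable borel" by measurable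
    show "\<bar>sine_rest K (X * u / real n) * sine_rest K (X * u / real m)\<bar> \<le> (real K + 1) * (real K + 1)" for u
      unfolding abs_mult by (intro mult_mono sine_rest_bound) auto
  qed auto
qed

text \<open>Frequencies between K and about X fall under \<open>mean_square_bound\<close>; beyond X
  the mean square of the Fourier remainder is so small that Cauchy-Schwarz over n suffices. The
  bound is small in two situations: G small with z0 = 1/2, or z0 large with G merely
  bounded.\<close>

lemma rest_mean_square:
  "\<exists>C>0. \<forall>\<Theta> (B::real) (z0::real) K (X::real) N G. amp B \<Theta> \<longrightarrow> (\<forall>z. 0 < z \<longrightarrow> z < z0 \<longrightarrow> \<Theta> z = 0) \<longrightarrow> 1/2 \<le> z0 \<longrightarrow> 1 \<le> X \<longrightarrow>
     real K \<le> X \<longrightarrow> real N \<le> 4 * sqrt X \<longrightarrow> (\<forall>S. finite S \<longrightarrow> S \<subseteq> {K<..} \<longrightarrow> (\<Sum>k\<in>S. \<Sum>l\<in>S. gcd_weight k l) \<le> G) \<longrightarrow>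
     integral {1..2} (\<lambda>y. (rest_sum \<Theta> K N (X * y))\<^sup>2) \<le> C * B\<^sup>2 * (sqrt (X / z0) * G + (3 + ln X)\<^sup>2)"
proof -
  obtain C0 where C0: "C0 > 0" and ms: "\<And>\<Theta> B z0 S X N. amp B \<Theta> \<Longrightarrow> (\<forall>z. 0 < z \<longrightarrow> z < z0 \<longrightarrow> \<Theta> z = 0) \<Longrightarrow> 1/2 \<le> z0 \<Longrightarrow> 1 \<le> X \<Longrightarrow>
     finite S \<Longrightarrow> S \<subseteq> {1..} \<Longrightarrow>
     integral {1..2} (\<lambda>y. (\<Sum>n=1..N. \<Theta> (X * y / (real n)\<^sup>2) * (\<Sum>k\<in>S. sin (2 * pi * (real k * (X * y / real n))) / (pi * real k)))\<^sup>2)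
       \<le> C0 * B\<^sup>2 * (sqrt (X / z0) * (\<Sum>k\<in>S. \<Sum>l\<in>S. gcd_weight k l) + (\<Sum>k\<in>S. 1 / real k)\<^sup>2)"
    using mean_square_bound by blast
  show ?thesis
  proof (intro exI[of _ "2 * C0 + 32"] conjI allI impI)
    show "0 < 2 * C0 + 32" using C0 by simp
    fix \<Theta> and B z0 X G :: real and K N :: nat
    assume \<Theta>: "amp B \<Theta>" and \<Theta>0: "\<forall>z. 0 < z \<longrightarrow> z < z0 \<longrightarrow> \<Theta> z = 0" and z0: "1/2 \<le> z0" and X: "1 \<le> X"
      and K: "real K \<le> X" and N: "real N \<le> 4 * sqrt X" and G: "\<forall>S. finite S \<longrightarrow> S \<subseteq> {K<..} \<longrightarrow> (\<Sum>k\<in>S. \<Sum>l\<in>S. gcd_weight k l) \<le> G"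
    have G0: "G \<ge> 0" using G[rule_format, of "{}"] by simp
    \<comment> \<open>After m frequencies the remainder has mean square at most 1/X for each n;
      Cauchy-Schwarz costs N^2 <= 16 X, so the total is bounded.\<close>
    define m where "m = nat \<lceil>X\<rceil>"
    have m: "m \<ge> 1" "K \<le> m" "real m \<le> 2 * X" "X \<le> real m" using X K unfolding m_def by linarith+
    define S where "S = {K+1..m}"
    define F1 where "F1 = (\<lambda>y. \<Sum>n=1..N. \<Theta> (X * y / (real n)\<^sup>2) * (\<Sum>k\<in>S. sin (2 * pi * (real k * (X * y / real n))) / (pi * real k)))"
    define F2 where "F2 = (\<lambda>y. rest_sum \<Theta> m N (X * y))"
    have split: "rest_sum \<Theta> K N (X * y) = F1 y + F2 y" for y
    proof -
      have "sine_rest K u = (\<Sum>k\<in>S. sin (2 * pi * (real k * u)) / (pi * real k)) + sine_rest m u" for u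
      proof -
        have "sine_sum m u = sine_sum K u + (\<Sum>k\<in>S. sin (2 * pi * (real k * u)) / (pi * real k))"
        proof -
          obtain d where "m = K + d" using m(2) le_Suc_ex by blast
          then show ?thesis unfolding sine_sum_def S_def
            using sum.ub_add_nat[of 1 K "\<lambda>k. sin (2 * pi * (real k * u)) / (pi * real k)" d] by simp
        qed
        then show ?thesis by (simp add: sine_rest_def)
      qed
      then show ?thesis by (simp add: rest_sum_def F1_def F2_def distrib_left sum.distrib)
    qed
    have c: "continuous_on {1..2} (\<lambda>y. \<Theta> (X * y / (real n)\<^sup>2))" if "n \<in> {1..N}" for n
      by (rule continuous_on_compose2[OF amp_continuous[OF \<Theta>]]) (use that X in \<open>auto intro!: continuous_intros\<close>)
    have cF1: "continuous_on {1..2} F1" unfolding F1_def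
    proof (intro continuous_on_sum continuous_on_mult c)
      fix n k
      show "continuous_on {1..2} (\<lambda>y. sin (2 * pi * (real k * (X * y / real n))) / (pi * real k))"
        unfolding divide_inverse by (intro continuous_intros)
    qed
    have iF1: "(\<lambda>y. (F1 y)\<^sup>2) integrable_on {1..2}" by (intro integrable_continuous_real continuous_intros cF1)
    have iF2: "(\<lambda>y. (F2 y)\<^sup>2) integrable_on {1..2}" unfolding F2_def by (rule integrable_rest_sum[OF \<Theta>]) (use X in auto)
    have iF: "(\<lambda>y. (rest_sum \<Theta> K N (X * y))\<^sup>2) integrable_on {1..2}" by (rule integrable_rest_sum[OF \<Theta>]) (use X in auto)
    have "integral {1..2} (\<lambda>y. (rest_sum \<Theta> K N (X * y))\<^sup>2) \<le> integral {1..2} (\<lambda>y. 2 * (F1 y)\<^sup>2 + 2 * (F2 y)\<^sup>2)"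
    proof (rule integral_le[OF iF])
      show "(\<lambda>y. 2 * (F1 y)\<^sup>2 + 2 * (F2 y)\<^sup>2) integrable_on {1..2}"
        by (intro integrable_add integrable_on_mult_right iF1 iF2)
      show "(rest_sum \<Theta> K N (X * y))\<^sup>2 \<le> 2 * (F1 y)\<^sup>2 + 2 * (F2 y)\<^sup>2" for y
        unfolding split using zero_le_power2[of "F1 y - F2 y"] by (simp add: power2_sum power2_diff)
    qed
    also have "\<dots> = 2 * integral {1..2} (\<lambda>y. (F1 y)\<^sup>2) + 2 * integral {1..2} (\<lambda>y. (F2 y)\<^sup>2)"
      using integral_add[OF integrable_on_mult_right[OF iF1] integrable_on_mult_right[OF iF2], of 2 2] by simp
    also have "integral {1..2} (\<lambda>y. (F1 y)\<^sup>2) \<le> C0 * B\<^sup>2 * (sqrt (X / z0) * G + (3 + ln X)\<^sup>2)"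
    proof -
      have "integral {1..2} (\<lambda>y. (F1 y)\<^sup>2) \<le> C0 * B\<^sup>2 * (sqrt (X / z0) * (\<Sum>k\<in>S. \<Sum>l\<in>S. gcd_weight k l) + (\<Sum>k\<in>S. 1 / real k)\<^sup>2)"
        unfolding F1_def by (rule ms[OF \<Theta> \<Theta>0 z0 X]) (auto simp: S_def)
      also have "\<dots> \<le> C0 * B\<^sup>2 * (sqrt (X / z0) * G + (3 + ln X)\<^sup>2)"
      proof (intro mult_left_mono add_mono)
        show "(\<Sum>k\<in>S. \<Sum>l\<in>S. gcd_weight k l) \<le> G" by (intro G[rule_format]) (auto simp: S_def)
        have "(\<Sum>k\<in>S. 1 / real k) \<le> (\<Sum>k=1..m. 1 / real k)" by (rule sum_mono2) (auto simp: S_def)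
        also have "\<dots> \<le> 1 + ln (real m)" by (rule sum_inverse_le_ln[OF m(1)])
        also have "ln (real m) \<le> ln (2 * X)" using m X by simp
        also have "ln (2 * X) = ln 2 + ln X" using X by (simp add: ln_mult)
        also have "ln (2::real) \<le> 2" using ln_le_minus_one[of "2::real"] by simp
        finally have "(\<Sum>k\<in>S. 1 / real k) \<le> 3 + ln X" by simp
        then show "(\<Sum>k\<in>S. 1 / real k)\<^sup>2 \<le> (3 + ln X)\<^sup>2" by (rule power_mono) (simp add: sum_nonneg)
        show "0 \<le> sqrt (X / z0)" "0 \<le> C0 * B\<^sup>2" using C0 X z0 by simp_all
      qed
      finally show ?thesis .
    qed
    also have "integral {1..2} (\<lambda>y. (F2 y)\<^sup>2) \<le> 16 * B\<^sup>2 * (3 + ln X)\<^sup>2"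
    proof -
      have B: "B \<ge> 0" using \<Theta> by (rule amp_nonneg)
      have ir: "(\<lambda>y. (sine_rest m (X / real n * y))\<^sup>2) integrable_on {1..2}" and br: "integral {1..2} (\<lambda>y. (sine_rest m (X / real n * y))\<^sup>2) \<le> 1 / X"
        if n: "n \<in> {1..N}" for n
      proof -
        define c where "c = X / real n"
        have n1: "real n \<ge> 1" "real n \<le> 4 * sqrt X" using n N by auto
        have c0: "c > 0" using n1 X by (simp add: c_def)
        \<comment> \<open>As n <= N <= 4 sqrt X, the scale c = X/n is at least 1/4. Thus 1 + 2/c <=
          9, which pi^2 >= 9 compensates.\<close>
        have "1/4 \<le> sqrt X / 4" using X by simp
        also have "sqrt X / 4 = X / (4 * sqrt X)" using X by (simp add: field_simps)
        also have "\<dots> \<le> c" unfolding c_def using n1 X by (intro divide_left_mono) auto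
        finally have c4: "1/4 \<le> c" .
        show "(\<lambda>y. (sine_rest m (X / real n * y))\<^sup>2) integrable_on {1..2}"
          using integral_stretch_pos(2)[OF integrable_sine_rest c0] by (simp add: c_def)
        have "integral {1..2} (\<lambda>y. (sine_rest m (c * y))\<^sup>2) = integral {c * 1..c * 2} (\<lambda>y. (sine_rest m y)\<^sup>2) / c"
          by (rule integral_stretch_pos(1)[OF integrable_sine_rest c0])
        also have "\<dots> \<le> ((c * 2 - c * 1 + 2) / (2 * pi\<^sup>2 * real m)) / c"
          using c0 by (intro divide_right_mono integral_sine_rest m(1)) auto
        also have "\<dots> = (1 + 2 / c) / (2 * pi\<^sup>2 * real m)" using c0 m(1) by (simp add: field_simps)
        also have "\<dots> \<le> 9 / (2 * 9 * X)"
        proof (rule frac_le)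
          show "1 + 2 / c \<le> 9" using c4 c0 by (simp add: field_simps)
          have "(9::real) \<le> pi\<^sup>2" using pi_gt3 power_mono[of 3 pi 2] by simp
          then show "2 * 9 * X \<le> 2 * pi\<^sup>2 * real m" using m X by (intro mult_mono) auto
        qed (use X in auto)
        also have "\<dots> \<le> 1 / X" using X by (simp add: field_simps)
        finally show "integral {1..2} (\<lambda>y. (sine_rest m (X / real n * y))\<^sup>2) \<le> 1 / X" by (simp add: c_def)
      qed
      have "integral {1..2} (\<lambda>y. (F2 y)\<^sup>2) \<le> integral {1..2} (\<lambda>y. \<Sum>n=1..N. (real N * B\<^sup>2) * (sine_rest m (X / real n * y))\<^sup>2)"
      proof (rule integral_le[OF iF2])
        show "(\<lambda>y. \<Sum>n=1..N. (real N * B\<^sup>2) * (sine_rest m (X / real n * y))\<^sup>2) integrable_on {1..2}"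
          by (intro integrable_sum integrable_on_mult_right ir) auto
        fix y :: real assume y: "y \<in> {1..2}"
        have "(F2 y)\<^sup>2 = (\<Sum>n=1..N. 1 * (\<Theta> (X * y / (real n)\<^sup>2) * sine_rest m (X * y / real n)))\<^sup>2"
          by (simp add: F2_def rest_sum_def)
        also have "\<dots> \<le> (\<Sum>n=1..N. 1\<^sup>2) * (\<Sum>n=1..N. (\<Theta> (X * y / (real n)\<^sup>2) * sine_rest m (X * y / real n))\<^sup>2)"
          by (rule Cauchy_Schwarz_ineq_sum)
        also have "\<dots> = real N * (\<Sum>n=1..N. (\<Theta> (X * y / (real n)\<^sup>2) * sine_rest m (X * y / real n))\<^sup>2)" by simp
        also have "\<dots> \<le> real N * (\<Sum>n=1..N. B\<^sup>2 * (sine_rest m (X / real n * y))\<^sup>2)"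
        proof (intro mult_left_mono sum_mono)
          fix n assume n: "n \<in> {1..N}"
          have "\<bar>\<Theta> (X * y / (real n)\<^sup>2)\<bar> \<le> B" by (rule amp_bound[OF \<Theta>]) (use n y X in auto)
          then have "\<bar>\<Theta> (X * y / (real n)\<^sup>2)\<bar>\<^sup>2 \<le> B\<^sup>2" by (intro power_mono) auto
          then show "(\<Theta> (X * y / (real n)\<^sup>2) * sine_rest m (X * y / real n))\<^sup>2 \<le> B\<^sup>2 * (sine_rest m (X / real n * y))\<^sup>2"
            unfolding power_mult_distrib by (intro mult_mono) auto
        qed auto
        finally show "(F2 y)\<^sup>2 \<le> (\<Sum>n=1..N. (real N * B\<^sup>2) * (sine_rest m (X / real n * y))\<^sup>2)"
          by (simp add: sum_distrib_left mult.assoc)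
      qed
      also have "\<dots> = (\<Sum>n=1..N. (real N * B\<^sup>2) * integral {1..2} (\<lambda>y. (sine_rest m (X / real n * y))\<^sup>2))"
      proof -
        have "(\<lambda>y. (real N * B\<^sup>2) * (sine_rest m (X / real n * y))\<^sup>2) integrable_on {1..2}" if "n \<in> {1..N}" for n
          by (intro integrable_on_mult_right ir that)
        then show ?thesis by (subst integral_sum) auto
      qed
      also have "\<dots> \<le> (\<Sum>n=1..N. (real N * B\<^sup>2) * (1 / X))"
        by (intro sum_mono mult_left_mono br) auto
      also have "\<dots> = B\<^sup>2 * ((real N)\<^sup>2 / X)" by (simp add: power2_eq_square)
      also have "\<dots> \<le> B\<^sup>2 * 16"
      proof (intro mult_left_mono)
        have "(real N)\<^sup>2 \<le> (4 * sqrt X)\<^sup>2" using N by (intro power_mono) auto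
        then show "(real N)\<^sup>2 / X \<le> 16" using X by (simp add: power_mult_distrib divide_le_eq)
      qed simp
      also have "\<dots> \<le> B\<^sup>2 * (16 * (3 + ln X)\<^sup>2)"
      proof (intro mult_left_mono)
        have "1 \<le> (3 + ln X)\<^sup>2" using X by (intro one_le_power) simp
        then show "(16::real) \<le> 16 * (3 + ln X)\<^sup>2" by simp
      qed simp
      finally show ?thesis by (simp add: mult_ac)
    qed
    finally have "integral {1..2} (\<lambda>y. (rest_sum \<Theta> K N (X * y))\<^sup>2) \<le> 2 * (C0 * B\<^sup>2 * (sqrt (X / z0) * G + (3 + ln X)\<^sup>2)) + 2 * (16 * B\<^sup>2 * (3 + ln X)\<^sup>2)" by simp
    also have "\<dots> \<le> 2 * (C0 * B\<^sup>2 * (sqrt (X / z0) * G + (3 + ln X)\<^sup>2)) + 32 * B\<^sup>2 * (sqrt (X / z0) * G + (3 + ln X)\<^sup>2)"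
    proof -
      have "0 \<le> sqrt (X / z0) * G" using G0 X z0 by simp
      then have "B\<^sup>2 * (3 + ln X)\<^sup>2 \<le> B\<^sup>2 * (sqrt (X / z0) * G + (3 + ln X)\<^sup>2)" by (intro mult_left_mono) auto
      then show ?thesis by simp
    qed
    also have "\<dots> = (2 * C0 + 32) * B\<^sup>2 * (sqrt (X / z0) * G + (3 + ln X)\<^sup>2)" by (simp add: algebra_simps)
    finally show "integral {1..2} (\<lambda>y. (rest_sum \<Theta> K N (X * y))\<^sup>2) \<le> (2 * C0 + 32) * B\<^sup>2 * (sqrt (X / z0) * G + (3 + ln X)\<^sup>2)" .
  qed
qed

text \<open>2 Fres is the contribution of a stationary point, and 1/pi belongs to the Fourier
  coefficients 1/(pi k) of the sawtooth.\<close>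

definition kappa :: complex where "kappa = 2 * Fres / of_real pi"

lemma norm_kappa: "(cmod kappa)\<^sup>2 = 1 / (2 * pi\<^sup>2)"
proof -
  have "(cmod kappa)\<^sup>2 = 4 * (cmod Fres)\<^sup>2 / pi\<^sup>2"
    by (simp add: kappa_def norm_divide norm_mult power_divide power_mult_distrib)
  then show ?thesis by (simp add: norm_Fres)
qed

text \<open>The substitution Phi(v) = Theta(1/v^2) translates weights in x/n^2 into amplitudes in
  n/t. The support [z1, z2] becomes [1/sqrt z2, 1/sqrt z1], the condition l >= 2k/A^2 becomes 32 z2
  k because A is a quarter of the left end, and the value at the stationary point is
  Theta(l/k).\<close>

lemma b_process_amp:
  assumes \<Theta>: "amp B0 \<Theta>" and z1: "0 < z1" "z1 < z2" and zero: "\<And>z. 0 < z \<Longrightarrow> z \<le> z1 \<or> z2 \<le> z \<Longrightarrow> \<Theta> z = 0"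
    and k: "k \<ge> 1" and L: "real L \<ge> 32 * z2 * real k"
    and N: "\<And>t. (1 / sqrt z1 + 1/2) * t \<le> real (N t)"
  shows "((\<lambda>t. (\<Sum>n=1..N t. of_real (\<Theta> (t\<^sup>2 / (real n)\<^sup>2)) * ee (real k * (t\<^sup>2 / real n))) / of_real (sqrt t) -
     (\<Sum>l=1..L. of_real (\<Theta> (real l / real k) * (real k powr (1/4) * real l powr (-3/4))) * (2 * Fres) * ee (2 * sqrt (real k * real l) * t))) \<longlongrightarrow> 0) at_top"
proof -
  obtain h' h'' where w: "amp_wit B0 \<Theta> h' h''" using \<Theta> by (rule ampE)
  note F = amp_witD[OF w]
  define \<Phi> where "\<Phi> = (\<lambda>v::real. \<Theta> (1 / v\<^sup>2))"
  define \<Phi>' where "\<Phi>' = (\<lambda>v::real. h' (1 / v\<^sup>2) * (- 2 / v ^ 3))"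
  define \<Phi>'' where "\<Phi>'' = (\<lambda>v::real. h'' (1 / v\<^sup>2) * (- 2 / v ^ 3) * (- 2 / v ^ 3) + (6 / v ^ 4) * h' (1 / v\<^sup>2))"
  define a where "a = 1 / sqrt z2"
  define b where "b = 1 / sqrt z1"
  have z2: "z2 > 0" using z1 by linarith
  interpret bump \<Phi> \<Phi>' \<Phi>'' a b k
  proof
    show "0 < a" using z2 by (simp add: a_def)
    show "a < b" using z1 by (simp add: a_def b_def frac_less2)
    fix v :: real assume v: "v > 0"
    then have v2: "1 / v\<^sup>2 > 0" by simp
    have d: "((\<lambda>v. 1 / v\<^sup>2) has_real_derivative - 2 / v ^ 3) (at v)"
      using v by (auto intro!: derivative_eq_intros simp: power2_eq_square power3_eq_cube)
    have d3: "((\<lambda>v. - 2 / v ^ 3) has_real_derivative 6 / v ^ 4) (at v)"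
      using v by (auto intro!: derivative_eq_intros simp: power2_eq_square power3_eq_cube power4_eq_xxxx)
    show "(\<Phi> has_real_derivative \<Phi>' v) (at v)" unfolding \<Phi>_def \<Phi>'_def by (rule DERIV_chain2[OF F(1)[OF v2] d])
    show "(\<Phi>' has_real_derivative \<Phi>'' v) (at v)" unfolding \<Phi>'_def \<Phi>''_def
      by (rule DERIV_mult[OF DERIV_chain2[OF F(2)[OF v2] d] d3])
    show "\<Phi> v = 0" if "v \<le> a \<or> b \<le> v"
    proof -
      have "1 / v\<^sup>2 \<le> z1 \<or> z2 \<le> 1 / v\<^sup>2"
      proof (cases "v \<le> a")
        case True
        then have "v\<^sup>2 \<le> a\<^sup>2" using v by (intro power_mono) auto
        then have "v\<^sup>2 \<le> 1 / z2" using z2 by (simp add: a_def power_divide)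
        then show ?thesis using v z2 by (simp add: field_simps)
      next
        case False
        then have "b \<le> v" using that by simp
        then have "b\<^sup>2 \<le> v\<^sup>2" using z1 by (intro power_mono) (auto simp: b_def)
        then have "1 / z1 \<le> v\<^sup>2" using z1 by (simp add: b_def power_divide)
        then show ?thesis using v z1 by (simp add: field_simps)
      qed
      then show ?thesis unfolding \<Phi>_def by (rule zero[OF v2])
    qed
  next
    show "continuous_on {0<..} \<Phi>''" unfolding \<Phi>''_def
      by (intro continuous_intros continuous_on_compose2[OF F(6)] continuous_on_compose2[OF F(7)]) auto
  qed (rule k)
  have A2: "2 * real k / A\<^sup>2 = 32 * z2 * real k"
    unfolding A_def using z2 by (simp add: a_def power_divide)
  have q: "q = 1 / sqrt z1 + 1/2" unfolding q_def by (simp add: b_def)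
  have "((\<lambda>t. (\<Sum>n=1..N t. f t (real n)) / of_real (sqrt t) -
     (\<Sum>l=1..L. of_real (\<Phi> (sqrt (real k / real l)) * (real k powr (1/4) * real l powr (-3/4))) * (2 * Fres) * ee (2 * sqrt (real k * real l) * t))) \<longlongrightarrow> 0) at_top"
    by (rule b_process) (use L N in \<open>simp_all add: A2 q\<close>)
  moreover have "f t (real n) = of_real (\<Theta> (t\<^sup>2 / (real n)\<^sup>2)) * ee (real k * (t\<^sup>2 / real n))" for t n
    unfolding f_def unfolding \<Phi>_def by (simp add: power_divide)
  moreover have "\<Phi> (sqrt (real k / real l)) = \<Theta> (real l / real k)" for l
    unfolding \<Phi>_def by simp
  ultimately show ?thesis by simp
qed

text \<open>Dividing k^(1/4) l^(-3/4) by k gives (kl)^(-3/4): apart from the weight, each term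
  depends only on the product kl, which is how tau(kl) arises.\<close>

lemma main_term:
  assumes \<Theta>: "amp B0 \<Theta>" and z2: "1/2 < z2" and zero: "\<And>z. 0 < z \<Longrightarrow> z \<le> 1/2 \<or> z2 \<le> z \<Longrightarrow> \<Theta> z = 0"
    and L: "real L \<ge> 32 * z2 * real K"
    and N: "\<And>t. 2 * t \<le> real (N t)"
  shows "((\<lambda>t. (\<Sum>n=1..N t. \<Theta> (t\<^sup>2 / (real n)\<^sup>2) * sine_sum K (t\<^sup>2 / real n)) / sqrt t -
     Im (kappa * (\<Sum>k=1..K. \<Sum>l=1..L. of_real (\<Theta> (real l / real k) * real (k * l) powr (-3/4)) * ee (2 * sqrt (real (k * l)) * t)))) \<longlongrightarrow> 0) at_top"
proof -
  have N': "(1 / sqrt (1/2) + 1/2) * t \<le> real (N t)" for t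
  proof (cases "t \<ge> 0")
    case True
    \<comment> \<open>For z1 = 1/2 the required length is (sqrt 2 + 1/2) t, and 3/2 + 1/2 =
      2.\<close>
    have "sqrt 2 \<le> 3/2" by (rule real_le_lsqrt) (auto simp: power2_eq_square)
    moreover have "1 / sqrt (1/2) = sqrt (2::real)" by (simp add: real_sqrt_divide)
    ultimately have "(1 / sqrt (1/2) + 1/2) * t \<le> 2 * t" using True by (intro mult_right_mono) auto
    then show ?thesis using N[of t] by linarith
  next
    case False
    then have "(1 / sqrt (1/2) + 1/2) * t \<le> 0" by (intro mult_nonneg_nonpos) auto
    then show ?thesis by (meson of_nat_0_le_iff order_trans)
  qed
  define A where "A = (\<lambda>k t. (\<Sum>n=1..N t. of_real (\<Theta> (t\<^sup>2 / (real n)\<^sup>2)) * ee (real k * (t\<^sup>2 / real n))) / complex_of_real (sqrt t))"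
  define C where "C = (\<lambda>k t. \<Sum>l=1..L. of_real (\<Theta> (real l / real k) * (real k powr (1/4) * real l powr (-3/4))) * (2 * Fres) * ee (2 * sqrt (real k * real l) * t))"
  have "((\<lambda>t. A k t - C k t) \<longlongrightarrow> 0) at_top" if "k \<in> {1..K}" for k
    unfolding A_def C_def
  proof (rule b_process_amp[OF \<Theta> _ z2 zero _ _ N'])
    have "32 * z2 * real k \<le> 32 * z2 * real K" using that z2 by (intro mult_left_mono) auto
    then show "32 * z2 * real k \<le> real L" using L by linarith
  qed (use that in auto)
  then have "((\<lambda>t. \<Sum>k=1..K. (A k t - C k t) / of_real (pi * real k)) \<longlongrightarrow> (\<Sum>k=1..K. 0 / of_real (pi * real k))) at_top"
    by (intro tendsto_sum tendsto_divide tendsto_const) auto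
  then have "((\<lambda>t. Im (\<Sum>k=1..K. (A k t - C k t) / of_real (pi * real k))) \<longlongrightarrow> Im 0) at_top"
    by (intro tendsto_Im) simp
  moreover have "Im (\<Sum>k=1..K. (A k t - C k t) / of_real (pi * real k)) = (\<Sum>n=1..N t. \<Theta> (t\<^sup>2 / (real n)\<^sup>2) * sine_sum K (t\<^sup>2 / real n)) / sqrt t -
     Im (kappa * (\<Sum>k=1..K. \<Sum>l=1..L. of_real (\<Theta> (real l / real k) * real (k * l) powr (-3/4)) * ee (2 * sqrt (real (k * l)) * t)))" for t
  proof -
    have 1: "(\<Sum>k=1..K. C k t / of_real (pi * real k)) = kappa * (\<Sum>k=1..K. \<Sum>l=1..L. of_real (\<Theta> (real l / real k) * real (k * l) powr (-3/4)) * ee (2 * sqrt (real (k * l)) * t))"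
      unfolding sum_distrib_left C_def sum_divide_distrib
    proof (intro sum.cong refl)
      fix k l assume kl: "k \<in> {1..K}" "l \<in> {1..L}"
      have "real k powr (1/4) / real k = real k powr (1/4) * real k powr (-1)"
        using kl by (simp add: powr_minus_divide)
      also have "\<dots> = real k powr (-3/4)" by (simp only: powr_add[symmetric]) simp
      finally have "real k powr (1/4) = real k * real k powr (-3/4)" using kl by (simp add: field_simps)
      then have e: "real k powr (1/4) * real l powr (-3/4) = real k * real (k * l) powr (-3/4)" by (simp add: powr_mult)
      have "of_real (\<Theta> (real l / real k) * (real k * real (k * l) powr (-3/4))) * (2 * Fres) * ee (2 * sqrt (real k * real l) * t) / complex_of_real (pi * real k)
        = kappa * (of_real (\<Theta> (real l / real k) * real (k * l) powr (-3/4)) * ee (2 * sqrt (real (k * l)) * t))"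
        using kl by (simp add: kappa_def)
      then show "of_real (\<Theta> (real l / real k) * (real k powr (1/4) * real l powr (-3/4))) * (2 * Fres) * ee (2 * sqrt (real k * real l) * t) / complex_of_real (pi * real k)
        = kappa * (of_real (\<Theta> (real l / real k) * real (k * l) powr (-3/4)) * ee (2 * sqrt (real (k * l)) * t))"
        unfolding e .
    qed
    have 2: "Im (\<Sum>k=1..K. A k t / of_real (pi * real k)) = (\<Sum>n=1..N t. \<Theta> (t\<^sup>2 / (real n)\<^sup>2) * sine_sum K (t\<^sup>2 / real n)) / sqrt t"
    proof -
      have Im_div: "Im (z / of_real r) = Im z / r" for z r by simp
      have "Im (A k t / of_real (pi * real k)) = (\<Sum>n=1..N t. \<Theta> (t\<^sup>2 / (real n)\<^sup>2) * (sin (2 * pi * (real k * (t\<^sup>2 / real n))) / (pi * real k))) / sqrt t" for k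
        unfolding A_def Im_div Im_sum sum_divide_distrib by (intro sum.cong refl) (simp add: Im_ee)
      then have "Im (\<Sum>k=1..K. A k t / of_real (pi * real k)) = (\<Sum>k=1..K. (\<Sum>n=1..N t. \<Theta> (t\<^sup>2 / (real n)\<^sup>2) * (sin (2 * pi * (real k * (t\<^sup>2 / real n))) / (pi * real k)))) / sqrt t"
        by (simp only: Im_sum sum_divide_distrib)
      also have "(\<Sum>k=1..K. (\<Sum>n=1..N t. \<Theta> (t\<^sup>2 / (real n)\<^sup>2) * (sin (2 * pi * (real k * (t\<^sup>2 / real n))) / (pi * real k))))
         = (\<Sum>n=1..N t. \<Theta> (t\<^sup>2 / (real n)\<^sup>2) * sine_sum K (t\<^sup>2 / real n))"
        unfolding sine_sum_def sum_distrib_left by (rule sum.swap)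
      finally show ?thesis .
    qed
    show ?thesis unfolding diff_divide_distrib sum_subtractf 1 minus_complex.simps 2 ..
  qed
  ultimately show ?thesis by simp
qed

section \<open>Pairs (k, l) grouped by their product\<close>

lemma hyp_points_of_nat:
  "hyp_points (real R) = {(k,l). 0 < k \<and> 0 < l \<and> k * l \<le> R}"
  unfolding hyp_points_def by (simp flip: of_nat_mult)

lemma card_factorizations_le: "real (card {(k,l)\<in>I. k * l = r}) \<le> tau r" if "finite I" "r > 0"
proof -
  have "inj_on fst {(k,l)\<in>I. k * l = r}" using that(2) by (auto simp: inj_on_def)
  then have "card {(k,l)\<in>I. k * l = r} = card (fst ` {(k,l)\<in>I. k * l = r})" by (simp add: card_image)
  also have "\<dots> \<le> card {d. d dvd r}"
    using that(2) by (intro card_mono) (auto simp: finite_divisors_nat)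
  finally show ?thesis by (simp add: num_divisors_def)
qed

lemma sum_hyp_points:
  fixes F :: "nat \<Rightarrow> complex"
  shows "(\<Sum>(k,l)\<in>hyp_points (real R). F (k * l)) = (\<Sum>r=1..R. of_real (tau r) * F r)"
proof -
  have "(\<Sum>(k,l)\<in>hyp_points (real R). F (k * l)) = (\<Sum>(r,d)\<in>(SIGMA r:{1..R}. {d. d dvd r}). F r)"
    unfolding hyp_points_of_nat
    by (rule sum.reindex_bij_witness[where j = "\<lambda>(k,l). (k * l, k)" and i = "\<lambda>(r,d). (d, r div d)"])
       (auto elim!: dvdE)
  also have "\<dots> = (\<Sum>r=1..R. \<Sum>d | d dvd r. F r)"
    by (subst sum.Sigma) (auto simp: finite_divisors_nat)
  finally show ?thesis by (simp add: num_divisors_def)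
qed

lemma sum_omega_hyp_points:
  fixes F :: "nat \<Rightarrow> complex"
  shows "(\<Sum>(k,l)\<in>hyp_points (real R). of_real (omega (real l / real k)) * F (k * l)) = (\<Sum>r=1..R. of_real (tau r) * F r)"
proof -
  let ?H = "hyp_points (real R)"
  have "(\<Sum>(k,l)\<in>?H. of_real (omega (real l / real k)) * F (k * l)) = (\<Sum>(k,l)\<in>?H. of_real (omega (real k / real l)) * F (k * l))"
    by (rule sum.reindex_bij_witness[where i = prod.swap and j = prod.swap])
       (auto simp: hyp_points_def mult.commute)
  then have "2 * (\<Sum>(k,l)\<in>?H. of_real (omega (real l / real k)) * F (k * l)) =
     (\<Sum>(k,l)\<in>?H. of_real (omega (real l / real k)) * F (k * l)) + (\<Sum>(k,l)\<in>?H. of_real (omega (real k / real l)) * F (k * l))"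
    by simp
  also have "\<dots> = (\<Sum>(k,l)\<in>?H. 2 * F (k * l))"
    unfolding sum.distrib[symmetric]
  proof (intro sum.cong refl, safe)
    fix k l assume "(k, l) \<in> ?H"
    have "omega (real l / real k) + omega (real k / real l) = 2"
      using omega_symmetric[of "real l / real k"] by simp
    then have "complex_of_real (omega (real l / real k)) + of_real (omega (real k / real l)) = 2"
      by (simp flip: of_real_add)
    then show "of_real (omega (real l / real k)) * F (k * l) + of_real (omega (real k / real l)) * F (k * l) = 2 * F (k * l)"
      by (simp flip: distrib_right)
  qed
  also have "\<dots> = 2 * (\<Sum>(k,l)\<in>?H. F (k * l))" by (simp add: sum_distrib_left split_beta)
  finally show ?thesis using sum_hyp_points[of F R] by simp
qed

text \<open>If kl <= R then l/k <= R <= Z, so the upper cut-off in Z is inactive and the weight is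
  the full \<open>omega\<close>. These pairs give exactly the Voronoi sum; the rest is a tail with
  kl > R.\<close>

lemma truncated_pairs_split:
  fixes F :: "nat \<Rightarrow> complex"
  assumes "R \<le> K" "R \<le> L" "real R \<le> Z" and R: "Z > 0"
  shows "(\<Sum>k=1..K. \<Sum>l=1..L. of_real (omega (real l / real k) * (1 - stp (real l / real k / Z))) * F (k * l))
    = (\<Sum>r=1..R. of_real (tau r) * F r) +
      (\<Sum>(k,l)\<in>{(k,l)\<in>{1..K} \<times> {1..L}. R < k * l}. of_real (omega (real l / real k) * (1 - stp (real l / real k / Z))) * F (k * l))"
proof -
  define c where "c = (\<lambda>(k,l). of_real (omega (real l / real k) * (1 - stp (real l / real k / Z))) * F (k * l))"
  let ?H = "hyp_points (real R)" and ?I = "{(k,l)\<in>{1..K} \<times> {1..L}. R < k * l}"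
  have un: "{1..K} \<times> {1..L} = ?H \<union> ?I"
  proof -
    have "k \<le> K \<and> l \<le> L" if "0 < k" "0 < l" "k * l \<le> R" for k l
    proof -
      have "k * 1 \<le> k * l" "1 * l \<le> k * l" using that by (intro mult_le_mono; simp)+
      then show ?thesis using that assms by linarith
    qed
    then show ?thesis unfolding hyp_points_of_nat by force
  qed
  have "(\<Sum>k=1..K. \<Sum>l=1..L. of_real (omega (real l / real k) * (1 - stp (real l / real k / Z))) * F (k * l)) = sum c ({1..K} \<times> {1..L})"
    unfolding c_def by (rule sum.cartesian_product)
  also have "\<dots> = sum c (?H \<union> ?I)" by (rule arg_cong[OF un])
  also have "\<dots> = sum c ?H + sum c ?I"
  proof (rule sum.union_disjoint)
    show "finite ?I" by (rule finite_subset[of _ "{1..K} \<times> {1..L}"]) auto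
    show "?H \<inter> ?I = {}" by (auto simp: hyp_points_of_nat)
  qed (rule finite_hyp_points)
  also have "sum c ?H = (\<Sum>(k,l)\<in>?H. of_real (omega (real l / real k)) * F (k * l))"
  proof (intro sum.cong refl, safe)
    fix k l assume "(k, l) \<in> ?H"
    then have kl: "0 < k" "0 < l" "k * l \<le> R" by (auto simp: hyp_points_of_nat)
    have "l \<le> R" using kl by (metis mult_le_mono1 One_nat_def Suc_leI le_trans mult_1)
    then have "real l / real k \<le> Z / 1" using kl assms by (intro frac_le) auto
    then have "real l / real k / Z \<le> 1" unfolding divide_le_eq_1_pos[OF R] by simp
    then have "stp (real l / real k / Z) = 0" by (rule stp_0)
    then show "c (k, l) = of_real (omega (real l / real k)) * F (k * l)" by (simp add: c_def)
  qed
  also have "\<dots> = (\<Sum>r=1..R. of_real (tau r) * F r)" by (rule sum_omega_hyp_points)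
  finally show ?thesis by (simp only: c_def)
qed

text \<open>A product r occurs for at most tau(r) pairs, and two pairs with that product contribute
  at most 4 r^(-3/2).\<close>

lemma diagonal_le:
  fixes a :: "nat \<times> nat \<Rightarrow> real"
  assumes fin: "finite I" and I: "\<And>k l. (k, l) \<in> I \<Longrightarrow> k * l > 0"
    and a: "\<And>k l. (k, l) \<in> I \<Longrightarrow> \<bar>a (k, l)\<bar> \<le> 2 * real (k * l) powr (-3/4)"
  shows "(\<Sum>i\<in>I. \<Sum>j\<in>I. if fst i * snd i = fst j * snd j then a i * a j else 0)
    \<le> 4 * (\<Sum>r\<in>(\<lambda>(k,l). k * l) ` I. tau r ^ 2 * real r powr (-3/2))"
proof -
  define \<rho> where "\<rho> = (\<lambda>(k,l). k * l :: nat)"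
  have \<rho>: "fst i * snd i = \<rho> i" for i by (simp add: \<rho>_def split_beta)
  define f where "f = (\<lambda>r. real r powr (-3/2))"
  have cnt: "real (card {j\<in>I. \<rho> j = r}) \<le> tau r" if "r \<in> \<rho> ` I" for r
  proof -
    have "r > 0" using that I by (auto simp: \<rho>_def)
    then show ?thesis using card_factorizations_le[OF fin, of r] by (simp add: \<rho>_def case_prod_beta')
  qed
  have "(\<Sum>i\<in>I. \<Sum>j\<in>I. if \<rho> i = \<rho> j then a i * a j else 0) \<le> (\<Sum>i\<in>I. \<Sum>j\<in>I. if \<rho> j = \<rho> i then 4 * f (\<rho> i) else 0)"
  proof (intro sum_mono)
    fix i j assume ij: "i \<in> I" "j \<in> I"
    obtain k l m n where kl: "i = (k, l)" "j = (m, n)" by fastforce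
    show "(if \<rho> i = \<rho> j then a i * a j else 0) \<le> (if \<rho> j = \<rho> i then 4 * f (\<rho> i) else 0)"
    proof (cases "\<rho> i = \<rho> j")
      case True
      have eq: "k * l = m * n" using True by (simp add: \<rho>_def kl)
      have "a i * a j \<le> \<bar>a i\<bar> * \<bar>a j\<bar>" by (simp flip: abs_mult)
      also have "\<dots> \<le> (2 * real (k * l) powr (-3/4)) * (2 * real (k * l) powr (-3/4))"
        using a[of k l] a[of m n] ij unfolding kl eq by (intro mult_mono) auto
      also have "\<dots> = 4 * (real (k * l) powr (-3/4) * real (k * l) powr (-3/4))" by simp
      also have "real (k * l) powr (-3/4) * real (k * l) powr (-3/4) = f (\<rho> i)"
        unfolding f_def \<rho>_def kl by (simp only: powr_add[symmetric]) simp
      finally show ?thesis using True by simp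
    qed simp
  qed
  also have "\<dots> = (\<Sum>i\<in>I. 4 * f (\<rho> i) * real (card {j\<in>I. \<rho> j = \<rho> i}))"
    by (intro sum.cong refl) (simp add: sum.If_cases[OF fin] Int_def)
  also have "\<dots> = (\<Sum>r\<in>\<rho> ` I. \<Sum>i | i \<in> I \<and> \<rho> i = r. 4 * f (\<rho> i) * real (card {j\<in>I. \<rho> j = \<rho> i}))"
    by (rule sum.image_gen[OF fin])
  also have "\<dots> = (\<Sum>r\<in>\<rho> ` I. 4 * f r * real (card {j\<in>I. \<rho> j = r}) * real (card {j\<in>I. \<rho> j = r}))"
    by (intro sum.cong refl) simp
  also have "\<dots> \<le> (\<Sum>r\<in>\<rho> ` I. 4 * (tau r ^ 2 * real r powr (-3/2)))"
  proof (intro sum_mono)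
    fix r assume r: "r \<in> \<rho> ` I"
    have "real (card {j\<in>I. \<rho> j = r}) * real (card {j\<in>I. \<rho> j = r}) \<le> tau r * tau r"
      using cnt[OF r] by (intro mult_mono) auto
    then have "4 * f r * (real (card {j\<in>I. \<rho> j = r}) * real (card {j\<in>I. \<rho> j = r})) \<le> 4 * f r * (tau r * tau r)"
      by (intro mult_left_mono) (auto simp: f_def)
    then show "4 * f r * real (card {j\<in>I. \<rho> j = r}) * real (card {j\<in>I. \<rho> j = r}) \<le> 4 * (tau r ^ 2 * real r powr (-3/2))"
      by (simp add: f_def power2_eq_square mult_ac)
  qed
  also have "\<dots> = 4 * (\<Sum>r\<in>\<rho> ` I. tau r ^ 2 * real r powr (-3/2))" by (simp add: sum_distrib_left)
  finally show ?thesis unfolding \<rho> unfolding \<rho>_def .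
qed

lemma tau_squared_tail:
  assumes "e > 0"
  shows "\<exists>R0. \<forall>R\<ge>R0. \<forall>S. finite S \<longrightarrow> S \<subseteq> {R<..} \<longrightarrow> (\<Sum>r\<in>S. tau r ^ 2 * real r powr (-3/2)) \<le> e"
proof -
  have "(\<lambda>n. tau n ^ 2 * real n powr (-3/2)) summable_on {0<..}"
    using has_sum_tau_squared by (auto simp: summable_on_def)
  then obtain F where F: "finite F" "F \<subseteq> {0<..}"
    and tail: "\<And>S. finite S \<Longrightarrow> S \<subseteq> {0<..} - F \<Longrightarrow> (\<Sum>r\<in>S. tau r ^ 2 * real r powr (-3/2)) \<le> e"
    using summable_tail_le[OF _ _ assms, of "\<lambda>n. tau n ^ 2 * real n powr (-3/2)" "{0<..}"] by auto
  obtain R0 where R0: "\<forall>x\<in>F. x \<le> R0" using F(1) finite_nat_set_iff_bounded_le by metis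
  show ?thesis
  proof (intro exI[of _ R0] allI impI)
    fix R S assume "R0 \<le> R" "finite S" "S \<subseteq> {R<..}"
    then show "(\<Sum>r\<in>S. tau r ^ 2 * real r powr (-3/2)) \<le> e"
      using R0 by (intro tail) force+
  qed
qed

text \<open>The bound depends on R but not on the finite set I, so K and L can be chosen after
  R.\<close>

lemma off_main_mean_square:
  fixes c :: "nat \<Rightarrow> nat \<Rightarrow> real"
  assumes fin: "finite I" and I: "\<And>k l. (k, l) \<in> I \<Longrightarrow> R < k * l" and c: "\<And>k l. \<bar>c k l\<bar> \<le> 2"
    and tail: "\<And>S. finite S \<Longrightarrow> S \<subseteq> {R<..} \<Longrightarrow> (\<Sum>r\<in>S. tau r ^ 2 * real r powr (-3/2)) \<le> e" and e: "e > 0"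
  shows "\<forall>\<^sub>F X in at_top. integral {1..X} (\<lambda>x. sqrt x * (cmod (\<Sum>(k,l)\<in>I. of_real (c k l) * (of_real (real (k * l) powr (-3/4)) * ee (2 * sqrt (real (k * l)) * sqrt x))))\<^sup>2)
     \<le> 3 * e * X powr (3/2)"
proof -
  define a where "a = (\<lambda>(k,l). c k l * real (k * l) powr (-3/4))"
  define fr where "fr = (\<lambda>(k,l). 4 * pi * sqrt (real (k * l)))"
  define J where "J = (\<lambda>X. integral {1..X} (\<lambda>x. sqrt x * (cmod (\<Sum>i\<in>I. of_real (a i) * cis (fr i * sqrt x)))\<^sup>2))"
  have fr: "fr i = fr j \<longleftrightarrow> fst i * snd i = fst j * snd j" for i j
    by (cases i; cases j) (simp add: fr_def flip: of_nat_mult)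
  have "(\<Sum>i\<in>I. \<Sum>j\<in>I. if fr i = fr j then complex_of_real (a i) * cnj (of_real (a j)) else 0)
     = of_real (\<Sum>i\<in>I. \<Sum>j\<in>I. if fst i * snd i = fst j * snd j then a i * a j else 0)"
    unfolding fr of_real_sum by (intro sum.cong refl) simp
  then have lim: "((\<lambda>X. X powr (-3/2) * J X) \<longlongrightarrow> 2/3 * (\<Sum>i\<in>I. \<Sum>j\<in>I. if fst i * snd i = fst j * snd j then a i * a j else 0)) at_top"
    using trig_mean_square[OF fin, of "\<lambda>i. of_real (a i)" fr] unfolding J_def by (simp only: Re_complex_of_real)
  have "(\<Sum>i\<in>I. \<Sum>j\<in>I. if fst i * snd i = fst j * snd j then a i * a j else 0) \<le> 4 * (\<Sum>r\<in>(\<lambda>(k,l). k * l) ` I. tau r ^ 2 * real r powr (-3/2))"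
  proof (rule diagonal_le[OF fin])
    fix k l assume "(k, l) \<in> I"
    show "k * l > 0" using I[OF \<open>(k, l) \<in> I\<close>] by linarith
    show "\<bar>a (k, l)\<bar> \<le> 2 * real (k * l) powr (-3/4)"
      using c[of k l] by (simp add: a_def abs_mult mult_right_mono)
  qed
  also have "\<dots> \<le> 4 * e" by (intro mult_left_mono tail) (use fin I in auto)
  \<comment> \<open>2/3 * 4e = 8e/3; the margin up to 3e turns the limit into an eventual
    bound.\<close>
  finally have "2/3 * (\<Sum>i\<in>I. \<Sum>j\<in>I. if fst i * snd i = fst j * snd j then a i * a j else 0) < 3 * e" using e by simp
  from order_tendstoD(2)[OF lim this] have "\<forall>\<^sub>F X in at_top. J X \<le> 3 * e * X powr (3/2)"
    using eventually_gt_at_top[of "0::real"]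
  proof eventually_elim
    case (elim X)
    have "X powr (-3/2) * X powr (3/2) = 1" using elim by (simp flip: powr_add)
    then have "J X = X powr (-3/2) * J X * X powr (3/2)" by simp
    also have "\<dots> \<le> 3 * e * X powr (3/2)" using elim by (intro mult_right_mono) auto
    finally show ?case .
  qed
  moreover have "(\<Sum>(k,l)\<in>I. of_real (c k l) * (of_real (real (k * l) powr (-3/4)) * ee (2 * sqrt (real (k * l)) * sqrt x))) = (\<Sum>i\<in>I. complex_of_real (a i) * cis (fr i * sqrt x))" for x
    unfolding a_def fr_def split_beta ee_def by (intro sum.cong refl) (simp add: mult_ac)
  ultimately show ?thesis unfolding J_def by (simp only:)
qed

text \<open>A class closed under sums, products and dilations that contains the discontinuous Delta
  and guarantees square integrability on [a, b] with a > 0.\<close>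

definition locally_bounded_measurable :: "(real \<Rightarrow> complex) \<Rightarrow> bool" where
  "locally_bounded_measurable f \<longleftrightarrow> f \<in> borel_measurable borel \<and> (\<forall>a b. 0 < a \<longrightarrow> (\<exists>B. \<forall>x\<in>{a..b}. cmod (f x) \<le> B))"

abbreviation (input) "lbm \<equiv> locally_bounded_measurable"

lemma lbm_continuous:
  assumes "f \<in> borel_measurable borel" "continuous_on {0<..} f" shows "lbm f"
  unfolding locally_bounded_measurable_def
proof (intro conjI allI impI)
  fix a b :: real assume "0 < a"
  then have "bounded (f ` {a..b})"
    by (intro compact_imp_bounded compact_continuous_image compact_Icc continuous_on_subset[OF assms(2)]) auto
  then show "\<exists>B. \<forall>x\<in>{a..b}. cmod (f x) \<le> B" by (auto simp: bounded_iff)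
qed (rule assms(1))

lemma lbm_const: "lbm (\<lambda>_. c)"
  by (rule lbm_continuous) auto

lemma lbm_add: assumes "lbm f" "lbm g" shows "lbm (\<lambda>x. f x + g x)"
  unfolding locally_bounded_measurable_def
proof (intro conjI allI impI)
  show "(\<lambda>x. f x + g x) \<in> borel_measurable borel"
    using assms by (intro borel_measurable_add) (auto simp: locally_bounded_measurable_def)
  fix a b :: real assume "0 < a"
  then obtain A B where A: "\<forall>x\<in>{a..b}. cmod (f x) \<le> A" and B: "\<forall>x\<in>{a..b}. cmod (g x) \<le> B"
    using assms unfolding locally_bounded_measurable_def by blast
  have "cmod (f x + g x) \<le> A + B" if "x \<in> {a..b}" for x
    using norm_triangle_le[OF add_mono] A B that by blast
  then show "\<exists>B. \<forall>x\<in>{a..b}. cmod (f x + g x) \<le> B" by blast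
qed

lemma lbm_mult: assumes "lbm f" "lbm g" shows "lbm (\<lambda>x. f x * g x)"
  unfolding locally_bounded_measurable_def
proof (intro conjI allI impI)
  show "(\<lambda>x. f x * g x) \<in> borel_measurable borel"
    using assms by (intro borel_measurable_times) (auto simp: locally_bounded_measurable_def)
  fix a b :: real assume "0 < a"
  then obtain A B where A: "\<forall>x\<in>{a..b}. cmod (f x) \<le> A" and B: "\<forall>x\<in>{a..b}. cmod (g x) \<le> B"
    using assms unfolding locally_bounded_measurable_def by blast
  have "cmod (f x * g x) \<le> A * B" if "x \<in> {a..b}" for x
    unfolding norm_mult using A[rule_format, OF that] B[rule_format, OF that] 
    by (intro mult_mono) (auto intro: order_trans[OF norm_ge_zero])
  then show "\<exists>B. \<forall>x\<in>{a..b}. cmod (f x * g x) \<le> B" by blast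
qed

lemma lbm_cmult: "lbm f \<Longrightarrow> lbm (\<lambda>x. c * f x)"
  by (rule lbm_mult[OF lbm_const])

lemma lbm_diff: assumes "lbm f" "lbm g" shows "lbm (\<lambda>x. f x - g x)"
  using lbm_add[OF assms(1) lbm_cmult[OF assms(2), of "- 1"]] by simp

lemma lbm_sum: "finite I \<Longrightarrow> (\<And>i. i \<in> I \<Longrightarrow> lbm (f i)) \<Longrightarrow> lbm (\<lambda>x. \<Sum>i\<in>I. f i x)"
  by (induction I rule: finite_induct) (auto intro: lbm_const lbm_add)

lemma lbm_Im: assumes "lbm f" shows "lbm (\<lambda>x. of_real (Im (f x)))"
  unfolding locally_bounded_measurable_def
proof (intro conjI allI impI)
  have [measurable]: "f \<in> borel_measurable borel" using assms by (simp add: locally_bounded_measurable_def)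
  show "(\<lambda>x. complex_of_real (Im (f x))) \<in> borel_measurable borel" by measurable
  fix a b :: real assume "0 < a"
  then obtain A where A: "\<forall>x\<in>{a..b}. cmod (f x) \<le> A"
    using assms unfolding locally_bounded_measurable_def by blast
  then show "\<exists>B. \<forall>x\<in>{a..b}. cmod (complex_of_real (Im (f x))) \<le> B"
    unfolding norm_of_real by (meson abs_Im_le_cmod order_trans)
qed

lemma lbm_scale: assumes "lbm f" "d > 0" shows "lbm (\<lambda>x. f (x / d))"
  unfolding locally_bounded_measurable_def
proof (intro conjI allI impI)
  have [measurable]: "f \<in> borel_measurable borel" using assms by (simp add: locally_bounded_measurable_def)
  show "(\<lambda>x. f (x / d)) \<in> borel_measurable borel" by measurable
  fix a b :: real assume "0 < a"
  then obtain A where A: "\<forall>x\<in>{a / d..b / d}. cmod (f x) \<le> A"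
    using assms unfolding locally_bounded_measurable_def by (meson divide_pos_pos)
  show "\<exists>B. \<forall>x\<in>{a..b}. cmod (f (x / d)) \<le> B"
    using A assms(2) by (intro exI[of _ A] ballI) (auto simp: divide_right_mono)
qed

lemma lbm_square_integrable:
  assumes "lbm f" "a > 0" shows "(\<lambda>x. (cmod (f x))\<^sup>2) integrable_on {a..b}"
proof -
  have [measurable]: "f \<in> borel_measurable borel" using assms by (simp add: locally_bounded_measurable_def)
  obtain A where A: "\<forall>x\<in>{a..b}. cmod (f x) \<le> A"
    using assms unfolding locally_bounded_measurable_def by blast
  show ?thesis
  proof (rule integrable_bounded_measurable)
    show "(\<lambda>x. (cmod (f x))\<^sup>2) \<in> borel_measurable borel" by measurable
    show "norm ((cmod (f x))\<^sup>2) \<le> A\<^sup>2" if "x \<in> {a..b}" for x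
      using A that by (simp add: power_mono)
  qed
qed

text \<open>Monotonicity of \<open>Dsum\<close> gives both measurability and boundedness; the other
  terms are continuous for x > 0.\<close>

lemma lbm_Delta: "lbm (\<lambda>x. of_real (Delta x))"
proof -
  have mono: "mono Dsum" unfolding mono_def Dsum_def
    by (intro allI impI sum_mono2 finite_le_real) auto
  have [measurable]: "Dsum \<in> borel_measurable borel" by (rule borel_measurable_mono[OF mono])
  have D: "lbm (\<lambda>x. of_real (Dsum x))"
    unfolding locally_bounded_measurable_def
  proof (intro conjI allI impI exI ballI)
    show "(\<lambda>x. complex_of_real (Dsum x)) \<in> borel_measurable borel" by measurable
    fix a b x :: real assume "x \<in> {a..b}"
    moreover have "Dsum x \<ge> 0" unfolding Dsum_def by (intro sum_nonneg) auto
    ultimately show "cmod (complex_of_real (Dsum x)) \<le> Dsum b" using monoD[OF mono, of x b] by simp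
  qed
  have c: "lbm (\<lambda>x. of_real (x * ln x + (2 * euler_mascheroni - 1) * x))"
    by (rule lbm_continuous) (auto intro!: continuous_intros)
  have "complex_of_real (Delta x) = of_real (Dsum x) - of_real (x * ln x + (2 * euler_mascheroni - 1) * x)" for x
    by (simp add: Delta_def)
  with lbm_diff[OF D c] show ?thesis by simp
qed

definition voronoi_sum :: "nat \<Rightarrow> real \<Rightarrow> real" where
  "voronoi_sum R x = x powr (1/4) * Im (kappa * (\<Sum>r=1..R. of_real (tau r) *
     (of_real (real r powr (-3/4)) * ee (2 * sqrt (real r) * sqrt x))))"

lemma lbm_trig: "lbm (\<lambda>x. ee (c * sqrt x))"
proof (rule lbm_continuous)
  show "(\<lambda>x. ee (c * sqrt x)) \<in> borel_measurable borel" by measurable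
  show "continuous_on {0<..} (\<lambda>x. ee (c * sqrt x))" by (intro continuous_on_ee continuous_intros)
qed

lemma lbm_powr: "lbm (\<lambda>x. of_real (x powr s))"
  by (rule lbm_continuous) (auto intro!: continuous_intros)

lemma lbm_voronoi_sum: "lbm (\<lambda>x. of_real (voronoi_sum R x))"
  unfolding voronoi_sum_def of_real_mult
  by (intro lbm_mult lbm_powr lbm_Im lbm_cmult lbm_sum lbm_trig finite_atLeastAtMost)

section \<open>From dyadic windows to the Voronoi approximation of Delta\<close>

lemma sum4_square_le:
  fixes a b c d :: real shows "(a + b + c + d)\<^sup>2 \<le> 4 * (a\<^sup>2 + b\<^sup>2 + c\<^sup>2 + d\<^sup>2)"
proof -
  have "0 \<le> (a-b)\<^sup>2 + (a-c)\<^sup>2 + (a-d)\<^sup>2 + (b-c)\<^sup>2 + (b-d)\<^sup>2 + (c-d)\<^sup>2" by simp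
  then show ?thesis by (simp add: power2_eq_square algebra_simps)
qed

text \<open>Halving X repeatedly loses nothing, because 2 (X/2)^(3/2) <= X^(3/2). The fixed initial
  piece is eventually absorbed by a second e X^(3/2), hence the factor 2.\<close>

lemma integral_dyadic:
  fixes f :: "real \<Rightarrow> real"
  assumes int: "\<And>a b. a > 0 \<Longrightarrow> f integrable_on {a..b}" and nn: "\<And>x. f x \<ge> 0"
    and win: "\<And>X. X \<ge> X0 \<Longrightarrow> integral {X..2 * X} f \<le> e * X powr (3/2)" and c: "c > 0" and e: "e > 0"
  shows "\<forall>\<^sub>F X in at_top. integral {c..X} f \<le> 2 * e * X powr (3/2)"
proof -
  define X1 where "X1 = max (max X0 1) c"
  have X1: "X1 \<ge> X0" "X1 \<ge> 1" "X1 \<ge> c" by (auto simp: X1_def)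
  define V where "V = (\<lambda>X. integral {c..X} f)"
  have V: "V X \<le> V (2 * X1) + e * X powr (3/2)" if "X1 \<le> X" "X \<le> 2 ^ n * X1" for X n
    using that
  proof (induction n arbitrary: X)
    case 0
    have "V X \<le> V (2 * X1)" unfolding V_def
      by (rule integral_subset_le) (use 0 X1 int c nn in auto)
    moreover have "0 \<le> e * X powr (3/2)" using e by simp
    ultimately show ?case by linarith
  next
    case (Suc n)
    show ?case
    proof (cases "X \<le> 2 * X1")
      case True
      have "V X \<le> V (2 * X1)" unfolding V_def
        by (rule integral_subset_le) (use True X1 int c nn in auto)
      moreover have "0 \<le> e * X powr (3/2)" using e by simp
      ultimately show ?thesis by linarith
    next
      case False
      define Y where "Y = X / 2"
      have Y: "X1 \<le> Y" "Y \<le> 2 ^ n * X1" "X = 2 * Y" using False Suc.prems by (auto simp: Y_def)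
      have "V X = V Y + integral {Y..2 * Y} f" unfolding V_def Y(3)
        by (rule Henstock_Kurzweil_Integration.integral_combine[symmetric]) (use Y X1 c int in auto)
      also have "\<dots> \<le> (V (2 * X1) + e * Y powr (3/2)) + e * Y powr (3/2)"
        by (intro add_mono Suc.IH win) (use Y X1 in auto)
      also have "\<dots> = V (2 * X1) + e * (2 * Y powr (3/2))" by simp
      also have "\<dots> \<le> V (2 * X1) + e * X powr (3/2)"
      proof (intro add_left_mono mult_left_mono)
        have "(2::real) = 2 powr 1" by simp
        also have "\<dots> \<le> 2 powr (3/2)" by (intro powr_mono) auto
        finally have "2 * Y powr (3/2) \<le> 2 powr (3/2) * Y powr (3/2)" by (intro mult_right_mono) auto
        also have "\<dots> = X powr (3/2)" unfolding Y(3) using Y X1 by (simp add: powr_mult)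
        finally show "2 * Y powr (3/2) \<le> X powr (3/2)" .
      qed (use e in simp)
      finally show ?thesis .
    qed
  qed
  have "\<forall>\<^sub>F X in at_top. V (2 * X1) / e \<le> X powr (3/2)"
    by (rule filterlim_at_top[THEN iffD1, rule_format]) real_asymp
  then show ?thesis using eventually_ge_at_top[of X1]
  proof eventually_elim
    case (elim X)
    obtain n where "X / X1 < 2 ^ n" using real_arch_pow[of 2 "X / X1"] by auto
    then have "X \<le> 2 ^ n * X1" using X1 by (simp add: divide_less_eq)
    from V[OF elim(2) this] have "V X \<le> V (2 * X1) + e * X powr (3/2)" .
    moreover have "V (2 * X1) \<le> e * X powr (3/2)" using elim(1) e by (simp add: divide_le_eq mult.commute)
    ultimately show ?case by (simp add: V_def)
  qed
qed

lemma ceiling_window: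
  assumes X: "X \<ge> 1" and x: "x \<in> {X..2 * X}" and N: "N = nat \<lceil>2 * sqrt (2 * X)\<rceil>"
  shows "2 * sqrt x \<le> real N" "real N \<le> 4 * sqrt X" "sqrt (2 * x) \<le> real N" "nat \<lceil>2 * sqrt x\<rceil> \<le> N"
proof -
  have N1: "2 * sqrt (2 * X) \<le> real N" unfolding N by linarith
  have s: "sqrt x \<le> sqrt (2 * X)" using x by simp
  show 1: "2 * sqrt x \<le> real N" using N1 s by linarith
  have q2: "sqrt 2 \<le> 3/2" by (rule real_le_lsqrt) (auto simp: power2_eq_square)
  have "2 * sqrt (2 * X) = 2 * sqrt 2 * sqrt X" by (simp add: real_sqrt_mult)
  also have "\<dots> \<le> 3 * sqrt X" using q2 X by (intro mult_right_mono) auto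
  finally have b: "2 * sqrt (2 * X) \<le> 3 * sqrt X" .
  have "0 \<le> 2 * sqrt (2 * X)" using X by simp
  then have "real N \<le> 2 * sqrt (2 * X) + 1" unfolding N by linarith
  then have "real N \<le> 3 * sqrt X + 1" using b by linarith
  moreover have "1 \<le> sqrt X" using X by simp
  ultimately show "real N \<le> 4 * sqrt X" by linarith
  have "sqrt (2 * x) = sqrt 2 * sqrt x" by (simp add: real_sqrt_mult)
  also have "\<dots> \<le> 2 * sqrt x" using q2 x X by (intro mult_right_mono) auto
  finally show "sqrt (2 * x) \<le> real N" using 1 by linarith
  show "nat \<lceil>2 * sqrt x\<rceil> \<le> N" unfolding N using s by (intro nat_mono ceiling_mono) simp
qed

lemma window_rest_sum:
  assumes \<Theta>: "amp B \<Theta>" and X: "X > 0"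
  shows "(\<lambda>x. (rest_sum \<Theta> K N x)\<^sup>2) integrable_on {X..2 * X}"
    and "integral {X..2 * X} (\<lambda>x. (rest_sum \<Theta> K N x)\<^sup>2) = X * integral {1..2} (\<lambda>y. (rest_sum \<Theta> K N (X * y))\<^sup>2)"
proof -
  show 1: "(\<lambda>x. (rest_sum \<Theta> K N x)\<^sup>2) integrable_on {X..2 * X}"
    using integrable_rest_sum[OF \<Theta> X, of 1 K N "2 * X"] by simp
  show "integral {X..2 * X} (\<lambda>x. (rest_sum \<Theta> K N x)\<^sup>2) = X * integral {1..2} (\<lambda>y. (rest_sum \<Theta> K N (X * y))\<^sup>2)"
    using integral_window[OF 1 X] .
qed

lemma amp_mono:
  assumes "amp B h" "B \<le> B'" shows "amp B' h"
proof -
  obtain h' h'' where w: "amp_wit B h h' h''" using assms(1) by (rule ampE)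
  note F = amp_witD[OF w]
  show ?thesis
    by (rule ampI[OF F(1) F(2) order_trans[OF F(3) assms(2)] order_trans[OF F(4) assms(2)] order_trans[OF F(5) assms(2)] F(7)])
qed

text \<open>One B for every Z is essential: Z is chosen later, depending on B. Dilation invariance
  of \<open>amp\<close> provides it.\<close>

lemma amp_smooth_parts:
  "\<exists>B. \<forall>Z>0. amp B (\<lambda>z. omega z * (1 - stp (z / Z))) \<and> amp B (\<lambda>z. omega z * stp (z / Z))"
proof -
  obtain Bs where Bs: "amp Bs stp" using amp_stp by blast
  obtain Bo where Bo: "amp Bo omega" using amp_omega by blast
  have Bs0: "Bs \<ge> 0" and Bo0: "Bo \<ge> 0" using Bs Bo amp_nonneg by auto
  have "amp (4 * Bo * (1 + 4 * Bs)) (\<lambda>z. omega z * (1 - stp (z / Z))) \<and> amp (4 * Bo * (1 + 4 * Bs)) (\<lambda>z. omega z * stp (z / Z))" if Z: "Z > 0" for Z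
  proof
    have s: "amp Bs (\<lambda>z. stp (z / Z))" using amp_scale[OF Bs, of "1 / Z"] Z by simp
    have "amp (\<bar>1\<bar> + 4 * \<bar>-1\<bar> * Bs) (\<lambda>z. 1 + (-1) * stp (z / Z))"
      by (rule amp_add[OF amp_const amp_mult[OF amp_const s]])
    from amp_mult[OF Bo this] show "amp (4 * Bo * (1 + 4 * Bs)) (\<lambda>z. omega z * (1 - stp (z / Z)))" by simp
    have "amp (4 * Bo * Bs) (\<lambda>z. omega z * stp (z / Z))" by (rule amp_mult[OF Bo s])
    then show "amp (4 * Bo * (1 + 4 * Bs)) (\<lambda>z. omega z * stp (z / Z))"
      by (rule amp_mono) (use Bs0 Bo0 in \<open>auto intro!: mult_left_mono\<close>)
  qed
  then show ?thesis by (intro exI[of _ "4 * Bo * (1 + 4 * Bs)"] allI impI)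
qed

text \<open>Theta2 keeps the whole sawtooth (K = 0), while Theta1 splits it at K. Since omega
  vanishes up to 1/2, terms with n >= 2 sqrt x contribute nothing. The main sum may therefore have a
  length depending on x, as the B-process wants, while the two rests share one N over a whole
  window.\<close>

lemma Delta_decomposition:
  fixes K N :: nat and Z x :: real
  assumes x: "x \<ge> 2" and N: "sqrt (2 * x) \<le> real N" "nat \<lceil>2 * sqrt x\<rceil> \<le> N"
  defines "\<Theta>1 \<equiv> \<lambda>z. omega z * (1 - stp (z / Z))" and "\<Theta>2 \<equiv> \<lambda>z. omega z * stp (z / Z)"
  shows "\<bar>Delta x - (rest_sum \<Theta>2 0 N x + rest_sum \<Theta>1 K N x +
    (\<Sum>n=1..nat \<lceil>2 * sqrt x\<rceil>. \<Theta>1 (x / (real n)\<^sup>2) * sine_sum K (x / real n)))\<bar> \<le> 9"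
proof -
  have "(\<Sum>n=1..nat \<lceil>2 * sqrt x\<rceil>. \<Theta>1 (x / (real n)\<^sup>2) * sine_sum K (x / real n)) = (\<Sum>n=1..N. \<Theta>1 (x / (real n)\<^sup>2) * sine_sum K (x / real n))"
  proof (rule sum.mono_neutral_left)
    show "\<forall>n\<in>{1..N} - {1..nat \<lceil>2 * sqrt x\<rceil>}. \<Theta>1 (x / (real n)\<^sup>2) * sine_sum K (x / real n) = 0"
    proof
      fix n assume "n \<in> {1..N} - {1..nat \<lceil>2 * sqrt x\<rceil>}"
      then have n: "n \<ge> 1" "2 * sqrt x \<le> real n" by (auto simp: not_le) linarith
      have "(2 * sqrt x)\<^sup>2 \<le> (real n)\<^sup>2" by (rule power_mono[OF n(2)]) (use x in simp)
      then have "4 * x \<le> (real n)\<^sup>2" using x by (simp add: power_mult_distrib)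
      then have "x / (real n)\<^sup>2 \<le> 1/2" using n x by (simp add: divide_le_eq)
      then have "omega (x / (real n)\<^sup>2) = 0" using n x by (intro omega_0) auto
      then show "\<Theta>1 (x / (real n)\<^sup>2) * sine_sum K (x / real n) = 0" by (simp add: \<Theta>1_def)
    qed
  qed (use N in auto)
  moreover have "rest_sum \<Theta>2 0 N x + rest_sum \<Theta>1 K N x + (\<Sum>n=1..N. \<Theta>1 (x / (real n)\<^sup>2) * sine_sum K (x / real n))
     = - (\<Sum>n=1..N. psi (x / real n) * omega (x / (real n)\<^sup>2))"
    unfolding rest_sum_def sum.distrib[symmetric] sum_negf[symmetric]
    by (intro sum.cong refl) (simp add: sine_rest_def sine_sum_def \<Theta>1_def \<Theta>2_def algebra_simps)
  ultimately show ?thesis using Delta_smooth[OF x N(1)] by simp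
qed

text \<open>The weight \<open>\<Theta>1\<close> keeps a bounded range of $x/n^2$, where finitely many frequencies
  give the Voronoi terms in the limit; \<open>\<Theta>2\<close> and the frequencies beyond $K$ are small in mean square.
  The involution $(k,l) \mapsto (l,k)$ turns the weights \<open>omega\<close> of the pairs with $kl = r$ into $\tau(r)$.\<close>

lemma Delta_voronoi_window:
  assumes e: "e > 0"
  shows "\<exists>R0. \<forall>R\<ge>R0. \<exists>X0. \<forall>X\<ge>X0. integral {X..2 * X} (\<lambda>x. (Delta x - voronoi_sum R x)\<^sup>2) \<le> e * X powr (3/2)"
proof -
  obtain B where B': "\<forall>Z>0. amp B (\<lambda>z. omega z * (1 - stp (z / Z))) \<and> amp B (\<lambda>z. omega z * stp (z / Z))"
    using amp_smooth_parts by (elim exE)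
  note B = B'[rule_format, THEN conjunct1] B'[rule_format, THEN conjunct2]
  obtain C where C: "C > 0" and rest': "\<forall>\<Theta> (B::real) (z0::real) K (X::real) N G. amp B \<Theta> \<longrightarrow> (\<forall>z. 0 < z \<longrightarrow> z < z0 \<longrightarrow> \<Theta> z = 0) \<longrightarrow> 1/2 \<le> z0 \<longrightarrow> 1 \<le> X \<longrightarrow>
     real K \<le> X \<longrightarrow> real N \<le> 4 * sqrt X \<longrightarrow> (\<forall>S. finite S \<longrightarrow> S \<subseteq> {K<..} \<longrightarrow> (\<Sum>k\<in>S. \<Sum>l\<in>S. gcd_weight k l) \<le> G) \<longrightarrow>
     integral {1..2} (\<lambda>y. (rest_sum \<Theta> K N (X * y))\<^sup>2) \<le> C * B\<^sup>2 * (sqrt (X / z0) * G + (3 + ln X)\<^sup>2)"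
    using rest_mean_square by (elim exE conjE)
  note rest = rest'[THEN spec, THEN spec, THEN spec, THEN spec, THEN spec, THEN spec, THEN spec,
    THEN mp, THEN mp, THEN mp, THEN mp, THEN mp, THEN mp, THEN mp]
  define D where "D = C * B\<^sup>2 + 1"
  have D: "D > 0" using C by (simp add: D_def add_nonneg_pos)
  have CD: "C * B\<^sup>2 \<le> D" by (simp add: D_def)
  \<comment> \<open>The final count is 4 (2 + 2 + 2 + 9) = 60 multiples of delta.\<close>
  define \<delta> where "\<delta> = e / 100"
  have \<delta>: "\<delta> > 0" using e by (simp add: \<delta>_def)
  obtain T where T: "T \<ge> 0" "\<forall>S. finite S \<longrightarrow> S \<subseteq> {0<..} \<longrightarrow> (\<Sum>k\<in>S. \<Sum>l\<in>S. gcd_weight k l) \<le> T"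
    using gcd_weight_bounded by blast
  \<comment> \<open>The 2 pays for 1/sqrt(1/2), since Theta1 is only known to vanish below z0 =
    1/2.\<close>
  obtain K0 where K0: "\<And>K S. K \<ge> K0 \<Longrightarrow> finite S \<Longrightarrow> S \<subseteq> {K<..} \<Longrightarrow> (\<Sum>k\<in>S. \<Sum>l\<in>S. gcd_weight k l) \<le> \<delta> / (2 * D)"
    using gcd_weight_tail[of "\<delta> / (2 * D)"] \<delta> D by auto
  obtain R0 where R0: "\<And>R S. R \<ge> R0 \<Longrightarrow> finite S \<Longrightarrow> S \<subseteq> {R<..} \<Longrightarrow> (\<Sum>r\<in>S. tau r ^ 2 * real r powr (-3/2)) \<le> \<delta>"
    using tau_squared_tail[OF \<delta>] by blast
  show ?thesis
  proof (intro exI[of _ R0] allI impI)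
    fix R assume R: "R0 \<le> R"
    \<comment> \<open>Z >= R serves \<open>truncated_pairs_split\<close>; the square makes D T /
      sqrt Z at most delta, which disposes of the Theta2 part with the trivial bound T.\<close>
    define Z where "Z = max (max 1 (real R)) ((D * T / \<delta>)\<^sup>2)"
    have Z: "Z \<ge> 1" "Z \<ge> real R" "Z \<ge> (D * T / \<delta>)\<^sup>2" by (auto simp: Z_def)
    have sZ: "D * T / sqrt Z \<le> \<delta>"
    proof -
      have "D * T / \<delta> \<le> sqrt Z" using Z(3) by (rule real_le_rsqrt)
      then show ?thesis using Z \<delta> by (simp add: divide_le_eq mult.commute)
    qed
    define K where "K = max K0 R"
    \<comment> \<open>Theta1 vanishes from 2Z on, so \<open>main_term\<close> requires L >= 32 * 2Z
      * K; the summand R makes room for all pairs with kl <= R.\<close>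
    define L where "L = nat \<lceil>64 * Z * real K\<rceil> + R"
    have K: "K0 \<le> K" "R \<le> K" by (auto simp: K_def)
    have L: "R \<le> L" "64 * Z * real K \<le> real L" unfolding L_def by linarith+
    define \<Theta>1 where "\<Theta>1 = (\<lambda>z. omega z * (1 - stp (z / Z)))"
    define \<Theta>2 where "\<Theta>2 = (\<lambda>z. omega z * stp (z / Z))"
    have a1: "amp B \<Theta>1" and a2: "amp B \<Theta>2" unfolding \<Theta>1_def \<Theta>2_def using B Z by auto
    define M where "M = (\<lambda>x. \<Sum>n=1..nat \<lceil>2 * sqrt x\<rceil>. \<Theta>1 (x / (real n)\<^sup>2) * sine_sum K (x / real n))"
    define F where "F = (\<lambda>x n. of_real (real n powr (-3/4)) * ee (2 * sqrt (real n) * sqrt x))"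
    define Q where "Q = (\<lambda>x. \<Sum>k=1..K. \<Sum>l=1..L. of_real (\<Theta>1 (real l / real k)) * F x (k * l))"
    define I where "I = {(k,l)\<in>{1..K} \<times> {1..L}. R < k * l}"
    have finI: "finite I" unfolding I_def by (rule finite_subset[of _ "{1..K} \<times> {1..L}"]) auto
    define w where "w = (\<lambda>x. \<Sum>(k,l)\<in>I. of_real (\<Theta>1 (real l / real k)) * F x (k * l))"
    have Qw: "Q x = (\<Sum>r=1..R. of_real (tau r) * F x r) + w x" for x
      unfolding Q_def w_def I_def \<Theta>1_def by (rule truncated_pairs_split) (use K L Z in auto)
    define \<eta> where "\<eta> = (\<lambda>t. M (t\<^sup>2) / sqrt t - Im (kappa * Q (t\<^sup>2)))"
    have \<eta>: "(\<eta> \<longlongrightarrow> 0) at_top"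
    proof -
      have "((\<lambda>t. (\<Sum>n=1..nat \<lceil>2 * t\<rceil>. \<Theta>1 (t\<^sup>2 / (real n)\<^sup>2) * sine_sum K (t\<^sup>2 / real n)) / sqrt t -
        Im (kappa * (\<Sum>k=1..K. \<Sum>l=1..L. of_real (\<Theta>1 (real l / real k) * real (k * l) powr (-3/4)) * ee (2 * sqrt (real (k * l)) * t)))) \<longlongrightarrow> 0) at_top"
      proof (rule main_term[OF a1])
        show "1/2 < 2 * Z" using Z by simp
        show "32 * (2 * Z) * real K \<le> real L" using L by simp
        show "2 * t \<le> real (nat \<lceil>2 * t\<rceil>)" for t by linarith
        fix z :: real assume z: "0 < z" "z \<le> 1/2 \<or> 2 * Z \<le> z"
        show "\<Theta>1 z = 0"
        proof (cases "z \<le> 1/2")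
          case True
          then show ?thesis using omega_0[OF z(1)] by (simp add: \<Theta>1_def)
        next
          case False
          then have "z / Z \<ge> 2" using z Z by (simp add: le_divide_eq)
          then show ?thesis using stp_1 by (simp add: \<Theta>1_def)
        qed
      qed
      then show ?thesis
      proof (rule Lim_transform_eventually)
        show "\<forall>\<^sub>F t in at_top. (\<Sum>n=1..nat \<lceil>2 * t\<rceil>. \<Theta>1 (t\<^sup>2 / (real n)\<^sup>2) * sine_sum K (t\<^sup>2 / real n)) / sqrt t -
        Im (kappa * (\<Sum>k=1..K. \<Sum>l=1..L. of_real (\<Theta>1 (real l / real k) * real (k * l) powr (-3/4)) * ee (2 * sqrt (real (k * l)) * t))) = \<eta> t"
          using eventually_ge_at_top[of 0]
        proof eventually_elim
          case (elim t)
          then have "sqrt (t\<^sup>2) = t" by simp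
          then show ?case unfolding \<eta>_def M_def Q_def F_def by (simp only: of_real_mult mult.assoc)
        qed
      qed
    qed
    have w_int: "\<forall>\<^sub>F X in at_top. integral {1..X} (\<lambda>x. sqrt x * (cmod (w x))\<^sup>2) \<le> 3 * \<delta> * X powr (3/2)"
      unfolding w_def F_def
    proof (rule off_main_mean_square[OF finI])
      show "R < k * l" if "(k, l) \<in> I" for k l using that by (auto simp: I_def)
      show "(\<Sum>r\<in>S. tau r ^ 2 * real r powr (-3/2)) \<le> \<delta>" if "finite S" "S \<subseteq> {R<..}" for S
        by (rule R0[OF R that])
      fix k l :: nat
      have "\<bar>\<Theta>1 (real l / real k)\<bar> \<le> 2 * 1" unfolding \<Theta>1_def abs_mult
        using omega_range[of "real l / real k"] stp_range[of "real l / real k / Z"] by (intro mult_mono) auto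
      then show "\<bar>\<Theta>1 (real l / real k)\<bar> \<le> 2" by simp
    qed (rule \<delta>)
    have ev: "\<forall>\<^sub>F X in at_top. (\<forall>x\<ge>X. \<bar>\<eta> (sqrt x)\<bar> \<le> sqrt \<delta> / 2 \<and> 9 \<le> x powr (1/4) * (sqrt \<delta> / 2)) \<and>
       integral {1..2 * X} (\<lambda>x. sqrt x * (cmod (w x))\<^sup>2) \<le> 3 * \<delta> * (2 * X) powr (3/2) \<and>
       D * (3 + ln X)\<^sup>2 \<le> \<delta> * sqrt X \<and> X \<ge> 2 \<and> X \<ge> real K"
    proof (intro eventually_conj)
      have "((\<lambda>x. \<eta> (sqrt x)) \<longlongrightarrow> 0) at_top" by (rule filterlim_compose[OF \<eta> sqrt_at_top])
      from tendstoD[OF this, of "sqrt \<delta> / 2"] have "\<forall>\<^sub>F x in at_top. \<bar>\<eta> (sqrt x)\<bar> < sqrt \<delta> / 2"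
        using \<delta> by (simp add: dist_real_def)
      moreover have "\<forall>\<^sub>F x::real in at_top. 9 / (sqrt \<delta> / 2) \<le> x powr (1/4)"
        by (rule filterlim_at_top[THEN iffD1, rule_format]) real_asymp
      ultimately have "\<forall>\<^sub>F x in at_top. \<bar>\<eta> (sqrt x)\<bar> \<le> sqrt \<delta> / 2 \<and> 9 \<le> x powr (1/4) * (sqrt \<delta> / 2)"
      proof eventually_elim
        case (elim x)
        have "sqrt \<delta> / 2 > 0" using \<delta> by simp
        then have "9 \<le> x powr (1/4) * (sqrt \<delta> / 2)" using elim(2) pos_divide_le_eq by blast
        then show ?case using elim(1) by simp
      qed
      then show "\<forall>\<^sub>F X in at_top. \<forall>x\<ge>X. \<bar>\<eta> (sqrt x)\<bar> \<le> sqrt \<delta> / 2 \<and> 9 \<le> x powr (1/4) * (sqrt \<delta> / 2)"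
        by (rule eventually_all_ge_at_top)
      show "\<forall>\<^sub>F X in at_top. integral {1..2 * X} (\<lambda>x. sqrt x * (cmod (w x))\<^sup>2) \<le> 3 * \<delta> * (2 * X) powr (3/2)"
        by (rule eventually_compose_filterlim[OF w_int]) real_asymp
      have "((\<lambda>X::real. (3 + ln X)\<^sup>2 / sqrt X) \<longlongrightarrow> 0) at_top" by real_asymp
      from order_tendstoD(2)[OF this, of "\<delta> / D"]
      have "\<forall>\<^sub>F X in at_top. (3 + ln X)\<^sup>2 / sqrt X < \<delta> / D" using \<delta> D by simp
      then show "\<forall>\<^sub>F X in at_top. D * (3 + ln X)\<^sup>2 \<le> \<delta> * sqrt X"
        using eventually_gt_at_top[of 0] 
      proof eventually_elim
        case (elim X)
        then show ?case using D by (simp add: divide_simps mult_ac)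
      qed
    qed (rule eventually_ge_at_top)+
    then obtain X0 where X0: "\<And>X. X \<ge> X0 \<Longrightarrow> (\<forall>x\<ge>X. \<bar>\<eta> (sqrt x)\<bar> \<le> sqrt \<delta> / 2 \<and> 9 \<le> x powr (1/4) * (sqrt \<delta> / 2)) \<and>
       integral {1..2 * X} (\<lambda>x. sqrt x * (cmod (w x))\<^sup>2) \<le> 3 * \<delta> * (2 * X) powr (3/2) \<and>
       D * (3 + ln X)\<^sup>2 \<le> \<delta> * sqrt X \<and> X \<ge> 2 \<and> X \<ge> real K"
      unfolding eventually_at_top_linorder by blast
    show "\<exists>X0. \<forall>X\<ge>X0. integral {X..2 * X} (\<lambda>x. (Delta x - voronoi_sum R x)\<^sup>2) \<le> e * X powr (3/2)"
    proof (intro exI[of _ X0] allI impI)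
      fix X assume "X0 \<le> X"
      note H = X0[OF this]
      have X: "X \<ge> 2" "X \<ge> 1" "X > 0" using H by auto
      define N where "N = nat \<lceil>2 * sqrt (2 * X)\<rceil>"
      note NN = ceiling_window[OF X(2) _ N_def]
      have N4: "real N \<le> 4 * sqrt X" by (rule NN(2)[of X]) (use X in simp)
      define S where "S = rest_sum \<Theta>2 0 N"
      define U where "U = rest_sum \<Theta>1 K N"
      have X32: "X * sqrt X = X powr (3/2)"
      proof -
        have "X * sqrt X = X powr 1 * X powr (1/2)" using X by (simp add: powr_half_sqrt)
        also have "\<dots> = X powr (3/2)" by (simp only: powr_add[symmetric]) simp
        finally show ?thesis .
      qed
      have bound: "X * (C * B\<^sup>2 * (sqrt (X / z0) * G + (3 + ln X)\<^sup>2)) \<le> 2 * \<delta> * X powr (3/2)" if "D * G / sqrt z0 \<le> \<delta>" "z0 > 0" "G \<ge> 0" for z0 G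
      proof -
        have "C * B\<^sup>2 * (sqrt (X / z0) * G + (3 + ln X)\<^sup>2) \<le> D * (sqrt (X / z0) * G + (3 + ln X)\<^sup>2)"
          by (rule mult_right_mono[OF CD]) (use that X in auto)
        also have "\<dots> = D * G / sqrt z0 * sqrt X + D * (3 + ln X)\<^sup>2"
          by (simp add: real_sqrt_divide algebra_simps)
        also have "\<dots> \<le> \<delta> * sqrt X + \<delta> * sqrt X"
          by (intro add_mono mult_right_mono that) (use H X in auto)
        finally have "X * (C * B\<^sup>2 * (sqrt (X / z0) * G + (3 + ln X)\<^sup>2)) \<le> X * (\<delta> * sqrt X + \<delta> * sqrt X)"
          using X by (intro mult_left_mono) auto
        also have "\<dots> = 2 * \<delta> * (X * sqrt X)" by (simp add: algebra_simps)
        finally show ?thesis unfolding X32 .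
      qed
      have iS: "(\<lambda>x. (S x)\<^sup>2) integrable_on {X..2 * X}" and bS: "integral {X..2 * X} (\<lambda>x. (S x)\<^sup>2) \<le> 2 * \<delta> * X powr (3/2)"
      proof -
        show "(\<lambda>x. (S x)\<^sup>2) integrable_on {X..2 * X}" unfolding S_def by (rule window_rest_sum(1)[OF a2 X(3)])
        have "integral {1..2} (\<lambda>y. (rest_sum \<Theta>2 0 N (X * y))\<^sup>2) \<le> C * B\<^sup>2 * (sqrt (X / Z) * T + (3 + ln X)\<^sup>2)"
        proof (rule rest[OF a2 _ _ X(2) _ N4 T(2)])
          show "\<forall>z. 0 < z \<longrightarrow> z < Z \<longrightarrow> \<Theta>2 z = 0"
          proof (intro allI impI)
            fix z assume "0 < z" "z < Z"
            then have "stp (z / Z) = 0" by (intro stp_0) simp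
            then show "\<Theta>2 z = 0" by (simp add: \<Theta>2_def)
          qed
        qed (use Z X in auto)
        then have "integral {X..2 * X} (\<lambda>x. (S x)\<^sup>2) \<le> X * (C * B\<^sup>2 * (sqrt (X / Z) * T + (3 + ln X)\<^sup>2))"
          unfolding S_def window_rest_sum(2)[OF a2 X(3)] using X by (intro mult_left_mono) auto
        also have "\<dots> \<le> 2 * \<delta> * X powr (3/2)" by (rule bound[OF sZ]) (use Z T in auto)
        finally show "integral {X..2 * X} (\<lambda>x. (S x)\<^sup>2) \<le> 2 * \<delta> * X powr (3/2)" .
      qed
      have iU: "(\<lambda>x. (U x)\<^sup>2) integrable_on {X..2 * X}" and bU: "integral {X..2 * X} (\<lambda>x. (U x)\<^sup>2) \<le> 2 * \<delta> * X powr (3/2)"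
      proof -
        show "(\<lambda>x. (U x)\<^sup>2) integrable_on {X..2 * X}" unfolding U_def by (rule window_rest_sum(1)[OF a1 X(3)])
        have "integral {1..2} (\<lambda>y. (rest_sum \<Theta>1 K N (X * y))\<^sup>2) \<le> C * B\<^sup>2 * (sqrt (X / (1/2)) * (\<delta> / (2 * D)) + (3 + ln X)\<^sup>2)"
        proof (rule rest[OF a1 _ _ X(2) _ N4])
          show "\<forall>z. 0 < z \<longrightarrow> z < 1/2 \<longrightarrow> \<Theta>1 z = 0" by (simp add: \<Theta>1_def omega_0)
          show "\<forall>S. finite S \<longrightarrow> S \<subseteq> {K<..} \<longrightarrow> (\<Sum>k\<in>S. \<Sum>l\<in>S. gcd_weight k l) \<le> \<delta> / (2 * D)"
            using K0[OF K(1)] by blast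
        qed (use H in auto)
        then have "integral {X..2 * X} (\<lambda>x. (U x)\<^sup>2) \<le> X * (C * B\<^sup>2 * (sqrt (X / (1/2)) * (\<delta> / (2 * D)) + (3 + ln X)\<^sup>2))"
          unfolding U_def window_rest_sum(2)[OF a1 X(3)] using X by (intro mult_left_mono) auto
        also have "\<dots> \<le> 2 * \<delta> * X powr (3/2)"
        proof (rule bound)
          have "1/2 \<le> sqrt (1/2::real)" by (rule real_le_rsqrt) (simp add: power2_eq_square)
          then have "\<delta> / 2 / sqrt (1/2) \<le> \<delta>" using \<delta> by (simp add: divide_le_eq)
          then show "D * (\<delta> / (2 * D)) / sqrt (1/2) \<le> \<delta>" using D by simp
        qed (use \<delta> D in auto)
        finally show "integral {X..2 * X} (\<lambda>x. (U x)\<^sup>2) \<le> 2 * \<delta> * X powr (3/2)" .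
      qed
      have lw: "lbm w" unfolding w_def F_def split_beta by (intro lbm_sum finI lbm_cmult lbm_trig)
      have iw: "(\<lambda>x. sqrt x * (cmod (w x))\<^sup>2) integrable_on {a..b}" if "a > 0" for a b
      proof -
        have "(\<lambda>x. (cmod (of_real (x powr (1/4)) * w x))\<^sup>2) integrable_on {a..b}"
          by (rule lbm_square_integrable[OF lbm_mult[OF lbm_powr lw] that])
        moreover have "(cmod (of_real (x powr (1/4)) * w x))\<^sup>2 = sqrt x * (cmod (w x))\<^sup>2" if "x \<in> {a..b}" for x
        proof -
          have "(x powr (1/4))\<^sup>2 = x powr (1/2)" unfolding power2_eq_square by (simp only: powr_add[symmetric]) simp
          then show ?thesis using that \<open>a > 0\<close> by (simp add: norm_mult power_mult_distrib powr_half_sqrt)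
        qed
        ultimately show ?thesis by (rule integrable_eq)
      qed
      have bw: "integral {X..2 * X} (\<lambda>x. sqrt x * (cmod (w x))\<^sup>2) \<le> 9 * \<delta> * X powr (3/2)"
      proof -
        have "integral {X..2 * X} (\<lambda>x. sqrt x * (cmod (w x))\<^sup>2) \<le> integral {1..2 * X} (\<lambda>x. sqrt x * (cmod (w x))\<^sup>2)"
          by (rule integral_subset_le) (use X iw in auto)
        also have "\<dots> \<le> 3 * \<delta> * (2 * X) powr (3/2)" using H by blast
        also have "(2 * X) powr (3/2) = 2 powr (3/2) * X powr (3/2)" using X by (simp add: powr_mult)
        also have "3 * \<delta> * (2 powr (3/2) * X powr (3/2)) \<le> 3 * \<delta> * (3 * X powr (3/2))"
        proof (intro mult_left_mono mult_right_mono)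
          have "(2::real) powr (3/2) = 2 powr 1 * 2 powr (1/2)" by (simp only: powr_add[symmetric]) simp
          moreover have "sqrt 2 \<le> 3/2" by (rule real_le_lsqrt) (auto simp: power2_eq_square)
          ultimately show "(2::real) powr (3/2) \<le> 3" by (simp add: powr_half_sqrt)
        qed (use \<delta> in auto)
        finally show ?thesis by simp
      qed
      have kap: "(cmod kappa)\<^sup>2 \<le> 1"
      proof -
        have "(9::real) \<le> pi\<^sup>2" using pi_gt3 power_mono[of 3 pi 2] by simp
        then show ?thesis unfolding norm_kappa by (simp add: divide_le_eq)
      qed
      have pt: "(Delta x - voronoi_sum R x)\<^sup>2 \<le> 4 * ((S x)\<^sup>2 + (U x)\<^sup>2 + \<delta> * sqrt x + sqrt x * (cmod (w x))\<^sup>2)"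
        if x: "x \<in> {X..2 * X}" for x
      proof -
        have x0: "x \<ge> 2" "x \<ge> X" "x > 0" using x X by auto
        define q where "q = x powr (1/4)"
        have q2: "q\<^sup>2 = sqrt x"
        proof -
          have "q\<^sup>2 = x powr (1/2)" unfolding q_def power2_eq_square by (simp only: powr_add[symmetric]) simp
          then show ?thesis using x0 by (simp add: powr_half_sqrt)
        qed
        have qs: "q = sqrt (sqrt x)" using real_sqrt_unique[OF q2] by (simp add: q_def)
        have q0: "q > 0" using x0 by (simp add: q_def)
        have Mx: "M x = q * Im (kappa * Q x) + q * \<eta> (sqrt x)"
          using x0 q0 unfolding \<eta>_def qs[symmetric] by (simp add: field_simps)
        have vor: "voronoi_sum R x = q * Im (kappa * (\<Sum>r=1..R. of_real (tau r) * F x r))"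
          by (simp only: voronoi_sum_def q_def F_def)
        have dec: "\<bar>Delta x - (S x + U x + M x)\<bar> \<le> 9"
          unfolding S_def U_def M_def \<Theta>1_def \<Theta>2_def
          by (rule Delta_decomposition[OF x0(1) NN(3)[OF x] NN(4)[OF x]])
        \<comment> \<open>h collects the bounded error 9 and the error of the B-process; from X0 on,
          each is at most half of q sqrt delta.\<close>
        define h where "h = Delta x - (S x + U x + M x) + q * \<eta> (sqrt x)"
        have "Delta x - voronoi_sum R x = S x + U x + h + q * Im (kappa * w x)"
          unfolding h_def Mx vor Qw by (simp add: algebra_simps)
        then have p1: "(Delta x - voronoi_sum R x)\<^sup>2 \<le> 4 * ((S x)\<^sup>2 + (U x)\<^sup>2 + h\<^sup>2 + (q * Im (kappa * w x))\<^sup>2)"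
          using sum4_square_le[of "S x" "U x" h "q * Im (kappa * w x)"] by simp
        have p2: "h\<^sup>2 \<le> \<delta> * sqrt x"
        proof -
          have e1: "\<bar>\<eta> (sqrt x)\<bar> \<le> sqrt \<delta> / 2" "9 \<le> q * (sqrt \<delta> / 2)" using H x0(2) unfolding q_def by blast+
          have "\<bar>q * \<eta> (sqrt x)\<bar> \<le> q * (sqrt \<delta> / 2)" using e1(1) q0 by (simp add: abs_mult)
          then have "\<bar>h\<bar> \<le> q * sqrt \<delta>" unfolding h_def using dec e1(2) by linarith
          then have "\<bar>h\<bar>\<^sup>2 \<le> (q * sqrt \<delta>)\<^sup>2" by (intro power_mono) auto
          then show ?thesis using \<delta> by (simp add: power_mult_distrib q2 mult.commute)
        qed
        have p3: "(q * Im (kappa * w x))\<^sup>2 \<le> sqrt x * (cmod (w x))\<^sup>2"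
        proof -
          have "\<bar>Im (kappa * w x)\<bar>\<^sup>2 \<le> (cmod (kappa * w x))\<^sup>2" by (intro power_mono abs_Im_le_cmod) auto
          also have "\<dots> = (cmod kappa)\<^sup>2 * (cmod (w x))\<^sup>2" by (simp add: norm_mult power_mult_distrib)
          also have "\<dots> \<le> 1 * (cmod (w x))\<^sup>2" by (intro mult_right_mono kap) auto
          finally show ?thesis using x0 by (simp add: power_mult_distrib q2 mult_left_mono)
        qed
        show ?thesis
          by (rule order_trans[OF p1], rule mult_left_mono[OF add_mono[OF add_mono[OF order.refl p2] p3]]) simp
      qed
      have isq: "(\<lambda>x. \<delta> * sqrt x) integrable_on {X..2 * X}"
        by (intro integrable_continuous_real continuous_intros)
      have bsq: "integral {X..2 * X} (\<lambda>x. \<delta> * sqrt x) \<le> 2 * \<delta> * X powr (3/2)"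
      proof -
        have "integral {X..2 * X} (\<lambda>x. \<delta> * sqrt x) \<le> integral {X..2 * X} (\<lambda>x. \<delta> * (2 * sqrt X))"
        proof (rule integral_le[OF isq integrable_const_ivl])
          fix x assume x: "x \<in> {X..2 * X}"
          have "sqrt x \<le> sqrt (4 * X)" using x X by simp
          then show "\<delta> * sqrt x \<le> \<delta> * (2 * sqrt X)" using \<delta> by (simp add: real_sqrt_mult)
        qed
        also have "\<dots> = 2 * \<delta> * (X * sqrt X)" using X by simp
        finally show ?thesis unfolding X32 .
      qed
      have "integral {X..2 * X} (\<lambda>x. (Delta x - voronoi_sum R x)\<^sup>2)
          \<le> integral {X..2 * X} (\<lambda>x. 4 * ((S x)\<^sup>2 + (U x)\<^sup>2 + \<delta> * sqrt x + sqrt x * (cmod (w x))\<^sup>2))"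
      proof (rule integral_le)
        have "(\<lambda>x. (cmod (of_real (Delta x) - of_real (voronoi_sum R x)))\<^sup>2) integrable_on {X..2 * X}"
          by (intro lbm_square_integrable lbm_diff lbm_Delta lbm_voronoi_sum X)
        then show "(\<lambda>x. (Delta x - voronoi_sum R x)\<^sup>2) integrable_on {X..2 * X}"
          by (simp flip: of_real_diff)
        show "(\<lambda>x. 4 * ((S x)\<^sup>2 + (U x)\<^sup>2 + \<delta> * sqrt x + sqrt x * (cmod (w x))\<^sup>2)) integrable_on {X..2 * X}"
          by (intro integrable_on_mult_right integrable_add iS iU isq iw X)
      qed (rule pt)
      also have "\<dots> = 4 * (integral {X..2 * X} (\<lambda>x. (S x)\<^sup>2) + integral {X..2 * X} (\<lambda>x. (U x)\<^sup>2)
          + integral {X..2 * X} (\<lambda>x. \<delta> * sqrt x) + integral {X..2 * X} (\<lambda>x. sqrt x * (cmod (w x))\<^sup>2))"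
        by (subst integral_mult_right) (subst integral_add | intro integrable_add iS iU isq iw X | rule refl)+
      also have "\<dots> \<le> 4 * (2 * \<delta> * X powr (3/2) + 2 * \<delta> * X powr (3/2) + 2 * \<delta> * X powr (3/2) + 9 * \<delta> * X powr (3/2))"
        by (intro mult_left_mono add_mono bS bU bsq bw) auto
      also have "\<dots> = 60 * \<delta> * X powr (3/2)" by simp
      also have "\<dots> \<le> e * X powr (3/2)" by (intro mult_right_mono) (use e in \<open>auto simp: \<delta>_def\<close>)
      finally show "integral {X..2 * X} (\<lambda>x. (Delta x - voronoi_sum R x)\<^sup>2) \<le> e * X powr (3/2)" .
    qed
  qed
qed

section \<open>The mean square of the partial sums\<close>

text \<open>The exchange of limits: R is fixed by the accuracy of D and l, and only then does X
  grow. The parameter eta keeps the cross term linear in B and D.\<close>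

lemma mean_square_limit:
  fixes A :: "real \<Rightarrow> real" and B D :: "nat \<Rightarrow> real \<Rightarrow> real" and l :: "nat \<Rightarrow> real"
  assumes close: "\<And>\<eta> R X. \<eta> > 0 \<Longrightarrow> X \<ge> 1 \<Longrightarrow> \<bar>A X - B R X\<bar> \<le> \<eta> * B R X + (1 + 1 / \<eta>) * D R X"
    and B: "\<And>R. (B R \<longlongrightarrow> l R) at_top" and l: "l \<longlonglongrightarrow> L"
    and D: "\<And>e. e > 0 \<Longrightarrow> \<exists>R0. \<forall>R\<ge>R0. \<forall>\<^sub>F X in at_top. D R X \<le> e"
  shows "(A \<longlongrightarrow> L) at_top"
proof (rule tendstoI)
  fix e :: real assume e: "e > 0"
  \<comment> \<open>The budget is e/4 from eta, e/8 from D and e/2 from B and l. Eventually B is at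
    most |L| + 2, which explains the denominator.\<close>
  define \<eta> where "\<eta> = e / (4 * (\<bar>L\<bar> + 2))"
  have \<eta>: "\<eta> > 0" "\<eta> * (\<bar>L\<bar> + 2) = e / 4" using e by (auto simp: \<eta>_def divide_simps)
  define k where "k = 1 + 1 / \<eta>"
  have \<eta>1: "k > 0" using \<eta> by (simp add: k_def add_pos_pos)
  define d where "d = e / (8 * k)"
  have d: "d > 0" "k * d = e / 8" using e \<eta>1 by (simp_all add: d_def)
  obtain R0 where R0: "\<forall>R\<ge>R0. \<forall>\<^sub>F X in at_top. D R X \<le> d" using D[OF d(1)] by blast
  have "\<forall>\<^sub>F R in sequentially. dist (l R) L < min 1 (e / 4)" using tendstoD[OF l, of "min 1 (e / 4)"] e by simp
  then have "\<forall>\<^sub>F R in sequentially. dist (l R) L < min 1 (e / 4) \<and> R \<ge> R0"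
    using eventually_ge_at_top by (rule eventually_conj)
  then obtain R where R: "dist (l R) L < min 1 (e / 4)" "R \<ge> R0"
    unfolding eventually_sequentially by blast
  have "\<forall>\<^sub>F X in at_top. dist (B R X) (l R) < min 1 (e / 4)" using tendstoD[OF B, of "min 1 (e / 4)" R] e by simp
  moreover have "\<forall>\<^sub>F X in at_top. D R X \<le> d" using R0 R by blast
  ultimately show "\<forall>\<^sub>F X in at_top. dist (A X) L < e" using eventually_ge_at_top[of 1]
  proof eventually_elim
    case (elim X)
    have "\<bar>B R X - l R\<bar> < 1" "\<bar>B R X - l R\<bar> < e / 4" "\<bar>l R - L\<bar> < 1" "\<bar>l R - L\<bar> < e / 4"
      using elim(1) R(1) by (auto simp: dist_real_def)
    then have b: "\<bar>B R X - L\<bar> < e / 2" "B R X \<le> \<bar>L\<bar> + 2" by linarith+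
    have "\<bar>A X - B R X\<bar> \<le> \<eta> * B R X + k * D R X" unfolding k_def by (rule close[OF \<eta>(1) elim(3)])
    also have "\<dots> \<le> \<eta> * (\<bar>L\<bar> + 2) + k * d"
      by (rule add_mono[OF mult_left_mono[OF b(2)] mult_left_mono[OF elim(2)]]) (use \<eta> \<eta>1 in auto)
    also have "\<dots> = e / 4 + e / 8" by (simp only: \<eta>(2) d(2))
    finally have "\<bar>A X - L\<bar> < e" using b(1) e by linarith
    then show ?case by (simp add: dist_real_def)
  qed
qed

text \<open>| |a|^2 - |b|^2 | is at most 2 |b| |a-b| + |a-b|^2, and the mixed term is split by the
  arithmetic-geometric mean inequality. This pointwise form integrates directly, without
  Cauchy-Schwarz for integrals.\<close>

lemma norm_square_close:
  fixes a b :: complex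
  assumes "\<eta> > 0"
  shows "\<bar>(cmod a)\<^sup>2 - (cmod b)\<^sup>2\<bar> \<le> \<eta> * (cmod b)\<^sup>2 + (1 + 1 / \<eta>) * (cmod (a - b))\<^sup>2"
proof -
  define x y z where "x = cmod a" and "y = cmod b" and "z = cmod (a - b)"
  have t: "\<bar>x - y\<bar> \<le> z" "0 \<le> x" "0 \<le> y" "0 \<le> z" unfolding x_def y_def z_def using norm_triangle_ineq3 by auto
  have "\<bar>x\<^sup>2 - y\<^sup>2\<bar> = \<bar>x - y\<bar> * (x + y)" using t by (simp add: power2_eq_square square_diff_square_factored abs_mult mult.commute)
  also have "\<dots> \<le> z * (2 * y + z)" using t by (intro mult_mono) auto
  also have "\<dots> = 2 * y * z + z\<^sup>2" by (simp add: power2_eq_square algebra_simps)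
  also have "2 * y * z \<le> \<eta> * y\<^sup>2 + z\<^sup>2 / \<eta>"
  proof -
    have "0 \<le> (\<eta> * y - z)\<^sup>2 / \<eta>" using assms by simp
    also have "\<dots> = \<eta> * y\<^sup>2 + z\<^sup>2 / \<eta> - 2 * y * z"
      using assms by (simp add: power2_diff power_mult_distrib diff_divide_distrib add_divide_distrib power2_eq_square[of \<eta>])
    finally show ?thesis by simp
  qed
  also have "\<eta> * y\<^sup>2 + z\<^sup>2 / \<eta> + z\<^sup>2 = \<eta> * y\<^sup>2 + (1 + 1 / \<eta>) * z\<^sup>2" by (simp add: algebra_simps)
  finally show ?thesis by (simp add: x_def y_def z_def)
qed

lemma sum_divisor_pairs:
  fixes F :: "nat \<Rightarrow> nat \<Rightarrow> complex"
  shows "(\<Sum>n | 0 < n \<and> real n \<le> x. \<Sum>d | d dvd n. F d (n div d)) = (\<Sum>(a,b)\<in>hyp_points x. F a b)"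
proof -
  have "(\<Sum>n | 0 < n \<and> real n \<le> x. \<Sum>d | d dvd n. F d (n div d))
      = (\<Sum>(n,d)\<in>(SIGMA n:{n. 0 < n \<and> real n \<le> x}. {d. d dvd n}). F d (n div d))"
    by (rule sum.Sigma) (auto simp: finite_le_real finite_divisors_nat)
  also have "\<dots> = (\<Sum>(a,b)\<in>hyp_points x. F a b)"
    by (rule sum.reindex_bij_witness[where i = "\<lambda>(a,b). (a * b, a)" and j = "\<lambda>(n,d). (d, n div d)"])
       (auto simp: hyp_points_def elim!: dvdE)
  finally show ?thesis .
qed

text \<open>The condition re = sd is the equality r/d = s/e of frequencies, written without
  division.\<close>

definition pair_weight :: "nat \<Rightarrow> nat \<Rightarrow> nat \<Rightarrow> real" where
  "pair_weight R d e = (\<Sum>r=1..R. \<Sum>s=1..R. if r * e = s * d then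
     (real d powr (-1/4) * tau r * real r powr (-3/4)) * (real e powr (-1/4) * tau s * real s powr (-3/4)) else 0)"

text \<open>With p the gcd, d = pn and e = pm, the solutions of re = sd are r = nt, s = mt, so the
  sum is a partial sum of the series in \<open>has_sum_tau_tau\<close>, up to t = R / max(n, m).
  Since nm = de/p^2, the powers of d, e, n, m combine to p^(3/2)/(de).\<close>

lemma pair_weight_tendsto:
  assumes d: "d > 0" and e: "e > 0"
  shows "(\<lambda>R. pair_weight R d e) \<longlonglongrightarrow> zeta (3/2) ^ 4 / zeta 3 *
     (real (gcd d e) powr (3/2) / real (d * e) * tau (reduced_prod d e) * local_product (reduced_prod d e))"
proof -
  define p n m where "p = gcd d e" and "n = d div p" and "m = e div p"
  have p: "p > 0" using d by (simp add: p_def)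
  have dn: "d = p * n" "e = p * m" by (simp_all add: p_def n_def m_def)
  have nm: "n > 0" "m > 0" using d e dn by (auto intro: gr0I)
  have cop: "coprime n m" unfolding n_def m_def p_def using d by (intro div_gcd_coprime) auto
  have red: "reduced_prod d e = n * m"
  proof -
    have "d * e = (n * m) * p\<^sup>2" by (simp add: dn power2_eq_square)
    then show ?thesis unfolding reduced_prod_def p_def[symmetric] using p by simp
  qed
  define w where "w = (real d * real e) powr (-1/4) * (real n * real m) powr (-3/4)"
  define G where "G = (\<lambda>t. tau (n * t) * tau (m * t) * real t powr (-3/2))"
  have w: "w = real p powr (3/2) / real (d * e)"
  proof -
    have "real n * real m = (real d * real e) * real p powr (-2)"
    proof -
      have "real p powr (-2) = 1 / (real p)\<^sup>2" using p by (simp add: powr_minus_divide powr_numeral)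
      then show ?thesis using p by (simp add: dn power2_eq_square)
    qed
    then have "(real n * real m) powr (-3/4) = (real d * real e) powr (-3/4) * (real p powr (-2)) powr (-3/4)"
      by (simp add: powr_mult)
    also have "(real p powr (-2)) powr (-3/4) = real p powr (3/2)" by (simp add: powr_powr)
    finally have "w = ((real d * real e) powr (-1/4) * (real d * real e) powr (-3/4)) * real p powr (3/2)"
      by (simp add: w_def)
    also have "(real d * real e) powr (-1/4) * (real d * real e) powr (-3/4) = (real d * real e) powr (-1)"
      by (simp only: powr_add[symmetric]) simp
    also have "\<dots> = 1 / (real d * real e)" using d e by (simp add: powr_minus_divide)
    finally show ?thesis by simp
  qed
  have eq: "pair_weight R d e = w * (\<Sum>t=1..R div max n m. G t)" for R
  proof -
    define h where "h = (\<lambda>(r,s). (real d powr (-1/4) * tau r * real r powr (-3/4)) * (real e powr (-1/4) * tau s * real s powr (-3/4)))"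
    have "pair_weight R d e = (\<Sum>x\<in>{1..R} \<times> {1..R}. if fst x * e = snd x * d then h x else 0)"
      unfolding pair_weight_def h_def sum.cartesian_product by (intro sum.cong refl) auto
    also have "\<dots> = sum h {x \<in> {1..R} \<times> {1..R}. fst x * e = snd x * d}"
      by (rule sum.inter_filter[symmetric]) simp
    also have "\<dots> = (\<Sum>t=1..R div max n m. h (n * t, m * t))"
    proof (rule sum.reindex_bij_witness[where i = "\<lambda>t. (n * t, m * t)" and j = "\<lambda>x. fst x div n"])
      fix x assume x: "x \<in> {x \<in> {1..R} \<times> {1..R}. fst x * e = snd x * d}"
      obtain r s where rs: "x = (r, s)" by fastforce
      have "r * (p * m) = s * (p * n)" using x unfolding rs dn by simp
      then have "p * (r * m) = p * (s * n)" by algebra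
      then have "r * m = s * n" using p by simp
      then have "n dvd r * m" by simp
      then have "n dvd r" using cop by (simp add: coprime_dvd_mult_left_iff)
      then obtain t where t: "r = n * t" by (auto elim: dvdE)
      then have s: "s = m * t" using \<open>r * m = s * n\<close> nm by (simp add: mult.commute mult.left_commute)
      have t1: "n * t \<le> R" "m * t \<le> R" "t \<ge> 1" using x nm unfolding rs t s by (auto simp: Suc_le_eq)
      then have "max n m * t \<le> R" by (simp add: max_def)
      then have "t \<le> R div max n m" using nm by (simp add: less_eq_div_iff_mult_less_eq mult.commute max_def)
      then show "(n * (fst x div n), m * (fst x div n)) = x" "fst x div n \<in> {1..R div max n m}"
        using t1 nm by (simp_all add: rs t s)
      then show "h (n * (fst x div n), m * (fst x div n)) = h x" by simp
    next
      fix t assume t: "t \<in> {1..R div max n m}"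
      then have "t * max n m \<le> R" using nm by (simp add: less_eq_div_iff_mult_less_eq max_def)
      then have "t * n \<le> R" "t * m \<le> R"
        using mult_le_mono2[of n "max n m" t] mult_le_mono2[of m "max n m" t] by linarith+
      then show "(n * t, m * t) \<in> {x \<in> {1..R} \<times> {1..R}. fst x * e = snd x * d}"
        using t nm by (auto simp: dn mult_ac Suc_le_eq)
      show "fst (n * t, m * t) div n = t" using nm by simp
    qed
    also have "\<dots> = (\<Sum>t=1..R div max n m. w * G t)"
    proof (intro sum.cong refl)
      fix t assume t: "t \<in> {1..R div max n m}"
      have tt: "real t powr (-3/4) * real t powr (-3/4) = real t powr (-3/2)" by (simp only: powr_add[symmetric]) simp
      have "h (n * t, m * t) = (real d powr (-1/4) * real e powr (-1/4)) * (real n powr (-3/4) * real m powr (-3/4)) *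
         (tau (n * t) * tau (m * t) * (real t powr (-3/4) * real t powr (-3/4)))"
        by (simp add: h_def powr_mult)
      then show "h (n * t, m * t) = w * G t" unfolding tt w_def G_def by (simp add: powr_mult)
    qed
    finally show ?thesis by (simp add: sum_distrib_left)
  qed
  have "(G has_sum (zeta (3/2) ^ 4 / zeta 3 * (tau (n * m) * local_product (n * m)))) {0<..}"
    unfolding G_def by (rule has_sum_tau_tau[OF cop nm])
  then have "((\<lambda>S. sum G S) \<longlongrightarrow> zeta (3/2) ^ 4 / zeta 3 * (tau (n * m) * local_product (n * m))) (finite_subsets_at_top {0<..})"
    by (simp add: has_sum_def)
  moreover have "filterlim (\<lambda>q. {1..q::nat}) (finite_subsets_at_top {0<..}) sequentially"
    unfolding filterlim_finite_subsets_at_top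
  proof (intro allI impI)
    fix Y :: "nat set" assume Y: "finite Y \<and> Y \<subseteq> {0<..}"
    then obtain q0 where "\<forall>y\<in>Y. y \<le> q0" using finite_nat_set_iff_bounded_le by metis
    then show "\<forall>\<^sub>F q in sequentially. finite {1..q} \<and> Y \<subseteq> {1..q} \<and> {1..q} \<subseteq> {0<..}"
      using eventually_ge_at_top[of q0] Y by (elim eventually_mono) force
  qed
  ultimately have "(\<lambda>q. \<Sum>t=1..q. G t) \<longlonglongrightarrow> zeta (3/2) ^ 4 / zeta 3 * (tau (n * m) * local_product (n * m))"
    by (rule filterlim_compose)
  moreover have "filterlim (\<lambda>R. R div max n m) sequentially sequentially"
    unfolding filterlim_at_top
  proof
    fix Q show "\<forall>\<^sub>F R in sequentially. Q \<le> R div max n m"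
      using eventually_ge_at_top[of "Q * max n m"]
      by eventually_elim (use nm in \<open>simp add: less_eq_div_iff_mult_less_eq max_def\<close>)
  qed
  ultimately have "(\<lambda>R. w * (\<Sum>t=1..R div max n m. G t)) \<longlonglongrightarrow> w * (zeta (3/2) ^ 4 / zeta 3 * (tau (n * m) * local_product (n * m)))"
    by (intro tendsto_mult tendsto_const) (rule filterlim_compose)
  then have "(\<lambda>R. pair_weight R d e) \<longlonglongrightarrow> w * (zeta (3/2) ^ 4 / zeta 3 * (tau (n * m) * local_product (n * m)))"
    unfolding eq .
  then show ?thesis unfolding red w p_def by (simp add: mult_ac)
qed

section \<open>The partial sums, their trigonometric approximation and its diagonal\<close>

context paper_setup
begin

abbreviation "N \<equiv> M1 * M2"

definition partial_sum :: "real \<Rightarrow> complex" where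
  "partial_sum x = (\<Sum>n | 0 < n \<and> real n \<le> x. (f1 \<star> f2) n)"

lemma N_pos: "N > 0" using M1 M2 by simp

lemma finite_divisors_N: "finite {d. d dvd N}" using N_pos by (simp add: finite_divisors_nat)

lemma divisor_pos: "d dvd N \<Longrightarrow> d > 0" using N_pos by (auto intro: gr0I)

lemma partial_sum_eq:
  assumes x: "x > 0"
  shows "partial_sum x = (\<Sum>d | d dvd N. g d * of_real (Delta (x / real d)))"
proof -
  have "partial_sum x = (\<Sum>n | 0 < n \<and> real n \<le> x. \<Sum>d | d dvd n. g d * of_nat (num_divisors (n div d)))"
    unfolding partial_sum_def by (intro sum.cong refl f_conv) simp
  also have "\<dots> = (\<Sum>(a,b)\<in>hyp_points x. g a * of_nat (num_divisors b))" by (rule sum_divisor_pairs)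
  also have "\<dots> = (\<Sum>(a,b)\<in>(SIGMA d:{d. d dvd N}. {b. 0 < b \<and> real b \<le> x / real d}). g a * of_nat (num_divisors b))"
  proof (rule sum.mono_neutral_right)
    show "finite (hyp_points x)" by (rule finite_hyp_points)
    show "(SIGMA d:{d. d dvd N}. {b. 0 < b \<and> real b \<le> x / real d}) \<subseteq> hyp_points x"
      using divisor_pos by (auto simp: hyp_points_def le_divide_eq mult.commute)
    show "\<forall>i\<in>hyp_points x - (SIGMA d:{d. d dvd N}. {b. 0 < b \<and> real b \<le> x / real d}). (case i of (a, b) \<Rightarrow> g a * of_nat (num_divisors b)) = 0"
    proof
      fix i assume i: "i \<in> hyp_points x - (SIGMA d:{d. d dvd N}. {b. 0 < b \<and> real b \<le> x / real d})"
      obtain a b where ab': "i = (a, b)" by fastforce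
      have ab: "(a, b) \<in> hyp_points x" "(a, b) \<notin> (SIGMA d:{d. d dvd N}. {b. 0 < b \<and> real b \<le> x / real d})"
        using i unfolding ab' by blast+
      then have "a > 0" "real b \<le> x / real a" "b > 0" by (auto simp: hyp_points_def le_divide_eq mult.commute)
      then have "g a = 0" using ab(2) g_support[of a] by auto
      then show "(case i of (a, b) \<Rightarrow> g a * of_nat (num_divisors b)) = 0" unfolding ab' by simp
    qed
  qed
  also have "\<dots> = (\<Sum>d | d dvd N. \<Sum>b | 0 < b \<and> real b \<le> x / real d. g d * of_nat (num_divisors b))"
    by (rule sum.Sigma[symmetric]) (auto simp: finite_divisors_N finite_le_real)
  also have "\<dots> = (\<Sum>d | d dvd N. g d * of_real (Dsum (x / real d)))"
    by (simp add: Dsum_def sum_distrib_left)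
  also have "\<dots> = (\<Sum>d | d dvd N. g d * of_real (Delta (x / real d)) +
     (of_real (x * ln x + (2 * euler_mascheroni - 1) * x) * (g d / of_nat d) - of_real x * (g d * complex_of_real (ln (real d)) / of_nat d)))"
  proof (intro sum.cong refl)
    fix d assume "d \<in> {d. d dvd N}"
    then have d: "real d > 0" using divisor_pos by simp
    have "Dsum (x / real d) = Delta (x / real d) + ((x * ln x + (2 * euler_mascheroni - 1) * x) / real d - x * (ln (real d) / real d))"
      unfolding Delta_def using d x by (simp add: ln_divide_pos field_simps)
    then have "g d * of_real (Dsum (x / real d)) = g d * (of_real (Delta (x / real d)) + (of_real (x * ln x + (2 * euler_mascheroni - 1) * x) / of_nat d - of_real x * (of_real (ln (real d)) / of_nat d)))"
      by (simp only: of_real_add of_real_diff of_real_mult of_real_divide of_real_of_nat_eq)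
    moreover have "G * (D + (A / n - X * (l / n))) = G * D + (A * (G / n) - X * (G * l / n))" for G D A n X l :: complex
      by (simp add: distrib_left right_diff_distrib mult_ac)
    ultimately show "g d * of_real (Dsum (x / real d)) = g d * of_real (Delta (x / real d)) +
     (of_real (x * ln x + (2 * euler_mascheroni - 1) * x) * (g d / of_nat d) - of_real x * (g d * complex_of_real (ln (real d)) / of_nat d))"
      by (simp only:)
  qed
  also have "\<dots> = (\<Sum>d | d dvd N. g d * of_real (Delta (x / real d)))"
    unfolding sum.distrib sum_subtractf sum_distrib_left[symmetric] sum_g sum_g_ln by simp
  finally show ?thesis .
qed

definition approx :: "nat \<Rightarrow> real \<Rightarrow> complex" where
  "approx R x = (\<Sum>d | d dvd N. g d * of_real (voronoi_sum R (x / real d)))"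

text \<open>The Boolean is the sign of the frequency: Im z = (z - cnj z)/(2i) writes each Voronoi
  term as two conjugate exponentials. The coefficients g are complex, so the imaginary part cannot
  be taken outside the sum over d.\<close>

definition modes :: "nat \<Rightarrow> (bool \<times> nat \<times> nat) set" where
  "modes R = UNIV \<times> {d. d dvd N} \<times> {1..R}"

definition weight :: "nat \<Rightarrow> nat \<Rightarrow> real" where
  "weight d r = real d powr (-1/4) * tau r * real r powr (-3/4)"

definition phase :: "bool \<Rightarrow> complex" where
  "phase s = (if s then kappa / (2 * \<i>) else - cnj kappa / (2 * \<i>))"

definition mode_coeff :: "bool \<times> nat \<times> nat \<Rightarrow> complex" where
  "mode_coeff = (\<lambda>(s, d, r). g d * of_real (weight d r) * phase s)"

definition mode_freq :: "bool \<times> nat \<times> nat \<Rightarrow> real" where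
  "mode_freq = (\<lambda>(s, d, r). (if s then 1 else -1) * (4 * pi * sqrt (real r / real d)))"

lemma finite_modes: "finite (modes R)"
  unfolding modes_def using finite_divisors_N by simp

lemma sum_modes:
  "(\<Sum>i\<in>modes R. H i) = (\<Sum>s\<in>UNIV. \<Sum>d | d dvd N. \<Sum>r=1..R. H (s, d, r))"
  unfolding modes_def by (simp only: sum.cartesian_product')

lemma approx_eq:
  assumes x: "x > 0"
  shows "approx R x = of_real (x powr (1/4)) * (\<Sum>i\<in>modes R. mode_coeff i * cis (mode_freq i * sqrt x))"
proof -
  have v: "complex_of_real (voronoi_sum R (x / real d)) = of_real (x powr (1/4)) * (\<Sum>r=1..R.
      of_real (weight d r) * (phase True * cis (mode_freq (True, d, r) * sqrt x) + phase False * cis (mode_freq (False, d, r) * sqrt x)))"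
    if d: "d dvd N" for d
  proof -
    have d0: "real d > 0" using divisor_pos[OF d] by simp
    define z where "z = kappa * (\<Sum>r=1..R. of_real (tau r) * (of_real (real r powr (-3/4)) * ee (2 * sqrt (real r) * sqrt (x / real d))))"
    have im: "complex_of_real (Im z) = (z - cnj z) / (2 * \<i>)" by (simp add: complex_eq_iff)
    have p: "(x / real d) powr (1/4) = x powr (1/4) * real d powr (-1/4)"
      using x d0 by (simp add: powr_divide powr_minus_divide)
    have "(z - cnj z) / (2 * \<i>) = (\<Sum>r=1..R. of_real (tau r * real r powr (-3/4)) * (phase True * cis (mode_freq (True, d, r) * sqrt x) + phase False * cis (mode_freq (False, d, r) * sqrt x)))"
    proof -
      have e: "ee (2 * sqrt (real r) * sqrt (x / real d)) = cis (mode_freq (True, d, r) * sqrt x)"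
        and c: "cis (mode_freq (False, d, r) * sqrt x) = cnj (cis (mode_freq (True, d, r) * sqrt x))" for r
        by (simp_all add: ee_def mode_freq_def real_sqrt_divide cis_cnj mult_ac)
      show ?thesis unfolding z_def complex_cnj_mult cnj_sum e c sum_distrib_left sum_subtractf[symmetric] sum_divide_distrib
        by (intro sum.cong refl) (simp add: phase_def field_simps)
    qed
    then have "complex_of_real (voronoi_sum R (x / real d)) = of_real (x powr (1/4) * real d powr (-1/4)) *
       (\<Sum>r=1..R. of_real (tau r * real r powr (-3/4)) * (phase True * cis (mode_freq (True, d, r) * sqrt x) + phase False * cis (mode_freq (False, d, r) * sqrt x)))"
      unfolding voronoi_sum_def z_def[symmetric] p of_real_mult[of _ "Im z"] im by (simp only:)
    also have "\<dots> = of_real (x powr (1/4)) * (\<Sum>r=1..R. of_real (real d powr (-1/4)) * (of_real (tau r * real r powr (-3/4)) *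
       (phase True * cis (mode_freq (True, d, r) * sqrt x) + phase False * cis (mode_freq (False, d, r) * sqrt x))))"
      by (simp only: of_real_mult mult.assoc sum_distrib_left)
    finally show ?thesis by (simp add: weight_def mult.assoc)
  qed
  have "approx R x = (\<Sum>d | d dvd N. g d * (of_real (x powr (1/4)) * (\<Sum>r=1..R.
      of_real (weight d r) * (phase True * cis (mode_freq (True, d, r) * sqrt x) + phase False * cis (mode_freq (False, d, r) * sqrt x)))))"
    unfolding approx_def by (intro sum.cong refl) (simp only: v mem_Collect_eq)
  also have "\<dots> = of_real (x powr (1/4)) * (\<Sum>d | d dvd N. \<Sum>r=1..R.
      mode_coeff (True, d, r) * cis (mode_freq (True, d, r) * sqrt x) + mode_coeff (False, d, r) * cis (mode_freq (False, d, r) * sqrt x))"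
    unfolding sum_distrib_left by (intro sum.cong refl) (simp add: mode_coeff_def algebra_simps)
  also have "(\<Sum>d | d dvd N. \<Sum>r=1..R.
      mode_coeff (True, d, r) * cis (mode_freq (True, d, r) * sqrt x) + mode_coeff (False, d, r) * cis (mode_freq (False, d, r) * sqrt x))
    = (\<Sum>i\<in>modes R. mode_coeff i * cis (mode_freq i * sqrt x))"
    by (simp add: sum_modes UNIV_bool sum.distrib add.commute)
  finally show ?thesis .
qed

lemma lbm_approx: "lbm (approx R)"
proof -
  have "lbm (\<lambda>x. \<Sum>d | d dvd N. g d * of_real (voronoi_sum R (x / real d)))"
  proof (intro lbm_sum finite_divisors_N lbm_cmult)
    fix d assume "d \<in> {d. d dvd N}"
    then have "real d > 0" using divisor_pos by simp
    from lbm_scale[OF lbm_voronoi_sum this] show "lbm (\<lambda>x. of_real (voronoi_sum R (x / real d)))" .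
  qed
  then show ?thesis unfolding approx_def[abs_def] .
qed

text \<open>The expression through Delta is available only for x > 0; agreement there is enough,
  because all integrals start at 1.\<close>

lemma partial_sum_lbm: "\<exists>E. lbm E \<and> (\<forall>x>0. partial_sum x = E x)"
proof (intro exI[of _ "\<lambda>x. \<Sum>d | d dvd N. g d * of_real (Delta (x / real d))"] conjI allI impI partial_sum_eq)
  show "lbm (\<lambda>x. \<Sum>d | d dvd N. g d * of_real (Delta (x / real d)))"
  proof (intro lbm_sum finite_divisors_N lbm_cmult)
    fix d assume "d \<in> {d. d dvd N}"
    then have "real d > 0" using divisor_pos by simp
    from lbm_scale[OF lbm_Delta this] show "lbm (\<lambda>x. of_real (Delta (x / real d)))" .
  qed
qed

lemma approx_mean_square:
  "((\<lambda>X. X powr (-3/2) * integral {1..X} (\<lambda>x. (cmod (approx R x))\<^sup>2))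
     \<longlongrightarrow> 2/3 * Re (\<Sum>i\<in>modes R. \<Sum>j\<in>modes R. if mode_freq i = mode_freq j then mode_coeff i * cnj (mode_coeff j) else 0)) at_top"
proof -
  have "(cmod (approx R x))\<^sup>2 = sqrt x * (cmod (\<Sum>i\<in>modes R. mode_coeff i * cis (mode_freq i * sqrt x)))\<^sup>2" if "x > 0" for x
  proof -
    have "(x powr (1/4))\<^sup>2 = x powr (1/2)" unfolding power2_eq_square by (simp only: powr_add[symmetric]) simp
    then show ?thesis using that by (simp add: approx_eq norm_mult power_mult_distrib powr_half_sqrt)
  qed
  then have "integral {1..X} (\<lambda>x. (cmod (approx R x))\<^sup>2) = integral {1..X} (\<lambda>x. sqrt x * (cmod (\<Sum>i\<in>modes R. mode_coeff i * cis (mode_freq i * sqrt x)))\<^sup>2)" for X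
    by (intro integral_cong) auto
  then show ?thesis using trig_mean_square[OF finite_modes] by simp
qed

text \<open>All frequencies are nonzero, so modes of opposite sign never meet.\<close>

lemma same_freq_iff:
  assumes "d > 0" "e > 0" "q > 0" "r > 0"
  shows "mode_freq (s, d, q) = mode_freq (t, e, r) \<longleftrightarrow> s = t \<and> q * e = r * d"
proof -
  have "real q / real d = real r / real e \<longleftrightarrow> real (q * e) = real (r * d)"
    using assms by (simp add: frac_eq_eq)
  then have eq: "real q / real d = real r / real e \<longleftrightarrow> q * e = r * d" by (simp only: of_nat_eq_iff)
  have pos: "sqrt (real q / real d) > 0" "sqrt (real r / real e) > 0" using assms by auto
  show ?thesis
  proof (cases "s = t")
    case True
    then show ?thesis using eq by (auto simp: mode_freq_def)
  next
    case False
    have "4 * pi * sqrt (real q / real d) > 0" "4 * pi * sqrt (real r / real e) > 0" using pos by auto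
    then show ?thesis using False unfolding mode_freq_def by (cases s; cases t) auto
  qed
qed

lemma norm_phase: "phase s * cnj (phase s) = of_real (1 / (8 * pi\<^sup>2))"
proof -
  have "(cmod (phase s))\<^sup>2 = (cmod kappa)\<^sup>2 / 4"
    by (simp add: phase_def norm_divide norm_mult power_divide)
  then show ?thesis unfolding complex_norm_square[symmetric] norm_kappa by simp
qed

text \<open>The two signs contribute equally, which turns |phase|^2 = 1/(8 pi^2) into 1/(4
  pi^2).\<close>

lemma diagonal_eq:
  "(\<Sum>i\<in>modes R. \<Sum>j\<in>modes R. if mode_freq i = mode_freq j then mode_coeff i * cnj (mode_coeff j) else 0)
    = of_real (1 / (4 * pi\<^sup>2)) * (\<Sum>d | d dvd N. \<Sum>e | e dvd N. g d * cnj (g e) * of_real (pair_weight R d e))"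
proof -
  have "(\<Sum>i\<in>modes R. \<Sum>j\<in>modes R. if mode_freq i = mode_freq j then mode_coeff i * cnj (mode_coeff j) else 0)
    = (\<Sum>s\<in>UNIV. \<Sum>d | d dvd N. \<Sum>q=1..R. \<Sum>t\<in>UNIV. \<Sum>e | e dvd N. \<Sum>r=1..R.
        if mode_freq (s, d, q) = mode_freq (t, e, r) then mode_coeff (s, d, q) * cnj (mode_coeff (t, e, r)) else 0)"
    unfolding sum_modes ..
  also have "\<dots> = (\<Sum>s\<in>(UNIV::bool set). \<Sum>d | d dvd N. \<Sum>q=1..R. \<Sum>e | e dvd N. \<Sum>r=1..R.
        of_real (1 / (8 * pi\<^sup>2)) * (g d * cnj (g e) * of_real (if q * e = r * d then weight d q * weight e r else 0)))"
  proof (intro sum.cong refl)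
    fix s d q assume d: "d \<in> {d. d dvd N}" and q: "q \<in> {1..R}"
    have "(\<Sum>t\<in>UNIV. \<Sum>e | e dvd N. \<Sum>r=1..R. if mode_freq (s, d, q) = mode_freq (t, e, r) then mode_coeff (s, d, q) * cnj (mode_coeff (t, e, r)) else 0)
      = (\<Sum>t\<in>UNIV. if t = s then (\<Sum>e | e dvd N. \<Sum>r=1..R.
        of_real (1 / (8 * pi\<^sup>2)) * (g d * cnj (g e) * of_real (if q * e = r * d then weight d q * weight e r else 0))) else 0)"
    proof (intro sum.cong refl)
      fix t
      have F: "mode_freq (s, d, q) = mode_freq (t, e, r) \<longleftrightarrow> s = t \<and> q * e = r * d" if "e dvd N" "r \<in> {1..R}" for e r
        by (rule same_freq_iff) (use that d q divisor_pos in auto)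
      show "(\<Sum>e | e dvd N. \<Sum>r=1..R. if mode_freq (s, d, q) = mode_freq (t, e, r) then mode_coeff (s, d, q) * cnj (mode_coeff (t, e, r)) else 0)
       = (if t = s then (\<Sum>e | e dvd N. \<Sum>r=1..R.
        of_real (1 / (8 * pi\<^sup>2)) * (g d * cnj (g e) * of_real (if q * e = r * d then weight d q * weight e r else 0))) else 0)"
      proof (cases "t = s")
        case True
        have m: "mode_coeff (s, d, q) * cnj (mode_coeff (s, e, r)) = of_real (1 / (8 * pi\<^sup>2)) * (g d * cnj (g e) * of_real (weight d q * weight e r))" for e r
          unfolding norm_phase[of s, symmetric] by (simp add: mode_coeff_def)
        have "(\<Sum>e | e dvd N. \<Sum>r=1..R. if mode_freq (s, d, q) = mode_freq (t, e, r) then mode_coeff (s, d, q) * cnj (mode_coeff (t, e, r)) else 0)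
          = (\<Sum>e | e dvd N. \<Sum>r=1..R. of_real (1 / (8 * pi\<^sup>2)) * (g d * cnj (g e) * of_real (if q * e = r * d then weight d q * weight e r else 0)))"
        proof (intro sum.cong refl)
          fix e r assume er: "e \<in> {e. e dvd N}" "r \<in> {1..R}"
          show "(if mode_freq (s, d, q) = mode_freq (t, e, r) then mode_coeff (s, d, q) * cnj (mode_coeff (t, e, r)) else 0)
            = of_real (1 / (8 * pi\<^sup>2)) * (g d * cnj (g e) * of_real (if q * e = r * d then weight d q * weight e r else 0))"
            using F[of e r] er True m[of e r] by simp
        qed
        then show ?thesis using True by simp
      next
        case False
        have "(\<Sum>e | e dvd N. \<Sum>r=1..R. if mode_freq (s, d, q) = mode_freq (t, e, r) then mode_coeff (s, d, q) * cnj (mode_coeff (t, e, r)) else 0) = 0"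
          using F False by (intro sum.neutral ballI) auto
        then show ?thesis using False by simp
      qed
    qed
    then show "(\<Sum>t\<in>UNIV. \<Sum>e | e dvd N. \<Sum>r=1..R. if mode_freq (s, d, q) = mode_freq (t, e, r) then mode_coeff (s, d, q) * cnj (mode_coeff (t, e, r)) else 0)
      = (\<Sum>e | e dvd N. \<Sum>r=1..R.
        of_real (1 / (8 * pi\<^sup>2)) * (g d * cnj (g e) * of_real (if q * e = r * d then weight d q * weight e r else 0)))"
      by (simp only: sum.delta[OF finite_class.finite_UNIV] UNIV_I if_True)
  qed
  also have "\<dots> = 2 * (\<Sum>d | d dvd N. \<Sum>q=1..R. \<Sum>e | e dvd N. \<Sum>r=1..R.
        of_real (1 / (8 * pi\<^sup>2)) * (g d * cnj (g e) * of_real (if q * e = r * d then weight d q * weight e r else 0)))"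
    by (simp only: sum_constant) simp
  also have "\<dots> = 2 * (\<Sum>d | d dvd N. \<Sum>e | e dvd N. \<Sum>q=1..R. \<Sum>r=1..R.
        of_real (1 / (8 * pi\<^sup>2)) * (g d * cnj (g e) * of_real (if q * e = r * d then weight d q * weight e r else 0)))"
    by (simp only: sum.swap[of _ "{1..R}" "{d. d dvd N}"])
  also have "\<dots> = 2 * (of_real (1 / (8 * pi\<^sup>2)) * (\<Sum>d | d dvd N. \<Sum>e | e dvd N. g d * cnj (g e) * of_real (pair_weight R d e)))"
    unfolding pair_weight_def weight_def of_real_sum sum_distrib_left ..
  finally show ?thesis by simp
qed

definition limit_sum :: complex where
  "limit_sum = (\<Sum>n | n dvd N. \<Sum>m | m dvd N. g n * cnj (g m) *
     complex_of_real (real (gcd n m) powr (3 / 2) / real (n * m) * real (num_divisors (reduced_prod n m)) * local_product (reduced_prod n m)))"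

text \<open>The real weights are symmetric in n and m, so conjugation merely exchanges the two
  summation variables.\<close>

lemma limit_sum_real: "limit_sum = of_real (Re limit_sum)"
proof -
  have "cnj limit_sum = (\<Sum>n | n dvd N. \<Sum>m | m dvd N. g m * cnj (g n) *
     complex_of_real (real (gcd m n) powr (3 / 2) / real (m * n) * real (num_divisors (reduced_prod m n)) * local_product (reduced_prod m n)))"
    unfolding limit_sum_def cnj_sum
    by (intro sum.cong refl) (simp add: gcd.commute mult.commute reduced_prod_def)
  also have "\<dots> = limit_sum" unfolding limit_sum_def by (rule sum.swap)
  finally have "limit_sum \<in> \<real>" by (simp add: Reals_cnj_iff)
  then show ?thesis by (simp add: of_real_Re)
qed

text \<open>The constant is 2/3 * 1/(4 pi^2) = 1/(6 pi^2).\<close>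

lemma diagonal_tendsto:
  "(\<lambda>R. 2/3 * Re (\<Sum>i\<in>modes R. \<Sum>j\<in>modes R. if mode_freq i = mode_freq j then mode_coeff i * cnj (mode_coeff j) else 0))
    \<longlonglongrightarrow> 1 / (6 * pi\<^sup>2) * (zeta (3 / 2) ^ 4 / zeta 3) * Re limit_sum"
proof -
  define c where "c = zeta (3 / 2) ^ 4 / zeta 3"
  have "(\<lambda>R. \<Sum>d | d dvd N. \<Sum>e | e dvd N. g d * cnj (g e) * of_real (pair_weight R d e)) \<longlonglongrightarrow>
     (\<Sum>d | d dvd N. \<Sum>e | e dvd N. g d * cnj (g e) * of_real (c * (real (gcd d e) powr (3/2) / real (d * e) * tau (reduced_prod d e) * local_product (reduced_prod d e))))"
    unfolding c_def
    by (intro tendsto_sum tendsto_mult tendsto_const tendsto_of_real pair_weight_tendsto) (auto intro: divisor_pos)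
  also have "(\<Sum>d | d dvd N. \<Sum>e | e dvd N. g d * cnj (g e) * of_real (c * (real (gcd d e) powr (3/2) / real (d * e) * tau (reduced_prod d e) * local_product (reduced_prod d e))))
     = of_real c * limit_sum"
    unfolding limit_sum_def sum_distrib_left of_real_mult[of c] by (simp only: mult.left_commute)
  finally have "(\<lambda>R. 2/3 * Re (of_real (1 / (4 * pi\<^sup>2)) * (\<Sum>d | d dvd N. \<Sum>e | e dvd N. g d * cnj (g e) * of_real (pair_weight R d e))))
     \<longlonglongrightarrow> 2/3 * Re (of_real (1 / (4 * pi\<^sup>2)) * (of_real c * limit_sum))"
    by (intro tendsto_mult tendsto_const tendsto_Re)
  moreover have "2/3 * Re (of_real (1 / (4 * pi\<^sup>2)) * (of_real c * limit_sum)) = 1 / (6 * pi\<^sup>2) * c * Re limit_sum"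
  proof -
    have "Re (of_real a * (of_real b * z)) = a * (b * Re z)" for a b z by simp
    then show ?thesis by (simp only:)
  qed
  ultimately show ?thesis unfolding diagonal_eq c_def by simp
qed

end

section \<open>Convergence of the mean square and positivity of the limit\<close>

context paper_setup
begin

text \<open>Cauchy-Schwarz over the finitely many d reduces the error to dilates of the single
  function Delta - \<open>voronoi_sum\<close>, each dilation costing a factor d.\<close>

lemma approx_error:
  assumes e: "e > 0"
  shows "\<exists>R0. \<forall>R\<ge>R0. \<forall>\<^sub>F X in at_top.
    X powr (-3/2) * integral {1..X} (\<lambda>x. (cmod (partial_sum x - approx R x))\<^sup>2) \<le> e"
proof -
  define G where "G = (\<Sum>d | d dvd N. (cmod (g d))\<^sup>2)"
  define C where "C = G * (\<Sum>d | d dvd N. real d) + 1"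
  have G: "G \<ge> 0" unfolding G_def by (intro sum_nonneg) auto
  have C: "C > 0" "G * (\<Sum>d | d dvd N. real d) \<le> C" using G by (auto simp: C_def intro!: add_nonneg_pos mult_nonneg_nonneg sum_nonneg)
  \<comment> \<open>The 2 compensates the doubling in \<open>integral_dyadic\<close>; C collects the
    weights of Cauchy-Schwarz and the dilation factors.\<close>
  define \<delta> where "\<delta> = e / (2 * C)"
  have \<delta>: "\<delta> > 0" using e C by (simp add: \<delta>_def)
  obtain R0 where R0: "\<forall>R\<ge>R0. \<exists>X0. \<forall>X\<ge>X0. integral {X..2 * X} (\<lambda>x. (Delta x - voronoi_sum R x)\<^sup>2) \<le> \<delta> * X powr (3/2)"
    using Delta_voronoi_window[OF \<delta>] by (elim exE)
  show ?thesis
  proof (intro exI[of _ R0] allI impI)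
    fix R assume "R0 \<le> R"
    then obtain X0 where X0: "\<forall>X\<ge>X0. integral {X..2 * X} (\<lambda>x. (Delta x - voronoi_sum R x)\<^sup>2) \<le> \<delta> * X powr (3/2)"
      using R0 by blast
    define F where "F = (\<lambda>x. (Delta x - voronoi_sum R x)\<^sup>2)"
    have iF: "F integrable_on {a..b}" if "a > 0" for a b
    proof -
      have "(\<lambda>x. (cmod (of_real (Delta x) - of_real (voronoi_sum R x)))\<^sup>2) integrable_on {a..b}"
        by (intro lbm_square_integrable lbm_diff lbm_Delta lbm_voronoi_sum that)
      then show ?thesis unfolding F_def by (simp flip: of_real_diff)
    qed
    \<comment> \<open>The dilations by 1/d with d dividing N carry [1, X] into [1/N, X]; this fixes
      the lower limit.\<close>
    have "\<forall>\<^sub>F X in at_top. integral {1 / real N..X} F \<le> 2 * \<delta> * X powr (3/2)"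
      by (rule integral_dyadic[where ?X0.0 = X0]) (use iF X0 N_pos \<delta> in \<open>auto simp: F_def\<close>)
    then show "\<forall>\<^sub>F X in at_top. X powr (-3/2) * integral {1..X} (\<lambda>x. (cmod (partial_sum x - approx R x))\<^sup>2) \<le> e"
      using eventually_ge_at_top[of 1]
    proof eventually_elim
      case (elim X)
      have pt: "(cmod (partial_sum x - approx R x))\<^sup>2 \<le> (\<Sum>d | d dvd N. G * F (1 / real d * x))" if x: "x \<in> {1..X}" for x
      proof -
        have "partial_sum x - approx R x = (\<Sum>d | d dvd N. g d * of_real (Delta (x / real d) - voronoi_sum R (x / real d)))"
          using x by (simp add: partial_sum_eq approx_def sum_subtractf right_diff_distrib)
        then have "cmod (partial_sum x - approx R x) \<le> (\<Sum>d | d dvd N. cmod (g d) * \<bar>Delta (x / real d) - voronoi_sum R (x / real d)\<bar>)"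
          by (simp only:) (rule sum_norm_le, simp only: norm_mult norm_of_real order.refl)
        then have "(cmod (partial_sum x - approx R x))\<^sup>2 \<le> (\<Sum>d | d dvd N. cmod (g d) * \<bar>Delta (x / real d) - voronoi_sum R (x / real d)\<bar>)\<^sup>2"
          by (intro power_mono) auto
        also have "\<dots> \<le> G * (\<Sum>d | d dvd N. \<bar>Delta (x / real d) - voronoi_sum R (x / real d)\<bar>\<^sup>2)"
          unfolding G_def by (rule Cauchy_Schwarz_ineq_sum)
        finally show ?thesis by (simp add: F_def sum_distrib_left)
      qed
      have st: "integral {1..X} (\<lambda>x. F (1 / real d * x)) \<le> real d * (2 * \<delta> * X powr (3/2))"
        and ist: "(\<lambda>x. F (1 / real d * x)) integrable_on {1..X}" if d: "d dvd N" for d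
      proof -
        have d0: "real d > 0" "real d \<ge> 1" using divisor_pos[OF d] by auto
        have dN: "real d \<le> real N" by (rule of_nat_mono[OF dvd_imp_le[OF d N_pos]])
        have i: "F integrable_on {1 / real d * 1..1 / real d * X}" using d0 by (intro iF) simp
        show "(\<lambda>x. F (1 / real d * x)) integrable_on {1..X}"
          by (rule integral_stretch_pos(2)[OF i]) (use d0 in simp)
        have "integral {1..X} (\<lambda>x. F (1 / real d * x)) = integral {1 / real d * 1..1 / real d * X} F / (1 / real d)"
          by (rule integral_stretch_pos(1)[OF i]) (use d0 in simp)
        also have "\<dots> = real d * integral {1 / real d * 1..1 / real d * X} F" by simp
        also have "\<dots> \<le> real d * integral {1 / real N..X} F"
        proof (intro mult_left_mono integral_subset_le iF)
          have "1 / real N \<le> 1 / real d * 1" unfolding mult_1_right by (rule frac_le) (use d0 dN in auto)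
          moreover have "1 / real d * X \<le> 1 * X" using d0 elim by (intro mult_right_mono) auto
          ultimately show "{1 / real d * 1..1 / real d * X} \<subseteq> {1 / real N..X}" by auto
        qed (use d0 N_pos in \<open>auto simp: F_def\<close>)
        also have "\<dots> \<le> real d * (2 * \<delta> * X powr (3/2))" by (rule mult_left_mono[OF elim(1)]) simp
        finally show "integral {1..X} (\<lambda>x. F (1 / real d * x)) \<le> real d * (2 * \<delta> * X powr (3/2))" .
      qed
      have "integral {1..X} (\<lambda>x. (cmod (partial_sum x - approx R x))\<^sup>2) \<le> integral {1..X} (\<lambda>x. \<Sum>d | d dvd N. G * F (1 / real d * x))"
      proof (rule integral_le[OF _ _ pt])
        obtain E where E: "lbm E" "\<forall>x>0. partial_sum x = E x" using partial_sum_lbm by blast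
        have "(\<lambda>x. (cmod (E x - approx R x))\<^sup>2) integrable_on {1..X}"
          by (intro lbm_square_integrable lbm_diff E lbm_approx) simp
        then show "(\<lambda>x. (cmod (partial_sum x - approx R x))\<^sup>2) integrable_on {1..X}"
          by (rule integrable_eq) (use E in auto)
        show "(\<lambda>x. \<Sum>d | d dvd N. G * F (1 / real d * x)) integrable_on {1..X}"
          by (intro integrable_sum finite_divisors_N integrable_on_mult_right ist) simp
      qed
      also have "\<dots> = (\<Sum>d | d dvd N. G * integral {1..X} (\<lambda>x. F (1 / real d * x)))"
      proof -
        have "(\<lambda>x. G * F (1 / real d * x)) integrable_on {1..X}" if "d \<in> {d. d dvd N}" for d
          using that by (intro integrable_on_mult_right ist) simp
        from integral_sum[OF finite_divisors_N this] show ?thesis by (simp only: integral_mult_right)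
      qed
      also have "\<dots> \<le> (\<Sum>d | d dvd N. G * (real d * (2 * \<delta> * X powr (3/2))))"
        by (intro sum_mono mult_left_mono st G) simp
      also have "\<dots> = G * (\<Sum>d | d dvd N. real d) * (2 * \<delta> * X powr (3/2))"
        by (simp only: sum_distrib_left sum_distrib_right mult.assoc)
      also have "\<dots> \<le> C * (2 * \<delta> * X powr (3/2))" using C(2) \<delta> by (intro mult_right_mono) auto
      also have "\<dots> = e * X powr (3/2)" using C(1) by (simp add: \<delta>_def)
      finally have "X powr (-3/2) * integral {1..X} (\<lambda>x. (cmod (partial_sum x - approx R x))\<^sup>2) \<le> X powr (-3/2) * (e * X powr (3/2))"
        by (intro mult_left_mono) auto
      also have "\<dots> = e * (X powr (-3/2) * X powr (3/2))" by simp
      also have "X powr (-3/2) * X powr (3/2) = 1" using elim by (simp flip: powr_add)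
      finally show ?case by simp
    qed
  qed
qed

theorem mean_square_asymptotic:
  "((\<lambda>X. X powr (-3/2) * integral {1..X} (\<lambda>x. (cmod (partial_sum x))\<^sup>2))
    \<longlongrightarrow> 1 / (6 * pi\<^sup>2) * (zeta (3 / 2) ^ 4 / zeta 3) * Re limit_sum) at_top"
proof (rule mean_square_limit[where B = "\<lambda>R X. X powr (-3/2) * integral {1..X} (\<lambda>x. (cmod (approx R x))\<^sup>2)"
    and D = "\<lambda>R X. X powr (-3/2) * integral {1..X} (\<lambda>x. (cmod (partial_sum x - approx R x))\<^sup>2)",
    OF _ approx_mean_square diagonal_tendsto approx_error])
  fix \<eta> X :: real and R :: nat assume \<eta>: "\<eta> > 0" and X: "X \<ge> 1"
  obtain E where E: "lbm E" "\<forall>x>0. partial_sum x = E x" using partial_sum_lbm by blast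
  let ?I = "\<lambda>f. integral {1..X} (\<lambda>x. (cmod (f x))\<^sup>2)"
  have PE: "?I partial_sum = ?I E" "?I (\<lambda>x. partial_sum x - approx R x) = ?I (\<lambda>x. E x - approx R x)"
    using E by (auto intro!: integral_cong)
  have i: "(\<lambda>x. (cmod (E x))\<^sup>2) integrable_on {1..X}" "(\<lambda>x. (cmod (approx R x))\<^sup>2) integrable_on {1..X}"
    "(\<lambda>x. (cmod (E x - approx R x))\<^sup>2) integrable_on {1..X}"
    by (intro lbm_square_integrable lbm_diff E(1) lbm_approx zero_less_one)+
  have "\<bar>?I E - ?I (approx R)\<bar> = norm (integral {1..X} (\<lambda>x. (cmod (E x))\<^sup>2 - (cmod (approx R x))\<^sup>2))"
    by (simp add: integral_diff[OF i(1,2)])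
  also have "\<dots> \<le> integral {1..X} (\<lambda>x. \<eta> * (cmod (approx R x))\<^sup>2 + (1 + 1 / \<eta>) * (cmod (E x - approx R x))\<^sup>2)"
  proof (rule integral_norm_bound_integral)
    show "(\<lambda>x. (cmod (E x))\<^sup>2 - (cmod (approx R x))\<^sup>2) integrable_on {1..X}" by (rule integrable_diff[OF i(1,2)])
    show "(\<lambda>x. \<eta> * (cmod (approx R x))\<^sup>2 + (1 + 1 / \<eta>) * (cmod (E x - approx R x))\<^sup>2) integrable_on {1..X}"
      by (intro integrable_add integrable_on_mult_right i)
  qed (simp only: real_norm_def norm_square_close[OF \<eta>])
  also have "\<dots> = \<eta> * ?I (approx R) + (1 + 1 / \<eta>) * ?I (\<lambda>x. E x - approx R x)"
    using integral_add[OF integrable_on_mult_right[OF i(2), of \<eta>] integrable_on_mult_right[OF i(3), of "1 + 1 / \<eta>"]]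
    by (simp only: integral_mult_right)
  finally have "X powr (-3/2) * \<bar>?I E - ?I (approx R)\<bar> \<le> X powr (-3/2) * (\<eta> * ?I (approx R) + (1 + 1 / \<eta>) * ?I (\<lambda>x. E x - approx R x))"
    by (rule mult_left_mono) simp
  moreover have "\<bar>X powr (-3/2) * ?I E - X powr (-3/2) * ?I (approx R)\<bar> = X powr (-3/2) * \<bar>?I E - ?I (approx R)\<bar>"
    unfolding right_diff_distrib[symmetric] abs_mult by simp
  ultimately show "\<bar>X powr (-3/2) * ?I partial_sum - X powr (-3/2) * ?I (approx R)\<bar>
     \<le> \<eta> * (X powr (-3/2) * ?I (approx R)) + (1 + 1 / \<eta>) * (X powr (-3/2) * ?I (\<lambda>x. partial_sum x - approx R x))"
    unfolding PE by (simp only: distrib_left mult.left_commute)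
qed

text \<open>The sign is not visible in the double sum, since g is complex. Instead the diagonal sums
  are bounded below by one square that does not depend on R, and this bound survives the
  limit.\<close>

lemma limit_positive: "1 / (6 * pi\<^sup>2) * (zeta (3 / 2) ^ 4 / zeta 3) * Re limit_sum > 0"
proof -
  define d0 where "d0 = Max {d. d dvd N \<and> g d \<noteq> 0}"
  have fin: "finite {d. d dvd N \<and> g d \<noteq> 0}" by (rule finite_subset[OF _ finite_divisors_N]) auto
  have "1 \<in> {d. d dvd N \<and> g d \<noteq> 0}" using g_1 by simp
  then have "d0 \<in> {d. d dvd N \<and> g d \<noteq> 0}" unfolding d0_def using Max_in[OF fin] by blast
  then have d0: "d0 dvd N" "g d0 \<noteq> 0" "d0 > 0" using divisor_pos by auto
  have max: "g d = 0" if "d dvd N" "d > d0" for d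
    using Max_ge[OF fin, of d] that unfolding d0_def[symmetric] by auto
  define i0 where "i0 = (True, d0, 1::nat)"
  define c where "c = (cmod (mode_coeff i0))\<^sup>2"
  have "cmod (phase True) \<noteq> 0" using norm_phase[of True] by auto
  then have "mode_coeff i0 \<noteq> 0"
    unfolding i0_def mode_coeff_def weight_def using d0 by auto
  then have c: "c > 0" by (simp add: c_def)
  have ge: "c \<le> Re (\<Sum>i\<in>modes R. \<Sum>j\<in>modes R. if mode_freq i = mode_freq j then mode_coeff i * cnj (mode_coeff j) else 0)" if R: "R \<ge> 1" for R
  proof -
    have "(\<Sum>i\<in>{i\<in>modes R. mode_freq i = mode_freq i0}. mode_coeff i) = (\<Sum>i\<in>{i0}. mode_coeff i)"
    proof (rule sum.mono_neutral_right)
      show "finite {i \<in> modes R. mode_freq i = mode_freq i0}" using finite_modes by simp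
      show "{i0} \<subseteq> {i \<in> modes R. mode_freq i = mode_freq i0}" using d0 R by (auto simp: modes_def i0_def)
      show "\<forall>i\<in>{i \<in> modes R. mode_freq i = mode_freq i0} - {i0}. mode_coeff i = 0"
      proof
        fix i assume i: "i \<in> {i \<in> modes R. mode_freq i = mode_freq i0} - {i0}"
        obtain s d r where sdr: "i = (s, d, r)" by (cases i) auto
        have dr: "d dvd N" "r \<ge> 1" using i by (auto simp: sdr modes_def)
        have "mode_freq (s, d, r) = mode_freq (True, d0, 1)" using i by (simp add: sdr i0_def)
        then have sr: "s = True" "r * d0 = 1 * d"
          \<comment> \<open>A mode with the frequency of \<open>i0\<close> has d = r d0. If r > 1
            then d exceeds d0 and g(d) = 0 by maximality, so only \<open>i0\<close> itself
            contributes.\<close>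
          using same_freq_iff[of d d0 r 1 s True] dr d0 divisor_pos[OF dr(1)] by auto
        have "r \<noteq> 1" using i sr by (auto simp: sdr i0_def)
        then have "1 * d0 < r * d0" using dr d0 by (intro mult_strict_right_mono) auto
        then have "d > d0" unfolding sr(2) by (simp only: mult_1)
        then have "g d = 0" using max dr by blast
        then show "mode_coeff i = 0" by (simp add: sdr mode_coeff_def)
      qed
    qed
    then have ceq: "c = (cmod (\<Sum>i\<in>{i\<in>modes R. mode_freq i = mode_freq i0}. mode_coeff i))\<^sup>2" by (simp add: c_def)
    show ?thesis unfolding ceq by (rule sum_same_frequency_ge[OF finite_modes])
  qed
  have "2/3 * c \<le> 1 / (6 * pi\<^sup>2) * (zeta (3 / 2) ^ 4 / zeta 3) * Re limit_sum"
  proof (rule tendsto_lowerbound[OF diagonal_tendsto])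
    show "\<forall>\<^sub>F R in sequentially. 2/3 * c \<le> 2/3 * Re (\<Sum>i\<in>modes R. \<Sum>j\<in>modes R. if mode_freq i = mode_freq j then mode_coeff i * cnj (mode_coeff j) else 0)"
      using eventually_ge_at_top[of 1] by eventually_elim (rule mult_left_mono[OF ge]; simp)
  qed simp
  then show ?thesis using c by linarith
qed

end

theorem theorem1p3:
  fixes f1 f2 g :: "nat \<Rightarrow> complex" and M1 M2 :: nat
  assumes "multiplicative f1" and "multiplicative f2"
    and "has_period f1 M1" and "has_period f2 M2"
    and "period_conditions f1 M1" and "period_conditions f2 M2"
    and "g = f1 \<star> f2 \<star> moebius_mu \<star> moebius_mu"
  shows "\<exists>L::real.
    ((\<lambda>X::real. 1 / X powr (3 / 2) *
        integral {1..X} (\<lambda>x. (cmod (\<Sum>n | 0 < n \<and> real n \<le> x. (f1 \<star> f2) n))\<^sup>2))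
      \<longlongrightarrow> L) at_top \<and>
    L > 0 \<and>
    complex_of_real L =
      complex_of_real (1 / (6 * pi\<^sup>2) * (zeta (3 / 2) ^ 4 / zeta 3)) *
      (\<Sum>n | n dvd M1 * M2. \<Sum>m | m dvd M1 * M2.
         g n * cnj (g m) *
         complex_of_real (real (gcd n m) powr (3 / 2) / real (n * m) *
           real (num_divisors (reduced_prod n m)) * local_product (reduced_prod n m)))"
proof -
  interpret paper_setup f1 f2 g M1 M2
    using assms by unfold_locales (auto simp: has_period_def)
  have "X powr (-3/2) = 1 / X powr (3/2)" for X :: real
    using powr_minus_divide[of X "3/2"] by simp
  then have "((\<lambda>X. 1 / X powr (3 / 2) * integral {1..X} (\<lambda>x. (cmod (partial_sum x))\<^sup>2))
    \<longlongrightarrow> 1 / (6 * pi\<^sup>2) * (zeta (3 / 2) ^ 4 / zeta 3) * Re limit_sum) at_top"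
    using mean_square_asymptotic by (simp only:)
  moreover have "complex_of_real (1 / (6 * pi\<^sup>2) * (zeta (3 / 2) ^ 4 / zeta 3) * Re limit_sum)
     = complex_of_real (1 / (6 * pi\<^sup>2) * (zeta (3 / 2) ^ 4 / zeta 3)) * limit_sum"
    unfolding of_real_mult[of _ "Re limit_sum"] limit_sum_real[symmetric] ..
  ultimately show ?thesis using limit_positive
    unfolding limit_sum_def[symmetric] partial_sum_def by blast
qed

end
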